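(* Let $d\ge1$, $s_0=\max(0,\tfrac d2-1)$, $s_2>s_0$ and $\max\big(\tfrac38,\tfrac12-\tfrac12(s_2-s_0)\big)<b<\tfrac12$. Then there is a constant $C$ such that for all $\tau\in(0,1)$, all $\theta\ge\tau$ and all sequences $\{v_n\}_{n\in\mathbb{Z}}$, $\{w_n\}_{n\in\mathbb{Z}}$ of functions on $\mathbb{T}^d$ for which the norms on the right-hand side are finite: \begin{align*} \|\Pi_\theta v_n\Pi_\theta w_n\|_{X_{1,\tau}^{s_2+\frac12,-b}}+\|\Pi_\theta\overline{v_n}\,\Pi_\theta w_n\|_{X_{1,\tau}^{s_2+\frac12,-b}}&\le C\|v_n\|_{X_{2,\tau}^{s_2,b}}\|w_n\|_{X_{1,\tau}^{s_2+\frac12,b}},\\ \|\Pi_\theta v_n\Pi_\theta w_n\|_{X_{1,\tau}^{s_0+\frac12,-b}}+\|\Pi_\theta\overline{v_n}\,\Pi_\theta w_n\|_{X_{1,\tau}^{s_0+\frac12,-b}}&\le C\|v_n\|_{X_{2,\tau}^{s_0,b}}\|w_n\|_{X_{1,\tau}^{s_2+\frac12,b}},\\ \|\Pi_\theta v_n\Pi_\theta w_n\|_{X_{1,\tau}^{s_0+\frac12,-b}}+\|\Pi_\theta\overline{v_n}\,\Pi_\theta w_n\|_{X_{1,\tau}^{s_0+\frac12,-b}}&\le C\|v_n\|_{X_{2,\tau}^{s_2,b}}\|w_n\|_{X_{1,\tau}^{s_0+\frac12,b}},\\ \|\Pi_\theta v_n\Pi_\theta\overline{w_n}\|_{X_{2,\tau}^{s_2+1,-b}}+\|\Pi_\theta\overline{v_n}\,\Pi_\theta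 w_n\|_{X_{2,\tau}^{s_2+1,-b}}&\le C\|v_n\|_{X_{1,\tau}^{s_2+\frac12,b}}\|w_n\|_{X_{1,\tau}^{s_2+\frac12,b}},\\ \|\Pi_\theta v_n\Pi_\theta\overline{w_n}\|_{X_{2,\tau}^{s_0+1,-b}}+\|\Pi_\theta\overline{v_n}\,\Pi_\theta w_n\|_{X_{2,\tau}^{s_0+1,-b}}&\le C\|v_n\|_{X_{1,\tau}^{s_2+\frac12,b}}\|w_n\|_{X_{1,\tau}^{s_0+\frac12,b}}. \end{align*}
   Context: $\mathbb{T}^d=(\mathbb{R}/2\pi\mathbb{Z})^d$; $\langle y\rangle=(1+|y|^2)^{1/2}$ (also for complex $y$). Filter. A constant $c\in(0,2\pi)$ is fixed. For $\theta>0$, $\Pi_\theta$ is the Fourier multiplier that keeps exactly the frequencies $k\in\mathbb{Z}^d$ with $\theta^{1/2}k\in[-c^{1/2}d^{-1/2},c^{1/2}d^{-1/2})^d$ and sets all others to zero. Discrete Bourgain spaces. For a sequence $\{v_n(x)\}_{n\in\mathbb{Z}}$ of functions on $\mathbb{T}^d$ set $$\widetilde{v_n}(\sigma,k)=\tau\sum_{m\in\mathbb{Z}}\widehat{v_m}(k)e^{-im\tau\sigma},\qquad \widehat{v_m}(k)=\int_{\mathbb{T}^d}v_m(x)e^{-i\langle k,x\rangle}dx,$$ which is $2\pi/\tau$-periodic in $\sigma$, and $d_\tau(\sigma)=\frac{e^{i\tau\sigma}-1}{\tau}$. The norms are (up to equivalence uniform in $\tau$) $$\|v_n\|_{X_{1,\tau}^{s,b}}=\|\langle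 k\rangle^s\langle d_\tau(\sigma+|k|^2)\rangle^b\widetilde{v_n}(\sigma,k)\|_{L^2_\sigma l^2_k((-\frac\pi\tau,\frac\pi\tau)\times\mathbb{Z}^d)},$$ $$\|v_n\|_{X_{2,\tau}^{s,b}}=\|\langle k\rangle^s\langle d_\tau(\sigma-|k|)\rangle^b\widetilde{v_n}(\sigma,k)\|_{L^2_\sigma l^2_k((-\frac\pi\tau,\frac\pi\tau)\times\mathbb{Z}^d)}.$$ The constant $C$ may depend on $d,s_2,b,c$ but not on $\tau$, $\theta$ or the sequences. *)

theory Defs
  imports "HOL-Analysis.Analysis"
begin

section \<open>Functions on the torus, Fourier coefficients and the filter\<close>

text \<open>
  The dimension is \<open>d = CARD('d)\<close>. A function on the torus is a function on \<open>real ^ 'd\<close> that has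
  period \<open>2 * pi\<close> in every coordinate and is Lebesgue integrable over one period cell, so that
  its Fourier coefficients are given by convergent integrals.
\<close>

definition period_cell :: "(real ^ 'd) set" where
  "period_cell = cbox 0 (\<chi> i. 2 * pi)"

definition torus_function :: "(real ^ 'd \<Rightarrow> complex) \<Rightarrow> bool" where
  "torus_function f \<longleftrightarrow>
     (\<forall>x i. f (x + axis i (2 * pi)) = f x) \<and> f absolutely_integrable_on period_cell"

definition real_vec :: "int ^ 'd \<Rightarrow> real ^ 'd" where
  "real_vec k = (\<chi> i. real_of_int (k $ i))"

definition fourier_coeff :: "(real ^ 'd \<Rightarrow> complex) \<Rightarrow> int ^ 'd \<Rightarrow> complex" where
  "fourier_coeff f k =
     (LINT x:period_cell|lebesgue. f x * exp (- \<i> * complex_of_real (real_vec k \<bullet> x)))"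

definition filter_freqs :: "real \<Rightarrow> real \<Rightarrow> (int ^ 'd) set" where
  "filter_freqs c \<theta> =
     {k. \<forall>i. sqrt \<theta> * real_of_int (k $ i)
              \<in> {- (sqrt c / sqrt (real CARD('d))) ..< sqrt c / sqrt (real CARD('d))}}"

text \<open>
  The Fourier multiplier with symbol the indicator function of \<^const>\<open>filter_freqs\<close>. The sum is
  finite for \<open>\<theta> > 0\<close>; the factor \<open>(2 * pi) ^ d\<close> inverts the unnormalised coefficients
  \<^const>\<open>fourier_coeff\<close>.
\<close>

definition freq_filter :: "real \<Rightarrow> real \<Rightarrow> (real ^ 'd \<Rightarrow> complex) \<Rightarrow> real ^ 'd \<Rightarrow> complex" where
  "freq_filter c \<theta> f x =
     (\<Sum>k\<in>filter_freqs c \<theta>. fourier_coeff f k * exp (\<i> * complex_of_real (real_vec k \<bullet> x)))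
       / (2 * complex_of_real pi) ^ CARD('d)"

lemma finite_filter_freqs:
  assumes "\<theta> > 0"
  shows "finite (filter_freqs c \<theta> :: (int ^ 'd) set)"
proof -
  define M where "M = \<lceil>\<bar>sqrt c / sqrt (real CARD('d))\<bar> / sqrt \<theta>\<rceil>"
  have "vec_nth ` (filter_freqs c \<theta> :: (int ^ 'd) set) \<subseteq> PiE UNIV (\<lambda>_. {-M..M})"
  proof safe
    fix k :: "int ^ 'd" and i :: 'd
    assume "k \<in> filter_freqs c \<theta>"
    then have "sqrt \<theta> * real_of_int (k $ i)
        \<in> {- (sqrt c / sqrt (real CARD('d))) ..< sqrt c / sqrt (real CARD('d))}"
      unfolding filter_freqs_def by blast
    then have "\<bar>sqrt \<theta> * real_of_int (k $ i)\<bar> \<le> \<bar>sqrt c / sqrt (real CARD('d))\<bar>"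
      unfolding atLeastLessThan_iff by linarith
    then have "\<bar>real_of_int (k $ i)\<bar> \<le> \<bar>sqrt c / sqrt (real CARD('d))\<bar> / sqrt \<theta>"
      using assms by (simp add: abs_mult pos_le_divide_eq mult_ac)
    also have "\<dots> \<le> real_of_int M"
      unfolding M_def by (rule le_of_int_ceiling)
    finally show "k $ i \<in> {-M..M}"
      by auto
  qed auto
  moreover have "finite (PiE (UNIV :: 'd set) (\<lambda>_. {-M..M}))"
    by (intro finite_PiE) auto
  ultimately have "finite (vec_nth ` (filter_freqs c \<theta> :: (int ^ 'd) set))"
    by (rule finite_subset)
  then show ?thesis
    by (rule finite_imageD) (auto intro: injI simp: vec_eq_iff inj_on_def)
qed


section \<open>Discrete Bourgain norms\<close>

definition japanese_bracket :: "'a::real_normed_vector \<Rightarrow> real" where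
  "japanese_bracket y = sqrt (1 + (norm y)\<^sup>2)"

definition d_tau :: "real \<Rightarrow> real \<Rightarrow> complex" where
  "d_tau \<tau> \<sigma> = (exp (\<i> * complex_of_real (\<tau> * \<sigma>)) - 1) / complex_of_real \<tau>"

text \<open>
  \<open>is_dft \<tau> v k g\<close> says that \<open>g\<close> is the discrete space-time Fourier transform of the sequence \<open>v\<close>
  at frequency \<open>k\<close>. For the sequences of interest the coefficients are only square summable in
  the time index, so the series over all integers is understood as an unordered sum in
  \<open>L\<^sup>2(-\<pi>/\<tau>, \<pi>/\<tau>)\<close>. It determines \<open>g\<close> almost everywhere on that interval.
\<close>

definition is_dft ::
  "real \<Rightarrow> (int \<Rightarrow> real ^ 'd \<Rightarrow> complex) \<Rightarrow> int ^ 'd \<Rightarrow> (real \<Rightarrow> complex) \<Rightarrow> bool" where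
  "is_dft \<tau> v k g \<longleftrightarrow>
     g \<in> borel_measurable borel \<and>
     ((\<lambda>F. \<integral>\<^sup>+\<sigma>\<in>{- pi / \<tau> <..< pi / \<tau>}.
             ennreal ((cmod (complex_of_real \<tau> *
               (\<Sum>m\<in>F. fourier_coeff (v m) k * exp (- \<i> * complex_of_real (of_int m * \<tau> * \<sigma>)))
               - g \<sigma>))\<^sup>2) \<partial>lborel)
       \<longlongrightarrow> 0) (finite_subsets_at_top (UNIV :: int set))"

definition dft :: "real \<Rightarrow> (int \<Rightarrow> real ^ 'd \<Rightarrow> complex) \<Rightarrow> int ^ 'd \<Rightarrow> real \<Rightarrow> complex" where
  "dft \<tau> v k = (SOME g. is_dft \<tau> v k g)"

definition ennreal_sqrt :: "ennreal \<Rightarrow> ennreal" where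
  "ennreal_sqrt x = (if x = \<infinity> then \<infinity> else ennreal (sqrt (enn2real x)))"

text \<open>
  The norm with weight \<open>\<langle>k\<rangle>\<^sup>s \<langle>d\<^sub>\<tau>(\<sigma> + \<omega> k)\<rangle>\<^sup>b\<close>, with values in \<open>[0, \<infinity>]\<close>. For fixed \<open>\<tau> > 0\<close> the
  modulation weight is bounded above and below, so the norm can be finite only if the transform
  exists in \<open>L\<^sup>2\<close> at every \<open>k\<close>; otherwise it is infinite.
\<close>

definition bourgain_norm ::
  "(int ^ 'd \<Rightarrow> real) \<Rightarrow> real \<Rightarrow> real \<Rightarrow> real \<Rightarrow> (int \<Rightarrow> real ^ 'd \<Rightarrow> complex) \<Rightarrow> ennreal" where
  "bourgain_norm \<omega> \<tau> s b v =
     (if \<forall>k. \<exists>g. is_dft \<tau> v k g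
      then ennreal_sqrt
        (\<integral>\<^sup>+k. (\<integral>\<^sup>+\<sigma>\<in>{- pi / \<tau> <..< pi / \<tau>}.
            ennreal ((cmod (complex_of_real
              (japanese_bracket (real_vec k) powr s
                * japanese_bracket (d_tau \<tau> (\<sigma> + \<omega> k)) powr b)
              * dft \<tau> v k \<sigma>))\<^sup>2) \<partial>lborel) \<partial>count_space UNIV)
      else \<infinity>)"

definition X1_norm ::
  "real \<Rightarrow> real \<Rightarrow> real \<Rightarrow> (int \<Rightarrow> real ^ 'd \<Rightarrow> complex) \<Rightarrow> ennreal" where
  "X1_norm = bourgain_norm (\<lambda>k. (norm (real_vec k))\<^sup>2)"

definition X2_norm ::
  "real \<Rightarrow> real \<Rightarrow> real \<Rightarrow> (int \<Rightarrow> real ^ 'd \<Rightarrow> complex) \<Rightarrow> ennreal" where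
  "X2_norm = bourgain_norm (\<lambda>k. - norm (real_vec k))"

end

theory Submission
  imports Defs "HOL-Computational_Algebra.Primes"
begin

text \<open>After passing to absolute values of the space-time transforms, all ten bounds follow from a
  single trilinear estimate for \<open>\<integral>\<integral> K(p\<^sub>0, p\<^sub>2) U(p\<^sub>0) V(p\<^sub>0 - p\<^sub>2) W(p\<^sub>2)\<close>, where \<open>p\<^sub>j = (k\<^sub>j, \<sigma>\<^sub>j)\<close>, \<open>p\<^sub>0\<close> and
  \<open>p\<^sub>2\<close> are measured by the Schroedinger and \<open>p\<^sub>1 = p\<^sub>0 - p\<^sub>2\<close> by the wave modulation. If \<open>k\<^sub>0\<close> and \<open>k\<^sub>2\<close> have very
  different sizes, the resonance identity forces one modulation to be as large as the square of the
  larger frequency, because \<open>c < 2\<pi>\<close> and the filter exclude aliasing; then Cauchy-Schwarz suffices.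
  Otherwise, up to terms treated in the same way, \<open>K\<close> is bounded by \<open>\<langle>k\<^sub>1\<rangle>\<close> to the power \<open>-s\<close>
  times powers of exponent below \<open>-1/2\<close> of the two Schroedinger modulations, and rearranging a correlation of two Schroedinger waves into their
  convolution reduces the claim to weighted sums of lattice points on spheres. These are sliced into
  circles, on which the divisor bound and the area of lattice triangles on short arcs limit the points.\<close>

section \<open>Lattice points on circles\<close>

text \<open>The obstacle is that \<open>b\<close> lies below 1/2: \<open>lam\<close> to the power
  \<open>- 2 * b\<close> is not integrable over a period uniformly in \<tau>, so lattice counting
  cannot start from the given modulation exponents. The wave modulation l1 is traded for better
  ones: while l0 l2 < <k1>^2 l1, its power -b raises the exponents of the two Schroedinger
  modulations l0, l2 from b to some \<beta> > 1/2, at the price of 2 (\<beta> - b) powers of <k1>.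
  The lower bound 1/2 - (s2 - s0)/2 on b says that this price leaves a power of <k1> above s0. In
  the opposite case <k1> gains 2 b powers.

  Convolutions are forced by geometry. For fixed k1 the equation |k0|^2 - |k0 - k1|^2 = n is a
  hyperplane, along which <k1> is constant and gives no decay; for a fixed sum p the equation |k|^2
  + |p - k|^2 = n is a sphere, along which the weight varies.

  Sums over spheres converge only above s0. All five estimates therefore use one kernel with
  exponent s2, and where a norm of index s0 occurs, the surplus s2 - s0 is charged to the factor
  measured in s2.\<close>

lemma card_divisors_mult_le:
  fixes m n :: nat
  assumes "m > 0" "n > 0"
  shows "card {d. d dvd m * n} \<le> card {d. d dvd m} * card {d. d dvd n}"
proof -
  have "{d. d dvd m * n} \<subseteq> (\<lambda>(a, b). a * b) ` ({d. d dvd m} \<times> {d. d dvd n})"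
  proof
    fix d assume "d \<in> {d. d dvd m * n}"
    then obtain a b where "d = a * b" "a dvd m" "b dvd n"
      using division_decomp[of d m n] by auto
    then show "d \<in> (\<lambda>(a, b). a * b) ` ({d. d dvd m} \<times> {d. d dvd n})" by force
  qed
  then have "card {d. d dvd m * n} \<le> card ((\<lambda>(a, b). a * b) ` ({d. d dvd m} \<times> {d. d dvd n}))"
    by (intro card_mono) (use assms in auto)
  also have "\<dots> \<le> card ({d. d dvd m} \<times> {d. d dvd n})"
    by (intro card_image_le) (use assms in auto)
  finally show ?thesis by (simp add: card_cartesian_product)
qed

lemma card_divisors_prime_power:
  fixes p :: nat
  assumes "prime p"
  shows "card {d. d dvd p ^ a} = a + 1"
proof -
  have "{d. d dvd p ^ a} = (\<lambda>i. p ^ i) ` {..a}"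
    using divides_primepow_nat[OF assms] by auto
  moreover have "inj_on (\<lambda>i. p ^ i) {..a}"
    using prime_gt_1_nat[OF assms] by (auto intro!: inj_onI simp: power_inject_exp)
  ultimately show ?thesis by (simp add: card_image)
qed

text \<open>The divisor count is the product of a + 1 over the prime powers p^a exactly dividing n.
  Each factor is at most p^(a \<epsilon>) when p is large, and at most D p^(a \<epsilon>) for the
  boundedly many small primes, so the total loss is a fixed power of D.\<close>

theorem divisor_bound:
  fixes \<epsilon> :: real
  assumes "\<epsilon> > 0"
  shows "\<exists>C\<ge>1. \<forall>n>0. real (card {d::nat. d dvd n}) \<le> C * real n powr \<epsilon>"
proof -
  \<comment> \<open>Beyond \<open>B\<close> one has p powr \<epsilon> \<ge> 2, hence p powr (a
    \<epsilon>) \<ge> 2 ^ a \<ge> a + 1 with no constant.\<close>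
  define B where "B = nat \<lceil>2 powr (1 / \<epsilon>)\<rceil>"
  have "(\<lambda>a. (real a + 1) * 2 powr (- (real a * \<epsilon>))) \<longlonglongrightarrow> 0"
  proof -
    have "(\<lambda>a. real a * (2 powr (-\<epsilon>)) ^ a + (2 powr (-\<epsilon>)) ^ a) \<longlonglongrightarrow> 0 + 0"
      using assms
      by (intro tendsto_add LIMSEQ_realpow_zero powser_times_n_limit_0)
        (auto simp: powr_less_one)
    moreover have "real a * (2 powr (-\<epsilon>)) ^ a + (2 powr (-\<epsilon>)) ^ a
        = (real a + 1) * 2 powr (- (real a * \<epsilon>))" for a
    proof -
      have "(2 powr (-\<epsilon>)) ^ a = 2 powr (- (real a * \<epsilon>))"
        by (subst powr_realpow[symmetric]) (auto simp: powr_powr mult.commute)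
      then show ?thesis by (simp add: algebra_simps)
    qed
    ultimately show ?thesis by simp
  qed
  then have "Bseq (\<lambda>a. (real a + 1) * 2 powr (- (real a * \<epsilon>)))"
    by (intro convergent_imp_Bseq convergentI)
  then obtain K where K: "\<bar>(real a + 1) * 2 powr (- (real a * \<epsilon>))\<bar> \<le> K" for a
    unfolding Bseq_def real_norm_def by blast
  \<comment> \<open>The maximum with 1 makes powers of \<open>D\<close> increase with the exponent,
    so that the number of small prime factors can be replaced by \<open>B + 1\<close>.\<close>
  define D where "D = max 1 K"
  have D1: "D \<ge> 1" by (simp add: D_def)
  have D: "real a + 1 \<le> D * real p powr (real a * \<epsilon>)" if "p \<ge> 2" for a p :: nat
  proof -
    have "(real a + 1) * 2 powr (- (real a * \<epsilon>)) \<le> D"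
      using K[of a] unfolding D_def by linarith
    then have "real a + 1 \<le> D * 2 powr (real a * \<epsilon>)"
      by (simp add: powr_minus field_simps)
    also have "\<dots> \<le> D * real p powr (real a * \<epsilon>)"
      using D1 that assms by (intro mult_left_mono powr_mono2) auto
    finally show ?thesis .
  qed
  have big: "real a + 1 \<le> real p powr (real a * \<epsilon>)" if "p > B" for a p :: nat
  proof -
    have "2 powr (1 / \<epsilon>) \<le> real p" using that unfolding B_def by linarith
    then have "(2 powr (1/\<epsilon>)) powr \<epsilon> \<le> real p powr \<epsilon>"
      using assms by (intro powr_mono2) auto
    then have 2: "2 \<le> real p powr \<epsilon>" using assms by (simp add: powr_powr)
    have "a + 1 \<le> 2 ^ a" by (induction a) auto
    then have "real (a + 1) \<le> real (2 ^ a)" by (rule of_nat_mono)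
    then have "real a + 1 \<le> 2 ^ a" by simp
    also have "\<dots> \<le> (real p powr \<epsilon>) ^ a" by (intro power_mono 2) auto
    also have "\<dots> = real p powr (real a * \<epsilon>)"
      using that by (simp add: powr_power mult.commute)
    finally show ?thesis .
  qed
  \<comment> \<open>The induction removes one prime with its full multiplicity. Only primes up to
    \<open>B\<close> enter the exponent of \<open>D\<close>, which keeps the constant independent of
    n.\<close>
  have "real (card {d. d dvd n}) \<le> D ^ card (prime_factors n \<inter> {..B}) * real n powr \<epsilon>" if "n > 0" for n :: nat
    using that
  proof (induction n rule: less_induct)
    case (less n)
    show ?case
    proof (cases "n = 1")
      case True
      then show ?thesis by simp
    next
      case False
      then obtain p where p: "prime p" "p dvd n" using prime_factor_nat by blast
      define a where "a = multiplicity p n"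
      have a: "a > 0" using p less.prems by (simp add: a_def prime_multiplicity_gt_zero_iff)
      have "n \<noteq> 0" "\<not> is_unit p" using less.prems p(1) not_prime_unit by auto
      then obtain m where m': "n = p ^ multiplicity p n * m" "\<not> p dvd m"
        by (rule multiplicity_decompose')
      then have m: "n = p ^ a * m" "\<not> p dvd m" by (simp_all add: a_def)
      have m0: "m > 0" using m less.prems by (cases m) auto
      have p2: "p \<ge> 2" using p(1) prime_ge_2_nat by blast
      have mn: "m < n"
      proof -
        have "1 < p ^ a" using one_less_power[of p a] p2 a by linarith
        then show ?thesis using m m0 by simp
      qed
      have pf: "prime_factors n = insert p (prime_factors m)"
        using m m0 p a by (simp add: prime_factors_product prime_factorization_prime_power)
      have pm: "p \<notin> prime_factors m" using m by auto
      have pos: "0 \<le> D ^ card (prime_factors m \<inter> {..B}) * real m powr \<epsilon>" using D1 by simp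
      have "card {d. d dvd n} \<le> (a + 1) * card {d. d dvd m}"
        using card_divisors_mult_le[of "p ^ a" m] m0 p2 card_divisors_prime_power[OF p(1), of a]
        by (simp add: m(1))
      then have "real (card {d. d dvd n}) \<le> (real a + 1) * real (card {d. d dvd m})"
        by (simp flip: of_nat_le_iff[where 'a = real] add: algebra_simps)
      also have "\<dots> \<le> (real a + 1) * (D ^ card (prime_factors m \<inter> {..B}) * real m powr \<epsilon>)"
        by (intro mult_left_mono less.IH mn m0) auto
      also have "\<dots> \<le> D ^ card (prime_factors n \<inter> {..B}) * real n powr \<epsilon>"
      proof -
        have n: "real n powr \<epsilon> = real p powr (real a * \<epsilon>) * real m powr \<epsilon>"
        proof -
          have "real (p ^ a) powr \<epsilon> = real p powr (real a * \<epsilon>)"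
            using p2 unfolding of_nat_power by (subst powr_realpow[symmetric]) (auto simp: powr_powr)
          then show ?thesis by (simp add: m(1) powr_mult)
        qed
        show ?thesis
        proof (cases "p \<le> B")
          case True
          then have "prime_factors n \<inter> {..B} = insert p (prime_factors m \<inter> {..B})"
            using pf by auto
          then have c: "card (prime_factors n \<inter> {..B}) = Suc (card (prime_factors m \<inter> {..B}))"
            using pm by simp
          show ?thesis unfolding c n
            using mult_right_mono[OF D[OF p2, of a] pos] by (simp add: mult_ac)
        next
          case False
          then have c: "prime_factors n \<inter> {..B} = prime_factors m \<inter> {..B}"
            using pf by auto
          show ?thesis unfolding c n
            using mult_right_mono[OF big[of p a] pos] False by (simp add: mult_ac)
        qed
      qed
      finally show ?thesis .
    qed
  qed
  moreover have "D ^ card (prime_factors n \<inter> {..B}) \<le> D ^ (B + 1)" for n :: nat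
  proof (intro power_increasing D1)
    have "card (prime_factors n \<inter> {..B}) \<le> card {..B}" by (intro card_mono) auto
    then show "card (prime_factors n \<inter> {..B}) \<le> B + 1" by simp
  qed
  ultimately have "\<forall>n>0. real (card {d::nat. d dvd n}) \<le> D ^ (B+1) * real n powr \<epsilon>"
    by (intro allI impI) (blast intro: order_trans mult_right_mono powr_ge_zero)
  moreover have "1 \<le> D ^ (B + 1)" using D1 by (rule one_le_power)
  ultimately show ?thesis by blast
qed


section \<open>Counting lattice points on a circle by divisors of its squared radius\<close>

lemma card_le_fibers:
  assumes "finite G" "finite S" "f ` S \<subseteq> G" "\<And>g. g \<in> G \<Longrightarrow> card {x \<in> S. f x = g} \<le> n"
  shows "card S \<le> card G * n"
proof -
  have "S = (\<Union>g\<in>G. {x \<in> S. f x = g})" using assms(3) by auto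
  then have "card S \<le> (\<Sum>g\<in>G. card {x \<in> S. f x = g})"
    using card_UN_le[OF assms(1), of "\<lambda>g. {x \<in> S. f x = g}"] by simp
  also have "\<dots> \<le> (\<Sum>g\<in>G. n)" by (intro sum_mono assms)
  finally show ?thesis by simp
qed

definition circle_points :: "int \<Rightarrow> (int \<times> int) set" where
  "circle_points m = {(x, y). x\<^sup>2 + y\<^sup>2 = m}"

lemma finite_circle_points: "finite (circle_points m)"
proof (rule finite_subset)
  show "circle_points m \<subseteq> {-m..m} \<times> {-m..m}"
  proof safe
    fix x y assume "(x, y) \<in> circle_points m"
    then have "x\<^sup>2 \<le> m" "y\<^sup>2 \<le> m" by (auto simp: circle_points_def)
    moreover have "\<bar>x\<bar> \<le> x\<^sup>2" "\<bar>y\<bar> \<le> y\<^sup>2"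
      using self_le_power[of "\<bar>x\<bar>" 2] self_le_power[of "\<bar>y\<bar>" 2] by (cases "x = 0"; cases "y = 0"; auto)+
    ultimately show "x \<in> {-m..m}" "y \<in> {-m..m}" by auto
  qed
qed auto

lemma coprime_circle:
  fixes x y m :: int
  assumes "coprime x y" "x\<^sup>2 + y\<^sup>2 = m"
  shows "coprime x m"
proof -
  have "gcd x m = gcd x (y\<^sup>2)"
    using gcd_add_mult[of x x "y\<^sup>2"] assms(2) by (simp add: power2_eq_square)
  then show ?thesis using assms(1) by (metis coprime_iff_gcd_eq_1 coprime_power_right_iff)
qed

text \<open>m divides (x y0 - x0 y)(x y0 + x0 y). The part g of m taken up by the first factor
  leaves m / g for the second, so two points with the same g split m in the same way, and both g and
  m / g divide their cross product. In Gaussian integers, g records at which primes the point picks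
  the same conjugate factor as the base point.\<close>

lemma cross_product_divisible:
  fixes x0 y0 x y x' y' m :: int
  assumes 0: "x0\<^sup>2 + y0\<^sup>2 = m" "coprime x0 y0"
    and 1: "x\<^sup>2 + y\<^sup>2 = m" "coprime x y"
    and 2: "x'\<^sup>2 + y'\<^sup>2 = m" "coprime x' y'"
    and g: "gcd (x * y0 - x0 * y) m = gcd (x' * y0 - x0 * y') m"
    and m: "m > 0"
  shows "m dvd 2 * (x * y' - x' * y)"
proof -
  define g where "g = gcd (x * y0 - x0 * y) m"
  have gpos: "g > 0" using m by (simp add: g_def)
  obtain m1 where m1: "m = g * m1" unfolding g_def by (meson dvdE gcd_dvd2)
  have split: "g dvd a * y0 - x0 * b \<and> m1 dvd a * y0 + x0 * b"
    if "a\<^sup>2 + b\<^sup>2 = m" "gcd (a * y0 - x0 * b) m = g" for a b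
  proof
    show gu: "g dvd a * y0 - x0 * b" using that(2) by (metis gcd_dvd1)
    then obtain u1 where u1: "a * y0 - x0 * b = g * u1" by blast
    have "g * gcd u1 m1 = g"
      using that(2) gpos unfolding u1 m1 by (simp add: gcd_mult_left)
    then have cop: "coprime m1 u1" using gpos by (simp add: coprime_iff_gcd_eq_1 gcd.commute)
    have "(a * y0 - x0 * b) * (a * y0 + x0 * b) = a\<^sup>2 * y0\<^sup>2 - x0\<^sup>2 * b\<^sup>2"
      by (simp add: algebra_simps power2_eq_square)
    also have "\<dots> = (m - b\<^sup>2) * y0\<^sup>2 - (m - y0\<^sup>2) * b\<^sup>2"
    proof -
      have "a\<^sup>2 = m - b\<^sup>2" "x0\<^sup>2 = m - y0\<^sup>2" using that(1) 0(1) by auto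
      then show ?thesis by simp
    qed
    also have "\<dots> = m * (y0\<^sup>2 - b\<^sup>2)" by (simp add: algebra_simps)
    finally have "g * (u1 * (a * y0 + x0 * b)) = g * (m1 * (y0\<^sup>2 - b\<^sup>2))"
      unfolding u1 m1 by (simp add: mult_ac)
    then have "u1 * (a * y0 + x0 * b) = m1 * (y0\<^sup>2 - b\<^sup>2)" using gpos by simp
    then have "m1 dvd u1 * (a * y0 + x0 * b)" by simp
    then show "m1 dvd a * y0 + x0 * b"
      using cop by (simp add: coprime_dvd_mult_right_iff)
  qed
  have s1: "g dvd x * y0 - x0 * y" "m1 dvd x * y0 + x0 * y"
    using split[OF 1(1)] by (auto simp: g_def)
  have s2: "g dvd x' * y0 - x0 * y'" "m1 dvd x' * y0 + x0 * y'"
    using split[OF 2(1)] g by (auto simp: g_def)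
  have cy: "coprime y0 m" using coprime_circle[of y0 x0 m] 0 by (simp add: ac_simps)
  have cx: "coprime x m" using coprime_circle[of x y m] 1 by simp
  have cg: "coprime y0 g" "coprime y0 m1" using cy m1 by auto
  define \<Delta> where "\<Delta> = x * y' - x' * y"
  have "y0 * \<Delta> = (x * y0 - x0 * y) * y' - (x' * y0 - x0 * y') * y"
    by (simp add: \<Delta>_def algebra_simps)
  then have "g dvd y0 * \<Delta>" using s1 s2 by simp
  then have g\<Delta>: "g dvd \<Delta>" using cg by (simp add: coprime_dvd_mult_right_iff coprime_commute)
  have "y0 * \<Delta> = (x * y0 + x0 * y) * y' - (x' * y0 + x0 * y') * y"
    by (simp add: \<Delta>_def algebra_simps)
  then have "m1 dvd y0 * \<Delta>" using s1 s2 by simp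
  then have m\<Delta>: "m1 dvd \<Delta>" using cg by (simp add: coprime_dvd_mult_right_iff coprime_commute)
  \<comment> \<open>A common divisor of \<open>g\<close> and \<open>m1\<close> divides the sum 2 x
    y0 of the two factors and is coprime to x and y0, hence divides 2.\<close>
  define h where "h = gcd g m1"
  have hm: "h dvd m" by (simp add: h_def m1)
  have "h dvd (x * y0 - x0 * y) + (x * y0 + x0 * y)"
  proof (rule dvd_add)
    show "h dvd x * y0 - x0 * y" using s1(1) by (rule dvd_trans[rotated]) (simp add: h_def)
    show "h dvd x * y0 + x0 * y" using s1(2) by (rule dvd_trans[rotated]) (simp add: h_def)
  qed
  then have "h dvd (x * y0) * 2" by (simp add: mult_ac)
  moreover have "coprime h (x * y0)"
    using cx cy hm by (meson coprime_commute coprime_divisors coprime_mult_right_iff dvd_refl)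
  ultimately have h2: "h dvd 2" by (simp add: coprime_dvd_mult_right_iff)
  obtain s t where st: "s * g + t * m1 = h" using bezout_int[of g m1] by (auto simp: h_def)
  obtain a b where ab: "\<Delta> = g * a" "\<Delta> = m1 * b" using g\<Delta> m\<Delta> by blast
  \<comment> \<open>As \<open>g\<close> and \<open>m1\<close> need not be coprime, Bezout gives only
    that m divides \<Delta> h; this is the origin of the factor 2 in the conclusion.\<close>
  have "\<Delta> * h = s * g * \<Delta> + t * m1 * \<Delta>" by (simp add: algebra_simps flip: st)
  also have "\<dots> = s * g * (m1 * b) + t * m1 * (g * a)" using ab by simp
  also have "\<dots> = m * (s * b + t * a)" by (simp add: m1 algebra_simps)
  finally have "m dvd \<Delta> * h" by simp
  then have "m dvd \<Delta> * 2" using h2 by (meson dvd_refl dvd_trans mult_dvd_mono)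
  then show ?thesis by (simp add: \<Delta>_def mult_ac)
qed

text \<open>Points are grouped by a divisor of m, the gcd of m with the cross product against a base
  point. Inside a group, twice the cross product with a fixed member is a multiple of m of size at
  most 2 m, so it has 5 values; together with the sign of the inner product it determines the point,
  whence 10.\<close>

lemma card_primitive_circle_points:
  fixes m :: int
  assumes m: "m > 0"
  shows "card {(x, y) \<in> circle_points m. coprime x y} \<le> 10 * card {d. d dvd nat m}"
proof (cases "{(x, y) \<in> circle_points m. coprime x y} = {}")
  case False
  let ?S = "{(x, y) \<in> circle_points m. coprime x y}"
  obtain x0 y0 where p0: "x0\<^sup>2 + y0\<^sup>2 = m" "coprime x0 y0" using False by (auto simp: circle_points_def)
  let ?f = "\<lambda>(x, y). nat (gcd (x * y0 - x0 * y) m)"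
  have "card ?S \<le> card {d. d dvd nat m} * 10"
  proof (rule card_le_fibers[where f = ?f])
    show "?f ` ?S \<subseteq> {d. d dvd nat m}" using m by (auto simp: nat_dvd_iff)
    show "finite ?S" by (rule finite_subset[OF _ finite_circle_points]) auto
  next
    fix g
    let ?F = "{p \<in> ?S. ?f p = g}"
    show "card ?F \<le> 10"
    proof (cases "?F = {}")
      case False
      then obtain x y where p: "x\<^sup>2 + y\<^sup>2 = m" "coprime x y" "nat (gcd (x * y0 - x0 * y) m) = g"
        by (auto simp: circle_points_def)
      let ?h = "\<lambda>(x', y'). (2 * (x * y' - x' * y), x * x' + y * y' \<ge> 0)"
      have "card ?F = card (?h ` ?F)"
      proof (rule card_image[symmetric], rule inj_onI)
        fix P Q assume PQ: "P \<in> ?F" "Q \<in> ?F" "?h P = ?h Q"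
        obtain a b c d where ab: "P = (a, b)" "Q = (c, d)" by fastforce
        have abm: "a\<^sup>2 + b\<^sup>2 = m" "c\<^sup>2 + d\<^sup>2 = m" using PQ ab by (auto simp: circle_points_def)
        have \<Delta>: "x * b - a * y = x * d - c * y" and sg: "x * a + y * b \<ge> 0 \<longleftrightarrow> x * c + y * d \<ge> 0"
          using PQ(3) ab by auto
        \<comment> \<open>Lagrange's identity: the squares of inner and cross product add up to m^2,
          so the cross product fixes the inner product up to sign.\<close>
        have "(x * a + y * b)\<^sup>2 + (x * b - a * y)\<^sup>2 = (x\<^sup>2 + y\<^sup>2) * (a\<^sup>2 + b\<^sup>2)"
          by (simp add: algebra_simps power2_eq_square)
        moreover have "(x * c + y * d)\<^sup>2 + (x * d - c * y)\<^sup>2 = (x\<^sup>2 + y\<^sup>2) * (c\<^sup>2 + d\<^sup>2)"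
          by (simp add: algebra_simps power2_eq_square)
        ultimately have "(x * a + y * b)\<^sup>2 = (x * c + y * d)\<^sup>2" using \<Delta> abm by simp
        moreover have "u = v" if "u\<^sup>2 = v\<^sup>2" "u \<ge> 0 \<longleftrightarrow> v \<ge> 0" for u v :: int
          using that by (auto simp: power2_eq_iff)
        ultimately have E: "x * a + y * b = x * c + y * d"
          using sg by blast
        \<comment> \<open>The point is recovered from its inner and cross product with (x, y), as
          both are linear in it with determinant m.\<close>
        have "m * a = x * (x * a + y * b) - y * (x * b - a * y)"
          using p(1) by (simp add: algebra_simps power2_eq_square flip: p(1))
        also have "\<dots> = x * (x * c + y * d) - y * (x * d - c * y)" by (simp only: E \<Delta>)
        also have "\<dots> = m * c" using p(1) by (simp add: algebra_simps power2_eq_square flip: p(1))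
        finally have "a = c" using m by simp
        have "m * b = y * (x * a + y * b) + x * (x * b - a * y)"
          using p(1) by (simp add: algebra_simps power2_eq_square flip: p(1))
        also have "\<dots> = y * (x * c + y * d) + x * (x * d - c * y)" by (simp only: E \<Delta>)
        also have "\<dots> = m * d" using p(1) by (simp add: algebra_simps power2_eq_square flip: p(1))
        finally have "b = d" using m by simp
        show "P = Q" using ab \<open>a = c\<close> \<open>b = d\<close> by simp
      qed
      also have "\<dots> \<le> card ({0, m, -m, 2 * m, -2 * m} \<times> (UNIV :: bool set))"
      proof (rule card_mono)
        show "?h ` ?F \<subseteq> {0, m, -m, 2 * m, -2 * m} \<times> UNIV"
        proof (rule image_subsetI)
          fix P assume P: "P \<in> ?F"
          obtain a b where ab: "P = (a, b)" by fastforce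
          have abm: "a\<^sup>2 + b\<^sup>2 = m" "coprime a b" "nat (gcd (a * y0 - x0 * b) m) = g"
            using P ab by (auto simp: circle_points_def)
          have "gcd (x * y0 - x0 * y) m = gcd (a * y0 - x0 * b) m"
            using abm(3) p(3) by (metis gcd_ge_0_int int_nat_eq)
          then have "m dvd 2 * (x * b - a * y)"
            by (rule cross_product_divisible[OF p0 p(1,2) abm(1,2) _ m])
          then obtain q where q: "2 * (x * b - a * y) = m * q" by blast
          have "(x * a + y * b)\<^sup>2 + (x * b - a * y)\<^sup>2 = (x\<^sup>2 + y\<^sup>2) * (a\<^sup>2 + b\<^sup>2)"
            by (simp add: algebra_simps power2_eq_square)
          then have "(x * b - a * y)\<^sup>2 \<le> m\<^sup>2"
            using p(1) abm(1) by (metis le_add_same_cancel2 power2_eq_square zero_le_power2)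
          then have "\<bar>x * b - a * y\<bar> \<le> m" using m by (simp add: abs_le_square_iff[symmetric])
          moreover have "\<bar>m * q\<bar> = 2 * \<bar>x * b - a * y\<bar>"
            unfolding q[symmetric] abs_mult by simp
          ultimately have "\<bar>m * q\<bar> \<le> m * 2" by simp
          then have "\<bar>q\<bar> \<le> 2" using m by (simp add: abs_mult)
          then have "q \<in> {-2, -1, 0, 1, 2}" by auto
          then have "m * q \<in> {0, m, -m, 2 * m, -2 * m}" by auto
          then show "?h P \<in> {0, m, -m, 2 * m, -2 * m} \<times> UNIV" unfolding ab using q by auto
        qed
      qed auto
      also have "\<dots> \<le> 10"
      proof -
        have "card {0, m, -m, 2 * m, -2 * m} \<le> 5"
          using card_length[of "[0, m, -m, 2 * m, -2 * m]"] by simp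
        then show ?thesis by (simp add: card_cartesian_product)
      qed
      finally show ?thesis .
    next
      case True
      show ?thesis unfolding True by simp
    qed
  qed (use m in auto)
  then show ?thesis by simp
next
  case True
  show ?thesis unfolding True by simp
qed

text \<open>Dividing out the gcd e of the coordinates leaves a primitive point on the circle of
  squared radius m / e^2. Since e divides m, the sum over e costs a second divisor count.\<close>

lemma card_circle_points:
  fixes m :: int
  assumes m: "m > 0"
  shows "card (circle_points m) \<le> 10 * (card {d. d dvd nat m})\<^sup>2"
proof -
  let ?D = "\<lambda>n. card {d::nat. d dvd n}"
  let ?f = "\<lambda>(x, y). nat (gcd x y :: int)"
  have "card (circle_points m) \<le> ?D (nat m) * (10 * ?D (nat m))"
  proof (rule card_le_fibers[where f = ?f, OF _ finite_circle_points])
    show "?f ` circle_points m \<subseteq> {d. d dvd nat m}"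
    proof (rule image_subsetI)
      fix P assume "P \<in> circle_points m"
      then obtain x y where "P = (x, y)" "m = x * x + y * y" by (auto simp: circle_points_def power2_eq_square)
      then show "?f P \<in> {d. d dvd nat m}" using m by (auto simp: nat_dvd_iff)
    qed
  next
    fix e assume "e \<in> {d. d dvd nat m}"
    let ?F = "{p \<in> circle_points m. ?f p = e}"
    show "card ?F \<le> 10 * ?D (nat m)"
    proof (cases "?F = {}")
      case False
      then obtain x y where xy: "x\<^sup>2 + y\<^sup>2 = m" "nat (gcd x y) = e" by (auto simp: circle_points_def)
      have "gcd x y \<noteq> 0" using xy(1) m by auto
      then have "gcd x y > 0" using gcd_ge_0_int[of x y] by linarith
      then have e0: "e > 0" using xy(2) by auto
      define m' where "m' = (x div int e)\<^sup>2 + (y div int e)\<^sup>2"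
      have dv: "int e dvd x" "int e dvd y" using xy(2) by auto
      have mm: "m = (int e)\<^sup>2 * m'"
        using dv by (auto simp: m'_def xy(1)[symmetric] power_mult_distrib[symmetric] distrib_left)
      have m'0: "m' > 0" using m e0 unfolding mm by (simp add: zero_less_mult_iff)
      have "?F \<subseteq> (\<lambda>(a, b). (int e * a, int e * b)) ` {(x, y) \<in> circle_points m'. coprime x y}"
      proof
        fix P assume "P \<in> ?F"
        then obtain a b where P: "P = (a, b)" "a\<^sup>2 + b\<^sup>2 = m" "nat (gcd a b) = e"
          by (auto simp: circle_points_def)
        have ge: "gcd a b = int e" using P(3) by auto
        then obtain a' b' where ab: "a = int e * a'" "b = int e * b'" by (metis dvdE gcd_dvd1 gcd_dvd2)
        have "int e * gcd a' b' = int e" using ge unfolding ab by (simp add: gcd_mult_left)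
        then have "coprime a' b'" using e0 by (simp add: coprime_iff_gcd_eq_1)
        moreover have "(int e)\<^sup>2 * (a'\<^sup>2 + b'\<^sup>2) = (int e)\<^sup>2 * m'"
          using P(2) ab mm by (simp add: algebra_simps power_mult_distrib)
        then have "a'\<^sup>2 + b'\<^sup>2 = m'" using e0 by simp
        ultimately show "P \<in> (\<lambda>(a, b). (int e * a, int e * b)) ` {(x, y) \<in> circle_points m'. coprime x y}"
          using P(1) ab by (force simp: circle_points_def)
      qed
      then have "card ?F \<le> card {(x, y) \<in> circle_points m'. coprime x y}"
        by (rule surj_card_le[rotated]) (auto intro: finite_subset[OF _ finite_circle_points])
      also have "\<dots> \<le> 10 * ?D (nat m')" by (rule card_primitive_circle_points[OF m'0])
      also have "?D (nat m') \<le> ?D (nat m)"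
      proof (intro card_mono)
        have "nat m' dvd nat m" using m m'0 unfolding mm by (simp add: nat_mult_distrib)
        then show "{d. d dvd nat m'} \<subseteq> {d. d dvd nat m}" by (auto intro: dvd_trans)
      qed (use m in auto)
      finally show ?thesis by simp
    next
      case True
      show ?thesis unfolding True by simp
    qed
  qed (use m in auto)
  then show ?thesis by (simp add: power2_eq_square mult_ac)
qed

lemma card_circle_points_powr:
  fixes \<epsilon> :: real
  assumes "\<epsilon> > 0"
  shows "\<exists>C\<ge>1. \<forall>m>0. real (card (circle_points m)) \<le> C * real_of_int m powr \<epsilon>"
proof -
  obtain C where C: "C \<ge> 1" "\<And>n. n > 0 \<Longrightarrow> real (card {d::nat. d dvd n}) \<le> C * real n powr (\<epsilon> / 2)"
    using divisor_bound[of "\<epsilon> / 2"] assms by auto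
  have "real (card (circle_points m)) \<le> (10 * C\<^sup>2) * real_of_int m powr \<epsilon>" if "m > 0" for m
  proof -
    have "real (card (circle_points m)) \<le> real (10 * (card {d. d dvd nat m})\<^sup>2)"
      using card_circle_points[OF that] by (rule of_nat_mono)
    also have "\<dots> = 10 * (real (card {d. d dvd nat m}))\<^sup>2" by simp
    also have "\<dots> \<le> 10 * (C * real (nat m) powr (\<epsilon> / 2))\<^sup>2"
      using C(2)[of "nat m"] that by (intro mult_left_mono power_mono) auto
    also have "\<dots> = (10 * C\<^sup>2) * real_of_int m powr \<epsilon>"
      using that by (simp add: power_mult_distrib power2_eq_square flip: powr_add)
    finally show ?thesis .
  qed
  moreover have "10 * C\<^sup>2 \<ge> 1" using one_le_power[OF C(1), of 2] by simp
  ultimately show ?thesis by blast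
qed

text \<open>This is the square of "product of the sides = 4 times circumradius times area", with
  squared circumradius m and the determinant on the right equal to twice the signed area.\<close>

lemma circumradius_identity:
  fixes x1 y1 x2 y2 x3 y3 m :: int
  assumes "x1\<^sup>2 + y1\<^sup>2 = m" "x2\<^sup>2 + y2\<^sup>2 = m" "x3\<^sup>2 + y3\<^sup>2 = m"
  shows "((x1 - x2)\<^sup>2 + (y1 - y2)\<^sup>2) * ((x2 - x3)\<^sup>2 + (y2 - y3)\<^sup>2) * ((x3 - x1)\<^sup>2 + (y3 - y1)\<^sup>2)
    = 4 * m * ((x2 - x1) * (y3 - y1) - (x3 - x1) * (y2 - y1))\<^sup>2"
proof -
  define p q r where "p = x1 * x2 + y1 * y2" and "q = x2 * x3 + y2 * y3" and "r = x3 * x1 + y3 * y1"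
  define P Q R where "P = x1 * y2 - x2 * y1" and "Q = x2 * y3 - x3 * y2" and "R = x3 * y1 - x1 * y3"
  have lag: "(a * d - c * b)\<^sup>2 = (a\<^sup>2 + b\<^sup>2) * (c\<^sup>2 + d\<^sup>2) - (a * c + b * d)\<^sup>2" for a b c d :: int
    by (simp add: power2_eq_square algebra_simps)
  have pP: "P\<^sup>2 = m\<^sup>2 - p\<^sup>2" "Q\<^sup>2 = m\<^sup>2 - q\<^sup>2" "R\<^sup>2 = m\<^sup>2 - r\<^sup>2"
    using lag[of x1 y2 x2 y1] lag[of x2 y3 x3 y2] lag[of x3 y1 x1 y3] assms
    unfolding p_def q_def r_def P_def Q_def R_def by (simp_all add: power2_eq_square mult_ac)
  have lag2: "(a * d - c * b) * (c * f - e * d)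
      = (a * c + b * d) * (c * e + d * f) - (c\<^sup>2 + d\<^sup>2) * (e * a + f * b)" for a b c d e f :: int
    by (simp add: power2_eq_square algebra_simps)
  have PQ: "P * Q = p * q - m * r" "Q * R = q * r - m * p" "R * P = r * p - m * q"
    using lag2[of x1 y2 x2 y1 y3 x3] lag2[of x2 y3 x3 y2 y1 x1] lag2[of x3 y1 x1 y3 y2 x2] assms
    unfolding p_def q_def r_def P_def Q_def R_def by simp_all
  have dist: "(a - c)\<^sup>2 + (b - d)\<^sup>2 = (a\<^sup>2 + b\<^sup>2) + (c\<^sup>2 + d\<^sup>2) - 2 * (a * c + b * d)" for a b c d :: int
    by (simp add: power2_eq_square algebra_simps)
  have d: "(x1 - x2)\<^sup>2 + (y1 - y2)\<^sup>2 = 2 * (m - p)" "(x2 - x3)\<^sup>2 + (y2 - y3)\<^sup>2 = 2 * (m - q)"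
     "(x3 - x1)\<^sup>2 + (y3 - y1)\<^sup>2 = 2 * (m - r)"
    unfolding dist assms p_def q_def r_def by simp_all
  have D: "(x2 - x1) * (y3 - y1) - (x3 - x1) * (y2 - y1) = P + Q + R"
    unfolding P_def Q_def R_def by (simp add: algebra_simps)
  have "m * (P + Q + R)\<^sup>2 = 2 * ((m - p) * (m - q) * (m - r))"
  proof -
    \<comment> \<open>Three vectors in the plane are linearly dependent; \<open>rel\<close> says
      that their Gram determinant vanishes.\<close>
    have "(x1\<^sup>2 + y1\<^sup>2) * (x2\<^sup>2 + y2\<^sup>2) * (x3\<^sup>2 + y3\<^sup>2) + 2 * p * q * r
        = (x1\<^sup>2 + y1\<^sup>2) * q\<^sup>2 + (x2\<^sup>2 + y2\<^sup>2) * r\<^sup>2 + (x3\<^sup>2 + y3\<^sup>2) * p\<^sup>2"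
      unfolding p_def q_def r_def by (simp add: power2_eq_square algebra_simps)
    then have rel: "m ^ 3 + 2 * p * q * r = m * (p\<^sup>2 + q\<^sup>2 + r\<^sup>2)"
      unfolding assms by (simp add: power3_eq_cube algebra_simps)
    have "(P + Q + R)\<^sup>2 = P\<^sup>2 + Q\<^sup>2 + R\<^sup>2 + 2 * (P * Q + Q * R + R * P)"
      by (simp add: power2_eq_square algebra_simps)
    also have "\<dots> = 3 * m\<^sup>2 - (p\<^sup>2 + q\<^sup>2 + r\<^sup>2) + 2 * (p * q + q * r + r * p) - 2 * m * (p + q + r)"
      unfolding pP PQ by (simp add: algebra_simps)
    finally have F: "(P + Q + R)\<^sup>2
        = 3 * m\<^sup>2 - (p\<^sup>2 + q\<^sup>2 + r\<^sup>2) + 2 * (p * q + q * r + r * p) - 2 * m * (p + q + r)" .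
    show ?thesis unfolding F using rel by (simp add: power2_eq_square power3_eq_cube algebra_simps)
  qed
  then show ?thesis unfolding d D by (simp add: algebra_simps)
qed

text \<open>Three lattice points on a circle span a triangle of area at least \<open>1/2\<close>, and the area
  is the product of the side lengths over four times the radius.\<close>

lemma near_circle_points_le_2:
  fixes a b \<rho> :: real
  assumes \<rho>: "16 * \<rho> ^ 3 \<le> real_of_int m" and m: "m > 0"
  shows "card {(x, y) \<in> circle_points m. (real_of_int x - a)\<^sup>2 + (real_of_int y - b)\<^sup>2 < \<rho>} \<le> 2"
    (is "card ?N \<le> 2")
proof (rule ccontr)
  assume "\<not> card ?N \<le> 2"
  then have "card ?N \<ge> 3" by simp
  then obtain T where T: "T \<subseteq> ?N" "card T = 3" by (meson obtain_subset_with_card_n)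
  then obtain P1 P2 P3 where P: "T = {P1, P2, P3}" "P1 \<noteq> P2" "P2 \<noteq> P3" "P3 \<noteq> P1"
    using card_3_iff by metis
  obtain x1 y1 x2 y2 x3 y3 where Q: "P1 = (x1, y1)" "P2 = (x2, y2)" "P3 = (x3, y3)"
    by (meson surj_pair)
  define d where "d = (\<lambda>(x::int) (y::int) (u::int) (v::int). (x - u)\<^sup>2 + (y - v)\<^sup>2)"
  have on: "x1\<^sup>2 + y1\<^sup>2 = m" "x2\<^sup>2 + y2\<^sup>2 = m" "x3\<^sup>2 + y3\<^sup>2 = m"
    and near: "(real_of_int x1 - a)\<^sup>2 + (real_of_int y1 - b)\<^sup>2 < \<rho>"
      "(real_of_int x2 - a)\<^sup>2 + (real_of_int y2 - b)\<^sup>2 < \<rho>"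
      "(real_of_int x3 - a)\<^sup>2 + (real_of_int y3 - b)\<^sup>2 < \<rho>"
    using T P Q by (auto simp: circle_points_def)
  \<comment> \<open>\<rho> is a squared radius, so squared mutual distances stay below 4 \<rho>.
    Three of them multiply to 64 \<rho>^3 = 4 (16 \<rho>^3), which explains the 16 in the
    hypothesis.\<close>
  have d4: "real_of_int (d x y u v) < 4 * \<rho>"
    if "(real_of_int x - a)\<^sup>2 + (real_of_int y - b)\<^sup>2 < \<rho>"
       "(real_of_int u - a)\<^sup>2 + (real_of_int v - b)\<^sup>2 < \<rho>" for x y u v
  proof -
    have *: "(s - t)\<^sup>2 \<le> 2 * (s - w)\<^sup>2 + 2 * (t - w)\<^sup>2" for s t w :: real
      using zero_le_power2[of "(s - w) + (t - w)"] by (simp add: power2_eq_square algebra_simps)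
    show ?thesis
      using *[of "real_of_int x" "real_of_int u" a] *[of "real_of_int y" "real_of_int v" b] that
      unfolding d_def by simp
  qed
  have dpos: "d x y u v > 0" if "(x, y) \<noteq> (u, v)" for x y u v
    using that by (auto simp: d_def sum_power2_gt_zero_iff)
  have pos: "d x1 y1 x2 y2 > 0" "d x2 y2 x3 y3 > 0" "d x3 y3 x1 y1 > 0"
    using dpos P Q by auto
  define D where "D = (x2 - x1) * (y3 - y1) - (x3 - x1) * (y2 - y1)"
  have id: "d x1 y1 x2 y2 * d x2 y2 x3 y3 * d x3 y3 x1 y1 = 4 * m * D\<^sup>2"
    using circumradius_identity[OF on] by (simp add: d_def D_def)
  \<comment> \<open>The identity itself excludes collinear triples: all sides are nonzero, so
    \<open>D\<close> is a nonzero integer.\<close>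
  have "d x1 y1 x2 y2 * d x2 y2 x3 y3 * d x3 y3 x1 y1 > 0" using pos by simp
  then have "D \<noteq> 0" using id by auto
  then have "D\<^sup>2 \<ge> 1" by (simp add: int_one_le_iff_zero_less)
  then have "4 * m \<le> d x1 y1 x2 y2 * d x2 y2 x3 y3 * d x3 y3 x1 y1"
    using m unfolding id by (simp add: mult_le_cancel_left1)
  then have "real_of_int (4 * m) \<le> real_of_int (d x1 y1 x2 y2 * d x2 y2 x3 y3 * d x3 y3 x1 y1)"
    by (rule of_int_le_iff[THEN iffD2])
  also have "\<dots> < (4 * \<rho>) * (4 * \<rho>) * (4 * \<rho>)"
    unfolding of_int_mult
    by (intro mult_strict_mono d4 near mult_pos_pos) (use d4[OF near(1,2)] d4[OF near(2,3)] pos in auto)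
  also have "\<dots> = 4 * (16 * \<rho> ^ 3)" by (simp add: power3_eq_cube)
  finally show False using \<rho> by simp
qed

text \<open>With \<rho> of order m^(1/3), at most two points lie within squared distance \<rho> of
  the centre and count as 1 each. Every other weight is at most \<rho>^(-\<epsilon>), of order
  m^(-\<epsilon>/3), which cancels the bound C m^(\<epsilon>/3) for their number. Hence no
  dependence on radius or centre.\<close>

lemma circle_points_weighted_sum:
  fixes \<epsilon> :: real
  assumes \<epsilon>: "\<epsilon> > 0"
  shows "\<exists>B\<ge>0. \<forall>m a b. (\<Sum>(x, y)\<in>circle_points m.
    (1 + (real_of_int x - a)\<^sup>2 + (real_of_int y - b)\<^sup>2) powr (-\<epsilon>)) \<le> B"
proof -
  obtain C where C: "C \<ge> 1" "\<And>m. m > 0 \<Longrightarrow> real (card (circle_points m)) \<le> C * real_of_int m powr (\<epsilon> / 3)"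
    using card_circle_points_powr[of "\<epsilon> / 3"] \<epsilon> by auto
  define B where "B = 2 + C * 16 powr (\<epsilon> / 3)"
  have B1: "B \<ge> 2" using C(1) by (simp add: B_def)
  have "(\<Sum>(x, y)\<in>circle_points m. (1 + (real_of_int x - a)\<^sup>2 + (real_of_int y - b)\<^sup>2) powr (-\<epsilon>)) \<le> B"
    for m a b
  proof -
    let ?w = "\<lambda>(x, y). (1 + (real_of_int x - a)\<^sup>2 + (real_of_int y - b)\<^sup>2) powr (-\<epsilon>)"
    have w1: "?w P \<le> 1" for P
    proof -
      have "1 + ((u - a)\<^sup>2 + (v - b)\<^sup>2) \<ge> (1::real)" for u v by simp
      from powr_mono2'[OF _ _ this, of "-\<epsilon>"] show ?thesis
        using \<epsilon> by (cases P) (simp add: add.assoc)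
    qed
    consider "m > 0" | "m = 0" | "m < 0" by linarith
    then show ?thesis
    proof cases
      case 1
      define \<rho> where "\<rho> = (real_of_int m / 16) powr (1/3)"
      have \<rho>0: "\<rho> > 0" using 1 by (simp add: \<rho>_def)
      have \<rho>3: "\<rho> ^ 3 = real_of_int m / 16"
        using 1 \<rho>0 by (subst powr_realpow[symmetric]) (auto simp: \<rho>_def powr_powr)
      let ?N = "{(x, y) \<in> circle_points m. (real_of_int x - a)\<^sup>2 + (real_of_int y - b)\<^sup>2 < \<rho>}"
      have "sum ?w (circle_points m) = sum ?w ?N + sum ?w (circle_points m - ?N)"
        by (rule sum.subset_diff[THEN trans[OF _ add.commute]]) (auto simp: finite_circle_points)
      also have "sum ?w ?N \<le> 2"
      proof -
        have "card ?N \<le> 2" by (rule near_circle_points_le_2) (use 1 \<rho>3 in simp_all)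
        moreover have "sum ?w ?N \<le> real (card ?N) * 1" by (rule sum_bounded_above) (rule w1)
        ultimately show ?thesis by linarith
      qed
      also have "sum ?w (circle_points m - ?N) \<le> (\<Sum>P\<in>circle_points m - ?N. \<rho> powr (-\<epsilon>))"
      proof (rule sum_mono)
        fix P assume "P \<in> circle_points m - ?N"
        then show "?w P \<le> \<rho> powr (-\<epsilon>)"
          using \<rho>0 \<epsilon> by (auto intro!: powr_mono2')
      qed
      also have "\<dots> \<le> real (card (circle_points m)) * \<rho> powr (-\<epsilon>)"
        using card_mono[OF finite_circle_points Diff_subset, of m ?N] by (simp add: mult_right_mono)
      also have "\<dots> \<le> (C * real_of_int m powr (\<epsilon> / 3)) * \<rho> powr (-\<epsilon>)"
        by (intro mult_right_mono C 1) auto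
      also have "\<dots> = C * 16 powr (\<epsilon> / 3)"
        using 1 by (simp add: \<rho>_def powr_powr powr_divide powr_minus field_simps)
      finally show ?thesis by (simp add: B_def)
    next
      case 2
      have "circle_points m = {(0, 0)}" using 2 by (auto simp: circle_points_def)
      then show ?thesis using w1[of "(0, 0)"] B1 by simp
    next
      case 3
      have "circle_points m = {}" using 3 by (auto simp: circle_points_def) (smt (verit) zero_le_power2)
      then show ?thesis using B1 by simp
    qed
  qed
  then show ?thesis using B1 by (intro exI[of _ B]) auto
qed

section \<open>Weighted lattice sums\<close>

abbreviation brk :: "int ^ 'd \<Rightarrow> real" where
  "brk k \<equiv> japanese_bracket (real_vec k)"

lemma brk_sq: "(brk k)\<^sup>2 = 1 + (\<Sum>i\<in>UNIV. (real_of_int (k $ i))\<^sup>2)"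
  by (simp add: japanese_bracket_def real_vec_def norm_vec_def L2_set_def sum_nonneg)

lemma square_powr: "(x\<^sup>2) powr a = x powr (2 * a)" if "x > 0" for x a :: real
  using that by (simp add: power2_eq_square powr_mult flip: powr_add)

lemma bracket_ge_1: "japanese_bracket y \<ge> 1"
  by (simp add: japanese_bracket_def)

text \<open>A countable type is the increasing union of the finite sets of elements with code below
  n, so monotone convergence passes bounds for finite sums to the integral.\<close>

lemma nn_integral_count_space_le:
  fixes f :: "'a::countable \<Rightarrow> ennreal"
  assumes "\<And>F. finite F \<Longrightarrow> (\<Sum>k\<in>F. f k) \<le> C"
  shows "(\<integral>\<^sup>+k. f k \<partial>count_space UNIV) \<le> C"
proof -
  define A where "A = (\<lambda>n. {k::'a. to_nat k < n})"
  have fin: "finite (A n)" for n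
    unfolding A_def by (rule finite_imageD[of to_nat]) (auto intro: finite_subset[of _ "{..<n}"] simp:
        inj_on_def)
  have "(\<integral>\<^sup>+k. f k \<partial>count_space UNIV) = (\<integral>\<^sup>+k. (SUP n. f k * indicator (A n) k) \<partial>count_space UNIV)"
  proof (rule nn_integral_cong)
    fix k :: 'a
    have "(SUP n. f k * indicator (A n) k) = f k"
    proof (rule antisym)
      show "(SUP n. f k * indicator (A n) k) \<le> f k"
        by (rule SUP_least) (auto simp: indicator_def)
      show "f k \<le> (SUP n. f k * indicator (A n) k)"
        by (rule SUP_upper2[of "Suc (to_nat k)"]) (auto simp: A_def)
    qed
    then show "f k = (SUP n. f k * indicator (A n) k)" by simp
  qed
  also have "\<dots> = (SUP n. \<integral>\<^sup>+k. f k * indicator (A n) k \<partial>count_space UNIV)"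
    by (rule nn_integral_monotone_convergence_SUP)
      (auto simp: incseq_def le_fun_def A_def indicator_def)
  also have "\<dots> \<le> C"
  proof (rule SUP_least)
    fix n
    have "(\<integral>\<^sup>+k. f k * indicator (A n) k \<partial>count_space UNIV) = (\<integral>\<^sup>+k. f k \<partial>count_space (A n))"
      by (simp add: nn_integral_count_space_indicator)
    also have "\<dots> = (\<Sum>k\<in>A n. f k)" by (rule nn_integral_count_space_finite[OF fin])
    also have "\<dots> \<le> C" by (rule assms[OF fin])
    finally show "(\<integral>\<^sup>+k. f k * indicator (A n) k \<partial>count_space UNIV) \<le> C" .
  qed
  finally show ?thesis .
qed

text \<open>The point is uniformity in the shift \<open>p\<close>: the weights on spheres are
  centred at arbitrary lattice points.\<close>

lemma sum_int_bracket_powr: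
  fixes \<gamma> :: real
  assumes "\<gamma> > 1"
  shows "\<exists>H\<ge>0. \<forall>F p. finite F \<longrightarrow> (\<Sum>n\<in>F. (1 + (real_of_int (n - p))\<^sup>2) powr (-\<gamma> / 2)) \<le> H"
proof -
  define f where "f = (\<lambda>n::nat. (1 + (real n)\<^sup>2) powr (-\<gamma> / 2))"
  have "f n \<le> real n powr (-\<gamma>)" if "n \<ge> 1" for n
  proof -
    have "f n \<le> ((real n)\<^sup>2) powr (-\<gamma> / 2)"
      unfolding f_def using that assms by (intro powr_mono2') auto
    also have "\<dots> = real n powr (-\<gamma>)"
      using that by (simp add: square_powr)
    finally show ?thesis .
  qed
  moreover have "summable (\<lambda>n. real n powr (-\<gamma>))"
    using assms by (simp add: summable_real_powr_iff)
  ultimately have sf: "summable f"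
    by (intro summable_comparison_test[of f]) (auto intro!: exI[of _ 1] simp: f_def)
  have f0: "f n \<ge> 0" for n by (simp add: f_def)
  have half: "(\<Sum>n\<in>F. f (nat \<bar>n\<bar>)) \<le> suminf f" if "finite F" "inj_on (\<lambda>n. nat \<bar>n\<bar>) F" for F :: "int set"
  proof -
    have "(\<Sum>n\<in>F. f (nat \<bar>n\<bar>)) = sum f ((\<lambda>n. nat \<bar>n\<bar>) ` F)"
      using that(2) by (simp add: sum.reindex)
    also have "\<dots> \<le> suminf f" using that sf f0 by (intro sum_le_suminf) auto
    finally show ?thesis .
  qed
  have "(\<Sum>n\<in>F. (1 + (real_of_int (n - p))\<^sup>2) powr (-\<gamma> / 2)) \<le> 2 * suminf f" if F: "finite F" for F p
  proof -
    have "(\<Sum>n\<in>F. (1 + (real_of_int (n - p))\<^sup>2) powr (-\<gamma> / 2)) = (\<Sum>n\<in>F. f (nat \<bar>n - p\<bar>))"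
      by (simp add: f_def)
    also have "\<dots> = (\<Sum>n\<in>(\<lambda>n. n - p) ` F. f (nat \<bar>n\<bar>))"
      by (simp add: sum.reindex inj_on_def)
    also have "\<dots> = (\<Sum>n\<in>((\<lambda>n. n - p) ` F) \<inter> {0..}. f (nat \<bar>n\<bar>)) + (\<Sum>n\<in>((\<lambda>n. n - p) ` F) \<inter> {..<0}. f (nat \<bar>n\<bar>))"
      using F by (subst sum.union_disjoint[symmetric]) (auto intro!: sum.cong)
    also have "\<dots> \<le> suminf f + suminf f"
      using F by (intro add_mono half) (auto simp: inj_on_def)
    finally show ?thesis by simp
  qed
  moreover have "suminf f \<ge> 0" by (rule suminf_nonneg[OF sf f0])
  ultimately show ?thesis by (intro exI[of _ "2 * suminf f"]) auto
qed

text \<open>Fubini over the coordinates in \<open>J\<close>: each choice of their values cuts out a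
  slice on which \<phi> sums to at most \<open>B\<close>, and the product weights are then summed
  coordinate by coordinate. It is used with \<open>J\<close> everything, where slices are points,
  and with all but two coordinates, where they lie on circles.\<close>

lemma sum_slices:
  fixes F :: "(int ^ 'd) set" and h :: "'d::finite \<Rightarrow> int \<Rightarrow> real"
  assumes F: "finite F" and h: "\<And>l n. h l n \<ge> 0" and H: "\<And>l X. finite X \<Longrightarrow> sum (h l) X \<le> H"
    and \<phi>: "\<And>r. (\<Sum>k\<in>{k \<in> F. \<forall>l\<in>J. k $ l = r l}. \<phi> k) \<le> B" and B: "B \<ge> 0"
  shows "(\<Sum>k\<in>F. \<phi> k * (\<Prod>l\<in>J. h l (k $ l))) \<le> B * H ^ card J"
proof -
  define \<rho> where "\<rho> = (\<lambda>k::int^'d. restrict (\<lambda>l. k $ l) J)"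
  define X where "X = (\<lambda>l. (\<lambda>k::int^'d. k $ l) ` F)"
  have fib: "{k \<in> F. \<rho> k = r} = {k \<in> F. \<forall>l\<in>J. k $ l = r l}" if "r \<in> \<rho> ` F" for r
    using that by (auto simp: \<rho>_def restrict_def fun_eq_iff)
  have "(\<Sum>k\<in>F. \<phi> k * (\<Prod>l\<in>J. h l (k $ l))) = (\<Sum>r\<in>\<rho> ` F. \<Sum>k\<in>{k \<in> F. \<rho> k = r}. \<phi> k * (\<Prod>l\<in>J. h l (k $ l)))"
    by (rule sum.image_gen[OF F])
  also have "\<dots> = (\<Sum>r\<in>\<rho> ` F. (\<Sum>k\<in>{k \<in> F. \<forall>l\<in>J. k $ l = r l}. \<phi> k) * (\<Prod>l\<in>J. h l (r l)))"
    by (intro sum.cong refl) (simp add: fib sum_distrib_right)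
  also have "\<dots> \<le> (\<Sum>r\<in>\<rho> ` F. B * (\<Prod>l\<in>J. h l (r l)))"
    by (intro sum_mono mult_right_mono \<phi> prod_nonneg) (auto simp: h)
  also have "\<dots> \<le> (\<Sum>r\<in>PiE J X. B * (\<Prod>l\<in>J. h l (r l)))"
  proof (rule sum_mono2)
    show "finite (PiE J X)" using F by (intro finite_PiE) (auto simp: X_def)
    show "\<rho> ` F \<subseteq> PiE J X" by (auto simp: \<rho>_def X_def)
  qed (auto intro!: mult_nonneg_nonneg prod_nonneg B h)
  also have "\<dots> = B * (\<Prod>l\<in>J. \<Sum>n\<in>X l. h l n)"
    using F by (subst prod_sum_PiE) (auto simp: X_def sum_distrib_left)
  also have "\<dots> \<le> B * (\<Prod>l\<in>J. H)"
    using F by (intro mult_left_mono prod_mono B) (auto simp: X_def intro!: H sum_nonneg h)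
  finally show ?thesis by simp
qed

lemma coord_le_brk: "1 + (real_of_int (k $ i))\<^sup>2 \<le> (brk k)\<^sup>2"
  unfolding brk_sq using member_le_sum[of i UNIV "\<lambda>i. (real_of_int (k $ i))\<^sup>2"] by simp

text \<open>The bracket dominates each one-dimensional bracket, so \<alpha> can be shared equally;
  every coordinate then receives an exponent \<alpha> / d > 1.\<close>

lemma sum_brk_powr:
  fixes \<alpha> :: real
  assumes "\<alpha> > real CARD('d::finite)"
  shows "\<exists>C\<ge>0. (\<integral>\<^sup>+k. ennreal (brk (k :: int ^ 'd) powr (-\<alpha>)) \<partial>count_space UNIV) \<le> ennreal C"
proof -
  define \<gamma> where "\<gamma> = \<alpha> / real CARD('d)"
  have \<gamma>: "\<gamma> > 1" using assms by (simp add: \<gamma>_def)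
  obtain H where H: "H \<ge> 0" "\<And>F p. finite F \<Longrightarrow> (\<Sum>n\<in>F. (1 + (real_of_int (n - p))\<^sup>2) powr (-\<gamma> / 2)) \<le> H"
    using sum_int_bracket_powr[OF \<gamma>] by blast
  have "(\<Sum>k\<in>F. ennreal (brk k powr (-\<alpha>))) \<le> ennreal (1 * H ^ card (UNIV :: 'd set))"
    if F: "finite F" for F :: "(int ^ 'd) set"
  proof -
    have pt: "brk k powr (-\<alpha>) \<le> 1 * (\<Prod>l\<in>UNIV. (1 + (real_of_int (k $ l))\<^sup>2) powr (-\<gamma> / 2))" for k :: "int ^ 'd"
    proof -
      have "brk k powr (-\<alpha>) = (\<Prod>l\<in>(UNIV :: 'd set). brk k powr (-\<gamma>))"
        using bracket_ge_1[of "real_vec k"] by (simp add: powr_power \<gamma>_def)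
      also have "\<dots> \<le> (\<Prod>l\<in>UNIV. (1 + (real_of_int (k $ l))\<^sup>2) powr (-\<gamma> / 2))"
      proof (intro prod_mono conjI)
        fix l
        have "brk k powr (-\<gamma>) = ((brk k)\<^sup>2) powr (-\<gamma> / 2)"
          using bracket_ge_1[of "real_vec k"] by (simp add: square_powr)
        also have "\<dots> \<le> (1 + (real_of_int (k $ l))\<^sup>2) powr (-\<gamma> / 2)"
          using \<gamma> by (intro powr_mono2' coord_le_brk) (auto simp: add_pos_nonneg)
        finally show "brk k powr (-\<gamma>) \<le> (1 + (real_of_int (k $ l))\<^sup>2) powr (-\<gamma> / 2)" .
      qed auto
      finally show ?thesis by simp
    qed
    have "(\<Sum>k\<in>F. brk k powr (-\<alpha>)) \<le> (\<Sum>k\<in>F. 1 * (\<Prod>l\<in>UNIV. (1 + (real_of_int (k $ l))\<^sup>2) powr (-\<gamma> / 2)))"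
      by (intro sum_mono pt)
    also have "\<dots> \<le> 1 * H ^ card (UNIV :: 'd set)"
    proof (rule sum_slices[where h = "\<lambda>l n. (1 + (real_of_int n)\<^sup>2) powr (-\<gamma> / 2)"])
      show "sum (\<lambda>n. (1 + (real_of_int n)\<^sup>2) powr (-\<gamma> / 2)) X \<le> H" if "finite X" for X
        using H(2)[OF that, of 0] by simp
      fix r :: "'d \<Rightarrow> int"
      have "{k \<in> F. \<forall>l\<in>UNIV. k $ l = r l} \<subseteq> {vec_lambda r}" by (auto simp: vec_eq_iff)
      then have "card {k \<in> F. \<forall>l\<in>UNIV. k $ l = r l} \<le> card {vec_lambda r}" by (intro card_mono) auto
      then show "(\<Sum>k\<in>{k \<in> F. \<forall>l\<in>UNIV. k $ l = r l}. 1) \<le> (1::real)" by simp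
    qed (use F in auto)
    finally show ?thesis by (subst sum_ennreal) (auto intro!: ennreal_leI)
  qed
  then have "(\<integral>\<^sup>+k. ennreal (brk (k :: int ^ 'd) powr (-\<alpha>)) \<partial>count_space UNIV)
      \<le> ennreal (1 * H ^ card (UNIV :: 'd set))"
    by (rule nn_integral_count_space_le)
  then show ?thesis using H(1) by (intro exI[of _ "1 * H ^ card (UNIV :: 'd set)"]) auto
qed

text \<open>Summing a frozen coordinate costs slightly more than one power of the weight. Freezing
  all but two costs slightly more than d - 2, and what is left of 2 s > d - 2 is a positive power on
  a circle, where any positive power suffices. This is the origin of s0. In dimension one a sphere
  has at most two points.\<close>

lemma sphere_points_weighted_sum:
  fixes s :: real
  assumes s: "s > max 0 (real CARD('d::finite) / 2 - 1)"
  shows "\<exists>B\<ge>0. \<forall>m (A :: int ^ 'd) F. finite F \<longrightarrow> F \<subseteq> {C. (\<Sum>i\<in>UNIV. (C $ i)\<^sup>2) = m} \<longrightarrow>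
     (\<Sum>C\<in>F. brk (C - A) powr (-2 * s)) \<le> B"
proof (cases "CARD('d) = 1")
  case True
  then obtain i where i: "UNIV = {i::'d}" by (rule card_1_singletonE)
  have "(\<Sum>C\<in>F. brk (C - A) powr (-2 * s)) \<le> 2"
    if F: "finite F" "F \<subseteq> {C. (\<Sum>i\<in>UNIV. (C $ i)\<^sup>2) = m}" for m and A :: "int ^ 'd" and F
  proof (cases "F = {}")
    case False
    then obtain C0 where C0: "C0 \<in> F" by auto
    have "F \<subseteq> {C0, - C0}"
    proof
      fix C assume "C \<in> F"
      have one: "(\<Sum>l\<in>UNIV. (D $ l)\<^sup>2) = (D $ i)\<^sup>2" for D :: "int ^ 'd" unfolding i by simp
      have "(\<Sum>l\<in>UNIV. (C $ l)\<^sup>2) = m" "(\<Sum>l\<in>UNIV. (C0 $ l)\<^sup>2) = m"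
        using \<open>C \<in> F\<close> F(2) C0 by auto
      then have "(C $ i)\<^sup>2 = (C0 $ i)\<^sup>2" unfolding one by simp
      then have c: "C $ i = C0 $ i \<or> C $ i = - C0 $ i" by (simp add: power2_eq_iff)
      have all: "j = i" for j :: 'd using i by auto
      have eq: "C = D" if "C $ i = D $ i" for D
      proof (subst vec_eq_iff, rule allI)
        fix l show "C $ l = D $ l" using that unfolding all[of l] .
      qed
      have "C = C0 \<or> C = - C0" using c eq[of C0] eq[of "- C0"] by auto
      then show "C \<in> {C0, - C0}" by auto
    qed
    then have "card F \<le> card {C0, - C0}" by (intro card_mono) auto
    also have "\<dots> \<le> 2" by (simp add: card_insert_if)
    finally have c: "card F \<le> 2" .
    have "(\<Sum>C\<in>F. brk (C - A) powr (-2 * s)) \<le> (\<Sum>C\<in>F. 1)"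
    proof (rule sum_mono)
      fix C
      show "brk (C - A) powr (-2 * s) \<le> 1"
        using powr_mono2'[of "-2 * s" 1 "brk (C - A)"] bracket_ge_1[of "real_vec (C - A)"] s by auto
    qed
    then show ?thesis using c by simp
  qed simp
  then show ?thesis by (intro exI[of _ 2]) auto
next
  case False
  let ?d = "real CARD('d)"
  have "CARD('d) > 0" by simp
  then have d2: "CARD('d) \<ge> 2" using False by linarith
  then obtain S where S: "S \<subseteq> (UNIV :: 'd set)" "card S = 2" by (meson obtain_subset_with_card_n)
  then obtain i j where ij: "i \<noteq> j" "S = {i, j}" by (meson card_2_iff)
  define J where "J = (UNIV :: 'd set) - {i, j}"
  have "card J = CARD('d) - 2" using S ij unfolding J_def by (subst card_Diff_subset) auto
  then have cJ: "real (card J) = ?d - 2" using d2 by simp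
  \<comment> \<open>The excess of 2 s over d - 2 is 2 d \<eta>. Each of the d - 2 frozen coordinates
    takes exponent 1 + \<eta>, which leaves 2 \<epsilon> = (d + 2) \<eta> for the circle.\<close>
  define \<eta> where "\<eta> = (2 * s - (?d - 2)) / (2 * ?d)"
  define \<gamma> where "\<gamma> = 1 + \<eta>"
  define \<epsilon> where "\<epsilon> = \<eta> * (?d + 2) / 2"
  have \<eta>: "\<eta> > 0" using s d2 by (simp add: \<eta>_def)
  have \<gamma>: "\<gamma> > 1" using \<eta> by (simp add: \<gamma>_def)
  have \<epsilon>: "\<epsilon> > 0" using \<eta> by (simp add: \<epsilon>_def)
  have "2 * s = 2 * ?d * \<eta> + (?d - 2)" using d2 by (simp add: \<eta>_def)
  then have split: "2 * s = 2 * \<epsilon> + real (card J) * \<gamma>"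
    by (simp add: \<epsilon>_def \<gamma>_def cJ field_simps)
  obtain H where H: "H \<ge> 0" "\<And>F p. finite F \<Longrightarrow> (\<Sum>n\<in>F. (1 + (real_of_int (n - p))\<^sup>2) powr (-\<gamma> / 2)) \<le> H"
    using sum_int_bracket_powr[OF \<gamma>] by blast
  obtain B where B: "B \<ge> 0" "\<And>m a b. (\<Sum>(x, y)\<in>circle_points m.
      (1 + (real_of_int x - a)\<^sup>2 + (real_of_int y - b)\<^sup>2) powr (-\<epsilon>)) \<le> B"
    using circle_points_weighted_sum[OF \<epsilon>] by blast
  have "(\<Sum>C\<in>F. brk (C - A) powr (-2 * s)) \<le> B * H ^ card J"
    if F: "finite F" "F \<subseteq> {C. (\<Sum>i\<in>UNIV. (C $ i)\<^sup>2) = m}" for m and A :: "int ^ 'd" and F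
  proof -
    let ?\<phi> = "\<lambda>C. (1 + (real_of_int (C $ i) - A $ i)\<^sup>2 + (real_of_int (C $ j) - A $ j)\<^sup>2) powr (-\<epsilon>)"
    have pt: "brk (C - A) powr (-2 * s) \<le> ?\<phi> C * (\<Prod>l\<in>J. (1 + (real_of_int (C $ l - A $ l))\<^sup>2) powr (-\<gamma> / 2))"
      for C
    proof -
      let ?b = "brk (C - A)"
      have b: "?b \<ge> 1" by (rule bracket_ge_1)
      have b2: "(?b\<^sup>2) powr x = ?b powr (2 * x)" for x
        using b by (simp add: square_powr)
      have "?b powr (-2 * s) = ?b powr (-2 * \<epsilon>) * (\<Prod>l\<in>J. ?b powr (-\<gamma>))"
        using b split by (simp add: powr_power mult_ac flip: powr_add)
      also have "\<dots> \<le> ?\<phi> C * (\<Prod>l\<in>J. (1 + (real_of_int (C $ l - A $ l))\<^sup>2) powr (-\<gamma> / 2))"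
      proof (intro mult_mono prod_mono conjI prod_nonneg)
        have "1 + (\<Sum>l\<in>{i, j}. (real_of_int ((C - A) $ l))\<^sup>2) \<le> ?b\<^sup>2"
          unfolding brk_sq by (intro add_left_mono sum_mono2) auto
        then have "(?b\<^sup>2) powr (-\<epsilon>) \<le> ?\<phi> C"
          using ij \<epsilon> by (intro powr_mono2') (auto simp: add_pos_nonneg)
        then show "?b powr (-2 * \<epsilon>) \<le> ?\<phi> C" unfolding b2 by simp
      next
        fix l
        have "(?b\<^sup>2) powr (-\<gamma> / 2) \<le> (1 + (real_of_int (C $ l - A $ l))\<^sup>2) powr (-\<gamma> / 2)"
          using coord_le_brk[of "C - A" l] \<gamma> by (intro powr_mono2') (auto simp: add_pos_nonneg)
        then show "?b powr (-\<gamma>) \<le> (1 + (real_of_int (C $ l - A $ l))\<^sup>2) powr (-\<gamma> / 2)"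
          unfolding b2 by simp
      qed auto
      finally show ?thesis .
    qed
    have "(\<Sum>C\<in>F. brk (C - A) powr (-2 * s))
        \<le> (\<Sum>C\<in>F. ?\<phi> C * (\<Prod>l\<in>J. (1 + (real_of_int (C $ l - A $ l))\<^sup>2) powr (-\<gamma> / 2)))"
      by (intro sum_mono pt)
    also have "\<dots> \<le> B * H ^ card J"
    proof (rule sum_slices[where h = "\<lambda>l n. (1 + (real_of_int (n - A $ l))\<^sup>2) powr (-\<gamma> / 2)"])
      fix r :: "'d \<Rightarrow> int"
      let ?G = "{C \<in> F. \<forall>l\<in>J. C $ l = r l}"
      let ?p = "\<lambda>C::int^'d. (C $ i, C $ j)"
      have inj: "inj_on ?p ?G"
      proof (rule inj_onI)
        fix C D assume *: "C \<in> ?G" "D \<in> ?G" "?p C = ?p D"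
        show "C = D"
        proof (subst vec_eq_iff, rule allI)
          fix l show "C $ l = D $ l"
            using * by (cases "l \<in> J") (auto simp: J_def)
        qed
      qed
      have img: "?p ` ?G \<subseteq> circle_points (m - (\<Sum>l\<in>J. (r l)\<^sup>2))"
      proof (rule image_subsetI)
        fix C assume C: "C \<in> ?G"
        then have "(\<Sum>l\<in>UNIV. (C $ l)\<^sup>2) = m" using F(2) by auto
        moreover have "(\<Sum>l\<in>UNIV. (C $ l)\<^sup>2) = (\<Sum>l\<in>J. (C $ l)\<^sup>2) + (\<Sum>l\<in>{i, j}. (C $ l)\<^sup>2)"
          unfolding J_def by (rule sum.subset_diff) auto
        moreover have "(\<Sum>l\<in>J. (C $ l)\<^sup>2) = (\<Sum>l\<in>J. (r l)\<^sup>2)" using C by (intro sum.cong) auto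
        ultimately show "?p C \<in> circle_points (m - (\<Sum>l\<in>J. (r l)\<^sup>2))"
          using ij by (simp add: circle_points_def)
      qed
      have "(\<Sum>C\<in>?G. ?\<phi> C) = (\<Sum>(x, y)\<in>?p ` ?G.
          (1 + (real_of_int x - A $ i)\<^sup>2 + (real_of_int y - A $ j)\<^sup>2) powr (-\<epsilon>))"
        by (subst sum.reindex[OF inj]) simp
      also have "\<dots> \<le> (\<Sum>(x, y)\<in>circle_points (m - (\<Sum>l\<in>J. (r l)\<^sup>2)).
          (1 + (real_of_int x - A $ i)\<^sup>2 + (real_of_int y - A $ j)\<^sup>2) powr (-\<epsilon>))"
        by (rule sum_mono2[OF finite_circle_points img]) auto
      also have "\<dots> \<le> B" by (rule B(2))
      finally show "(\<Sum>C\<in>?G. ?\<phi> C) \<le> B" .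
    qed (use F H(2) B(1) in auto)
    finally show ?thesis .
  qed
  then show ?thesis using B(1) H(1) by (intro exI[of _ "B * H ^ card J"]) auto
qed

section \<open>Convolution on a group modulo periods\<close>

lemma ennreal_mult_le_sum_squares: "x * y \<le> x\<^sup>2 + (y::ennreal)\<^sup>2"
proof (cases "x \<le> y")
  case True
  then have "x * y \<le> y\<^sup>2" by (simp add: power2_eq_square mult_right_mono)
  then show ?thesis by (simp add: add_increasing)
next
  case False
  then have "x * y \<le> x\<^sup>2" by (simp add: power2_eq_square mult_left_mono)
  then show ?thesis by (simp add: add_increasing2)
qed

text \<open>Functions of frequency and time are periodic in time, so integrating over one period is
  invariant under translation only for periodic functions: \<open>per\<close> lists the periods.\<close>

locale conv_measure = sigma_finite_measure M for M :: "'a::ab_group_add measure" +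
  fixes per :: "'a set"
  assumes space_UNIV: "space M = UNIV"
    and measurable_diff_pair: "(\<lambda>(x, y). x - y) \<in> M \<Otimes>\<^sub>M M \<rightarrow>\<^sub>M M"
    and translate: "\<And>f :: 'a \<Rightarrow> ennreal. \<lbrakk>f \<in> borel_measurable M; \<And>h x. h \<in> per \<Longrightarrow> f (x + h) = f x\<rbrakk>
        \<Longrightarrow> (\<integral>\<^sup>+x. f (x + a) \<partial>M) = (\<integral>\<^sup>+x. f x \<partial>M)"
    and reflect: "\<And>f :: 'a \<Rightarrow> ennreal. \<lbrakk>f \<in> borel_measurable M; \<And>h x. h \<in> per \<Longrightarrow> f (x + h) = f x\<rbrakk>
        \<Longrightarrow> (\<integral>\<^sup>+x. f (- x) \<partial>M) = (\<integral>\<^sup>+x. f x \<partial>M)"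
begin

definition periodic :: "('a \<Rightarrow> ennreal) \<Rightarrow> bool" where
  "periodic f \<longleftrightarrow> f \<in> borel_measurable M \<and> (\<forall>h\<in>per. \<forall>x. f (x + h) = f x)"

lemma periodic_measurable: "periodic f \<Longrightarrow> f \<in> borel_measurable M"
  by (simp add: periodic_def)

lemma measurable_diff_M [measurable (raw)]:
  assumes [measurable]: "f \<in> N \<rightarrow>\<^sub>M M" "g \<in> N \<rightarrow>\<^sub>M M"
  shows "(\<lambda>x. f x - g x) \<in> N \<rightarrow>\<^sub>M M"
  using measurable_compose[OF _ measurable_diff_pair, of "\<lambda>x. (f x, g x)" N] by simp

lemma measurable_uminus_M [measurable (raw)]:
  assumes [measurable]: "f \<in> N \<rightarrow>\<^sub>M M"
  shows "(\<lambda>x. - f x) \<in> N \<rightarrow>\<^sub>M M"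
proof -
  have "(\<lambda>x. 0 - f x) \<in> N \<rightarrow>\<^sub>M M" by (intro measurable_diff_M) (auto simp: space_UNIV)
  then show ?thesis by simp
qed

lemma measurable_add_M [measurable (raw)]:
  assumes [measurable]: "f \<in> N \<rightarrow>\<^sub>M M" "g \<in> N \<rightarrow>\<^sub>M M"
  shows "(\<lambda>x. f x + g x) \<in> N \<rightarrow>\<^sub>M M"
proof -
  have "(\<lambda>x. f x - (- g x)) \<in> N \<rightarrow>\<^sub>M M" by measurable
  then show ?thesis by simp
qed

lemma measurable_const_M [measurable (raw)]: "(\<lambda>x. c) \<in> N \<rightarrow>\<^sub>M M"
  by (simp add: space_UNIV)

lemma periodic_diff_left:
  assumes "periodic f" "h \<in> per"
  shows "f (x - h) = f x"
proof -
  have "f ((x - h) + h) = f (x - h)" using assms unfolding periodic_def by blast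
  then show ?thesis by simp
qed

lemma periodic_add:
  assumes "periodic f"
  shows "periodic (\<lambda>x. f (x + a))"
proof -
  note [measurable] = periodic_measurable[OF assms]
  have "f (x + h + a) = f (x + a)" if "h \<in> per" for h x
  proof -
    have "f ((x + a) + h) = f (x + a)" using assms that unfolding periodic_def by blast
    then show ?thesis by (simp add: ac_simps)
  qed
  moreover have "(\<lambda>x. f (x + a)) \<in> borel_measurable M" by measurable
  ultimately show ?thesis unfolding periodic_def by blast
qed

lemma periodic_refl:
  assumes "periodic f"
  shows "periodic (\<lambda>x. f (- x))"
proof -
  note [measurable] = periodic_measurable[OF assms]
  have "f (- (x + h)) = f (- x)" if "h \<in> per" for h x
    using periodic_diff_left[OF assms that, of "- x"] by simp
  moreover have "(\<lambda>x. f (- x)) \<in> borel_measurable M" by measurable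
  ultimately show ?thesis unfolding periodic_def by blast
qed

lemma periodic_diff: "periodic f \<Longrightarrow> periodic (\<lambda>x. f (x - a))"
  using periodic_add[of f "- a"] by simp

lemma periodic_diff2: "periodic f \<Longrightarrow> periodic (\<lambda>x. f (a - x))"
  using periodic_refl[OF periodic_add[of f a]] by simp

lemma periodic_mult: "periodic f \<Longrightarrow> periodic g \<Longrightarrow> periodic (\<lambda>x. f x * g x)"
  by (auto simp: periodic_def)

lemma periodic_power: "periodic f \<Longrightarrow> periodic (\<lambda>x. f x ^ n)"
  by (auto simp: periodic_def)

lemma periodic_const: "periodic (\<lambda>_. c)"
  by (simp add: periodic_def)

lemma integral_add: "periodic f \<Longrightarrow> (\<integral>\<^sup>+x. f (x + a) \<partial>M) = (\<integral>\<^sup>+x. f x \<partial>M)"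
  by (rule translate) (auto simp: periodic_def)

lemma integral_diff: "periodic f \<Longrightarrow> (\<integral>\<^sup>+x. f (x - a) \<partial>M) = (\<integral>\<^sup>+x. f x \<partial>M)"
  using integral_add[of f "- a"] by simp

lemma integral_refl: "periodic f \<Longrightarrow> (\<integral>\<^sup>+x. f (- x) \<partial>M) = (\<integral>\<^sup>+x. f x \<partial>M)"
  by (rule reflect) (auto simp: periodic_def)

lemma integral_diff2: "periodic f \<Longrightarrow> (\<integral>\<^sup>+x. f (a - x) \<partial>M) = (\<integral>\<^sup>+x. f x \<partial>M)"
  using integral_refl[OF periodic_add[of f a]] integral_add[of f a] by simp

sublocale PM: pair_sigma_finite M M ..

lemma integral_swap:
  assumes [measurable]: "(\<lambda>(x, y). f x y) \<in> borel_measurable (M \<Otimes>\<^sub>M M)"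
  shows "(\<integral>\<^sup>+x. \<integral>\<^sup>+y. f x y \<partial>M \<partial>M) = (\<integral>\<^sup>+y. \<integral>\<^sup>+x. f x y \<partial>M \<partial>M)"
  by (rule PM.Fubini'[symmetric]) simp

section \<open>Trilinear forms bounded by Cauchy-Schwarz\<close>

lemma Cauchy_Schwarz_iterated:
  fixes f g :: "'a \<Rightarrow> 'a \<Rightarrow> ennreal"
  assumes [measurable]: "(\<lambda>(x, y). f x y) \<in> borel_measurable (M \<Otimes>\<^sub>M M)"
    "(\<lambda>(x, y). g x y) \<in> borel_measurable (M \<Otimes>\<^sub>M M)"
  shows "(\<integral>\<^sup>+x. \<integral>\<^sup>+y. f x y * g x y \<partial>M \<partial>M)\<^sup>2
    \<le> (\<integral>\<^sup>+x. \<integral>\<^sup>+y. (f x y)\<^sup>2 \<partial>M \<partial>M) * (\<integral>\<^sup>+x. \<integral>\<^sup>+y. (g x y)\<^sup>2 \<partial>M \<partial>M)"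
proof -
  have 1: "(\<integral>\<^sup>+x. \<integral>\<^sup>+y. h x y \<partial>M \<partial>M) = (\<integral>\<^sup>+p. (case p of (x, y) \<Rightarrow> h x y) \<partial>(M \<Otimes>\<^sub>M M))"
    if "(\<lambda>(x, y). h x y) \<in> borel_measurable (M \<Otimes>\<^sub>M M)" for h :: "'a \<Rightarrow> 'a \<Rightarrow> ennreal"
    using nn_integral_fst[OF that] by simp
  have "(\<integral>\<^sup>+x. \<integral>\<^sup>+y. f x y * g x y \<partial>M \<partial>M)
      = (\<integral>\<^sup>+p. (case p of (x, y) \<Rightarrow> f x y) * (case p of (x, y) \<Rightarrow> g x y) \<partial>(M \<Otimes>\<^sub>M M))"
    by (subst 1) (auto intro!: nn_integral_cong)
  also have "\<dots>\<^sup>2 \<le> (\<integral>\<^sup>+p. (case p of (x, y) \<Rightarrow> f x y)\<^sup>2 \<partial>(M \<Otimes>\<^sub>M M))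
      * (\<integral>\<^sup>+p. (case p of (x, y) \<Rightarrow> g x y)\<^sup>2 \<partial>(M \<Otimes>\<^sub>M M))"
    by (rule Cauchy_Schwarz_nn_integral) auto
  also have "\<dots> = (\<integral>\<^sup>+x. \<integral>\<^sup>+y. (f x y)\<^sup>2 \<partial>M \<partial>M) * (\<integral>\<^sup>+x. \<integral>\<^sup>+y. (g x y)\<^sup>2 \<partial>M \<partial>M)"
    by (subst (1 2) 1) (auto intro!: nn_integral_cong arg_cong2[of _ _ _ _ "(*)"])
  finally show ?thesis .
qed

lemma integral_prod_xy:
  assumes "periodic F" "periodic G"
  shows "(\<integral>\<^sup>+x. \<integral>\<^sup>+y. F x * G y \<partial>M \<partial>M) = (\<integral>\<^sup>+x. F x \<partial>M) * (\<integral>\<^sup>+x. G x \<partial>M)"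
  using assms[THEN periodic_measurable] by (simp add: nn_integral_cmult nn_integral_multc)

lemma integral_prod_xd:
  assumes "periodic F" "periodic G"
  shows "(\<integral>\<^sup>+x. \<integral>\<^sup>+y. F x * G (x - y) \<partial>M \<partial>M) = (\<integral>\<^sup>+x. F x \<partial>M) * (\<integral>\<^sup>+x. G x \<partial>M)"
  using assms[THEN periodic_measurable] assms(2)
  by (simp add: nn_integral_cmult nn_integral_multc integral_diff2 measurable_compose[OF _ periodic_measurable])

lemma integral_prod_yd:
  assumes "periodic F" "periodic G"
  shows "(\<integral>\<^sup>+x. \<integral>\<^sup>+y. F y * G (x - y) \<partial>M \<partial>M) = (\<integral>\<^sup>+x. F x \<partial>M) * (\<integral>\<^sup>+x. G x \<partial>M)"
proof -
  note [measurable] = assms[THEN periodic_measurable]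
  have "(\<integral>\<^sup>+x. \<integral>\<^sup>+y. F y * G (x - y) \<partial>M \<partial>M) = (\<integral>\<^sup>+y. \<integral>\<^sup>+x. F y * G (x - y) \<partial>M \<partial>M)"
    by (rule integral_swap) measurable
  then show ?thesis using assms(2) by (simp add: nn_integral_cmult nn_integral_multc integral_diff)
qed

text \<open>Any two of x, y, x - y are independent variables for the product measure. A square
  integrable weight on one of them can thus be paired so that Cauchy-Schwarz yields two products of
  independent factors; here u v is separated from l w. \<open>trilinear_1\<close> and
  \<open>trilinear_2\<close> are the cases of a weight on x - y and on y.\<close>

lemma trilinear_0:
  assumes "periodic l" "periodic u" "periodic v" "periodic w"
  shows "(\<integral>\<^sup>+x. \<integral>\<^sup>+y. l x * u x * v (x - y) * w y \<partial>M \<partial>M)\<^sup>2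
    \<le> (\<integral>\<^sup>+x. (l x)\<^sup>2 \<partial>M) * (\<integral>\<^sup>+x. (u x)\<^sup>2 \<partial>M) * (\<integral>\<^sup>+x. (v x)\<^sup>2 \<partial>M) * (\<integral>\<^sup>+x. (w x)\<^sup>2 \<partial>M)"
proof -
  note [measurable] = assms[THEN periodic_measurable]
  have "(\<integral>\<^sup>+x. \<integral>\<^sup>+y. (u x * v (x - y)) * (l x * w y) \<partial>M \<partial>M)\<^sup>2
    \<le> (\<integral>\<^sup>+x. \<integral>\<^sup>+y. (u x * v (x - y))\<^sup>2 \<partial>M \<partial>M) * (\<integral>\<^sup>+x. \<integral>\<^sup>+y. (l x * w y)\<^sup>2 \<partial>M \<partial>M)"
    by (rule Cauchy_Schwarz_iterated) measurable
  then show ?thesis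
    unfolding power_mult_distrib
    using integral_prod_xy[OF periodic_power[OF assms(1), of 2] periodic_power[OF assms(4), of 2]]
      integral_prod_xd[OF periodic_power[OF assms(2), of 2] periodic_power[OF assms(3), of 2]]
    by (simp add: mult_ac)
qed

lemma trilinear_1:
  assumes "periodic l" "periodic u" "periodic v" "periodic w"
  shows "(\<integral>\<^sup>+x. \<integral>\<^sup>+y. l (x - y) * u x * v (x - y) * w y \<partial>M \<partial>M)\<^sup>2
    \<le> (\<integral>\<^sup>+x. (l x)\<^sup>2 \<partial>M) * (\<integral>\<^sup>+x. (u x)\<^sup>2 \<partial>M) * (\<integral>\<^sup>+x. (v x)\<^sup>2 \<partial>M) * (\<integral>\<^sup>+x. (w x)\<^sup>2 \<partial>M)"
proof -
  note [measurable] = assms[THEN periodic_measurable]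
  have "(\<integral>\<^sup>+x. \<integral>\<^sup>+y. (u x * v (x - y)) * (w y * l (x - y)) \<partial>M \<partial>M)\<^sup>2
    \<le> (\<integral>\<^sup>+x. \<integral>\<^sup>+y. (u x * v (x - y))\<^sup>2 \<partial>M \<partial>M) * (\<integral>\<^sup>+x. \<integral>\<^sup>+y. (w y * l (x - y))\<^sup>2 \<partial>M \<partial>M)"
    by (rule Cauchy_Schwarz_iterated) measurable
  then show ?thesis
    unfolding power_mult_distrib
    using integral_prod_yd[OF periodic_power[OF assms(4), of 2] periodic_power[OF assms(1), of 2]]
      integral_prod_xd[OF periodic_power[OF assms(2), of 2] periodic_power[OF assms(3), of 2]]
    by (simp add: mult_ac)
qed

lemma trilinear_2:
  assumes "periodic l" "periodic u" "periodic v" "periodic w"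
  shows "(\<integral>\<^sup>+x. \<integral>\<^sup>+y. l y * u x * v (x - y) * w y \<partial>M \<partial>M)\<^sup>2
    \<le> (\<integral>\<^sup>+x. (l x)\<^sup>2 \<partial>M) * (\<integral>\<^sup>+x. (u x)\<^sup>2 \<partial>M) * (\<integral>\<^sup>+x. (v x)\<^sup>2 \<partial>M) * (\<integral>\<^sup>+x. (w x)\<^sup>2 \<partial>M)"
proof -
  note [measurable] = assms[THEN periodic_measurable]
  have "(\<integral>\<^sup>+x. \<integral>\<^sup>+y. (w y * v (x - y)) * (u x * l y) \<partial>M \<partial>M)\<^sup>2
    \<le> (\<integral>\<^sup>+x. \<integral>\<^sup>+y. (w y * v (x - y))\<^sup>2 \<partial>M \<partial>M) * (\<integral>\<^sup>+x. \<integral>\<^sup>+y. (u x * l y)\<^sup>2 \<partial>M \<partial>M)"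
    by (rule Cauchy_Schwarz_iterated) measurable
  then show ?thesis
    unfolding power_mult_distrib
    using integral_prod_yd[OF periodic_power[OF assms(4), of 2] periodic_power[OF assms(3), of 2]]
      integral_prod_xy[OF periodic_power[OF assms(2), of 2] periodic_power[OF assms(1), of 2]]
    by (simp add: mult_ac)
qed

text \<open>The substitution x = z + y exposes the correlation of \<open>f\<close> and
  \<open>h\<close> against which \<open>Y\<close> is paired.\<close>

lemma integral_rotate:
  assumes "periodic Y" "periodic f" "periodic h"
  shows "(\<integral>\<^sup>+x. \<integral>\<^sup>+y. Y (x - y) * (f x * h y) \<partial>M \<partial>M) = (\<integral>\<^sup>+z. \<integral>\<^sup>+y. Y z * (f (z + y) * h y) \<partial>M \<partial>M)"
proof -
  note [measurable] = assms[THEN periodic_measurable]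
  have "(\<integral>\<^sup>+x. \<integral>\<^sup>+y. Y (x - y) * (f x * h y) \<partial>M \<partial>M) = (\<integral>\<^sup>+y. \<integral>\<^sup>+x. Y (x - y) * (f x * h y) \<partial>M \<partial>M)"
    by (rule integral_swap) measurable
  also have "\<dots> = (\<integral>\<^sup>+y. \<integral>\<^sup>+z. Y z * (f (z + y) * h y) \<partial>M \<partial>M)"
  proof (rule nn_integral_cong)
    fix y
    have "periodic (\<lambda>x. h y * (Y x * f (x + y)))"
      by (rule periodic_mult[OF periodic_const periodic_mult[OF assms(1) periodic_add[OF assms(2)]]])
    from integral_diff[OF this, of y]
    show "(\<integral>\<^sup>+x. Y (x - y) * (f x * h y) \<partial>M) = (\<integral>\<^sup>+z. Y z * (f (z + y) * h y) \<partial>M)"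
      by (simp add: mult_ac)
  qed
  also have "\<dots> = (\<integral>\<^sup>+z. \<integral>\<^sup>+y. Y z * (f (z + y) * h y) \<partial>M \<partial>M)"
    by (rule integral_swap[symmetric]) measurable
  finally show ?thesis .
qed

text \<open>Expanding the square of a correlation and regrouping the four factors turns it into a
  sum over \<open>a + d = c + b\<close>: the correlation of \<open>f\<close> and \<open>g\<close> is controlled by their convolution.\<close>

lemma correlation_square:
  assumes "periodic m" "periodic f" "periodic g"
  shows "(\<integral>\<^sup>+z. (m z * (\<integral>\<^sup>+y. f (z + y) * g y \<partial>M))\<^sup>2 \<partial>M)
    = (\<integral>\<^sup>+p. \<integral>\<^sup>+a. \<integral>\<^sup>+c. (m (a + c - p))\<^sup>2 * ((f a * g (p - a)) * (f c * g (p - c))) \<partial>M \<partial>M \<partial>M)"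
proof -
  note [measurable] = assms[THEN periodic_measurable]
  have 1: "(\<integral>\<^sup>+y. f (z + y) * g y \<partial>M) = (\<integral>\<^sup>+a. f a * g (a - z) \<partial>M)" for z
  proof -
    have "periodic (\<lambda>a. f a * g (a - z))"
      by (rule periodic_mult[OF assms(2) periodic_diff[OF assms(3)]])
    from integral_add[OF this, of z] show ?thesis by (simp add: add.commute)
  qed
  \<comment> \<open>In the second copy of the correlation the integration variable is written as p -
    a; the new variable p will be the conserved sum of the two arguments.\<close>
  have 2: "(\<integral>\<^sup>+y. f (z + y) * g y \<partial>M) = (\<integral>\<^sup>+p. f (z + p - a) * g (p - a) \<partial>M)" for z a
  proof -
    have "periodic (\<lambda>y. f (y + z) * g y)"
      by (rule periodic_mult[OF periodic_add[OF assms(2)] assms(3)])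
    from integral_diff[OF this, of a] show ?thesis by (simp add: add.commute add_diff_eq)
  qed
  have "(\<integral>\<^sup>+z. (m z * (\<integral>\<^sup>+y. f (z + y) * g y \<partial>M))\<^sup>2 \<partial>M)
      = (\<integral>\<^sup>+z. \<integral>\<^sup>+a. \<integral>\<^sup>+p. (m z)\<^sup>2 * ((f a * g (a - z)) * (f (z + p - a) * g (p - a))) \<partial>M \<partial>M \<partial>M)"
  proof (rule nn_integral_cong)
    fix z
    have "(m z * (\<integral>\<^sup>+y. f (z + y) * g y \<partial>M))\<^sup>2
        = (m z)\<^sup>2 * ((\<integral>\<^sup>+a. f a * g (a - z) \<partial>M) * (\<integral>\<^sup>+y. f (z + y) * g y \<partial>M))"
      by (simp add: power2_eq_square mult_ac flip: 1)
    also have "\<dots> = (\<integral>\<^sup>+a. (m z)\<^sup>2 * ((f a * g (a - z)) * (\<integral>\<^sup>+y. f (z + y) * g y \<partial>M)) \<partial>M)"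
      by (simp add: nn_integral_cmult nn_integral_multc)
    also have "\<dots> = (\<integral>\<^sup>+a. \<integral>\<^sup>+p. (m z)\<^sup>2 * ((f a * g (a - z)) * (f (z + p - a) * g (p - a))) \<partial>M \<partial>M)"
      by (intro nn_integral_cong, subst 2) (simp add: nn_integral_cmult)
    finally show "(m z * (\<integral>\<^sup>+y. f (z + y) * g y \<partial>M))\<^sup>2
        = (\<integral>\<^sup>+a. \<integral>\<^sup>+p. (m z)\<^sup>2 * ((f a * g (a - z)) * (f (z + p - a) * g (p - a))) \<partial>M \<partial>M)" .
  qed
  also have "\<dots> = (\<integral>\<^sup>+a. \<integral>\<^sup>+z. \<integral>\<^sup>+p. (m z)\<^sup>2 * ((f a * g (a - z)) * (f (z + p - a) * g (p - a))) \<partial>M \<partial>M \<partial>M)"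
    by (rule integral_swap) measurable
  also have "\<dots> = (\<integral>\<^sup>+a. \<integral>\<^sup>+p. \<integral>\<^sup>+z. (m z)\<^sup>2 * ((f a * g (a - z)) * (f (z + p - a) * g (p - a))) \<partial>M \<partial>M \<partial>M)"
    by (intro nn_integral_cong integral_swap) measurable
  also have "\<dots> = (\<integral>\<^sup>+a. \<integral>\<^sup>+p. \<integral>\<^sup>+c. (m (a + c - p))\<^sup>2 * ((f a * g (p - a)) * (f c * g (p - c))) \<partial>M \<partial>M \<partial>M)"
  proof (rule nn_integral_cong, rule nn_integral_cong)
    fix a p
    \<comment> \<open>The substitution z = a + c - p turns f (z + p - a) into f c and g (a - z) into
      g (p - c): now the arguments of f and g add up to p in both copies.\<close>
    have "periodic (\<lambda>z. (f a * g (p - a)) * ((m z)\<^sup>2 * (g (a - z) * f (z + (p - a)))))"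
      by (rule periodic_mult[OF periodic_const periodic_mult[OF periodic_power[OF assms(1)]
          periodic_mult[OF periodic_diff2[OF assms(3)] periodic_add[OF assms(2)]]]])
    from integral_add[OF this, of "a - p"]
    show "(\<integral>\<^sup>+z. (m z)\<^sup>2 * ((f a * g (a - z)) * (f (z + p - a) * g (p - a))) \<partial>M)
       = (\<integral>\<^sup>+c. (m (a + c - p))\<^sup>2 * ((f a * g (p - a)) * (f c * g (p - c))) \<partial>M)"
      by (simp add: algebra_simps)
  qed
  also have "\<dots> = (\<integral>\<^sup>+p. \<integral>\<^sup>+a. \<integral>\<^sup>+c. (m (a + c - p))\<^sup>2 * ((f a * g (p - a)) * (f c * g (p - c))) \<partial>M \<partial>M \<partial>M)"
    by (rule integral_swap) measurable
  finally show ?thesis .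
qed

text \<open>\<open>v\<close> is split off by Cauchy-Schwarz, and the square of the remaining
  correlation is a quadratic form in the convolution factors u a w (p - a) for each sum p. Bounding
  products of two terms by sums of squares, as in Schur's test, puts all kernel factors on one
  variable, where \<open>B\<close> controls them uniformly in a and p. The factor 2 counts the two
  symmetric halves.\<close>

lemma trilinear_convolution_bound:
  assumes per: "periodic m" "periodic \<kappa>" "periodic \<mu>" "periodic u" "periodic v" "periodic w"
    and B: "\<And>p a. (\<integral>\<^sup>+c. (m (a + c - p))\<^sup>2 * (\<kappa> c * \<mu> (p - c))\<^sup>2 \<partial>M) \<le> B"
  shows "(\<integral>\<^sup>+x. \<integral>\<^sup>+y. m (x - y) * \<kappa> x * \<mu> y * u x * v (x - y) * w y \<partial>M \<partial>M)\<^sup>2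
    \<le> 2 * B * (\<integral>\<^sup>+x. (u x)\<^sup>2 \<partial>M) * (\<integral>\<^sup>+x. (v x)\<^sup>2 \<partial>M) * (\<integral>\<^sup>+x. (w x)\<^sup>2 \<partial>M)"
proof -
  note [measurable] = per[THEN periodic_measurable]
  define f where "f = (\<lambda>x. \<kappa> x * u x)"
  define g where "g = (\<lambda>x. \<mu> x * w x)"
  have fg: "periodic f" "periodic g" unfolding f_def g_def using per by (auto intro: periodic_mult)
  note [measurable] = fg[THEN periodic_measurable]
  have "(\<integral>\<^sup>+x. \<integral>\<^sup>+y. m (x - y) * \<kappa> x * \<mu> y * u x * v (x - y) * w y \<partial>M \<partial>M)
      = (\<integral>\<^sup>+x. \<integral>\<^sup>+y. (m (x - y) * v (x - y)) * (f x * g y) \<partial>M \<partial>M)"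
    by (simp add: f_def g_def mult_ac)
  also have "\<dots> = (\<integral>\<^sup>+z. \<integral>\<^sup>+y. (m z * v z) * (f (z + y) * g y) \<partial>M \<partial>M)"
    by (rule integral_rotate[OF periodic_mult[OF per(1,5)] fg])
  also have "\<dots> = (\<integral>\<^sup>+z. v z * (m z * (\<integral>\<^sup>+y. f (z + y) * g y \<partial>M)) \<partial>M)"
    by (intro nn_integral_cong, subst nn_integral_cmult) (simp_all add: mult_ac)
  also have "\<dots>\<^sup>2 \<le> (\<integral>\<^sup>+z. (v z)\<^sup>2 \<partial>M) * (\<integral>\<^sup>+z. (m z * (\<integral>\<^sup>+y. f (z + y) * g y \<partial>M))\<^sup>2 \<partial>M)"
    by (rule Cauchy_Schwarz_nn_integral) measurable
  finally have H1: "(\<integral>\<^sup>+x. \<integral>\<^sup>+y. m (x - y) * \<kappa> x * \<mu> y * u x * v (x - y) * w y \<partial>M \<partial>M)\<^sup>2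
    \<le> (\<integral>\<^sup>+z. (v z)\<^sup>2 \<partial>M) * (\<integral>\<^sup>+z. (m z * (\<integral>\<^sup>+y. f (z + y) * g y \<partial>M))\<^sup>2 \<partial>M)" .
  have "(\<integral>\<^sup>+z. (m z * (\<integral>\<^sup>+y. f (z + y) * g y \<partial>M))\<^sup>2 \<partial>M)
      = (\<integral>\<^sup>+p. \<integral>\<^sup>+a. \<integral>\<^sup>+c. (m (a + c - p))\<^sup>2 * ((f a * g (p - a)) * (f c * g (p - c))) \<partial>M \<partial>M \<partial>M)"
    by (rule correlation_square[OF per(1) fg])
  also have "\<dots> \<le> (\<integral>\<^sup>+p. 2 * B * (\<integral>\<^sup>+a. (u a * w (p - a))\<^sup>2 \<partial>M) \<partial>M)"
  proof (rule nn_integral_mono)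
    fix p
    define X where "X = (\<lambda>a. u a * w (p - a))"
    define N where "N = (\<lambda>a. \<kappa> a * \<mu> (p - a))"
    have [measurable]: "X \<in> borel_measurable M" "N \<in> borel_measurable M"
      unfolding X_def N_def by measurable
    have half: "(\<integral>\<^sup>+a. \<integral>\<^sup>+c. (X a)\<^sup>2 * ((m (a + c - p))\<^sup>2 * (N c)\<^sup>2) \<partial>M \<partial>M) \<le> B * (\<integral>\<^sup>+a. (X a)\<^sup>2 \<partial>M)"
    proof -
      have "(\<integral>\<^sup>+a. \<integral>\<^sup>+c. (X a)\<^sup>2 * ((m (a + c - p))\<^sup>2 * (N c)\<^sup>2) \<partial>M \<partial>M)
          = (\<integral>\<^sup>+a. (X a)\<^sup>2 * (\<integral>\<^sup>+c. (m (a + c - p))\<^sup>2 * (N c)\<^sup>2 \<partial>M) \<partial>M)"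
        by (simp add: nn_integral_cmult)
      also have "\<dots> \<le> (\<integral>\<^sup>+a. (X a)\<^sup>2 * B \<partial>M)"
        unfolding N_def by (intro nn_integral_mono mult_left_mono B) auto
      also have "\<dots> = (\<integral>\<^sup>+a. (X a)\<^sup>2 \<partial>M) * B" by (rule nn_integral_multc) measurable
      finally show ?thesis by (simp only: mult.commute[of B])
    qed
    have "(\<integral>\<^sup>+a. \<integral>\<^sup>+c. (m (a + c - p))\<^sup>2 * ((f a * g (p - a)) * (f c * g (p - c))) \<partial>M \<partial>M)
        \<le> (\<integral>\<^sup>+a. \<integral>\<^sup>+c. (X a)\<^sup>2 * ((m (a + c - p))\<^sup>2 * (N c)\<^sup>2) + (X c)\<^sup>2 * ((m (c + a - p))\<^sup>2 * (N a)\<^sup>2) \<partial>M \<partial>M)"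
    proof (intro nn_integral_mono)
      fix a c
      have "(f a * g (p - a)) * (f c * g (p - c)) = (X a * N c) * (X c * N a)"
        by (simp add: f_def g_def X_def N_def mult_ac)
      also have "\<dots> \<le> (X a * N c)\<^sup>2 + (X c * N a)\<^sup>2" by (rule ennreal_mult_le_sum_squares)
      finally have "(m (a + c - p))\<^sup>2 * ((f a * g (p - a)) * (f c * g (p - c)))
          \<le> (m (a + c - p))\<^sup>2 * ((X a * N c)\<^sup>2 + (X c * N a)\<^sup>2)"
        by (rule mult_left_mono) auto
      then show "(m (a + c - p))\<^sup>2 * ((f a * g (p - a)) * (f c * g (p - c)))
          \<le> (X a)\<^sup>2 * ((m (a + c - p))\<^sup>2 * (N c)\<^sup>2) + (X c)\<^sup>2 * ((m (c + a - p))\<^sup>2 * (N a)\<^sup>2)"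
        by (simp add: power_mult_distrib distrib_left mult_ac add.commute[of c a])
    qed
    also have "\<dots> = (\<integral>\<^sup>+a. \<integral>\<^sup>+c. (X a)\<^sup>2 * ((m (a + c - p))\<^sup>2 * (N c)\<^sup>2) \<partial>M \<partial>M)
        + (\<integral>\<^sup>+a. \<integral>\<^sup>+c. (X c)\<^sup>2 * ((m (c + a - p))\<^sup>2 * (N a)\<^sup>2) \<partial>M \<partial>M)"
      by (simp add: nn_integral_add)
    also have "(\<integral>\<^sup>+a. \<integral>\<^sup>+c. (X c)\<^sup>2 * ((m (c + a - p))\<^sup>2 * (N a)\<^sup>2) \<partial>M \<partial>M)
        = (\<integral>\<^sup>+a. \<integral>\<^sup>+c. (X a)\<^sup>2 * ((m (a + c - p))\<^sup>2 * (N c)\<^sup>2) \<partial>M \<partial>M)"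
      by (rule integral_swap) measurable
    also have "(\<integral>\<^sup>+a. \<integral>\<^sup>+c. (X a)\<^sup>2 * ((m (a + c - p))\<^sup>2 * (N c)\<^sup>2) \<partial>M \<partial>M)
        + (\<integral>\<^sup>+a. \<integral>\<^sup>+c. (X a)\<^sup>2 * ((m (a + c - p))\<^sup>2 * (N c)\<^sup>2) \<partial>M \<partial>M)
        \<le> B * (\<integral>\<^sup>+a. (X a)\<^sup>2 \<partial>M) + B * (\<integral>\<^sup>+a. (X a)\<^sup>2 \<partial>M)"
      by (intro add_mono half)
    finally show "(\<integral>\<^sup>+a. \<integral>\<^sup>+c. (m (a + c - p))\<^sup>2 * ((f a * g (p - a)) * (f c * g (p - c))) \<partial>M \<partial>M)
        \<le> 2 * B * (\<integral>\<^sup>+a. (u a * w (p - a))\<^sup>2 \<partial>M)"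
      by (simp add: X_def mult_2 distrib_right)
  qed
  also have "\<dots> = 2 * B * (\<integral>\<^sup>+p. \<integral>\<^sup>+a. (u a * w (p - a))\<^sup>2 \<partial>M \<partial>M)"
    by (rule nn_integral_cmult) measurable
  also have "(\<integral>\<^sup>+p. \<integral>\<^sup>+a. (u a * w (p - a))\<^sup>2 \<partial>M \<partial>M) = (\<integral>\<^sup>+x. (u x)\<^sup>2 \<partial>M) * (\<integral>\<^sup>+x. (w x)\<^sup>2 \<partial>M)"
    unfolding power_mult_distrib
    using integral_prod_yd[OF periodic_power[OF per(4), of 2] periodic_power[OF per(6), of 2]] by simp
  finally have H2: "(\<integral>\<^sup>+z. (m z * (\<integral>\<^sup>+y. f (z + y) * g y \<partial>M))\<^sup>2 \<partial>M)
      \<le> 2 * B * ((\<integral>\<^sup>+x. (u x)\<^sup>2 \<partial>M) * (\<integral>\<^sup>+x. (w x)\<^sup>2 \<partial>M))" .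
  show ?thesis
    using order_trans[OF H1 mult_left_mono[OF H2]] by (simp add: mult_ac)
qed

end

section \<open>Instances: discrete groups, and products of two such groups\<close>

lemma conv_measure_count_space:
  "conv_measure (count_space (UNIV :: 'a::{countable, ab_group_add} set)) {}"
proof -
  interpret sigma_finite_measure "count_space (UNIV :: 'a set)"
    by (rule sigma_finite_measure_count_space_countable) simp
  show ?thesis
  proof
    show "(\<lambda>(x, y). x - y) \<in> count_space UNIV \<Otimes>\<^sub>M count_space UNIV \<rightarrow>\<^sub>M count_space (UNIV :: 'a set)"
      by (simp add: pair_measure_countable)
  next
    fix f :: "'a \<Rightarrow> ennreal" and a
    show "(\<integral>\<^sup>+x. f (x + a) \<partial>count_space UNIV) = (\<integral>\<^sup>+x. f x \<partial>count_space UNIV)"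
      by (rule nn_integral_bij_count_space) (auto intro!: bij_betwI[where g = "\<lambda>x. x - a"])
    show "(\<integral>\<^sup>+x. f (- x) \<partial>count_space UNIV) = (\<integral>\<^sup>+x. f x \<partial>count_space UNIV)"
      by (rule nn_integral_bij_count_space) (auto intro!: bij_betwI[where g = uminus])
  qed simp
qed

lemma conv_measure_pair:
  assumes "conv_measure M per1" "conv_measure N per2"
  shows "conv_measure (M \<Otimes>\<^sub>M N) ((\<lambda>h. (h, 0)) ` per1 \<union> (\<lambda>h. (0, h)) ` per2)"
proof -
  interpret M: conv_measure M per1 by fact
  interpret N: conv_measure N per2 by fact
  interpret pair_sigma_finite M N ..
  interpret MN: sigma_finite_measure "M \<Otimes>\<^sub>M N" ..
  show ?thesis
  proof
    show "space (M \<Otimes>\<^sub>M N) = UNIV" by (simp add: space_pair_measure M.space_UNIV N.space_UNIV)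
    have "(\<lambda>p. (fst (fst p) - fst (snd p), snd (fst p) - snd (snd p)))
       \<in> (M \<Otimes>\<^sub>M N) \<Otimes>\<^sub>M (M \<Otimes>\<^sub>M N) \<rightarrow>\<^sub>M M \<Otimes>\<^sub>M N"
      by measurable
    then show "(\<lambda>(x, y). x - y) \<in> (M \<Otimes>\<^sub>M N) \<Otimes>\<^sub>M (M \<Otimes>\<^sub>M N) \<rightarrow>\<^sub>M M \<Otimes>\<^sub>M N"
      by (simp add: split_beta' minus_prod_def)
  next
    fix f :: "'a \<times> 'b \<Rightarrow> ennreal" and a :: "'a \<times> 'b"
    assume [measurable]: "f \<in> borel_measurable (M \<Otimes>\<^sub>M N)"
      and per: "\<And>h x. h \<in> (\<lambda>h. (h, 0)) ` per1 \<union> (\<lambda>h. (0, h)) ` per2 \<Longrightarrow> f (x + h) = f x"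
    have p1: "f (x + h, y) = f (x, y)" if "h \<in> per1" for h x y
      using per[of "(h, 0)" "(x, y)"] that by simp
    have p2: "f (x, y + h) = f (x, y)" if "h \<in> per2" for h x y
      using per[of "(0, h)" "(x, y)"] that by simp
    have per1: "M.periodic (\<lambda>x. f (x, y))" for y by (auto simp: M.periodic_def p1 N.space_UNIV)
    have per2: "N.periodic (\<lambda>y. f (x, y))" for x by (auto simp: N.periodic_def p2 M.space_UNIV)
    obtain a1 a2 where a: "a = (a1, a2)" by fastforce
    have it: "(\<integral>\<^sup>+p. g p \<partial>(M \<Otimes>\<^sub>M N)) = (\<integral>\<^sup>+x. \<integral>\<^sup>+y. g (x, y) \<partial>N \<partial>M)"
      if "g \<in> borel_measurable (M \<Otimes>\<^sub>M N)" for g :: "'a \<times> 'b \<Rightarrow> ennreal"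
      using N.nn_integral_fst[OF that] by simp
    have "(\<integral>\<^sup>+p. f (p + a) \<partial>(M \<Otimes>\<^sub>M N)) = (\<integral>\<^sup>+p. f (fst p + a1, snd p + a2) \<partial>(M \<Otimes>\<^sub>M N))"
      by (intro nn_integral_cong) (simp add: a plus_prod_def)
    also have "\<dots> = (\<integral>\<^sup>+x. \<integral>\<^sup>+y. f (x + a1, y + a2) \<partial>N \<partial>M)" by (subst it) auto
    also have "\<dots> = (\<integral>\<^sup>+x. \<integral>\<^sup>+y. f (x + a1, y) \<partial>N \<partial>M)"
      by (intro nn_integral_cong N.integral_add per2)
    also have "\<dots> = (\<integral>\<^sup>+y. \<integral>\<^sup>+x. f (x + a1, y) \<partial>M \<partial>N)" by (rule Fubini'[symmetric]) measurable
    also have "\<dots> = (\<integral>\<^sup>+y. \<integral>\<^sup>+x. f (x, y) \<partial>M \<partial>N)" by (intro nn_integral_cong M.integral_add per1)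
    also have "\<dots> = (\<integral>\<^sup>+x. \<integral>\<^sup>+y. f (x, y) \<partial>N \<partial>M)" by (rule Fubini') measurable
    also have "\<dots> = (\<integral>\<^sup>+p. f p \<partial>(M \<Otimes>\<^sub>M N))" by (rule it[symmetric]) measurable
    finally show "(\<integral>\<^sup>+p. f (p + a) \<partial>(M \<Otimes>\<^sub>M N)) = (\<integral>\<^sup>+p. f p \<partial>(M \<Otimes>\<^sub>M N))" .
    have "(\<integral>\<^sup>+p. f (- p) \<partial>(M \<Otimes>\<^sub>M N)) = (\<integral>\<^sup>+p. f (- fst p, - snd p) \<partial>(M \<Otimes>\<^sub>M N))"
      by (intro nn_integral_cong) (simp add: uminus_prod_def)
    also have "\<dots> = (\<integral>\<^sup>+x. \<integral>\<^sup>+y. f (- x, - y) \<partial>N \<partial>M)" by (subst it) auto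
    also have "\<dots> = (\<integral>\<^sup>+x. \<integral>\<^sup>+y. f (- x, y) \<partial>N \<partial>M)"
      by (intro nn_integral_cong N.integral_refl per2)
    also have "\<dots> = (\<integral>\<^sup>+y. \<integral>\<^sup>+x. f (- x, y) \<partial>M \<partial>N)" by (rule Fubini'[symmetric]) measurable
    also have "\<dots> = (\<integral>\<^sup>+y. \<integral>\<^sup>+x. f (x, y) \<partial>M \<partial>N)" by (intro nn_integral_cong M.integral_refl per1)
    also have "\<dots> = (\<integral>\<^sup>+x. \<integral>\<^sup>+y. f (x, y) \<partial>N \<partial>M)" by (rule Fubini') measurable
    also have "\<dots> = (\<integral>\<^sup>+p. f p \<partial>(M \<Otimes>\<^sub>M N))" by (rule it[symmetric]) measurable
    finally show "(\<integral>\<^sup>+p. f (- p) \<partial>(M \<Otimes>\<^sub>M N)) = (\<integral>\<^sup>+p. f p \<partial>(M \<Otimes>\<^sub>M N))" .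
  qed
qed

section \<open>The discrete modulation weight\<close>

definition time_measure :: "real \<Rightarrow> real measure" where
  "time_measure \<tau> = density lborel (indicator {- pi / \<tau> <..< pi / \<tau>})"

lemma space_of_time_measure [simp]: "space (time_measure \<tau>) = UNIV"
  and sets_time_measure [simp, measurable_cong]: "sets (time_measure \<tau>) = sets borel"
  by (simp_all add: time_measure_def)

lemma nn_integral_time_measure:
  "f \<in> borel_measurable borel \<Longrightarrow>
    (\<integral>\<^sup>+\<sigma>. f \<sigma> \<partial>time_measure \<tau>) = (\<integral>\<^sup>+\<sigma>\<in>{- pi / \<tau> <..< pi / \<tau>}. f \<sigma> \<partial>lborel)"
  by (simp add: time_measure_def nn_integral_density mult.commute)

lemma nn_integral_time_measure':
  assumes [measurable]: "f \<in> borel_measurable borel"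
  shows "(\<integral>\<^sup>+\<sigma>. f \<sigma> \<partial>time_measure \<tau>) = (\<integral>\<^sup>+\<sigma>\<in>{- pi / \<tau> ..< pi / \<tau>}. f \<sigma> \<partial>lborel)"
proof -
  have "AE \<sigma> in lborel. \<sigma> \<noteq> - pi / \<tau>" by (rule AE_lborel_singleton)
  then have "(\<integral>\<^sup>+\<sigma>\<in>{- pi / \<tau> <..< pi / \<tau>}. f \<sigma> \<partial>lborel) = (\<integral>\<^sup>+\<sigma>\<in>{- pi / \<tau> ..< pi / \<tau>}. f \<sigma> \<partial>lborel)"
    by (intro nn_integral_cong_AE) (auto elim!: eventually_mono simp: indicator_def)
  then show ?thesis by (simp add: nn_integral_time_measure)
qed

lemma periodic_int_shift:
  fixes f :: "real \<Rightarrow> 'a"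
  assumes "\<And>x. f (x + P) = f x"
  shows "f (x + of_int n * P) = f x"
proof -
  have *: "f (x + of_nat m * P) = f x" for m x
  proof (induction m)
    case (Suc m)
    have "f (x + of_nat (Suc m) * P) = f ((x + of_nat m * P) + P)" by (simp add: algebra_simps)
    then show ?case using assms Suc by simp
  qed simp
  show ?thesis
  proof (cases n)
    case (nonneg m)
    then show ?thesis using * by simp
  next
    case (neg m)
    have "f (x + of_int n * P) = f ((x + of_int n * P) + of_nat (Suc m) * P)" by (rule *[symmetric])
    also have "(x + of_int n * P) + of_nat (Suc m) * P = x" unfolding neg by (simp add: algebra_simps)
    finally show ?thesis .
  qed
qed

lemma ex_unique_period_shift:
  fixes P x :: real
  assumes "P > 0"
  shows "x + of_int n * P \<in> {- P / 2 ..< P / 2} \<longleftrightarrow> n = - \<lfloor>(x + P / 2) / P\<rfloor>"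
proof -
  have "x + of_int n * P \<in> {- P / 2 ..< P / 2} \<longleftrightarrow>
      of_int (- n) \<le> (x + P / 2) / P \<and> (x + P / 2) / P < of_int (- n) + 1"
    using assms by (simp add: field_simps) argo
  also have "\<dots> \<longleftrightarrow> \<lfloor>(x + P / 2) / P\<rfloor> = - n" by (rule floor_eq_iff[symmetric])
  finally show ?thesis by auto
qed

lemma nn_integral_period_shifts:
  fixes P x :: real
  assumes "P > 0"
  shows "(\<integral>\<^sup>+n. indicator {- P / 2 ..< P / 2} (x + of_int n * P) \<partial>count_space (UNIV :: int set))
      = (1 :: ennreal)"
proof -
  have "(\<integral>\<^sup>+n. indicator {- P / 2 ..< P / 2} (x + of_int n * P) \<partial>count_space (UNIV :: int set))
      = (\<integral>\<^sup>+n. indicator {- \<lfloor>(x + P / 2) / P\<rfloor>} n \<partial>count_space (UNIV :: int set))"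
    using ex_unique_period_shift[OF assms, of x]
    by (intro nn_integral_cong) (simp add: indicator_def del: atLeastLessThan_iff)
  then show ?thesis by simp
qed

lemma nn_integral_shift_lborel:
  fixes f :: "real \<Rightarrow> ennreal"
  assumes "f \<in> borel_measurable borel"
  shows "(\<integral>\<^sup>+x. f (x + a) \<partial>lborel) = (\<integral>\<^sup>+x. f x \<partial>lborel)"
  using nn_integral_real_affine[OF assms, of 1 a] by (simp add: add.commute)

text \<open>Unfolding: the translates of the period cell \<open>J\<close> form a partition of unity.
  Inserting it and moving each piece back by periodicity exchanges the translated cell with
  \<open>J\<close> itself.\<close>

lemma periodic_nn_integral_translate:
  fixes f :: "real \<Rightarrow> ennreal"
  assumes P: "P > 0" and [measurable]: "f \<in> borel_measurable borel" and per: "\<And>x. f (x + P) = f x"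
  shows "(\<integral>\<^sup>+x. f (x + a) * indicator {- P / 2 ..< P / 2} x \<partial>lborel)
    = (\<integral>\<^sup>+x. f x * indicator {- P / 2 ..< P / 2} x \<partial>lborel)"
proof -
  define J where "J = {- P / 2 ..< P / 2}"
  have [measurable]: "J \<in> sets borel" by (simp add: J_def)
  have one: "(\<integral>\<^sup>+n. indicator J (x + of_int n * P) \<partial>count_space (UNIV :: int set)) = (1 :: ennreal)" for x
    unfolding J_def by (rule nn_integral_period_shifts[OF P])
  have "(\<integral>\<^sup>+x. f (x + a) * indicator J x \<partial>lborel) = (\<integral>\<^sup>+x. f x * indicator J (x - a) \<partial>lborel)"
    using nn_integral_shift_lborel[of "\<lambda>x. f x * indicator J (x - a)" a] by simp
  also have "\<dots> = (\<integral>\<^sup>+x. \<integral>\<^sup>+n. f x * indicator J (x - a) * indicator J (x + of_int n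
      * P) \<partial>count_space UNIV \<partial>lborel)"
    by (simp add: nn_integral_cmult one)
  also have "\<dots> = (\<integral>\<^sup>+n. \<integral>\<^sup>+x. f x * indicator J (x - a) * indicator J (x + of_int n
      * P) \<partial>lborel \<partial>count_space UNIV)"
    by (rule nn_integral_count_space_nn_integral) auto
  also have "\<dots> = (\<integral>\<^sup>+n. \<integral>\<^sup>+x. f x * indicator J (x - a + of_int (- n) * P)
      * indicator J x \<partial>lborel \<partial>count_space UNIV)"
  proof (rule nn_integral_cong)
    fix n :: int
    have "(\<integral>\<^sup>+x. f x * indicator J (x - a) * indicator J (x + of_int n * P) \<partial>lborel)
       = (\<integral>\<^sup>+x. f (x + of_int (- n) * P) * indicator J (x + of_int (- n) * P - a) * indicator J (x
           + of_int (- n) * P + of_int n * P) \<partial>lborel)"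
      by (rule nn_integral_shift_lborel[symmetric]) measurable
    also have "\<dots> = (\<integral>\<^sup>+x. f x * indicator J (x - a + of_int (- n) * P) * indicator J x \<partial>lborel)"
      unfolding periodic_int_shift[where f = f and P = P, OF per]
          by (intro nn_integral_cong) (simp add: algebra_simps)
    finally show "(\<integral>\<^sup>+x. f x * indicator J (x - a) * indicator J (x + of_int n * P) \<partial>lborel)
       = (\<integral>\<^sup>+x. f x * indicator J (x - a + of_int (- n) * P) * indicator J x \<partial>lborel)" .
  qed
  also have "\<dots> = (\<integral>\<^sup>+x. \<integral>\<^sup>+n. f x * indicator J (x - a + of_int (- n) * P)
      * indicator J x \<partial>count_space UNIV \<partial>lborel)"
    by (rule nn_integral_count_space_nn_integral[symmetric]) auto
  also have "\<dots> = (\<integral>\<^sup>+x. f x * indicator J x \<partial>lborel)"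
  proof (rule nn_integral_cong)
    fix x
    have "(\<integral>\<^sup>+n. indicator J (x - a + of_int (- n) * P) \<partial>count_space (UNIV :: int set))
        = (\<integral>\<^sup>+n. indicator J (x - a + of_int n * P) \<partial>count_space (UNIV :: int set))"
      by (rule nn_integral_bij_count_space) (auto intro!: bij_betwI[where g = uminus])
    also have "\<dots> = (1 :: ennreal)" by (rule one)
    finally have 1: "(\<integral>\<^sup>+n. indicator J (x - a + of_int (- n) * P) \<partial>count_space (UNIV :: int set))
        = (1 :: ennreal)" .
    have "(\<integral>\<^sup>+n. f x * indicator J (x - a + of_int (- n) * P) * indicator J x \<partial>count_space (UNIV :: int set))
        = (\<integral>\<^sup>+n. (f x * indicator J x) * indicator J (x - a + of_int (- n) * P) \<partial>count_space (UNIV :: int set))"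
      by (simp add: mult_ac)
    also have "\<dots> = f x * indicator J x" by (subst nn_integral_cmult) (simp_all only: 1, simp_all)
    finally show "(\<integral>\<^sup>+n. f x * indicator J (x - a + of_int (- n) * P)
        * indicator J x \<partial>count_space (UNIV :: int set))
        = f x * indicator J x" .
  qed
  finally show ?thesis unfolding J_def .
qed

lemma conv_measure_time_measure:
  assumes \<tau>: "\<tau> > 0"
  shows "conv_measure (time_measure \<tau>) {2 * pi / \<tau>}"
proof -
  interpret finite_measure "time_measure \<tau>"
    using \<tau> by (intro finite_measureI) (simp add: time_measure_def emeasure_density)
  have J: "{- pi / \<tau> ..< pi / \<tau>} = {- (2 * pi / \<tau>) / 2 ..< (2 * pi / \<tau>) / 2}" by simp
  show ?thesis
  proof
    have "(\<lambda>(x, y). x - y) \<in> borel \<Otimes>\<^sub>M borel \<rightarrow>\<^sub>M (borel :: real measure)" by measurable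
    then show "(\<lambda>(x, y). x - y) \<in> time_measure \<tau> \<Otimes>\<^sub>M time_measure \<tau> \<rightarrow>\<^sub>M time_measure \<tau>"
      by (simp add: measurable_cong_sets[OF sets_pair_measure_cong[OF sets_time_measure
          sets_time_measure] sets_time_measure])
  next
    fix f :: "real \<Rightarrow> ennreal" and a
    assume "f \<in> borel_measurable (time_measure \<tau>)" and "\<And>h x. h \<in> {2 * pi / \<tau>} \<Longrightarrow> f (x + h) = f x"
    then have f: "f \<in> borel_measurable borel" and per: "\<And>x. f (x + 2 * pi / \<tau>) = f x"
      by (auto simp: measurable_cong_sets[OF sets_time_measure refl])
    note [measurable] = f
    show "(\<integral>\<^sup>+x. f (x + a) \<partial>time_measure \<tau>) = (\<integral>\<^sup>+x. f x \<partial>time_measure \<tau>)"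
      using periodic_nn_integral_translate[of "2 * pi / \<tau>" f a] \<tau> per f
      by (simp add: nn_integral_time_measure' J del: minus_divide_left)
    have "(\<integral>\<^sup>+x. f x * indicator {- pi / \<tau> <..< pi / \<tau>} x \<partial>lborel)
        = (\<integral>\<^sup>+x. f (- x) * indicator {- pi / \<tau> <..< pi / \<tau>} (- x) \<partial>lborel)"
      using nn_integral_real_affine[of "\<lambda>x. f x * indicator {- pi / \<tau> <..< pi / \<tau>} x" "-1" 0] by simp
    also have "\<dots> = (\<integral>\<^sup>+x. f (- x) * indicator {- pi / \<tau> <..< pi / \<tau>} x \<partial>lborel)"
      by (intro nn_integral_cong) (auto simp: indicator_def)
    finally show "(\<integral>\<^sup>+x. f (- x) \<partial>time_measure \<tau>) = (\<integral>\<^sup>+x. f x \<partial>time_measure \<tau>)"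
      by (simp add: nn_integral_time_measure)
  qed simp
qed

section \<open>Size, subadditivity and integrability of the modulation weight\<close>

abbreviation lam :: "real \<Rightarrow> real \<Rightarrow> real" where
  "lam \<tau> \<sigma> \<equiv> japanese_bracket (d_tau \<tau> \<sigma>)"

lemma norm_d_tau: "\<tau> > 0 \<Longrightarrow> cmod (d_tau \<tau> \<sigma>) = 2 * \<bar>sin (\<tau> * \<sigma> / 2)\<bar> / \<tau>"
  unfolding d_tau_def norm_divide by (simp add: dist_exp_i_1 del: of_real_mult)

lemma norm_d_tau_le: "\<tau> > 0 \<Longrightarrow> cmod (d_tau \<tau> \<sigma>) \<le> \<bar>\<sigma>\<bar>"
  using abs_sin_x_le_abs_x[of "\<tau> * \<sigma> / 2"] by (simp add: norm_d_tau field_simps abs_mult)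

text \<open>This is subadditivity of |sin|. It replaces the triangle inequality of the continuous
  setting: linear identities between phases become inequalities between modulations.\<close>

lemma norm_d_tau_add: "\<tau> > 0 \<Longrightarrow> cmod (d_tau \<tau> (x + y)) \<le> cmod (d_tau \<tau> x) + cmod (d_tau \<tau> y)"
proof -
  assume \<tau>: "\<tau> > 0"
  have "\<bar>sin (a + b)\<bar> \<le> \<bar>sin a\<bar> + \<bar>sin b\<bar>" for a b :: real
  proof -
    have "\<bar>sin (a + b)\<bar> \<le> \<bar>sin a * cos b\<bar> + \<bar>cos a * sin b\<bar>" unfolding sin_add by (rule abs_triangle_ineq)
    also have "\<dots> \<le> \<bar>sin a\<bar> * 1 + 1 * \<bar>sin b\<bar>"
      unfolding abs_mult by (intro add_mono mult_mono) auto
    finally show ?thesis by simp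
  qed
  from this[of "\<tau> * x / 2" "\<tau> * y / 2"] show ?thesis
    using \<tau> by (simp add: norm_d_tau field_simps)
qed

lemma norm_d_tau_minus: "\<tau> > 0 \<Longrightarrow> cmod (d_tau \<tau> (- x)) = cmod (d_tau \<tau> x)"
  by (simp add: norm_d_tau)

lemma bracket_add_le:
  assumes "norm z \<le> norm x + norm y"
  shows "japanese_bracket z \<le> japanese_bracket x + japanese_bracket y"
proof -
  have *: "a \<le> sqrt (1 + a\<^sup>2)" if "a \<ge> 0" for a :: real
    using that by (intro real_le_rsqrt) auto
  have "norm x * norm y \<le> japanese_bracket x * japanese_bracket y"
    unfolding japanese_bracket_def by (intro mult_mono *) auto
  moreover have "(norm z)\<^sup>2 \<le> (norm x + norm y)\<^sup>2" using assms by (intro power_mono) auto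
  ultimately have "1 + (norm z)\<^sup>2 \<le> (japanese_bracket x + japanese_bracket y)\<^sup>2"
    by (simp add: power2_sum japanese_bracket_def)
  then show ?thesis
    using bracket_ge_1[of x] bracket_ge_1[of y] unfolding japanese_bracket_def[of z]
    by (intro real_le_lsqrt) auto
qed

lemma lam_ge_1: "lam \<tau> \<sigma> \<ge> 1" by (rule bracket_ge_1)

lemma lam_add: "\<tau> > 0 \<Longrightarrow> lam \<tau> (x + y) \<le> lam \<tau> x + lam \<tau> y"
  by (rule bracket_add_le) (rule norm_d_tau_add)

lemma lam_minus: "\<tau> > 0 \<Longrightarrow> lam \<tau> (- x) = lam \<tau> x"
  by (simp add: japanese_bracket_def norm_d_tau_minus)

lemma lam_periodic: "\<tau> > 0 \<Longrightarrow> lam \<tau> (x + 2 * pi / \<tau>) = lam \<tau> x"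
proof -
  assume "\<tau> > 0"
  moreover have "exp (\<i> * (2 * complex_of_real pi)) = 1"
    using exp_two_pi_i by (simp add: mult_ac)
  ultimately show ?thesis by (simp add: d_tau_def distrib_left exp_add)
qed

lemma measurable_lam [measurable]: "lam \<tau> \<in> borel_measurable borel"
  unfolding japanese_bracket_def d_tau_def by measurable

text \<open>The sine is concave on [0, pi], so it lies above its chord from 0 to a. Choices of a
  close to pi serve the resonance bound, a = pi / 2 the comparison of \<open>lam\<close> with the
  modulus.\<close>

lemma sin_chord_le:
  fixes a y :: real
  assumes "0 \<le> y" "y \<le> a" "0 < a" "a \<le> pi"
  shows "y * (sin a / a) \<le> sin y"
proof -
  have "concave_on {0..pi} sin"
  proof (rule f''_le0_imp_concave[where f' = cos and f'' = "\<lambda>x. - sin x"])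
    show "- sin x \<le> 0" if "x \<in> {0..pi}" for x :: real using that by (simp add: sin_ge_zero)
  qed (auto intro!: derivative_eq_intros)
  from concave_onD[OF this, of "y / a" 0 a] show ?thesis
    using assms by (simp add: field_simps)
qed

text \<open>On one period the sine has argument at most pi / 2, where it exceeds half its argument.
  So the discrete weight dominates the continuous one with a constant independent of \<tau>.\<close>

lemma one_plus_abs_le_lam:
  assumes \<tau>: "\<tau> > 0" and \<sigma>: "\<bar>\<sigma>\<bar> \<le> pi / \<tau>"
  shows "1 + \<bar>\<sigma>\<bar> \<le> 3 * lam \<tau> \<sigma>"
proof -
  have x: "\<bar>\<tau> * \<sigma> / 2\<bar> \<le> pi / 2" using assms by (simp add: abs_mult field_simps)
  have "\<bar>\<tau> * \<sigma> / 2\<bar> / 2 \<le> \<bar>\<tau> * \<sigma> / 2\<bar> * (sin (pi / 2) / (pi / 2))"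
    using mult_left_mono[of pi 4 "\<bar>\<sigma> * \<tau>\<bar>"] pi_less_4 by (simp add: field_simps)
  also have "\<dots> \<le> sin \<bar>\<tau> * \<sigma> / 2\<bar>" by (rule sin_chord_le) (use x in auto)
  also have "\<dots> \<le> \<bar>sin (\<tau> * \<sigma> / 2)\<bar>" by (cases "\<tau> * \<sigma> / 2 \<ge> 0") auto
  finally have "\<bar>\<sigma>\<bar> / 2 \<le> cmod (d_tau \<tau> \<sigma>)"
    using \<tau> by (simp add: norm_d_tau abs_mult field_simps)
  moreover have "cmod (d_tau \<tau> \<sigma>) \<le> lam \<tau> \<sigma>"
    unfolding japanese_bracket_def by (intro real_le_rsqrt) simp
  ultimately show ?thesis using lam_ge_1[of \<tau> \<sigma>] by linarith
qed

lemma nn_integral_one_plus_abs_powr: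
  fixes \<gamma> :: real
  assumes \<gamma>: "\<gamma> > 1"
  shows "(\<integral>\<^sup>+x. ennreal ((1 + \<bar>x\<bar>) powr (-\<gamma>)) \<partial>lborel) \<le> ennreal (2 / (\<gamma> - 1))"
proof -
  have half: "(\<integral>\<^sup>+x. ennreal ((1 + \<bar>x\<bar>) powr (-\<gamma>)) * indicator {0..} x \<partial>lborel) = ennreal (1 / (\<gamma> - 1))"
  proof -
    have "(\<integral>\<^sup>+x. ennreal ((1 + \<bar>x\<bar>) powr (-\<gamma>)) * indicator {0..} x \<partial>lborel)
        = (\<integral>\<^sup>+x. ennreal ((1 + x) powr (-\<gamma>)) * indicator {0..} x \<partial>lborel)"
      by (intro nn_integral_cong) (auto simp: indicator_def)
    also have "\<dots> = ennreal (0 - (- ((1 + 0) powr (1 - \<gamma>)) / (\<gamma> - 1)))"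
    proof (rule nn_integral_FTC_atLeast)
      show "((\<lambda>x. - ((1 + x) powr (1 - \<gamma>)) / (\<gamma> - 1)) has_real_derivative (1 + x) powr (-\<gamma>)) (at x)"
        if "0 \<le> x" for x
      proof -
        have "((\<lambda>x. 1 + x) has_real_derivative 1) (at x)" by (auto intro!: derivative_eq_intros)
        from DERIV_fun_powr[OF this, of "1 - \<gamma>"] that
        have "((\<lambda>x. (1 + x) powr (1 - \<gamma>)) has_real_derivative (1 - \<gamma>) * (1 + x) powr (-\<gamma>)) (at x)"
          by simp
        from DERIV_cdivide[OF DERIV_minus[OF this], of "\<gamma> - 1"] show ?thesis
          by (rule DERIV_cong) (use \<gamma> in \<open>simp add: field_simps\<close>)
      qed
      have "((\<lambda>x. (1 + x) powr (1 - \<gamma>)) \<longlongrightarrow> 0) at_top"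
        using \<gamma> by (intro tendsto_neg_powr filterlim_tendsto_add_at_top[OF tendsto_const]) (auto intro:
            filterlim_ident)
      from tendsto_divide[OF tendsto_minus[OF this] tendsto_const[of "\<gamma> - 1"]] \<gamma>
      show "((\<lambda>x. - ((1 + x) powr (1 - \<gamma>)) / (\<gamma> - 1)) \<longlongrightarrow> 0) at_top" by simp
    qed auto
    finally show ?thesis by simp
  qed
  have "(\<integral>\<^sup>+x. ennreal ((1 + \<bar>x\<bar>) powr (-\<gamma>)) \<partial>lborel)
      \<le> (\<integral>\<^sup>+x. ennreal ((1 + \<bar>x\<bar>) powr (-\<gamma>)) * indicator {0..} x
          + ennreal ((1 + \<bar>-x\<bar>) powr (-\<gamma>)) * indicator {0..} (- x) \<partial>lborel)"
    by (intro nn_integral_mono) (auto simp: indicator_def)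
  also have "\<dots> = ennreal (1 / (\<gamma> - 1)) + (\<integral>\<^sup>+x. ennreal ((1 + \<bar>-x\<bar>) powr (-\<gamma>)) * indicator {0..} (- x) \<partial>lborel)"
    by (subst nn_integral_add) (simp_all add: half)
  also have "(\<integral>\<^sup>+x. ennreal ((1 + \<bar>-x\<bar>) powr (-\<gamma>)) * indicator {0..} (- x) \<partial>lborel) = ennreal (1 / (\<gamma> - 1))"
    using nn_integral_real_affine[of "\<lambda>x. ennreal ((1 + \<bar>x\<bar>) powr (-\<gamma>))
        * indicator {0..} x" "-1" 0] half by simp
  also have "ennreal (1 / (\<gamma> - 1)) + ennreal (1 / (\<gamma> - 1)) = ennreal (2 / (\<gamma> - 1))"
    using \<gamma> by (subst ennreal_plus[symmetric]) auto
  finally show ?thesis .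
qed

text \<open>The period 2 pi / \<tau> grows as \<tau> tends to 0, so a bound uniform in \<tau>
  amounts to integrability of (1 + |\<sigma>|)^(-\<gamma>) on the whole line; this is where \<gamma>
  > 1 enters.\<close>

lemma nn_integral_lam_powr:
  fixes \<gamma> :: real
  assumes \<gamma>: "\<gamma> > 1"
  shows "\<exists>C\<ge>0. \<forall>\<tau>>0. (\<integral>\<^sup>+\<sigma>. ennreal (lam \<tau> \<sigma> powr (-\<gamma>)) \<partial>time_measure \<tau>) \<le> ennreal C"
proof -
  have "(\<integral>\<^sup>+\<sigma>. ennreal (lam \<tau> \<sigma> powr (-\<gamma>)) \<partial>time_measure \<tau>) \<le> ennreal (3 powr \<gamma> * (2 / (\<gamma> - 1)))"
    if \<tau>: "\<tau> > 0" for \<tau>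
  proof -
    have "(\<integral>\<^sup>+\<sigma>. ennreal (lam \<tau> \<sigma> powr (-\<gamma>)) \<partial>time_measure \<tau>)
        = (\<integral>\<^sup>+\<sigma>\<in>{- pi / \<tau> <..< pi / \<tau>}. ennreal (lam \<tau> \<sigma> powr (-\<gamma>)) \<partial>lborel)"
      by (rule nn_integral_time_measure) measurable
    also have "\<dots> \<le> (\<integral>\<^sup>+\<sigma>. ennreal (3 powr \<gamma>) * ennreal ((1 + \<bar>\<sigma>\<bar>) powr (-\<gamma>)) \<partial>lborel)"
    proof (rule nn_integral_mono)
      fix \<sigma>
      show "ennreal (lam \<tau> \<sigma> powr (-\<gamma>)) * indicator {- pi / \<tau> <..< pi / \<tau>} \<sigma>
          \<le> ennreal (3 powr \<gamma>) * ennreal ((1 + \<bar>\<sigma>\<bar>) powr (-\<gamma>))"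
      proof (cases "\<sigma> \<in> {- pi / \<tau> <..< pi / \<tau>}")
        case True
        then have "1 + \<bar>\<sigma>\<bar> \<le> 3 * lam \<tau> \<sigma>" by (intro one_plus_abs_le_lam \<tau>) auto
        then have "(1 + \<bar>\<sigma>\<bar>) / 3 \<le> lam \<tau> \<sigma>" by simp
        then have "lam \<tau> \<sigma> powr (-\<gamma>) \<le> ((1 + \<bar>\<sigma>\<bar>) / 3) powr (-\<gamma>)"
          using \<gamma> by (intro powr_mono2') auto
        also have "\<dots> = 3 powr \<gamma> * (1 + \<bar>\<sigma>\<bar>) powr (-\<gamma>)"
          by (simp add: powr_divide powr_minus field_simps)
        finally show ?thesis using True by (simp add: ennreal_leI flip: ennreal_mult)
      next
        case False
        then have "indicator {- pi / \<tau> <..< pi / \<tau>} \<sigma> = (0 :: ennreal)" by (rule indicator_simps(2))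
        then show ?thesis by (simp only: mult_zero_right zero_le)
      qed
    qed
    also have "\<dots> = ennreal (3 powr \<gamma>) * (\<integral>\<^sup>+\<sigma>. ennreal ((1 + \<bar>\<sigma>\<bar>) powr (-\<gamma>)) \<partial>lborel)"
      by (rule nn_integral_cmult) measurable
    also have "\<dots> \<le> ennreal (3 powr \<gamma>) * ennreal (2 / (\<gamma> - 1))"
      by (intro mult_left_mono nn_integral_one_plus_abs_powr \<gamma>) auto
    also have "\<dots> = ennreal (3 powr \<gamma> * (2 / (\<gamma> - 1)))" using \<gamma> by (intro ennreal_mult[symmetric]) auto
    finally show ?thesis .
  qed
  moreover have "3 powr \<gamma> * (2 / (\<gamma> - 1)) \<ge> 0" using \<gamma> by simp
  ultimately show ?thesis by blast
qed

text \<open>The weight is nearly constant on intervals of length one: a shift by at most 1 adds at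
  most 2, hence multiplies a weight that is at least 1 by at most 3.\<close>

lemma lam_shift_powr_le:
  assumes "\<tau> > 0" "\<gamma> \<ge> 0" "\<bar>u\<bar> \<le> 1"
  shows "lam \<tau> x powr (-\<gamma>) \<le> 3 powr \<gamma> * lam \<tau> (x + u) powr (-\<gamma>)"
proof -
  have "cmod (d_tau \<tau> u) \<le> 1" using norm_d_tau_le[of \<tau> u] assms by linarith
  then have "lam \<tau> u \<le> sqrt (1 + 1)"
    unfolding japanese_bracket_def by (intro real_sqrt_le_mono add_left_mono) (simp add: power_le_one)
  also have "\<dots> \<le> 2" by (rule real_le_lsqrt) auto
  finally have "lam \<tau> (x + u) \<le> 3 * lam \<tau> x"
    using lam_add[OF assms(1), of x u] lam_ge_1[of \<tau> x] by linarith
  then have "lam \<tau> (x + u) / 3 \<le> lam \<tau> x" by simp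
  then have "lam \<tau> x powr (-\<gamma>) \<le> (lam \<tau> (x + u) / 3) powr (-\<gamma>)"
    using assms lam_ge_1[of \<tau> "x + u"] by (intro powr_mono2') auto
  also have "\<dots> = 3 powr \<gamma> * lam \<tau> (x + u) powr (-\<gamma>)"
    using lam_ge_1[of \<tau> "x + u"] by (simp add: powr_divide powr_minus field_simps)
  finally show ?thesis .
qed

text \<open>The sum is compared with an integral over [0, M + 1). The weight is periodic and does
  not decay globally, but \<tau> M \<le> K says that only a bounded number of periods of length 2 pi
  / \<tau> is covered.\<close>

lemma sum_lam_powr:
  fixes \<gamma> K :: real
  assumes \<gamma>: "\<gamma> > 1" and K: "K \<ge> 0"
  shows "\<exists>B\<ge>0. \<forall>\<tau> \<sigma> M. 0 < \<tau> \<longrightarrow> \<tau> \<le> 1 \<longrightarrow> \<tau> * real M \<le> K \<longrightarrow>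
    (\<Sum>m\<le>M. lam \<tau> (\<sigma> + real m) powr (-\<gamma>)) \<le> B"
proof -
  obtain C where C: "C \<ge> 0" "\<And>\<tau>. \<tau> > 0 \<Longrightarrow> (\<integral>\<^sup>+\<sigma>. ennreal (lam \<tau> \<sigma> powr (-\<gamma>)) \<partial>time_measure \<tau>) \<le> ennreal C"
    using nn_integral_lam_powr[OF \<gamma>] by blast
  \<comment> \<open>\<open>3 powr \<gamma>\<close> comes from replacing a term by its average over a
    unit interval, \<open>K + 3\<close> bounds the number \<open>J + 1\<close> of period
    cells.\<close>
  define B where "B = 3 powr \<gamma> * ((K + 3) * C)"
  have "(\<Sum>m\<le>M. lam \<tau> (\<sigma> + real m) powr (-\<gamma>)) \<le> B"
    if \<tau>: "0 < \<tau>" "\<tau> \<le> 1" "\<tau> * real M \<le> K" for \<tau> \<sigma> M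
  proof -
    interpret conv_measure "time_measure \<tau>" "{2 * pi / \<tau>}" by (rule conv_measure_time_measure) fact
    define P where "P = 2 * pi / \<tau>"
    have P: "P > 0" using \<tau> by (simp add: P_def)
    define g where "g = (\<lambda>x. ennreal (lam \<tau> (\<sigma> + x) powr (-\<gamma>)))"
    have [measurable]: "g \<in> borel_measurable borel" unfolding g_def by measurable
    have gper: "g (x + P) = g x" for x
      using lam_periodic[OF \<tau>(1), of "\<sigma> + x"] by (simp add: g_def P_def add_ac)
    define J where "J = nat \<lceil>(real M + 1) / P\<rceil>"
    have "(\<Sum>m\<le>M. ennreal (lam \<tau> (\<sigma> + real m) powr (-\<gamma>)))
        \<le> (\<Sum>m\<le>M. ennreal (3 powr \<gamma>) * (\<integral>\<^sup>+x. g x * indicator {real m ..< real m + 1} x \<partial>lborel))"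
    proof (rule sum_mono)
      fix m
      have "ennreal (lam \<tau> (\<sigma> + real m) powr (-\<gamma>))
          = (\<integral>\<^sup>+x. ennreal (lam \<tau> (\<sigma> + real m) powr (-\<gamma>)) * indicator {real m ..< real m + 1} x \<partial>lborel)"
        by (subst nn_integral_cmult_indicator) auto
      also have "\<dots> \<le> (\<integral>\<^sup>+x. ennreal (3 powr \<gamma>) * (g x * indicator {real m ..< real m + 1} x) \<partial>lborel)"
      proof (rule nn_integral_mono)
        fix x
        show "ennreal (lam \<tau> (\<sigma> + real m) powr (-\<gamma>)) * indicator {real m ..< real m + 1} x
            \<le> ennreal (3 powr \<gamma>) * (g x * indicator {real m ..< real m + 1} x)"
        proof (cases "x \<in> {real m ..< real m + 1}")
          case True
          then show ?thesis
            using lam_shift_powr_le[OF \<tau>(1), of \<gamma> "x - real m" "\<sigma> + real m"] \<gamma>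
            by (simp add: g_def ennreal_leI flip: ennreal_mult)
        qed simp
      qed
      also have "\<dots> = ennreal (3 powr \<gamma>) * (\<integral>\<^sup>+x. g x * indicator {real m ..< real m + 1} x \<partial>lborel)"
        by (rule nn_integral_cmult) measurable
      finally show "ennreal (lam \<tau> (\<sigma> + real m) powr (-\<gamma>))
          \<le> ennreal (3 powr \<gamma>) * (\<integral>\<^sup>+x. g x * indicator {real m ..< real m + 1} x \<partial>lborel)" .
    qed
    also have "\<dots> = ennreal (3 powr \<gamma>) * (\<integral>\<^sup>+x. (\<Sum>m\<le>M. g x * indicator {real m ..< real m + 1} x) \<partial>lborel)"
      by (subst nn_integral_sum) (auto simp: sum_distrib_left)
    also have "(\<integral>\<^sup>+x. (\<Sum>m\<le>M. g x * indicator {real m ..< real m + 1} x) \<partial>lborel)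
        \<le> (\<integral>\<^sup>+x. (\<Sum>j\<le>J. g x * indicator {- P / 2 ..< P / 2} (x - real j * P)) \<partial>lborel)"
    proof (rule nn_integral_mono)
      fix x
      have 1: "(\<Sum>m\<le>M. indicator {real m ..< real m + 1} x) \<le> (indicator {0 ..< real M + 1} x :: ennreal)"
      proof (cases "x \<in> {0 ..< real M + 1}")
        case True
        have "(\<Sum>m\<le>M. indicator {real m ..< real m + 1} x) = (\<Sum>m\<in>{nat \<lfloor>x\<rfloor>}. (1::ennreal))"
        proof (rule sum.mono_neutral_cong_right)
          show "{nat \<lfloor>x\<rfloor>} \<subseteq> {..M}" using True by (auto simp: nat_le_iff floor_le_iff)
          show "\<forall>i\<in>{..M} - {nat \<lfloor>x\<rfloor>}. indicator {real i ..< real i + 1} x = (0::ennreal)"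
          proof
            fix i assume "i \<in> {..M} - {nat \<lfloor>x\<rfloor>}"
            then have "i \<notin> {nat \<lfloor>x\<rfloor>}" by simp
            then have "\<not> (real i \<le> x \<and> x < real i + 1)"
              by (metis floor_unique nat_int of_int_of_nat_eq singletonI)
            then show "indicator {real i ..< real i + 1} x = (0::ennreal)" by auto
          qed
          show "indicator {real i ..< real i + 1} x = (1::ennreal)" if "i \<in> {nat \<lfloor>x\<rfloor>}" for i
            using that True by (auto simp: indicator_def)
        qed simp
        then show ?thesis using True by simp
      next
        case False
        then have "indicator {real m ..< real m + 1} x = (0::ennreal)" if "m \<le> M" for m
          using that by (auto simp: indicator_def)
        then show ?thesis by simp
      qed
      \<comment> \<open>The period cells tile the line; those numbered 0 to \<open>J\<close> reach
        past M + 1.\<close>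
      have 2: "indicator {0 ..< real M + 1} x \<le> (\<Sum>j\<le>J. indicator {- P / 2 ..< P / 2} (x - real j
          * P) :: ennreal)"
      proof (cases "x \<in> {0 ..< real M + 1}")
        case True
        define j where "j = \<lfloor>(x + P / 2) / P\<rfloor>"
        have j0: "j \<ge> 0" using True P by (simp add: j_def)
        have "(x + P / 2) / P = x / P + 1 / 2" using P by (simp add: field_simps)
        moreover have "x / P \<le> (real M + 1) / P" using True P by (intro divide_right_mono) auto
        ultimately have "(x + P / 2) / P \<le> (real M + 1) / P + 1 / 2" by simp
        then have "(x + P / 2) / P < real J + 1" unfolding J_def by linarith
        then have "j < int J + 1" unfolding j_def by linarith
        then have jJ: "nat j \<le> J" by simp
        have "x + of_int (- j) * P \<in> {- P / 2 ..< P / 2}"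
          using ex_unique_period_shift[OF P, of x "- j"] by (simp add: j_def)
        then have "indicator {- P / 2 ..< P / 2} (x - real (nat j) * P) = (1::ennreal)"
          using j0 by (simp add: indicator_def)
        then show ?thesis using True jJ member_le_sum[of "nat j" "{..J}" "\<lambda>j. indicator {- P / 2 ..< P /
            2} (x - real j * P) :: ennreal"]
          by simp
      qed simp
      show "(\<Sum>m\<le>M. g x * indicator {real m ..< real m + 1} x)
          \<le> (\<Sum>j\<le>J. g x * indicator {- P / 2 ..< P / 2} (x - real j * P))"
        using order_trans[OF 1 2] by (simp add: mult_left_mono flip: sum_distrib_left)
    qed
    also have "\<dots> = (\<Sum>j\<le>J. \<integral>\<^sup>+x. g x * indicator {- P / 2 ..< P / 2} (x - real j * P) \<partial>lborel)"
      by (rule nn_integral_sum) measurable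
    also have "\<dots> = (\<Sum>j\<le>J. \<integral>\<^sup>+x. g x * indicator {- P / 2 ..< P / 2} x \<partial>lborel)"
    proof (rule sum.cong[OF refl])
      fix j
      have "g (x + real j * P) = g x" for x
        using periodic_int_shift[where f = g and P = P and n = "int j", OF gper] by simp
      then show "(\<integral>\<^sup>+x. g x * indicator {- P / 2 ..< P / 2} (x - real j * P) \<partial>lborel)
          = (\<integral>\<^sup>+x. g x * indicator {- P / 2 ..< P / 2} x \<partial>lborel)"
        using nn_integral_shift_lborel[of "\<lambda>x. g x * indicator {- P / 2 ..< P / 2} (x - real j
            * P)" "real j * P"]
        by simp
    qed
    also have "(\<integral>\<^sup>+x. g x * indicator {- P / 2 ..< P / 2} x \<partial>lborel) = (\<integral>\<^sup>+x. g x \<partial>time_measure \<tau>)"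
      by (simp add: nn_integral_time_measure' P_def)
    also have "\<dots> = (\<integral>\<^sup>+x. ennreal (lam \<tau> x powr (-\<gamma>)) \<partial>time_measure \<tau>)"
    proof -
      have "periodic (\<lambda>x. ennreal (lam \<tau> x powr (-\<gamma>)))"
        using lam_periodic[OF \<tau>(1)] by (simp add: periodic_def)
      from integral_add[OF this, of \<sigma>] show ?thesis by (simp add: g_def add.commute)
    qed
    finally have "(\<Sum>m\<le>M. ennreal (lam \<tau> (\<sigma> + real m) powr (-\<gamma>)))
        \<le> ennreal (3 powr \<gamma>) * (\<Sum>j\<le>J. \<integral>\<^sup>+x. ennreal (lam \<tau> x powr (-\<gamma>)) \<partial>time_measure \<tau>)"
      by (simp add: mult_left_mono)
    also have "\<dots> \<le> ennreal (3 powr \<gamma>) * (\<Sum>j\<le>J. ennreal C)"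
      by (intro mult_left_mono sum_mono C \<tau>) auto
    also have "\<dots> = ennreal (3 powr \<gamma> * (real (J + 1) * C))"
      using C(1) by (simp add: ennreal_mult ennreal_of_nat_eq_real_of_nat)
    also have "\<dots> \<le> ennreal B"
    proof -
      have "(real M + 1) / P \<le> \<tau> * real M + \<tau>"
      proof -
        have "(real M + 1) / P = (\<tau> * (real M + 1)) / (2 * pi)" by (simp add: P_def)
        also have "\<dots> \<le> (\<tau> * (real M + 1)) / 1"
          using \<tau> pi_gt3 by (intro divide_left_mono) auto
        finally show ?thesis by (simp add: algebra_simps)
      qed
      then have "real J \<le> K + 2" using \<tau> P unfolding J_def by (simp add: of_nat_nat) linarith
      then show ?thesis unfolding B_def using C(1)
        by (intro ennreal_leI mult_left_mono mult_right_mono) auto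
    qed
    finally have "ennreal (\<Sum>m\<le>M. lam \<tau> (\<sigma> + real m) powr (-\<gamma>)) \<le> ennreal B"
      by (simp add: sum_ennreal)
    then show ?thesis using C(1) K by (simp add: B_def ennreal_le_iff)
  qed
  moreover have "B \<ge> 0" using C K by (simp add: B_def)
  ultimately show ?thesis by blast
qed

text \<open>The arguments add up to x + y, so one of the two weights is at least half of
  \<open>lam \<tau> (x + y)\<close>. That one leaves the integral, the other is integrable since
  \<gamma> > 1.\<close>

lemma nn_integral_lam_convolution:
  fixes \<gamma> :: real
  assumes \<gamma>: "\<gamma> > 1"
  shows "\<exists>C\<ge>0. \<forall>\<tau>>0. \<forall>x y. (\<integral>\<^sup>+\<sigma>. ennreal (lam \<tau> (\<sigma> + x) powr (-\<gamma>) * lam \<tau> (y - \<sigma>) powr (-\<gamma>)) \<partial>time_measure \<tau>)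
    \<le> ennreal (C * lam \<tau> (x + y) powr (-\<gamma>))"
proof -
  obtain C where C: "C \<ge> 0" "\<And>\<tau>. \<tau> > 0 \<Longrightarrow> (\<integral>\<^sup>+\<sigma>. ennreal (lam \<tau> \<sigma> powr (-\<gamma>)) \<partial>time_measure \<tau>) \<le> ennreal C"
    using nn_integral_lam_powr[OF \<gamma>] by blast
  have "(\<integral>\<^sup>+\<sigma>. ennreal (lam \<tau> (\<sigma> + x) powr (-\<gamma>) * lam \<tau> (y - \<sigma>) powr (-\<gamma>)) \<partial>time_measure \<tau>)
      \<le> ennreal ((2 powr \<gamma> * (2 * C)) * lam \<tau> (x + y) powr (-\<gamma>))" if \<tau>: "\<tau> > 0" for \<tau> x y
  proof -
    interpret conv_measure "time_measure \<tau>" "{2 * pi / \<tau>}" by (rule conv_measure_time_measure) fact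
    have per: "periodic (\<lambda>x. ennreal (lam \<tau> x powr (-\<gamma>)))"
      using lam_periodic[OF \<tau>] by (simp add: periodic_def)
    define D where "D = 2 powr \<gamma> * lam \<tau> (x + y) powr (-\<gamma>)"
    have D0: "D \<ge> 0" by (simp add: D_def)
    have pt: "lam \<tau> (\<sigma> + x) powr (-\<gamma>) * lam \<tau> (y - \<sigma>) powr (-\<gamma>)
        \<le> D * (lam \<tau> (\<sigma> + x) powr (-\<gamma>) + lam \<tau> (y - \<sigma>) powr (-\<gamma>))" for \<sigma>
    proof -
      have tri: "lam \<tau> (x + y) \<le> lam \<tau> (\<sigma> + x) + lam \<tau> (y - \<sigma>)"
        using lam_add[OF \<tau>, of "\<sigma> + x" "y - \<sigma>"] by (simp add: add_ac)
      have *: "u powr (-\<gamma>) \<le> D" if "u \<ge> lam \<tau> (x + y) / 2" for u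
      proof -
        have "u powr (-\<gamma>) \<le> (lam \<tau> (x + y) / 2) powr (-\<gamma>)"
          using that \<gamma> lam_ge_1[of \<tau> "x + y"] by (intro powr_mono2') auto
        also have "\<dots> = D"
          using lam_ge_1[of \<tau> "x + y"] by (simp add: D_def powr_divide powr_minus field_simps)
        finally show ?thesis .
      qed
      consider "lam \<tau> (\<sigma> + x) \<ge> lam \<tau> (x + y) / 2" | "lam \<tau> (y - \<sigma>) \<ge> lam \<tau> (x + y) / 2"
        using tri by linarith
      then show ?thesis
      proof cases
        case 1
        then have "lam \<tau> (\<sigma> + x) powr (-\<gamma>) * lam \<tau> (y - \<sigma>) powr (-\<gamma>) \<le> D * lam \<tau> (y - \<sigma>) powr (-\<gamma>)"
          by (intro mult_right_mono *) auto
        then show ?thesis using D0 by (simp add: distrib_left add_increasing)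
      next
        case 2
        then have "lam \<tau> (\<sigma> + x) powr (-\<gamma>) * lam \<tau> (y - \<sigma>) powr (-\<gamma>) \<le> lam \<tau> (\<sigma> + x) powr (-\<gamma>) * D"
          by (intro mult_left_mono *) auto
        then show ?thesis using D0 by (simp add: distrib_left add_increasing2 mult.commute)
      qed
    qed
    have "(\<integral>\<^sup>+\<sigma>. ennreal (lam \<tau> (\<sigma> + x) powr (-\<gamma>) * lam \<tau> (y - \<sigma>) powr (-\<gamma>)) \<partial>time_measure \<tau>)
        \<le> (\<integral>\<^sup>+\<sigma>. ennreal D * (ennreal (lam \<tau> (\<sigma> + x) powr (-\<gamma>))
            + ennreal (lam \<tau> (y - \<sigma>) powr (-\<gamma>))) \<partial>time_measure \<tau>)"
      using pt D0 by (intro nn_integral_mono) (simp add: ennreal_leI flip: ennreal_mult ennreal_plus)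
    also have "\<dots> = ennreal D * ((\<integral>\<^sup>+\<sigma>. ennreal (lam \<tau> (\<sigma> + x) powr (-\<gamma>)) \<partial>time_measure \<tau>)
        + (\<integral>\<^sup>+\<sigma>. ennreal (lam \<tau> (y - \<sigma>) powr (-\<gamma>)) \<partial>time_measure \<tau>))"
      by (subst nn_integral_cmult, measurable, subst nn_integral_add, measurable)
    also have "\<dots> \<le> ennreal D * (ennreal C + ennreal C)"
      unfolding integral_add[OF per] integral_diff2[OF per] using C(2)[OF \<tau>]
      by (intro mult_left_mono add_mono) auto
    also have "\<dots> = ennreal (D * (C + C))"
      using D0 C(1) by (subst ennreal_plus[symmetric]) (auto simp: ennreal_mult)
    finally show ?thesis by (simp add: D_def mult_ac)
  qed
  moreover have "2 powr \<gamma> * (2 * C) \<ge> 0" using C(1) by simp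
  ultimately show ?thesis by blast
qed

section \<open>Resonance and the interaction kernel\<close>

lemma norm_d_tau_le_lam: "cmod (d_tau \<tau> \<sigma>) \<le> lam \<tau> \<sigma>"
  unfolding japanese_bracket_def by (intro real_le_rsqrt) simp

text \<open>Two of the three frequencies of an interaction are filtered, so \<open>\<tau> R\<close> stays below \<open>2\<pi>\<close> by a
  fixed margin when \<open>|k\<^sub>0|\<close> and \<open>|k\<^sub>2|\<close> are far apart; this is where \<open>c < 2\<pi>\<close> rules out aliasing.\<close>

lemma no_aliasing:
  fixes c :: real
  assumes c: "0 < c" "c < 2 * pi"
  shows "\<exists>\<kappa>\<ge>1. \<exists>c1>0. \<forall>\<tau> e X Y Z. 0 < \<tau> \<longrightarrow> \<tau> < 1 \<longrightarrow> \<bar>e\<bar> = 1 \<longrightarrow> 0 \<le> X \<longrightarrow> 0 \<le> Y \<longrightarrow> 0 \<le> Z \<longrightarrow>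
    X \<le> Y + Z \<longrightarrow> Y \<le> X + Z \<longrightarrow> \<tau> * X\<^sup>2 \<le> c \<or> \<tau> * Y\<^sup>2 \<le> c \<longrightarrow>
    sqrt (1 + X\<^sup>2) > \<kappa> * sqrt (1 + Z\<^sup>2) \<longrightarrow>
    cmod (d_tau \<tau> (X\<^sup>2 - Z\<^sup>2 + e * Y)) \<ge> c1 * (1 + X\<^sup>2)"
proof -
  \<comment> \<open>t is the largest allowed ratio of the smaller to the larger bracket, so \<kappa>
    = 1 / t. The displayed function bounds \<tau> R and tends to c < 2 pi, so a small t keeps it
    below 2 pi.\<close>
  have "((\<lambda>t. c * (1 + 2 * t) / (1 - 2 * t)\<^sup>2) \<longlongrightarrow> c * (1 + 2 * 0) / (1 - 2 * 0)\<^sup>2) (at_right 0)"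
    by (intro tendsto_intros) auto
  then have "((\<lambda>t. c * (1 + 2 * t) / (1 - 2 * t)\<^sup>2) \<longlongrightarrow> c) (at_right 0)" by simp
  then have "eventually (\<lambda>t. c * (1 + 2 * t) / (1 - 2 * t)\<^sup>2 < 2 * pi) (at_right 0)"
    using c(2) by (rule order_tendstoD(2))
  moreover have "eventually (\<lambda>t::real. t \<in> {0<..<1/6}) (at_right 0)"
    by (rule eventually_at_right_real) simp
  ultimately have "eventually (\<lambda>t. c * (1 + 2 * t) / (1 - 2 * t)\<^sup>2 < 2 * pi \<and> t \<in> {0<..<1/6}) (at_right 0)"
    by (rule eventually_conj)
  then obtain t where t: "c * (1 + 2 * t) / (1 - 2 * t)\<^sup>2 < 2 * pi" "0 < t" "t < 1 / 6"
    using eventually_happens[of _ "at_right (0::real)"] by auto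
  \<comment> \<open>\<open>A\<close> bounds \<tau> R. As A / 2 < pi, the chord of the sine up to A /
    2 has positive slope \<open>w\<close>: the phase cannot wrap around to a multiple of 2
    pi.\<close>
  define A where "A = c * (1 + 2 * t) / (1 - 2 * t)\<^sup>2"
  have A: "0 < A" "A < 2 * pi" using t c by (auto simp: A_def)
  define w where "w = sin (A / 2) / (A / 2)"
  have w: "w > 0" using A sin_gt_zero[of "A / 2"] by (simp add: w_def)
  have "cmod (d_tau \<tau> (X\<^sup>2 - Z\<^sup>2 + e * Y)) \<ge> (w / 2) * (1 + X\<^sup>2)"
    if h: "0 < \<tau>" "\<tau> < 1" "\<bar>e\<bar> = 1" "0 \<le> X" "0 \<le> Y" "0 \<le> Z" "X \<le> Y + Z" "Y \<le> X + Z"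
      "\<tau> * X\<^sup>2 \<le> c \<or> \<tau> * Y\<^sup>2 \<le> c" "sqrt (1 + X\<^sup>2) > (1 / t) * sqrt (1 + Z\<^sup>2)" for \<tau> e X Y Z
  proof -
    define x where "x = sqrt (1 + X\<^sup>2)"
    define z where "z = sqrt (1 + Z\<^sup>2)"
    have x2: "x\<^sup>2 = 1 + X\<^sup>2" and z2: "z\<^sup>2 = 1 + Z\<^sup>2" by (simp_all add: x_def z_def)
    have z1: "z \<ge> 1" by (simp add: z_def)
    have zx: "z < t * x" using h(10) t by (simp add: x_def z_def field_simps)
    have x0: "x \<ge> 0" by (simp add: x_def)
    have tx: "1 < t * x" using z1 zx by linarith
    have Xx: "X \<le> x" unfolding x_def by (intro real_le_rsqrt) simp
    have Zz: "Z \<le> z" unfolding z_def by (intro real_le_rsqrt) simp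
    have "x \<le> 1 + X"
      unfolding x_def using h(4) by (intro real_le_lsqrt) (auto simp: power2_sum)
    have zle: "z \<le> x"
      using zx t x0 mult_right_mono[of t 1 x] by linarith
    \<comment> \<open>The wave phase is linear in x, hence a small multiple of x^2 as soon as t x >
      1.\<close>
    have Y2: "Y \<le> 2 * t * x\<^sup>2"
    proof -
      have "Y \<le> 2 * x" using h Xx Zz zle by linarith
      also have "\<dots> \<le> 2 * x * (t * x)" using tx x0 by (intro mult_le_cancel_left1[THEN iffD2]) auto
      finally show ?thesis by (simp add: power2_eq_square mult_ac)
    qed
    have zz: "z\<^sup>2 \<le> t * x\<^sup>2"
    proof -
      have "z * z \<le> (t * x) * x" using zx zle z1 x0 t by (intro mult_mono) auto
      then show ?thesis by (simp add: power2_eq_square mult_ac)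
    qed
    define R where "R = X\<^sup>2 - Z\<^sup>2 + e * Y"
    have eY: "\<bar>e * Y\<bar> \<le> 2 * t * x\<^sup>2" using Y2 h by (simp add: abs_mult)
    have Req: "R = x\<^sup>2 - z\<^sup>2 + e * Y" by (simp add: R_def x2 z2)
    \<comment> \<open>With t < 1/6, the terms z^2 \<le> t x^2 and |e Y| \<le> 2 t x^2 together take
      at most half of x^2.\<close>
    have "t * x\<^sup>2 \<le> (1/6) * x\<^sup>2" using t by (intro mult_right_mono) auto
    then have Rlow: "R \<ge> x\<^sup>2 / 2" using Req zz eY by linarith
    have Rup: "R \<le> (1 + 2 * t) * x\<^sup>2" 
    proof -
      have "(1 + 2 * t) * x\<^sup>2 = x\<^sup>2 + 2 * t * x\<^sup>2" by (simp add: distrib_right)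
      then show ?thesis using Req eY zero_le_power2[of z] by linarith
    qed
    \<comment> \<open>Whichever of X and Y satisfies the filter bound, it falls short of x by at
      most 2 t x, so the bound passes to x with a small loss.\<close>
    have xc: "sqrt \<tau> * x * (1 - 2 * t) \<le> sqrt c"
    proof -
      have *: "sqrt \<tau> * V \<le> sqrt c" if "\<tau> * V\<^sup>2 \<le> c" "V \<ge> 0" for V
        using real_sqrt_le_mono[OF that(1)] that(2) by (simp add: real_sqrt_mult)
      have "\<exists>V\<ge>0. sqrt \<tau> * V \<le> sqrt c \<and> x * (1 - 2 * t) \<le> V"
      proof (cases "\<tau> * X\<^sup>2 \<le> c")
        case True
        have "x - 2 * (t * x) \<le> X" using \<open>x \<le> 1 + X\<close> tx by linarith
        then show ?thesis using *[OF True h(4)] h(4) by (intro exI[of _ X]) (auto simp: algebra_simps)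
      next
        case False
        then have Y: "\<tau> * Y\<^sup>2 \<le> c" using h by auto
        have "x - 2 * (t * x) \<le> Y" using \<open>x \<le> 1 + X\<close> tx h Zz zx by linarith
        then show ?thesis using *[OF Y h(5)] h(5) by (intro exI[of _ Y]) (auto simp: algebra_simps)
      qed
      then obtain V where V: "sqrt \<tau> * V \<le> sqrt c" "x * (1 - 2 * t) \<le> V" by blast
      have "sqrt \<tau> * (x * (1 - 2 * t)) \<le> sqrt \<tau> * V" using V h by (intro mult_left_mono) auto
      then show ?thesis using V by (simp add: mult.assoc)
    qed
    have "(sqrt \<tau> * x * (1 - 2 * t))\<^sup>2 \<le> (sqrt c)\<^sup>2"
      using xc x0 h t by (intro power_mono) auto
    then have "\<tau> * x\<^sup>2 * (1 - 2 * t)\<^sup>2 \<le> c" using h c by (simp add: power_mult_distrib)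
    then have xc2: "\<tau> * x\<^sup>2 \<le> c / (1 - 2 * t)\<^sup>2" using t by (simp add: pos_le_divide_eq)
    have "\<tau> * R \<le> \<tau> * ((1 + 2 * t) * x\<^sup>2)" using Rup h by (intro mult_left_mono) auto
    also have "\<dots> = (1 + 2 * t) * (\<tau> * x\<^sup>2)" by simp
    also have "\<dots> \<le> (1 + 2 * t) * (c / (1 - 2 * t)\<^sup>2)" using xc2 t by (intro mult_left_mono) auto
    also have "\<dots> = A" by (simp add: A_def)
    finally have RA: "\<tau> * R \<le> A" .
    have R0: "R \<ge> 0" using Rlow zero_le_power2[of x] by linarith
    have "(\<tau> * R / 2) * w \<le> sin (\<tau> * R / 2)"
      unfolding w_def by (rule sin_chord_le) (use RA R0 h A in auto)
    also have "\<dots> \<le> \<bar>sin (\<tau> * R / 2)\<bar>" by simp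
    finally have "R * w \<le> cmod (d_tau \<tau> R)" using h by (simp add: norm_d_tau field_simps)
    moreover have "(x\<^sup>2 / 2) * w \<le> R * w" using Rlow w by (intro mult_right_mono) auto
    ultimately show ?thesis by (simp add: R_def x2 field_simps)
  qed
  moreover have "1 / t \<ge> 1" using t by simp
  moreover have "w / 2 > 0" using w by simp
  ultimately show ?thesis by blast
qed

text \<open>x, y, z stand for the brackets of k0, k1, k2, with y the wave frequency. If x and z are
  far apart, the largest modulation yields M^(-2 b), which pays for the ratio factor. If they are
  comparable, y is at most a multiple of the smallest bracket, and it is decisive whether l0 l2
  exceeds y^2 l1: if so, l1 and y gain 2 b powers; if not, l1 is spent on raising the exponent of l0
  l2 to \<beta>.\<close>

lemma kernel_bound_real:
  fixes s b \<beta> \<kappa> c1 :: real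
  assumes s: "s \<ge> 0" and b: "1/4 < b" and \<beta>: "\<beta> \<le> 2 * b" "b \<le> \<beta>" and \<kappa>: "\<kappa> \<ge> 1" and c1: "c1 > 0"
  shows "\<exists>C\<ge>0. \<forall>x y z l0 l1 l2. 1 \<le> x \<longrightarrow> 1 \<le> y \<longrightarrow> 1 \<le> z \<longrightarrow> 1 \<le> l0 \<longrightarrow> 1 \<le> l1 \<longrightarrow> 1 \<le> l2 \<longrightarrow>
    y \<le> x + z \<longrightarrow> (max x z > \<kappa> * min x z \<longrightarrow> l0 + l1 + l2 \<ge> c1 * (max x z)\<^sup>2) \<longrightarrow>
    (min x (min y z)) powr (- s) * (max x z / min x z) powr (1/2) * (l0 * l1 * l2) powr (- b)
    \<le> C * ((x powr (-(s + 2 * b)) + y powr (-(s + 2 * b)) + z powr (-(s + 2 * b)))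
          * (l0 powr (- 2 * b) + l1 powr (- 2 * b) + l2 powr (- 2 * b))
        + y powr (- (s - 2 * \<beta> + 2 * b)) * (l0 * l2) powr (- \<beta>))"
proof -
  define C where "C = (c1 / 3) powr (- b) + (2 * \<kappa>) powr s * \<kappa> powr (1/2)"
  have C0: "C \<ge> 0" by (simp add: C_def)
  have "(min x (min y z)) powr (- s) * (max x z / min x z) powr (1/2) * (l0 * l1 * l2) powr (- b)
    \<le> C * ((x powr (-(s + 2 * b)) + y powr (-(s + 2 * b)) + z powr (-(s + 2 * b)))
          * (l0 powr (- 2 * b) + l1 powr (- 2 * b) + l2 powr (- 2 * b))
        + y powr (- (s - 2 * \<beta> + 2 * b)) * (l0 * l2) powr (- \<beta>))"
    if h: "1 \<le> x" "1 \<le> y" "1 \<le> z" "1 \<le> l0" "1 \<le> l1" "1 \<le> l2" "y \<le> x + z"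
      "max x z > \<kappa> * min x z \<longrightarrow> l0 + l1 + l2 \<ge> c1 * (max x z)\<^sup>2" for x y z l0 l1 l2
  proof -
    define m M n where "m = min x (min y z)" and "M = max x z" and "n = min x z"
    define E where "E = x powr (-(s + 2 * b)) + y powr (-(s + 2 * b)) + z powr (-(s + 2 * b))"
    define F where "F = l0 powr (- 2 * b) + l1 powr (- 2 * b) + l2 powr (- 2 * b)"
    define S where "S = y powr (- (s - 2 * \<beta> + 2 * b)) * (l0 * l2) powr (- \<beta>)"
    have pos: "E \<ge> 0" "F \<ge> 0" "S \<ge> 0" by (auto simp: E_def F_def S_def)
    have m1: "m \<ge> 1" "n \<ge> 1" "M \<ge> 1" "m \<le> n" "n \<le> M" "m \<le> y" using h by (auto simp: m_def n_def M_def)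
    have ys: "y \<le> 2 * M" using h(7) by (auto simp: M_def)
    have Em: "m powr (-(s + 2 * b)) \<le> E" "y powr (-(s + 2 * b)) \<le> E"
      unfolding E_def m_def by (auto simp: min_def add_increasing add_increasing2)
    have "m powr (- s) * (M / n) powr (1/2) * (l0 * l1 * l2) powr (- b) \<le> C * (E * F + S)"
    proof (cases "M > \<kappa> * n")
      case True
      \<comment> \<open>The product of the modulations is at least L l^2: the largest one feels the
        resonance, and the smallest one is kept with exponent 2 b, which one of the three summands
        of \<open>F\<close> covers.\<close>
      define L l where "L = max l0 (max l1 l2)" and "l = min l0 (min l1 l2)"
      have l1: "l \<ge> 1" "L \<ge> 1" using h by (auto simp: l_def L_def)
      have "c1 * M\<^sup>2 \<le> l0 + l1 + l2" using h(8) True by (simp add: M_def n_def)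
      also have "\<dots> \<le> 3 * L" by (simp add: L_def)
      finally have LM: "c1 / 3 * M\<^sup>2 \<le> L" by simp
      have "L * (l * l) \<le> l0 * l1 * l2"
      proof -
        have l: "l \<le> l0" "l \<le> l1" "l \<le> l2" by (auto simp: l_def)
        have *: "l * l \<le> a * b" if "l \<le> a" "l \<le> b" for a b
          using that l1 by (intro mult_mono) auto
        consider "L = l0" | "L = l1" | "L = l2" unfolding L_def by linarith
        then show ?thesis
        proof cases
          case 1 then show ?thesis using mult_left_mono[OF *[OF l(2,3)], of L] l1 by (simp add: mult_ac)
        next
          case 2 then show ?thesis using mult_left_mono[OF *[OF l(1,3)], of L] l1 by (simp add: mult_ac)
        next
          case 3 then show ?thesis using mult_left_mono[OF *[OF l(1,2)], of L] l1 by (simp add: mult_ac)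
        qed
      qed
      then have "(l0 * l1 * l2) powr (- b) \<le> (L * (l * l)) powr (- b)"
        using b l1 by (intro powr_mono2') auto
      also have "\<dots> = L powr (- b) * l powr (- 2 * b)"
        using l1 by (simp add: powr_mult flip: powr_add)
      also have "L powr (- b) \<le> (c1 / 3 * M\<^sup>2) powr (- b)"
        using LM b c1 m1 by (intro powr_mono2') auto
      also have "\<dots> = (c1 / 3) powr (- b) * M powr (- 2 * b)"
        by (subst powr_mult) (use m1 c1 in \<open>auto simp: square_powr\<close>)
      finally have lb: "(l0 * l1 * l2) powr (- b) \<le> (c1 / 3) powr (- b) * M powr (- 2 * b) * l powr (- 2 * b)"
        by (simp add: mult_right_mono)
      \<comment> \<open>Since 2 b > 1/2, the total exponent of M is negative, so M may be lowered to
        m; the ratio factor is thereby absorbed.\<close>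
      have "(M / n) powr (1/2) * M powr (- 2 * b) = M powr (1/2 - 2 * b) * n powr (- (1/2))"
        using m1 by (simp add: powr_divide powr_minus field_simps flip: powr_add)
      also have "\<dots> \<le> m powr (1/2 - 2 * b) * m powr (- (1/2))"
        using m1 b by (intro mult_mono powr_mono2') auto
      also have "\<dots> = m powr (- 2 * b)" using m1 by (simp flip: powr_add)
      finally have rb: "(M / n) powr (1/2) * M powr (- 2 * b) \<le> m powr (- 2 * b)" .
      have "m powr (- s) * (M / n) powr (1/2) * (l0 * l1 * l2) powr (- b)
          \<le> m powr (- s) * (M / n) powr (1/2) * ((c1 / 3) powr (- b) * M powr (- 2 * b) * l powr (- 2 * b))"
        by (intro mult_left_mono lb) auto
      also have "\<dots> = (c1 / 3) powr (- b) * (m powr (- s) * ((M / n) powr (1/2) * M powr (- 2 * b))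
          * l powr (- 2 * b))"
        by (simp add: mult_ac)
      also have "\<dots> \<le> (c1 / 3) powr (- b) * (m powr (- s) * m powr (- 2 * b) * l powr (- 2 * b))"
        by (intro mult_left_mono mult_right_mono rb) auto
      also have "\<dots> = (c1 / 3) powr (- b) * (m powr (-(s + 2 * b)) * l powr (- 2 * b))"
        by (simp flip: powr_add)
      also have "\<dots> \<le> C * (E * F)"
      proof (intro mult_mono Em)
        show "l powr (- 2 * b) \<le> F" unfolding F_def l_def by (auto simp: min_def add_increasing add_increasing2)
      qed (auto simp: C_def pos)
      also have "\<dots> \<le> C * (E * F + S)" using C0 pos by (intro mult_left_mono) auto
      finally show ?thesis .
    next
      case False
      \<comment> \<open>For comparable x and z the triangle inequality gives y \<le> 2 M \<le> 2
        \<kappa> n, so all powers of m become powers of y.\<close>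
      have "y / (2 * \<kappa>) \<le> m"
      proof -
        have "y \<le> 2 * (\<kappa> * n)" using ys False by linarith
        then have "y / (2 * \<kappa>) \<le> n" using \<kappa> by (simp add: field_simps)
        moreover have "y / (2 * \<kappa>) \<le> y / 1" using \<kappa> h by (intro divide_left_mono) auto
        ultimately show ?thesis by (auto simp: m_def n_def)
      qed
      then have "m powr (- s) \<le> (y / (2 * \<kappa>)) powr (- s)"
        using s h \<kappa> by (intro powr_mono2') auto
      also have "\<dots> = (2 * \<kappa>) powr s * y powr (- s)"
        using h \<kappa> by (simp add: powr_divide powr_minus field_simps)
      finally have ms: "m powr (- s) \<le> (2 * \<kappa>) powr s * y powr (- s)" .
      have "M / n \<le> \<kappa>" using False m1 by (simp add: field_simps)
      then have rho: "(M / n) powr (1/2) \<le> \<kappa> powr (1/2)" using m1 by (intro powr_mono2) auto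
      have "m powr (- s) * (M / n) powr (1/2) \<le> ((2 * \<kappa>) powr s * y powr (- s)) * \<kappa> powr (1/2)"
        by (intro mult_mono ms rho) auto
      also have "\<dots> \<le> C * y powr (- s)" by (simp add: C_def algebra_simps)
      finally have base: "m powr (- s) * (M / n) powr (1/2) \<le> C * y powr (- s)" .
      have "y powr (- s) * (l0 * l1 * l2) powr (- b) \<le> E * F + S"
      proof (cases "l0 * l2 \<ge> y\<^sup>2 * l1")
        case True
        have "y\<^sup>2 * l1 * l1 \<le> l0 * l2 * l1" using True h by (intro mult_right_mono) auto
        then have "y\<^sup>2 * (l1 * l1) \<le> l0 * l1 * l2" by (simp add: mult_ac)
        then have "(l0 * l1 * l2) powr (- b) \<le> (y\<^sup>2 * (l1 * l1)) powr (- b)"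
          using b h by (intro powr_mono2') auto
        also have "\<dots> = y powr (- 2 * b) * l1 powr (- 2 * b)"
          using h by (simp add: powr_mult square_powr flip: powr_add)
        finally have "y powr (- s) * (l0 * l1 * l2) powr (- b)
            \<le> y powr (- s) * (y powr (- 2 * b) * l1 powr (- 2 * b))"
          by (intro mult_left_mono) auto
        also have "\<dots> = y powr (-(s + 2 * b)) * l1 powr (- 2 * b)"
          by (simp add: mult.assoc[symmetric] flip: powr_add)
        also have "\<dots> \<le> E * F"
          by (intro mult_mono Em) (auto simp: F_def pos)
        finally show ?thesis using pos by linarith
      next
        case False
        have l02: "l0 * l2 \<ge> 1" using h mult_mono[of 1 l0 1 l2] by auto
        have "(l0 * l1 * l2) powr (- b) = (l0 * l2) powr (- \<beta>) * ((l0 * l2) powr (\<beta> - b) * l1 powr (- b))"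
          using h by (simp add: powr_mult mult_ac powr_diff powr_minus field_simps)
        also have "\<dots> \<le> (l0 * l2) powr (- \<beta>) * ((y\<^sup>2 * l1) powr (\<beta> - b) * l1 powr (- b))"
          using False h \<beta> by (intro mult_left_mono mult_right_mono powr_mono2) auto
        also have "(y\<^sup>2 * l1) powr (\<beta> - b) * l1 powr (- b) = y powr (2 * (\<beta> - b)) * l1 powr (\<beta> - 2 * b)"
          using h by (simp add: powr_mult square_powr mult.assoc flip: powr_add)
        also have "\<dots> \<le> y powr (2 * (\<beta> - b)) * 1"
          using powr_mono[of "\<beta> - 2 * b" 0 l1] \<beta> h by (intro mult_left_mono) auto
        finally have "(l0 * l1 * l2) powr (- b) \<le> (l0 * l2) powr (- \<beta>) * y powr (2 * (\<beta> - b))"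
          by (simp add: mult_left_mono)
        then have "y powr (- s) * (l0 * l1 * l2) powr (- b)
            \<le> y powr (- s) * ((l0 * l2) powr (- \<beta>) * y powr (2 * (\<beta> - b)))"
          by (intro mult_left_mono) auto
        also have "\<dots> = S"
          by (simp add: S_def mult_ac flip: powr_add) (simp add: algebra_simps)
        finally show ?thesis using pos by (smt (verit) mult_nonneg_nonneg)
      qed
      then have "C * (y powr (- s) * (l0 * l1 * l2) powr (- b)) \<le> C * (E * F + S)"
        using C0 by (intro mult_left_mono) auto
      moreover have "m powr (- s) * (M / n) powr (1/2) * (l0 * l1 * l2) powr (- b)
          \<le> C * y powr (- s) * (l0 * l1 * l2) powr (- b)"
        by (intro mult_right_mono base) auto
      ultimately show ?thesis by (simp add: mult.assoc)
    qed
    then show ?thesis unfolding m_def M_def n_def E_def F_def S_def .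
  qed
  then show ?thesis using C0 by (intro exI[of _ C]) auto
qed

text \<open>It bounds the quotient of the output derivative weight by the input weights, with y the
  wave bracket and x, z the Schroedinger brackets. The lowest frequency gives decay of order s, and
  the square root of max / min is the cost of the half derivative by which the two scales differ.
  Symmetry in x and z lets one weight serve both kinds of output.\<close>

definition freq_weight :: "real \<Rightarrow> real \<Rightarrow> real \<Rightarrow> real \<Rightarrow> real" where
  "freq_weight s x y z = (min x (min y z)) powr (- s) * (max x z / min x z) powr (1/2)"

lemma freq_weight_swap: "freq_weight s x y z = freq_weight s z y x"
  by (simp add: freq_weight_def min.commute max.commute min.left_commute)

lemma mult_min_le:
  fixes x y z :: real
  assumes "1 \<le> x" "1 \<le> y" "1 \<le> z" "x \<le> y + z"
  shows "x * min x (min y z) \<le> 2 * (y * z)"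
proof -
  have "x * min x (min y z) \<le> (2 * max y z) * min y z"
    using assms by (intro mult_mono) auto
  also have "\<dots> = 2 * (y * z)" by (simp add: max_def min_def)
  finally show ?thesis .
qed

text \<open>Lowering s to s0 loses the power s - s0 of the smallest bracket only, so any factor
  whose bracket is not smaller can pay for it.\<close>

lemma freq_weight_raise:
  assumes "1 \<le> x" "1 \<le> y" "1 \<le> z" "min x (min y z) \<le> q" "s0 \<le> s"
  shows "freq_weight s0 x y z \<le> freq_weight s x y z * q powr (s - s0)"
proof -
  define m where "m = min x (min y z)"
  have m: "1 \<le> m" "m \<le> q" using assms by (auto simp: m_def)
  have "m powr (- s0) = m powr (- s) * m powr (s - s0)" using m by (simp flip: powr_add)
  also have "\<dots> \<le> m powr (- s) * q powr (s - s0)"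
    using m assms by (intro mult_left_mono powr_mono2) auto
  finally have "m powr (- s0) * (max x z / min x z) powr (1/2)
      \<le> (m powr (- s) * q powr (s - s0)) * (max x z / min x z) powr (1/2)"
    by (intro mult_right_mono) auto
  then show ?thesis by (simp add: freq_weight_def m_def mult_ac)
qed

text \<open>The s derivatives follow from x m \<le> 2 y z, since the larger of y and z is at least x
  / 2. The half derivative follows from x n \<le> M z, because x and z lie between n and M.\<close>

lemma freq_weight_Schroedinger:
  assumes "1 \<le> x" "1 \<le> y" "1 \<le> z" "x \<le> y + z" "s \<ge> 0"
  shows "x powr (s + 1/2) \<le> 2 powr s * freq_weight s x y z * (y powr s * z powr (s + 1/2))"
proof -
  define m M n where "m = min x (min y z)" and "M = max x z" and "n = min x z"
  have m: "m > 0" "M > 0" "n > 0" using assms by (auto simp: m_def M_def n_def)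
  have "(x * m) powr s \<le> (2 * (y * z)) powr s"
    using mult_min_le[OF assms(1-4)] assms m by (intro powr_mono2) (auto simp: m_def)
  then have 1: "x powr s * m powr s \<le> 2 powr s * (y powr s * z powr s)"
    using assms m by (simp add: powr_mult)
  have "(x * n) powr (1/2) \<le> (M * z) powr (1/2)"
    using assms by (intro powr_mono2 mult_mono) (auto simp: M_def n_def)
  then have 2: "x powr (1/2) * n powr (1/2) \<le> M powr (1/2) * z powr (1/2)"
    using assms m by (simp add: powr_mult)
  have "(x powr s * m powr s) * (x powr (1/2) * n powr (1/2))
      \<le> (2 powr s * (y powr s * z powr s)) * (M powr (1/2) * z powr (1/2))"
    by (intro mult_mono 1 2) auto
  then have 3: "x powr (s + 1/2) * (m powr s * n powr (1/2))
      \<le> 2 powr s * M powr (1/2) * (y powr s * z powr (s + 1/2))"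
    by (simp add: powr_add mult_ac)
  have fw: "freq_weight s x y z = M powr (1/2) / (m powr s * n powr (1/2))"
  proof -
    have "freq_weight s x y z = m powr (- s) * (M / n) powr (1/2)"
      by (simp only: freq_weight_def m_def M_def n_def)
    also have "\<dots> = inverse (m powr s) * (M powr (1/2) * inverse (n powr (1/2)))"
    proof -
      have "(M / n) powr (1/2) = M powr (1/2) / n powr (1/2)" by (rule powr_divide)
      then show ?thesis by (simp only: powr_minus divide_inverse)
    qed
    also have "\<dots> = M powr (1/2) / (m powr s * n powr (1/2))"
      by (simp only: divide_inverse inverse_mult_distrib mult_ac)
    finally show ?thesis .
  qed
  have "m powr s * n powr (1/2) > 0" using m by simp
  then show ?thesis unfolding fw using 3 by (simp only: times_divide_eq_right times_divide_eq_left
      pos_le_divide_eq)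
qed

text \<open>The extra full derivative is shared: y \<le> 2 M, and the square roots of x and z
  multiply to those of M and n. The product is short of M by exactly the ratio factor of
  \<open>freq_weight\<close>.\<close>

lemma freq_weight_wave:
  assumes "1 \<le> x" "1 \<le> y" "1 \<le> z" "y \<le> x + z" "s \<ge> 0"
  shows "y powr (s + 1) \<le> 2 powr (s + 1) * freq_weight s x y z * (x powr (s + 1/2) * z powr (s + 1/2))"
proof -
  define m M n where "m = min x (min y z)" and "M = max x z" and "n = min x z"
  have m: "m > 0" "M > 0" "n > 0" using assms by (auto simp: m_def M_def n_def)
  have "y * m \<le> 2 * (x * z)"
    using mult_min_le[of y x z] assms by (simp add: m_def min.left_commute)
  then have "(y * m) powr s \<le> (2 * (x * z)) powr s"
    using assms m by (intro powr_mono2) auto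
  then have 1: "y powr s * m powr s \<le> 2 powr s * (x powr s * z powr s)"
    using assms m by (simp add: powr_mult)
  have xz: "x powr (1/2) * z powr (1/2) = M powr (1/2) * n powr (1/2)"
    by (simp add: M_def n_def max_def min_def mult.commute)
  have "M powr (1/2) * M powr (1/2) = M" using m by (simp flip: powr_add)
  moreover have "y \<le> 2 * M" using assms by (auto simp: M_def)
  ultimately have 2: "y * n powr (1/2) \<le> 2 * (M powr (1/2) * (x powr (1/2) * z powr (1/2)))"
    unfolding xz by (simp add: mult.assoc[symmetric] mult_right_mono)
  have "(y powr s * m powr s) * (y * n powr (1/2))
      \<le> (2 powr s * (x powr s * z powr s)) * (2 * (M powr (1/2) * (x powr (1/2) * z powr (1/2))))"
    using assms by (intro mult_mono 1 2) auto
  then have 3: "y powr (s + 1) * (m powr s * n powr (1/2))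
      \<le> 2 powr (s + 1) * M powr (1/2) * (x powr (s + 1/2) * z powr (s + 1/2))"
    using assms by (simp add: powr_add mult_ac)
  have fw: "freq_weight s x y z = M powr (1/2) / (m powr s * n powr (1/2))"
  proof -
    have "freq_weight s x y z = m powr (- s) * (M / n) powr (1/2)"
      by (simp only: freq_weight_def m_def M_def n_def)
    also have "\<dots> = inverse (m powr s) * (M powr (1/2) * inverse (n powr (1/2)))"
    proof -
      have "(M / n) powr (1/2) = M powr (1/2) / n powr (1/2)" by (rule powr_divide)
      then show ?thesis by (simp only: powr_minus divide_inverse)
    qed
    also have "\<dots> = M powr (1/2) / (m powr s * n powr (1/2))"
      by (simp only: divide_inverse inverse_mult_distrib mult_ac)
    finally show ?thesis .
  qed
  have "m powr s * n powr (1/2) > 0" using m by simp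
  then show ?thesis unfolding fw using 3 by (simp only: times_divide_eq_right times_divide_eq_left
      pos_le_divide_eq)
qed

section \<open>The trilinear estimate\<close>

lemma ennreal_le_of_square_le:
  fixes a b :: ennreal
  assumes "a\<^sup>2 \<le> b\<^sup>2"
  shows "a \<le> b"
proof (cases b)
  case b: (real r)
  show ?thesis
  proof (cases a)
    case a: (real q)
    have "q\<^sup>2 \<le> r\<^sup>2" using assms a b by (simp add: ennreal_power)
    from power2_le_imp_le[OF this b(1)] have "q \<le> r" .
    then show ?thesis using a b by (simp add: ennreal_leI)
  next
    case top
    then show ?thesis using assms b by (simp add: ennreal_power top_unique)
  qed
qed simp

lemma ennreal_sqrt_square: "(ennreal_sqrt x)\<^sup>2 = x"
  by (cases x) (auto simp: ennreal_sqrt_def ennreal_power)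

lemma le_ennreal_sqrt: "x\<^sup>2 \<le> y \<Longrightarrow> x \<le> ennreal_sqrt y"
  by (rule ennreal_le_of_square_le) (simp add: ennreal_sqrt_square)

lemma sum_square_le:
  fixes x :: "'i \<Rightarrow> ennreal"
  assumes I: "finite I" and x: "\<And>i. i \<in> I \<Longrightarrow> (x i)\<^sup>2 \<le> D"
  shows "(\<Sum>i\<in>I. x i)\<^sup>2 \<le> (of_nat (card I))\<^sup>2 * D"
proof -
  have "(\<Sum>i\<in>I. x i) \<le> of_nat (card I) * ennreal_sqrt D"
    using x by (intro sum_bounded_above le_ennreal_sqrt) auto
  then have "(\<Sum>i\<in>I. x i)\<^sup>2 \<le> (of_nat (card I) * ennreal_sqrt D)\<^sup>2" by (rule power_mono) simp
  then show ?thesis by (simp add: power_mult_distrib ennreal_sqrt_square)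
qed

text \<open>Chooses which of the three variables carries a weight, so that all nine products of a
  frequency weight and a modulation weight are instances of one lemma.\<close>

definition pick :: "nat \<Rightarrow> 'a \<Rightarrow> 'a \<Rightarrow> 'a \<Rightarrow> 'a" where
  "pick j a b c = (if j = 0 then a else if j = 1 then b else c)"

lemma (in conv_measure) trilinear_pick:
  assumes "periodic l0" "periodic l1" "periodic l2" "periodic u" "periodic v" "periodic w"
    and "(\<integral>\<^sup>+x. (l0 x)\<^sup>2 \<partial>M) \<le> A" "(\<integral>\<^sup>+x. (l1 x)\<^sup>2 \<partial>M) \<le> A" "(\<integral>\<^sup>+x. (l2 x)\<^sup>2 \<partial>M) \<le> A"
  shows "(\<integral>\<^sup>+x. \<integral>\<^sup>+y. pick j (l0 x) (l1 (x - y)) (l2 y) * u x * v (x - y) * w y \<partial>M \<partial>M)\<^sup>2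
    \<le> A * (\<integral>\<^sup>+x. (u x)\<^sup>2 \<partial>M) * (\<integral>\<^sup>+x. (v x)\<^sup>2 \<partial>M) * (\<integral>\<^sup>+x. (w x)\<^sup>2 \<partial>M)"
proof -
  have *: "a * p * q * r \<le> A * p * q * r" if "a \<le> A" for a p q r :: ennreal
    using that by (intro mult_right_mono) auto
  consider "j = 0" | "j = 1" | "j \<noteq> 0 \<and> j \<noteq> 1" by auto
  then show ?thesis
  proof cases
    case 1
    then show ?thesis using order_trans[OF trilinear_0[OF assms(1,4,5,6)] *[OF assms(7)]]
        by (simp add: pick_def)
  next
    case 2
    then show ?thesis using order_trans[OF trilinear_1[OF assms(2,4,5,6)] *[OF assms(8)]]
        by (simp add: pick_def)
  next
    case 3
    then show ?thesis using order_trans[OF trilinear_2[OF assms(3,4,5,6)] *[OF assms(9)]]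
        by (simp add: pick_def)
  qed
qed

abbreviation freq_time_measure :: "real \<Rightarrow> ((int ^ 'd) \<times> real) measure" where
  "freq_time_measure \<tau> \<equiv> count_space UNIV \<Otimes>\<^sub>M time_measure \<tau>"

lemma conv_measure_freq_time_measure:
  "\<tau> > 0 \<Longrightarrow> conv_measure (freq_time_measure \<tau> :: ((int ^ 'd::finite) \<times> real) measure) {(0, 2 * pi / \<tau>)}"
  using conv_measure_pair[OF conv_measure_count_space[where 'a = "int ^ 'd"] conv_measure_time_measure, of \<tau>]
  by simp

abbreviation freq_time_periodic :: "real \<Rightarrow> ((int ^ 'd::finite) \<times> real \<Rightarrow> ennreal) \<Rightarrow> bool" where
  "freq_time_periodic \<tau> \<equiv> conv_measure.periodic (freq_time_measure \<tau>) {(0, 2 * pi / \<tau>)}"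

lemma measurable_freq_time_section:
  assumes "f \<in> borel_measurable (freq_time_measure \<tau>)"
  shows "(\<lambda>\<sigma>. f (k, \<sigma>)) \<in> borel_measurable borel"
proof -
  have "(\<lambda>\<sigma>. (k, \<sigma>)) \<in> time_measure \<tau> \<rightarrow>\<^sub>M freq_time_measure \<tau>" by measurable
  from measurable_compose[OF this assms] show ?thesis
    by (simp add: measurable_cong_sets[OF sets_time_measure refl])
qed

lemma freq_time_periodic_iff:
  assumes "\<tau> > 0"
  shows "freq_time_periodic \<tau> f \<longleftrightarrow>
    f \<in> borel_measurable (freq_time_measure \<tau>) \<and> (\<forall>k \<sigma>. f (k, \<sigma> + 2 * pi / \<tau>) = f (k, \<sigma>))"
  unfolding conv_measure.periodic_def[OF conv_measure_freq_time_measure[OF assms]] by auto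

lemma nn_integral_freq_time:
  assumes "\<tau> > 0" "f \<in> borel_measurable (freq_time_measure \<tau>)"
  shows "(\<integral>\<^sup>+p. f p \<partial>freq_time_measure \<tau>) = (\<integral>\<^sup>+k. \<integral>\<^sup>+\<sigma>. f (k, \<sigma>) \<partial>time_measure \<tau> \<partial>count_space (UNIV ::
      (int ^ 'd::finite) set))"
proof -
  interpret T: conv_measure "time_measure \<tau>" "{2 * pi / \<tau>}" by (rule conv_measure_time_measure) fact
  show ?thesis using T.nn_integral_fst[OF assms(2)] by simp
qed

text \<open>The modulation factor is handled by Cauchy-Schwarz in time at fixed frequencies, and the
  frequency factor then by Cauchy-Schwarz over the lattice.\<close>

lemma trilinear_freq_time_pick:
  fixes a :: "int ^ 'd::finite \<Rightarrow> ennreal" and \<phi>0 \<phi>1 \<phi>2 :: "int ^ 'd \<Rightarrow> real"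
  assumes \<tau>: "\<tau> > 0" and per: "freq_time_periodic \<tau> U" "freq_time_periodic \<tau> V" "freq_time_periodic \<tau> W"
    and L: "conv_measure.periodic (time_measure \<tau>) {2 * pi / \<tau>} L" "(\<integral>\<^sup>+\<sigma>. (L \<sigma>)\<^sup>2 \<partial>time_measure \<tau>) \<le> D"
    and a: "(\<integral>\<^sup>+k. (a k)\<^sup>2 \<partial>count_space UNIV) \<le> A"
  shows "(\<integral>\<^sup>+x. \<integral>\<^sup>+y. (pick j (a (fst x)) (a (fst (x - y))) (a (fst y))
      * pick l (L (snd x + \<phi>0 (fst x))) (L (snd (x - y) + \<phi>1 (fst (x - y)))) (L (snd y + \<phi>2 (fst y))))
      * U x * V (x - y) * W y \<partial>freq_time_measure \<tau> \<partial>freq_time_measure \<tau>)\<^sup>2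
    \<le> D * A * (\<integral>\<^sup>+x. (U x)\<^sup>2 \<partial>freq_time_measure \<tau>) * (\<integral>\<^sup>+x. (V x)\<^sup>2 \<partial>freq_time_measure \<tau>)
        * (\<integral>\<^sup>+x. (W x)\<^sup>2 \<partial>freq_time_measure \<tau>)"
proof -
  interpret T: conv_measure "time_measure \<tau>" "{2 * pi / \<tau>}" by (rule conv_measure_time_measure) fact
  interpret K: conv_measure "count_space (UNIV :: (int ^ 'd) set)" "{}" by (rule conv_measure_count_space)
  interpret N: conv_measure "freq_time_measure \<tau> :: ((int ^ 'd) \<times> real) measure" "{(0, 2 * pi / \<tau>)}"
    by (rule conv_measure_freq_time_measure) fact
  note [measurable] = per[THEN N.periodic_measurable]
  note L' = L(1)
  note [measurable] = T.periodic_measurable[OF L']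
  have Lb [measurable]: "L \<in> borel_measurable borel"
    using T.periodic_measurable[OF L'] by (simp add: measurable_cong_sets[OF sets_time_measure refl])
  have sec: "T.periodic (\<lambda>\<sigma>. U (k, \<sigma>))" "T.periodic (\<lambda>\<sigma>. V (k, \<sigma>))" "T.periodic (\<lambda>\<sigma>. W (k, \<sigma>))" for k
    using per measurable_freq_time_section[OF per(1)[THEN N.periodic_measurable], of k]
      measurable_freq_time_section[OF per(2)[THEN N.periodic_measurable], of k]
      measurable_freq_time_section[OF per(3)[THEN N.periodic_measurable], of k]
    by (auto simp: freq_time_periodic_iff[OF \<tau>] T.periodic_def measurable_cong_sets[OF sets_time_measure refl])
  define q where "q = (\<lambda>F :: (int ^ 'd) \<times> real \<Rightarrow> ennreal. \<lambda>k. \<integral>\<^sup>+\<sigma>. (F (k, \<sigma>))\<^sup>2 \<partial>time_measure \<tau>)"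
  \<comment> \<open>The time integral at frozen frequencies. The wave and Schroedinger phases only
    translate the modulation weights, which does not change their integrals over a period.\<close>
  define t where "t = (\<lambda>k0 k2. \<integral>\<^sup>+\<sigma>0. \<integral>\<^sup>+\<sigma>2. pick l (L (\<sigma>0 + \<phi>0 k0)) (L (\<sigma>0 - \<sigma>2
      + \<phi>1 (k0 - k2))) (L (\<sigma>2 + \<phi>2 k2))
      * U (k0, \<sigma>0) * V (k0 - k2, \<sigma>0 - \<sigma>2) * W (k2, \<sigma>2) \<partial>time_measure \<tau> \<partial>time_measure \<tau>)"
  have shiftL: "T.periodic (\<lambda>\<sigma>. L (\<sigma> + x))" "(\<integral>\<^sup>+\<sigma>. (L (\<sigma> + x))\<^sup>2 \<partial>time_measure \<tau>) \<le> D" for x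
    using L(2) T.integral_add[OF T.periodic_power[OF L', of 2], of x] by (auto intro: T.periodic_add[OF L'])
  have t: "(t k0 k2)\<^sup>2 \<le> D * q U k0 * q V (k0 - k2) * q W k2" for k0 k2
    unfolding t_def q_def
    using T.trilinear_pick[OF shiftL(1)[of "\<phi>0 k0"] shiftL(1)[of "\<phi>1 (k0 - k2)"] shiftL(1)[of "\<phi>2 k2"]
      sec(1)[of k0] sec(2)[of "k0 - k2"] sec(3)[of k2] shiftL(2) shiftL(2) shiftL(2), of l] by simp
  define r where "r = (\<lambda>F k. ennreal_sqrt (q F k))"
  have t': "t k0 k2 \<le> ennreal_sqrt D * r U k0 * r V (k0 - k2) * r W k2" for k0 k2
    by (rule ennreal_le_of_square_le) (use t[of k0 k2] in \<open>simp add: r_def power_mult_distrib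
        ennreal_sqrt_square\<close>)
  have mpick: "(\<lambda>p. pick l (f p) (g p) (h p)) \<in> borel_measurable R"
    if "f \<in> borel_measurable R" "g \<in> borel_measurable R" "h \<in> borel_measurable R"
    for f g h :: "'x \<Rightarrow> ennreal" and R :: "'x measure"
    using that by (simp add: pick_def)
  have "(\<integral>\<^sup>+x. \<integral>\<^sup>+y. (pick j (a (fst x)) (a (fst (x - y))) (a (fst y))
      * pick l (L (snd x + \<phi>0 (fst x))) (L (snd (x - y) + \<phi>1 (fst (x - y)))) (L (snd y + \<phi>2 (fst y))))
      * U x * V (x - y) * W y \<partial>freq_time_measure \<tau> \<partial>freq_time_measure \<tau>)
    = (\<integral>\<^sup>+k0. \<integral>\<^sup>+\<sigma>0. \<integral>\<^sup>+k2. \<integral>\<^sup>+\<sigma>2. (pick j (a k0) (a (k0 - k2)) (a k2)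
      * pick l (L (\<sigma>0 + \<phi>0 k0)) (L (\<sigma>0 - \<sigma>2 + \<phi>1 (k0 - k2))) (L (\<sigma>2 + \<phi>2 k2)))
      * U (k0, \<sigma>0) * V (k0 - k2, \<sigma>0 - \<sigma>2) * W (k2, \<sigma>2) \<partial>time_measure \<tau> \<partial>count_space UNIV \<partial>time_measure \<tau>
          \<partial>count_space UNIV)"
  proof -
    define G where "G = (\<lambda>x y. (pick j (a (fst x)) (a (fst (x - y))) (a (fst y))
      * pick l (L (snd x + \<phi>0 (fst x))) (L (snd (x - y) + \<phi>1 (fst (x - y)))) (L (snd y + \<phi>2 (fst y))))
      * U x * V (x - y) * W y)"
    have mj: "(\<lambda>p. pick j (a (fst (fst p))) (a (fst (fst p - snd p))) (a (fst (snd p))))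
        \<in> borel_measurable (freq_time_measure \<tau> \<Otimes>\<^sub>M freq_time_measure \<tau>)"
    proof -
      have "(\<lambda>p. fst (fst p - snd p)) \<in> freq_time_measure \<tau> \<Otimes>\<^sub>M freq_time_measure \<tau> \<rightarrow>\<^sub>M count_space
          (UNIV :: (int ^ 'd) set)"
        by measurable
      then show ?thesis unfolding pick_def by measurable
    qed
    have ml: "(\<lambda>p. pick l (L (snd (fst p) + \<phi>0 (fst (fst p)))) (L (snd (fst p - snd p)
        + \<phi>1 (fst (fst p - snd p)))) (L (snd (snd p) + \<phi>2 (fst (snd p)))))
        \<in> borel_measurable (freq_time_measure \<tau> \<Otimes>\<^sub>M freq_time_measure \<tau>)"
    proof -
      have [measurable]: "(\<lambda>p. fst p - snd p) \<in> freq_time_measure \<tau> \<Otimes>\<^sub>M freq_time_measure \<tau> \<rightarrow>\<^sub>M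
          (freq_time_measure \<tau> :: ((int ^ 'd) \<times> real) measure)"
        by measurable
      have *: "(\<lambda>p. L (snd p + \<phi> (fst p))) \<in> borel_measurable (freq_time_measure \<tau>)" for \<phi> :: "int ^ 'd \<Rightarrow> real"
        by measurable
      show ?thesis
        using measurable_compose[OF measurable_fst *[of \<phi>0]] measurable_compose[OF _ *[of \<phi>1], of "\<lambda>p.
            fst p - snd p"]
          measurable_compose[OF measurable_snd *[of \<phi>2]]
        by (intro mpick) auto
    qed
    have G: "(\<lambda>p. G (fst p) (snd p)) \<in> borel_measurable (freq_time_measure \<tau> \<Otimes>\<^sub>M freq_time_measure \<tau>)"
      unfolding G_def using mj ml by measurable
    have Gs: "G x \<in> borel_measurable (freq_time_measure \<tau>)" for x
      using measurable_compose[OF _ G, of "\<lambda>y. (x, y)" "freq_time_measure \<tau>"] by (simp add: N.space_UNIV)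
    have Gi: "(\<lambda>x. \<integral>\<^sup>+y. G x y \<partial>freq_time_measure \<tau>) \<in> borel_measurable (freq_time_measure \<tau>)"
      using G by (intro N.borel_measurable_nn_integral) (simp add: split_beta')
    have "(\<integral>\<^sup>+x. \<integral>\<^sup>+y. G x y \<partial>freq_time_measure \<tau> \<partial>freq_time_measure \<tau>)
        = (\<integral>\<^sup>+k0. \<integral>\<^sup>+\<sigma>0. \<integral>\<^sup>+k2. \<integral>\<^sup>+\<sigma>2. G (k0, \<sigma>0) (k2, \<sigma>2) \<partial>time_measure \<tau> \<partial>count_space UNIV
            \<partial>time_measure \<tau> \<partial>count_space UNIV)"
      by (subst nn_integral_freq_time[OF \<tau> Gi], subst nn_integral_freq_time[OF \<tau> Gs]) simp
    then show ?thesis by (simp add: G_def)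
  qed
  also have "\<dots> = (\<integral>\<^sup>+k0. \<integral>\<^sup>+k2. pick j (a k0) (a (k0 - k2)) (a k2)
      * t k0 k2 \<partial>count_space UNIV \<partial>count_space UNIV)"
  proof (rule nn_integral_cong)
    fix k0 :: "int ^ 'd"
    define H where "H = (\<lambda>k2 \<sigma>0 \<sigma>2. pick l (L (\<sigma>0 + \<phi>0 k0)) (L (\<sigma>0 - \<sigma>2 + \<phi>1 (k0 - k2))) (L (\<sigma>2 + \<phi>2 k2))
      * U (k0, \<sigma>0) * V (k0 - k2, \<sigma>0 - \<sigma>2) * W (k2, \<sigma>2))"
    have H: "(\<lambda>(\<sigma>0, \<sigma>2). H k2 \<sigma>0 \<sigma>2) \<in> borel_measurable (time_measure \<tau> \<Otimes>\<^sub>M time_measure \<tau>)" for k2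
    proof -
      note [measurable] = sec(1)[THEN T.periodic_measurable, of k0] sec(2)[THEN T.periodic_measurable,
          of "k0 - k2"]
        sec(3)[THEN T.periodic_measurable, of k2] shiftL(1)[THEN T.periodic_measurable, of "\<phi>0 k0"]
        shiftL(1)[THEN T.periodic_measurable, of "\<phi>1 (k0 - k2)"] shiftL(1)[THEN T.periodic_measurable,
            of "\<phi>2 k2"]
      show ?thesis unfolding H_def pick_def by measurable
    qed
    have Hs: "H k2 \<sigma>0 \<in> borel_measurable (time_measure \<tau>)" for k2 \<sigma>0
      using measurable_compose[OF _ H[of k2], of "\<lambda>y. (\<sigma>0, y)" "time_measure \<tau>"] by simp
    have Hi: "(\<lambda>\<sigma>0. \<integral>\<^sup>+\<sigma>2. H k2 \<sigma>0 \<sigma>2 \<partial>time_measure \<tau>) \<in> borel_measurable (time_measure \<tau>)" for k2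
      by (rule T.borel_measurable_nn_integral[OF H])
    have "(\<integral>\<^sup>+\<sigma>0. \<integral>\<^sup>+k2. \<integral>\<^sup>+\<sigma>2. pick j (a k0) (a (k0 - k2)) (a k2)
        * H k2 \<sigma>0 \<sigma>2 \<partial>time_measure \<tau> \<partial>count_space UNIV \<partial>time_measure \<tau>)
        = (\<integral>\<^sup>+\<sigma>0. \<integral>\<^sup>+k2. pick j (a k0) (a (k0 - k2)) (a k2)
            * (\<integral>\<^sup>+\<sigma>2. H k2 \<sigma>0 \<sigma>2 \<partial>time_measure \<tau>) \<partial>count_space UNIV \<partial>time_measure \<tau>)"
      by (intro nn_integral_cong nn_integral_cmult Hs)
    also have "\<dots> = (\<integral>\<^sup>+k2. \<integral>\<^sup>+\<sigma>0. pick j (a k0) (a (k0 - k2)) (a k2)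
        * (\<integral>\<^sup>+\<sigma>2. H k2 \<sigma>0 \<sigma>2 \<partial>time_measure \<tau>) \<partial>time_measure \<tau> \<partial>count_space UNIV)"
      using Hi by (intro nn_integral_count_space_nn_integral) auto
    also have "\<dots> = (\<integral>\<^sup>+k2. pick j (a k0) (a (k0 - k2)) (a k2) * t k0 k2 \<partial>count_space UNIV)"
    proof (rule nn_integral_cong)
      fix k2
      have "t k0 k2 = (\<integral>\<^sup>+\<sigma>0. \<integral>\<^sup>+\<sigma>2. H k2 \<sigma>0 \<sigma>2 \<partial>time_measure \<tau> \<partial>time_measure \<tau>)"
        by (simp only: t_def H_def)
      then show "(\<integral>\<^sup>+\<sigma>0. pick j (a k0) (a (k0 - k2)) (a k2)
          * (\<integral>\<^sup>+\<sigma>2. H k2 \<sigma>0 \<sigma>2 \<partial>time_measure \<tau>) \<partial>time_measure \<tau>)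
          = pick j (a k0) (a (k0 - k2)) (a k2) * t k0 k2"
        by (simp only: nn_integral_cmult[OF Hi])
    qed
    finally show "(\<integral>\<^sup>+\<sigma>0. \<integral>\<^sup>+k2. \<integral>\<^sup>+\<sigma>2. (pick j (a k0) (a (k0 - k2)) (a k2)
      * pick l (L (\<sigma>0 + \<phi>0 k0)) (L (\<sigma>0 - \<sigma>2 + \<phi>1 (k0 - k2))) (L (\<sigma>2 + \<phi>2 k2)))
      * U (k0, \<sigma>0) * V (k0 - k2, \<sigma>0 - \<sigma>2) * W (k2, \<sigma>2) \<partial>time_measure \<tau> \<partial>count_space UNIV \<partial>time_measure \<tau>)
      = (\<integral>\<^sup>+k2. pick j (a k0) (a (k0 - k2)) (a k2) * t k0 k2 \<partial>count_space UNIV)"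
      by (simp add: H_def mult.assoc)
  qed
  \<comment> \<open>\<open>r\<close> is the norm in time at one frequency. What is left is the same
    trilinear form over the lattice, with the time constant absorbed into the frequency
    weight.\<close>
  also have "\<dots> \<le> (\<integral>\<^sup>+k0. \<integral>\<^sup>+k2. pick j (ennreal_sqrt D * a k0) (ennreal_sqrt D
      * a (k0 - k2)) (ennreal_sqrt D * a k2)
      * r U k0 * r V (k0 - k2) * r W k2 \<partial>count_space UNIV \<partial>count_space UNIV)"
  proof (intro nn_integral_mono)
    fix k0 k2
    have "pick j (a k0) (a (k0 - k2)) (a k2) * t k0 k2
        \<le> pick j (a k0) (a (k0 - k2)) (a k2) * (ennreal_sqrt D * r U k0 * r V (k0 - k2) * r W k2)"
      by (intro mult_left_mono t') auto
    also have "\<dots> = pick j (ennreal_sqrt D * a k0) (ennreal_sqrt D * a (k0 - k2)) (ennreal_sqrt D * a k2)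
      * r U k0 * r V (k0 - k2) * r W k2"
      by (simp add: pick_def mult_ac)
    finally show "pick j (a k0) (a (k0 - k2)) (a k2) * t k0 k2
      \<le> pick j (ennreal_sqrt D * a k0) (ennreal_sqrt D * a (k0 - k2)) (ennreal_sqrt D * a k2)
      * r U k0 * r V (k0 - k2) * r W k2" .
  qed
  finally have le: "(\<integral>\<^sup>+x. \<integral>\<^sup>+y. (pick j (a (fst x)) (a (fst (x - y))) (a (fst y))
      * pick l (L (snd x + \<phi>0 (fst x))) (L (snd (x - y) + \<phi>1 (fst (x - y)))) (L (snd y + \<phi>2 (fst y))))
      * U x * V (x - y) * W y \<partial>freq_time_measure \<tau> \<partial>freq_time_measure \<tau>)
    \<le> (\<integral>\<^sup>+k0. \<integral>\<^sup>+k2. pick j (ennreal_sqrt D * a k0) (ennreal_sqrt D * a (k0 - k2)) (ennreal_sqrt D * a k2)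
      * r U k0 * r V (k0 - k2) * r W k2 \<partial>count_space UNIV \<partial>count_space UNIV)" .
  have A: "(\<integral>\<^sup>+k. (ennreal_sqrt D * a k)\<^sup>2 \<partial>count_space UNIV) \<le> D * A"
    using a by (simp add: power_mult_distrib ennreal_sqrt_square nn_integral_cmult mult_left_mono)
  have Kp: "K.periodic f" for f by (simp add: K.periodic_def)
  have qI: "(\<integral>\<^sup>+k. (r F k)\<^sup>2 \<partial>count_space UNIV) = (\<integral>\<^sup>+x. (F x)\<^sup>2 \<partial>freq_time_measure \<tau>)"
    if "F \<in> borel_measurable (freq_time_measure \<tau>)" for F
    using that by (subst nn_integral_freq_time[OF \<tau>]) (auto simp: r_def ennreal_sqrt_square q_def)
  have "(\<integral>\<^sup>+k0. \<integral>\<^sup>+k2. pick j (ennreal_sqrt D * a k0) (ennreal_sqrt D * a (k0 - k2)) (ennreal_sqrt D * a k2)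
      * r U k0 * r V (k0 - k2) * r W k2 \<partial>count_space UNIV \<partial>count_space UNIV)\<^sup>2
    \<le> D * A * (\<integral>\<^sup>+k. (r U k)\<^sup>2 \<partial>count_space UNIV) * (\<integral>\<^sup>+k. (r V k)\<^sup>2 \<partial>count_space UNIV)
        * (\<integral>\<^sup>+k. (r W k)\<^sup>2 \<partial>count_space UNIV)"
    by (rule K.trilinear_pick[OF Kp Kp Kp Kp Kp Kp A A A])
  from order_trans[OF power_mono[OF le] this] show ?thesis
    by (simp add: qI)
qed

section \<open>Lattice sums over paraboloids and the Strichartz-type trilinear bound\<close>

definition int_sq :: "int ^ 'd \<Rightarrow> int" where
  "int_sq k = (\<Sum>i\<in>UNIV. (k $ i)\<^sup>2)"

lemma norm_real_vec_sq: "(norm (real_vec k))\<^sup>2 = real_of_int (int_sq k)"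
  by (simp add: real_vec_def norm_vec_def L2_set_def sum_nonneg int_sq_def)

lemma int_sq_nonneg: "int_sq k \<ge> 0"
  by (simp add: int_sq_def sum_nonneg)

lemma real_vec_diff: "real_vec (a - b) = real_vec a - real_vec b"
  and real_vec_add: "real_vec (a + b) = real_vec a + real_vec b"
  and real_vec_minus: "real_vec (- a) = - real_vec a"
  by (simp_all add: real_vec_def vec_eq_iff)

lemma parallelogram_int_sq: "int_sq (k + k - p) = 2 * (int_sq k + int_sq (p - k)) - int_sq p"
proof -
  have "((k + k - p) $ i)\<^sup>2 = 2 * ((k $ i)\<^sup>2 + ((p - k) $ i)\<^sup>2) - (p $ i)\<^sup>2" for i
    by (simp add: power2_eq_square algebra_simps)
  then show ?thesis
    by (simp add: int_sq_def sum_subtractf sum.distrib flip: sum_distrib_left)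
qed

lemma brk_double_le: "brk (v + v) \<le> 2 * brk v"
proof -
  have "norm (real_vec (v + v)) \<le> norm (real_vec v) + norm (real_vec v)"
    unfolding real_vec_add by (rule norm_triangle_ineq)
  from bracket_add_le[OF this] show ?thesis by linarith
qed

text \<open>For fixed total frequency \<open>p\<close> the lattice points with \<open>|k|\<^sup>2 + |p - k|\<^sup>2 = n\<close> correspond to the
  points \<open>2k - p\<close> on a sphere.\<close>

lemma sphere_pairs_weighted_sum:
  fixes s :: real
  assumes s: "s > max 0 (real CARD('d::finite) / 2 - 1)"
  shows "\<exists>B\<ge>0. \<forall>n (p :: int ^ 'd) q F. finite F \<longrightarrow> F \<subseteq> {k. int_sq k + int_sq (p - k) = n} \<longrightarrow>
     (\<Sum>k\<in>F. brk (q + k - p) powr (-2 * s)) \<le> B"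
proof -
  obtain B where B: "B \<ge> 0" "\<And>m (A :: int ^ 'd) F. finite F \<Longrightarrow> F \<subseteq> {C. (\<Sum>i\<in>UNIV. (C $ i)\<^sup>2) = m} \<Longrightarrow>
     (\<Sum>C\<in>F. brk (C - A) powr (-2 * s)) \<le> B"
    using sphere_points_weighted_sum[OF s] by blast
  have "(\<Sum>k\<in>F. brk (q + k - p) powr (-2 * s)) \<le> 2 powr (2 * s) * B"
    if F: "finite F" "F \<subseteq> {k. int_sq k + int_sq (p - k) = n}" for n and p q :: "int ^ 'd" and F
  proof -
    define f where "f = (\<lambda>k :: int ^ 'd. k + k - p)"
    have inj: "inj_on f F" by (auto simp: f_def inj_on_def vec_eq_iff)
    have "(\<Sum>k\<in>F. brk (q + k - p) powr (-2 * s)) \<le> (\<Sum>k\<in>F. 2 powr (2 * s) * brk (f k - (p - (q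
        + q))) powr (-2 * s))"
    proof (rule sum_mono)
      fix k
      define v where "v = q + k - p"
      \<comment> \<open>The doubled variable makes the argument of the bracket twice the original
        one, at the cost of a factor 2 powr (2 s).\<close>
      have v: "f k - (p - (q + q)) = v + v" by (simp add: f_def v_def algebra_simps)
      have "brk (v + v) / 2 \<le> brk v" using brk_double_le[of v] by simp
      then have "brk v powr (-2 * s) \<le> (brk (v + v) / 2) powr (-2 * s)"
        using s bracket_ge_1[of "real_vec (v + v)"] by (intro powr_mono2') auto
      also have "\<dots> = 2 powr (2 * s) * brk (v + v) powr (-2 * s)"
        using bracket_ge_1[of "real_vec (v + v)"] by (simp add: powr_divide powr_minus field_simps)
      finally show "brk (q + k - p) powr (-2 * s) \<le> 2 powr (2 * s) * brk (f k - (p - (q + q))) powr (-2 * s)"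
        unfolding v v_def[symmetric] .
    qed
    also have "\<dots> = 2 powr (2 * s) * (\<Sum>C\<in>f ` F. brk (C - (p - (q + q))) powr (-2 * s))"
      by (simp add: sum.reindex[OF inj] sum_distrib_left)
    also have "\<dots> \<le> 2 powr (2 * s) * B"
    proof (intro mult_left_mono B(2))
      show "f ` F \<subseteq> {C. (\<Sum>i\<in>UNIV. (C $ i)\<^sup>2) = 2 * n - int_sq p}"
        using F(2) parallelogram_int_sq[of _ p] unfolding int_sq_def[symmetric] f_def by auto
    qed (use F in auto)
    finally show ?thesis .
  qed
  then show ?thesis using B(1) by (intro exI[of _ "2 powr (2 * s) * B"]) auto
qed

text \<open>The sum of the two phases is a nonnegative integer n, so the k can be sorted by it. For
  each n they lie on a sphere, with weighted sum at most \<open>B1\<close>, and the frequency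
  cut-off keeps \<tau> n \<le> 2 K, so the modulation weights sum over n to at most
  \<open>B2\<close>.\<close>

lemma paraboloid_kernel_bound:
  fixes s \<beta> K :: real
  assumes s: "s > max 0 (real CARD('d::finite) / 2 - 1)" and \<beta>: "\<beta> > 1/2" and K: "K \<ge> 0"
  shows "\<exists>B\<ge>0. \<forall>\<tau> (q :: int ^ 'd) p \<sigma>. 0 < \<tau> \<longrightarrow> \<tau> < 1 \<longrightarrow>
    (\<integral>\<^sup>+k. ennreal (indicator {k. \<tau> * (norm (real_vec k))\<^sup>2
        \<le> K} k * indicator {k. \<tau> * (norm (real_vec k))\<^sup>2 \<le> K} (p - k)
      * (brk (q + k - p) powr (-2 * s) * lam \<tau> (\<sigma> + (norm (real_vec k))\<^sup>2
          + (norm (real_vec (p - k)))\<^sup>2) powr (-2 * \<beta>)))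
      \<partial>count_space UNIV) \<le> ennreal B"
proof -
  obtain B1 where B1: "B1 \<ge> 0" "\<And>n (p :: int ^ 'd) q F. finite F \<Longrightarrow> F \<subseteq> {k. int_sq k + int_sq (p - k) = n} \<Longrightarrow>
     (\<Sum>k\<in>F. brk (q + k - p) powr (-2 * s)) \<le> B1"
    using sphere_pairs_weighted_sum[OF s] by blast
  obtain B2 where B2: "B2 \<ge> 0" "\<And>\<tau> \<sigma> M. 0 < \<tau> \<Longrightarrow> \<tau> \<le> 1 \<Longrightarrow> \<tau> * real M \<le> 2 * K \<Longrightarrow>
    (\<Sum>m\<le>M. lam \<tau> (\<sigma> + real m) powr (-(2 * \<beta>))) \<le> B2"
    using sum_lam_powr[of "2 * \<beta>" "2 * K"] \<beta> K by auto
  have "(\<integral>\<^sup>+k. ennreal (indicator {k. \<tau> * (norm (real_vec k))\<^sup>2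
      \<le> K} k * indicator {k. \<tau> * (norm (real_vec k))\<^sup>2 \<le> K} (p - k)
      * (brk (q + k - p) powr (-2 * s) * lam \<tau> (\<sigma> + (norm (real_vec k))\<^sup>2
          + (norm (real_vec (p - k)))\<^sup>2) powr (-2 * \<beta>)))
      \<partial>count_space UNIV) \<le> ennreal (B1 * B2)"
    if \<tau>: "0 < \<tau>" "\<tau> < 1" for \<tau> and q p :: "int ^ 'd" and \<sigma>
  proof (rule nn_integral_count_space_le)
    fix F :: "(int ^ 'd) set" assume F: "finite F"
    define H where "H = {k :: int ^ 'd. \<tau> * (norm (real_vec k))\<^sup>2 \<le> K}"
    define G where "G = {k \<in> F. k \<in> H \<and> p - k \<in> H}"
    define N where "N = (\<lambda>k :: int ^ 'd. nat (int_sq k + int_sq (p - k)))"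
    define M where "M = nat \<lfloor>2 * K / \<tau>\<rfloor>"
    have N: "real (N k) = (norm (real_vec k))\<^sup>2 + (norm (real_vec (p - k)))\<^sup>2" for k
      by (simp add: N_def norm_real_vec_sq int_sq_nonneg)
    have NM: "N k \<le> M" if "k \<in> G" for k
    proof -
      have "\<tau> * real (N k) \<le> 2 * K" using that by (simp add: G_def H_def N distrib_left)
      then have "real (N k) \<le> 2 * K / \<tau>" using \<tau> by (simp add: field_simps)
      then show ?thesis unfolding M_def by (simp add: le_nat_iff le_floor_iff)
    qed
    have MK: "\<tau> * real M \<le> 2 * K"
    proof -
      have "real M \<le> 2 * K / \<tau>" unfolding M_def using K \<tau> by (intro of_nat_floor) auto
      then show ?thesis using \<tau> by (simp add: field_simps)
    qed
    have "(\<Sum>k\<in>F. indicator H k * indicator H (p - k) * (brk (q + k - p) powr (-2 * s)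
        * lam \<tau> (\<sigma> + (norm (real_vec k))\<^sup>2 + (norm (real_vec (p - k)))\<^sup>2) powr (-2 * \<beta>)))
        = (\<Sum>k\<in>G. brk (q + k - p) powr (-2 * s) * lam \<tau> (\<sigma> + real (N k)) powr (-(2 * \<beta>)))"
      using F by (intro sum.mono_neutral_cong_right) (auto simp: G_def N indicator_def add.assoc)
    also have "\<dots> = (\<Sum>n\<le>M. \<Sum>k\<in>{k \<in> G. N k = n}. brk (q + k - p) powr (-2 * s) * lam \<tau> (\<sigma>
        + real (N k)) powr (-(2 * \<beta>)))"
      using F NM by (intro sum.group[symmetric]) (auto simp: G_def)
    also have "\<dots> = (\<Sum>n\<le>M. (\<Sum>k\<in>{k \<in> G. N k = n}. brk (q + k - p) powr (-2 * s)) * lam \<tau> (\<sigma>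
        + real n) powr (-(2 * \<beta>)))"
      by (simp add: sum_distrib_right)
    also have "\<dots> \<le> (\<Sum>n\<le>M. B1 * lam \<tau> (\<sigma> + real n) powr (-(2 * \<beta>)))"
    proof (intro sum_mono mult_right_mono B1(2))
      fix n
      show "{k \<in> G. N k = n} \<subseteq> {k. int_sq k + int_sq (p - k) = int n}"
      proof
        fix k assume "k \<in> {k \<in> G. N k = n}"
        then show "k \<in> {k. int_sq k + int_sq (p - k) = int n}"
          using int_sq_nonneg[of k] int_sq_nonneg[of "p - k"] by (auto simp: N_def)
      qed
    qed (use F in \<open>auto simp: G_def\<close>)
    also have "\<dots> = B1 * (\<Sum>n\<le>M. lam \<tau> (\<sigma> + real n) powr (-(2 * \<beta>)))" by (simp add: sum_distrib_left)
    also have "\<dots> \<le> B1 * B2" using \<tau> MK by (intro mult_left_mono B2(2) B1(1)) auto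
    finally show "(\<Sum>k\<in>F. ennreal (indicator {k. \<tau> * (norm (real_vec k))\<^sup>2
        \<le> K} k * indicator {k. \<tau> * (norm (real_vec k))\<^sup>2 \<le> K} (p - k)
      * (brk (q + k - p) powr (-2 * s) * lam \<tau> (\<sigma> + (norm (real_vec k))\<^sup>2
          + (norm (real_vec (p - k)))\<^sup>2) powr (-2 * \<beta>))))
      \<le> ennreal (B1 * B2)"
      unfolding H_def[symmetric] by (subst sum_ennreal) (auto intro!: ennreal_leI mult_nonneg_nonneg)
  qed
  then show ?thesis using B1(1) B2(1) by (intro exI[of _ "B1 * B2"]) auto
qed

abbreviation schroedinger_phase :: "int ^ 'd \<Rightarrow> real" where
  "schroedinger_phase k \<equiv> (norm (real_vec k))\<^sup>2"

text \<open>In the convolution bound the integral over time merges the two modulation weights into a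
  single one at the summed phase |k|^2 + |p - k|^2, which needs 2 \<beta> > 1. The remaining lattice
  sum is the paraboloid bound.\<close>

lemma trilinear_strichartz:
  fixes s \<beta> K :: real
  assumes s: "s > max 0 (real CARD('d::finite) / 2 - 1)" and \<beta>: "\<beta> > 1/2" and K: "K \<ge> 0"
  shows "\<exists>B\<ge>0. \<forall>\<tau> U V W. 0 < \<tau> \<longrightarrow> \<tau> < 1 \<longrightarrow> freq_time_periodic \<tau> U \<longrightarrow> freq_time_periodic \<tau> V \<longrightarrow>
      freq_time_periodic \<tau> W \<longrightarrow>
    (\<integral>\<^sup>+x. \<integral>\<^sup>+y. ennreal (brk (fst (x - y) :: int ^ 'd) powr (- s))
        * ennreal (indicator {k. \<tau> * schroedinger_phase k
            \<le> K} (fst x) * lam \<tau> (snd x + schroedinger_phase (fst x)) powr (- \<beta>))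
        * ennreal (indicator {k. \<tau> * schroedinger_phase k
            \<le> K} (fst y) * lam \<tau> (snd y + schroedinger_phase (fst y)) powr (- \<beta>))
        * U x * V (x - y) * W y \<partial>freq_time_measure \<tau> \<partial>freq_time_measure \<tau>)\<^sup>2
    \<le> ennreal B * (\<integral>\<^sup>+x. (U x)\<^sup>2 \<partial>freq_time_measure \<tau>) * (\<integral>\<^sup>+x. (V x)\<^sup>2 \<partial>freq_time_measure \<tau>)
        * (\<integral>\<^sup>+x. (W x)\<^sup>2 \<partial>freq_time_measure \<tau>)"
proof -
  obtain B1 where B1: "B1 \<ge> 0" "\<And>\<tau> (q :: int ^ 'd) p \<sigma>. 0 < \<tau> \<Longrightarrow> \<tau> < 1 \<Longrightarrow>
    (\<integral>\<^sup>+k. ennreal (indicator {k. \<tau> * (norm (real_vec k))\<^sup>2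
        \<le> K} k * indicator {k. \<tau> * (norm (real_vec k))\<^sup>2 \<le> K} (p - k)
      * (brk (q + k - p) powr (-2 * s) * lam \<tau> (\<sigma> + (norm (real_vec k))\<^sup>2
          + (norm (real_vec (p - k)))\<^sup>2) powr (-2 * \<beta>)))
      \<partial>count_space UNIV) \<le> ennreal B1"
    using paraboloid_kernel_bound[OF s \<beta> K] by blast
  obtain C where C: "C \<ge> 0" "\<And>\<tau> x y. \<tau> > 0 \<Longrightarrow> (\<integral>\<^sup>+\<sigma>. ennreal (lam \<tau> (\<sigma> + x) powr (-(2 * \<beta>))
      * lam \<tau> (y - \<sigma>) powr (-(2 * \<beta>))) \<partial>time_measure \<tau>)
    \<le> ennreal (C * lam \<tau> (x + y) powr (-(2 * \<beta>)))"
    using nn_integral_lam_convolution[of "2 * \<beta>"] \<beta> by auto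
  have "(\<integral>\<^sup>+x. \<integral>\<^sup>+y. ennreal (brk (fst (x - y) :: int ^ 'd) powr (- s))
        * ennreal (indicator {k. \<tau> * schroedinger_phase k
            \<le> K} (fst x) * lam \<tau> (snd x + schroedinger_phase (fst x)) powr (- \<beta>))
        * ennreal (indicator {k. \<tau> * schroedinger_phase k
            \<le> K} (fst y) * lam \<tau> (snd y + schroedinger_phase (fst y)) powr (- \<beta>))
        * U x * V (x - y) * W y \<partial>freq_time_measure \<tau> \<partial>freq_time_measure \<tau>)\<^sup>2
    \<le> ennreal (2 * (C * B1)) * (\<integral>\<^sup>+x. (U x)\<^sup>2 \<partial>freq_time_measure \<tau>)
        * (\<integral>\<^sup>+x. (V x)\<^sup>2 \<partial>freq_time_measure \<tau>) * (\<integral>\<^sup>+x. (W x)\<^sup>2 \<partial>freq_time_measure \<tau>)"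
    if \<tau>: "0 < \<tau>" "\<tau> < 1" and per: "freq_time_periodic \<tau> U" "freq_time_periodic \<tau> V" "freq_time_periodic
        \<tau> W" for \<tau> U V W
  proof -
    interpret N: conv_measure "freq_time_measure \<tau> :: ((int ^ 'd) \<times> real) measure" "{(0, 2 * pi / \<tau>)}"
      by (rule conv_measure_freq_time_measure) fact
    define H where "H = {k :: int ^ 'd. \<tau> * schroedinger_phase k \<le> K}"
    define m where "m = (\<lambda>p :: (int ^ 'd) \<times> real. ennreal (brk (fst p) powr (- s)))"
    define \<mu> where "\<mu> = (\<lambda>p :: (int ^ 'd) \<times> real. ennreal (indicator H (fst p) * lam \<tau> (snd p
        + schroedinger_phase (fst p)) powr (- \<beta>)))"
    have lp: "lam \<tau> (\<sigma> + 2 * pi / \<tau> + x) = lam \<tau> (\<sigma> + x)" for \<sigma> x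
      using lam_periodic[OF \<tau>(1), of "\<sigma> + x"] by (simp add: add_ac)
    have m: "N.periodic m"
    proof -
      have "m \<in> borel_measurable (freq_time_measure \<tau>)"
        unfolding m_def by measurable
      then show ?thesis by (simp add: freq_time_periodic_iff[OF \<tau>(1)] m_def)
    qed
    have \<mu>: "N.periodic \<mu>"
    proof -
      have "(\<lambda>p. (indicator H (fst p) :: real)) \<in> borel_measurable (freq_time_measure \<tau>)"
        by (rule measurable_compose[OF measurable_fst]) simp
      moreover have "(\<lambda>p. schroedinger_phase (fst p)) \<in> borel_measurable (freq_time_measure \<tau>)"
        by (rule measurable_compose[OF measurable_fst]) simp
      ultimately have "\<mu> \<in> borel_measurable (freq_time_measure \<tau>)"
        unfolding \<mu>_def by measurable
      then show ?thesis by (simp add: freq_time_periodic_iff[OF \<tau>(1)] \<mu>_def lp)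
    qed
    have B: "(\<integral>\<^sup>+c. (m (a + c - p))\<^sup>2 * (\<mu> c * \<mu> (p - c))\<^sup>2 \<partial>freq_time_measure \<tau>) \<le> ennreal (C * B1)" for p a
    proof -
      obtain kp \<sigma>p ka \<sigma>a where p: "p = (kp, \<sigma>p)" "a = (ka, \<sigma>a)" by fastforce
      have [measurable]: "(\<lambda>c. (m (a + c - p))\<^sup>2 * (\<mu> c
          * \<mu> (p - c))\<^sup>2) \<in> borel_measurable (freq_time_measure \<tau>)"
        using m \<mu> by (intro N.periodic_measurable[OF N.periodic_mult] N.periodic_power N.periodic_mult
            N.periodic_diff2 m \<mu>)
          (use N.periodic_add[OF m, of "a - p"] in \<open>simp add: algebra_simps\<close>)
      have "(\<integral>\<^sup>+c. (m (a + c - p))\<^sup>2 * (\<mu> c * \<mu> (p - c))\<^sup>2 \<partial>freq_time_measure \<tau>)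
          = (\<integral>\<^sup>+k. \<integral>\<^sup>+\<sigma>. (m (a + (k, \<sigma>) - p))\<^sup>2 * (\<mu> (k, \<sigma>)
              * \<mu> (p - (k, \<sigma>)))\<^sup>2 \<partial>time_measure \<tau> \<partial>count_space UNIV)"
        by (rule nn_integral_freq_time[OF \<tau>(1)]) measurable
      also have "\<dots> = (\<integral>\<^sup>+k. \<integral>\<^sup>+\<sigma>. ennreal (indicator H k * indicator H (kp - k) * brk (ka
          + k - kp) powr (-2 * s))
          * ennreal (lam \<tau> (\<sigma> + schroedinger_phase k) powr (-(2 * \<beta>)) * lam \<tau> (\<sigma>p
              + schroedinger_phase (kp - k) - \<sigma>) powr (-(2 * \<beta>)))
          \<partial>time_measure \<tau> \<partial>count_space UNIV)"
      proof (intro nn_integral_cong)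
        fix k :: "int ^ 'd" and \<sigma> :: real
        have sq: "(x powr t)\<^sup>2 = x powr (2 * t)" for x t :: real
          by (simp add: power2_eq_square flip: powr_add)
        have ind: "(indicator H x :: real)\<^sup>2 = indicator H x" for x by (simp add: indicator_def)
        show "(m (a + (k, \<sigma>) - p))\<^sup>2 * (\<mu> (k, \<sigma>) * \<mu> (p - (k, \<sigma>)))\<^sup>2
            = ennreal (indicator H k * indicator H (kp - k) * brk (ka + k - kp) powr (-2 * s))
          * ennreal (lam \<tau> (\<sigma> + schroedinger_phase k) powr (-(2 * \<beta>)) * lam \<tau> (\<sigma>p
              + schroedinger_phase (kp - k) - \<sigma>) powr (-(2 * \<beta>)))"
          unfolding m_def \<mu>_def p
          by (simp add: ennreal_power power_mult_distrib sq ind mult_ac diff_add_eq flip: ennreal_mult)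
      qed
      also have "\<dots> = (\<integral>\<^sup>+k. ennreal (indicator H k * indicator H (kp - k) * brk (ka + k - kp) powr (-2 * s))
          * (\<integral>\<^sup>+\<sigma>. ennreal (lam \<tau> (\<sigma> + schroedinger_phase k) powr (-(2 * \<beta>)) * lam \<tau> (\<sigma>p
              + schroedinger_phase (kp - k) - \<sigma>) powr (-(2 * \<beta>)))
          \<partial>time_measure \<tau>) \<partial>count_space UNIV)"
        by (intro nn_integral_cong nn_integral_cmult) measurable
      also have "\<dots> \<le> (\<integral>\<^sup>+k. ennreal (indicator H k * indicator H (kp - k) * brk (ka + k - kp) powr (-2 * s))
          * ennreal (C * lam \<tau> (schroedinger_phase k + (\<sigma>p + schroedinger_phase (kp - k))) powr (-(2
              * \<beta>))) \<partial>count_space UNIV)"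
        by (intro nn_integral_mono mult_left_mono C(2) \<tau>) auto
      also have "\<dots> = (\<integral>\<^sup>+k. ennreal C * ennreal (indicator H k * indicator H (kp - k)
          * (brk (ka + k - kp) powr (-2 * s) * lam \<tau> (\<sigma>p + schroedinger_phase k
              + schroedinger_phase (kp - k)) powr (-2 * \<beta>))) \<partial>count_space UNIV)"
        using C(1) by (intro nn_integral_cong) (simp add: mult_ac add_ac flip: ennreal_mult)
      also have "\<dots> = ennreal C * (\<integral>\<^sup>+k. ennreal (indicator H k * indicator H (kp - k)
          * (brk (ka + k - kp) powr (-2 * s) * lam \<tau> (\<sigma>p + schroedinger_phase k
              + schroedinger_phase (kp - k)) powr (-2 * \<beta>))) \<partial>count_space UNIV)"
        by (rule nn_integral_cmult) simp
      also have "\<dots> \<le> ennreal C * ennreal B1"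
        unfolding H_def by (intro mult_left_mono B1(2) \<tau>) auto
      also have "\<dots> = ennreal (C * B1)" using C(1) B1(1) by (simp add: ennreal_mult)
      finally show ?thesis .
    qed
    have "2 * ennreal (C * B1) = ennreal (2 * (C * B1))"
      using C(1) B1(1) by (simp add: ennreal_mult)
    then show ?thesis
      using N.trilinear_convolution_bound[OF m \<mu> \<mu> per B] unfolding m_def \<mu>_def H_def by simp
  qed
  moreover have "2 * (C * B1) \<ge> 0" using C(1) B1(1) by simp
  ultimately show ?thesis by blast
qed

text \<open>Two of the three frequencies obey the filter bound, stated through all pairs because the
  pair depends on the output: k1 and k2 for a Schroedinger output, k0 and k2 for a wave
  output.\<close>

definition two_filtered :: "real \<Rightarrow> real \<Rightarrow> int ^ 'd \<Rightarrow> int ^ 'd \<Rightarrow> int ^ 'd \<Rightarrow> bool" where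
  "two_filtered c \<tau> k0 k1 k2 \<longleftrightarrow>
     (\<tau> * (norm (real_vec k0))\<^sup>2 \<le> c \<or> \<tau> * (norm (real_vec k1))\<^sup>2 \<le> c) \<and>
     (\<tau> * (norm (real_vec k2))\<^sup>2 \<le> c \<or> \<tau> * (norm (real_vec k1))\<^sup>2 \<le> c) \<and>
     (\<tau> * (norm (real_vec k0))\<^sup>2 \<le> c \<or> \<tau> * (norm (real_vec k2))\<^sup>2 \<le> c)"

text \<open>The multiplier that remains when each function has absorbed its own norm weight. The
  sign \<open>e\<close> of the wave phase is -1 for a function measured by the wave norm and 1 for
  its complex conjugate.\<close>

definition interaction_kernel ::
  "real \<Rightarrow> real \<Rightarrow> real \<Rightarrow> real \<Rightarrow> real \<Rightarrow> (int ^ 'd) \<times> real \<Rightarrow> (int ^ 'd) \<times> real \<Rightarrow> real" where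
  "interaction_kernel c s b \<tau> e x y =
     (if two_filtered c \<tau> (fst x) (fst (x - y)) (fst y)
      then freq_weight s (brk (fst x)) (brk (fst (x - y))) (brk (fst y))
        * (lam \<tau> (snd x + schroedinger_phase (fst x)) * lam \<tau> (snd (x - y) + e * norm (real_vec (fst (x - y))))
          * lam \<tau> (snd y + schroedinger_phase (fst y))) powr (- b)
      else 0)"

text \<open>The resonance bound gives the modulations the size demanded by
  \<open>kernel_bound_real\<close>. The cut-off 4 c rather than c allows for a Schroedinger
  frequency that is not itself filtered but is a sum or difference of two filtered ones.\<close>

lemma interaction_kernel_bound:
  fixes c s b \<beta> :: real
  assumes c: "0 < c" "c < 2 * pi" and s: "s \<ge> 0" and b: "1/4 < b" "b < 1/2" and \<beta>: "\<beta> \<le> 2 * b" "b \<le> \<beta>"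
  shows "\<exists>C\<ge>0. \<forall>\<tau> e (x :: (int ^ 'd::finite) \<times> real) y. 0 < \<tau> \<longrightarrow> \<tau> < 1 \<longrightarrow> \<bar>e\<bar> = 1 \<longrightarrow>
    interaction_kernel c s b \<tau> e x y \<le> C * (
      (brk (fst x) powr (-(s + 2 * b)) + brk (fst (x - y)) powr (-(s + 2 * b)) + brk (fst y) powr (-(s
          + 2 * b)))
      * (lam \<tau> (snd x + schroedinger_phase (fst x)) powr (- 2 * b)
        + lam \<tau> (snd (x - y) + e * norm (real_vec (fst (x - y)))) powr (- 2 * b)
        + lam \<tau> (snd y + schroedinger_phase (fst y)) powr (- 2 * b))
      + brk (fst (x - y)) powr (- (s - 2 * \<beta> + 2 * b))
        * (indicator {k. \<tau> * schroedinger_phase k \<le> 4 * c} (fst x) * lam \<tau> (snd x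
            + schroedinger_phase (fst x)) powr (- \<beta>))
        * (indicator {k. \<tau> * schroedinger_phase k \<le> 4 * c} (fst y) * lam \<tau> (snd y
            + schroedinger_phase (fst y)) powr (- \<beta>)))"
proof -
  obtain \<kappa> c1 where \<kappa>: "\<kappa> \<ge> 1" "c1 > 0"
    and na: "\<And>\<tau> e X Y Z. \<lbrakk>0 < \<tau>; \<tau> < 1; \<bar>e\<bar> = 1; 0 \<le> X; 0 \<le> Y; 0 \<le> Z; X \<le> Y + Z; Y \<le> X + Z;
      \<tau> * X\<^sup>2 \<le> c \<or> \<tau> * Y\<^sup>2 \<le> c; sqrt (1 + X\<^sup>2) > \<kappa> * sqrt (1 + Z\<^sup>2)\<rbrakk> \<Longrightarrow>
      cmod (d_tau \<tau> (X\<^sup>2 - Z\<^sup>2 + e * Y)) \<ge> c1 * (1 + X\<^sup>2)"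
    using no_aliasing[OF c] by blast
  obtain C where C: "C \<ge> 0" and kb: "\<And>x y z l0 l1 l2. \<lbrakk>1 \<le> x; 1 \<le> y; 1 \<le> z; 1 \<le> l0; 1 \<le> l1; 1 \<le> l2;
    y \<le> x + z; max x z > \<kappa> * min x z \<longrightarrow> l0 + l1 + l2 \<ge> c1 * (max x z)\<^sup>2\<rbrakk> \<Longrightarrow>
    (min x (min y z)) powr (- s) * (max x z / min x z) powr (1/2) * (l0 * l1 * l2) powr (- b)
    \<le> C * ((x powr (-(s + 2 * b)) + y powr (-(s + 2 * b)) + z powr (-(s + 2 * b)))
          * (l0 powr (- 2 * b) + l1 powr (- 2 * b) + l2 powr (- 2 * b))
        + y powr (- (s - 2 * \<beta> + 2 * b)) * (l0 * l2) powr (- \<beta>))"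
    using kernel_bound_real[OF s b(1) \<beta> \<kappa>] by blast
  have "interaction_kernel c s b \<tau> e x y \<le> C * (
      (brk (fst x) powr (-(s + 2 * b)) + brk (fst (x - y)) powr (-(s + 2 * b)) + brk (fst y) powr (-(s
          + 2 * b)))
      * (lam \<tau> (snd x + schroedinger_phase (fst x)) powr (- 2 * b)
        + lam \<tau> (snd (x - y) + e * norm (real_vec (fst (x - y)))) powr (- 2 * b)
        + lam \<tau> (snd y + schroedinger_phase (fst y)) powr (- 2 * b))
      + brk (fst (x - y)) powr (- (s - 2 * \<beta> + 2 * b))
        * (indicator {k. \<tau> * schroedinger_phase k \<le> 4 * c} (fst x) * lam \<tau> (snd x
            + schroedinger_phase (fst x)) powr (- \<beta>))
        * (indicator {k. \<tau> * schroedinger_phase k \<le> 4 * c} (fst y) * lam \<tau> (snd y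
            + schroedinger_phase (fst y)) powr (- \<beta>)))"
    if \<tau>: "0 < \<tau>" "\<tau> < 1" "\<bar>e\<bar> = 1" for \<tau> e and x y :: "(int ^ 'd) \<times> real"
  proof (cases "two_filtered c \<tau> (fst x) (fst (x - y)) (fst y)")
    case True
    obtain k0 \<sigma>0 k2 \<sigma>2 where xy: "x = (k0, \<sigma>0)" "y = (k2, \<sigma>2)" by fastforce
    define k1 \<sigma>1 where "k1 = k0 - k2" and "\<sigma>1 = \<sigma>0 - \<sigma>2"
    define X Y Z where "X = norm (real_vec k0)" and "Y = norm (real_vec k1)" and "Z = norm (real_vec k2)"
    have nn: "X \<ge> 0" "Y \<ge> 0" "Z \<ge> 0" by (auto simp: X_def Y_def Z_def)
    have tri: "X \<le> Y + Z" "Y \<le> X + Z" "Z \<le> Y + X"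
      using norm_triangle_ineq4[of "real_vec k0" "real_vec k2"] norm_triangle_sub[of "real_vec k0"
          "real_vec k2"]
        norm_triangle_sub[of "real_vec k2" "real_vec k0"]
      by (simp_all add: X_def Y_def Z_def k1_def real_vec_diff norm_minus_commute)
    have filt: "\<tau> * X\<^sup>2 \<le> c \<or> \<tau> * Y\<^sup>2 \<le> c" "\<tau> * Z\<^sup>2 \<le> c \<or> \<tau> * Y\<^sup>2 \<le> c" "\<tau> * X\<^sup>2 \<le> c \<or> \<tau> * Z\<^sup>2 \<le> c"
      using True by (auto simp: two_filtered_def xy X_def Y_def Z_def k1_def)
    have br: "brk k0 = sqrt (1 + X\<^sup>2)" "brk k1 = sqrt (1 + Y\<^sup>2)" "brk k2 = sqrt (1 + Z\<^sup>2)"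
      by (simp_all add: japanese_bracket_def X_def Y_def Z_def)
    have brtri: "brk k1 \<le> brk k0 + brk k2"
      by (rule bracket_add_le) (use tri in \<open>simp add: X_def Y_def Z_def\<close>)
    define l0 l1 l2 where "l0 = lam \<tau> (\<sigma>0 + X\<^sup>2)" and "l1 = lam \<tau> (\<sigma>1 + e * Y)" and "l2 = lam \<tau> (\<sigma>2 + Z\<^sup>2)"
    \<comment> \<open>Subtracting the second and third phases from the first cancels \<sigma>0,
      \<sigma>1 and \<sigma>2, so the modulations jointly dominate a quantity depending on
      frequencies alone.\<close>
    have sumR: "cmod (d_tau \<tau> (X\<^sup>2 - Z\<^sup>2 + (- e) * Y)) \<le> l0 + l1 + l2"
    proof -
      have "X\<^sup>2 - Z\<^sup>2 + (- e) * Y = ((\<sigma>0 + X\<^sup>2) + - (\<sigma>1 + e * Y)) + - (\<sigma>2 + Z\<^sup>2)" by (simp add: \<sigma>1_def)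
      then have "cmod (d_tau \<tau> (X\<^sup>2 - Z\<^sup>2 + (- e) * Y))
          = cmod (d_tau \<tau> (((\<sigma>0 + X\<^sup>2) + - (\<sigma>1 + e * Y)) + - (\<sigma>2 + Z\<^sup>2)))"
        by (simp only:)
      also have "\<dots> \<le> cmod (d_tau \<tau> ((\<sigma>0 + X\<^sup>2) + - (\<sigma>1 + e * Y))) + cmod (d_tau \<tau> (- (\<sigma>2 + Z\<^sup>2)))"
        by (rule norm_d_tau_add[OF \<tau>(1)])
      also have "cmod (d_tau \<tau> ((\<sigma>0 + X\<^sup>2) + - (\<sigma>1 + e * Y)))
          \<le> cmod (d_tau \<tau> (\<sigma>0 + X\<^sup>2)) + cmod (d_tau \<tau> (- (\<sigma>1 + e * Y)))"
        by (rule norm_d_tau_add[OF \<tau>(1)])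
      finally have "cmod (d_tau \<tau> (X\<^sup>2 - Z\<^sup>2 + (- e) * Y))
          \<le> cmod (d_tau \<tau> (\<sigma>0 + X\<^sup>2)) + cmod (d_tau \<tau> (- (\<sigma>1 + e * Y))) + cmod (d_tau \<tau> (- (\<sigma>2 + Z\<^sup>2)))"
        by simp
      then show ?thesis
        unfolding norm_d_tau_minus[OF \<tau>(1)] l0_def l1_def l2_def
        using norm_d_tau_le_lam[of \<tau> "\<sigma>0 + X\<^sup>2"] norm_d_tau_le_lam[of \<tau> "\<sigma>1 + e
            * Y"] norm_d_tau_le_lam[of \<tau> "\<sigma>2 + Z\<^sup>2"]
        by linarith
    qed
    have res: "max (brk k0) (brk k2) > \<kappa> * min (brk k0) (brk k2) \<longrightarrow> l0 + l1 + l2 \<ge> c1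
        * (max (brk k0) (brk k2))\<^sup>2"
    proof
      assume big: "max (brk k0) (brk k2) > \<kappa> * min (brk k0) (brk k2)"
      show "l0 + l1 + l2 \<ge> c1 * (max (brk k0) (brk k2))\<^sup>2"
      proof (cases "brk k2 \<le> brk k0")
        case True
        then have "sqrt (1 + X\<^sup>2) > \<kappa> * sqrt (1 + Z\<^sup>2)" using big br
            by (simp add: max_def min_def split: if_splits)
        then have "c1 * (1 + X\<^sup>2) \<le> cmod (d_tau \<tau> (X\<^sup>2 - Z\<^sup>2 + (- e) * Y))"
          using na[of \<tau> "- e" X Y Z] \<tau> nn tri filt by simp
        moreover have "(max (brk k0) (brk k2))\<^sup>2 = 1 + X\<^sup>2" using True by (simp add: max_absorb1 br)
        ultimately show ?thesis using sumR by simp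
      next
        case False
        then have "sqrt (1 + Z\<^sup>2) > \<kappa> * sqrt (1 + X\<^sup>2)" using big br
            by (simp add: max_def min_def split: if_splits)
        \<comment> \<open>When k2 dominates, the resonance bound is applied with X and Z exchanged
          and the sign of the wave phase reversed; evenness of |d_tau| identifies the two.\<close>
        then have "c1 * (1 + Z\<^sup>2) \<le> cmod (d_tau \<tau> (Z\<^sup>2 - X\<^sup>2 + e * Y))"
          using na[of \<tau> e Z Y X] \<tau> nn tri filt by (simp add: add.commute)
        also have "\<dots> = cmod (d_tau \<tau> (X\<^sup>2 - Z\<^sup>2 + (- e) * Y))"
          using norm_d_tau_minus[OF \<tau>(1), of "X\<^sup>2 - Z\<^sup>2 + (- e) * Y"] by (simp add: algebra_simps)
        finally have "c1 * (1 + Z\<^sup>2) \<le> l0 + l1 + l2" using sumR by linarith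
        moreover have "(max (brk k0) (brk k2))\<^sup>2 = 1 + Z\<^sup>2" using False by (simp add: max_absorb2 br)
        ultimately show ?thesis by simp
      qed
    qed
    have quad: "\<tau> * U\<^sup>2 \<le> 4 * c" if "\<tau> * U\<^sup>2 \<le> c \<or> (\<tau> * Y\<^sup>2 \<le> c \<and> \<tau> * T\<^sup>2 \<le> c)" "U \<le> Y + T" "U \<ge> 0" for U T
    proof (cases "\<tau> * U\<^sup>2 \<le> c")
      case False
      have "U\<^sup>2 \<le> (Y + T)\<^sup>2" using that by (intro power_mono) auto
      also have "\<dots> \<le> 2 * Y\<^sup>2 + 2 * T\<^sup>2"
        using zero_le_power2[of "Y - T"] by (simp add: power2_sum power2_diff)
      finally have "\<tau> * U\<^sup>2 \<le> \<tau> * (2 * Y\<^sup>2 + 2 * T\<^sup>2)" using \<tau> by (intro mult_left_mono) auto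
      then show ?thesis using that(1) False by (simp add: algebra_simps)
    qed (use c in linarith)
    have H: "\<tau> * X\<^sup>2 \<le> 4 * c" "\<tau> * Z\<^sup>2 \<le> 4 * c"
      using quad[of X Z] quad[of Z X] filt tri nn by auto
    have "freq_weight s (brk k0) (brk k1) (brk k2) * (l0 * l1 * l2) powr (- b)
      \<le> C * ((brk k0 powr (-(s + 2 * b)) + brk k1 powr (-(s + 2 * b)) + brk k2 powr (-(s + 2 * b)))
          * (l0 powr (- 2 * b) + l1 powr (- 2 * b) + l2 powr (- 2 * b))
        + brk k1 powr (- (s - 2 * \<beta> + 2 * b)) * (l0 * l2) powr (- \<beta>))"
      unfolding freq_weight_def
      by (rule kb[OF bracket_ge_1 bracket_ge_1 bracket_ge_1 _ _ _ brtri res])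
        (auto simp: l0_def l1_def l2_def lam_ge_1)
    then show ?thesis
      using True H lam_ge_1 unfolding interaction_kernel_def xy
      by (simp add: X_def Y_def Z_def k1_def \<sigma>1_def l0_def l1_def l2_def powr_mult mult_ac)
  next
    case False
    then have "interaction_kernel c s b \<tau> e x y = 0" by (simp add: interaction_kernel_def)
    then show ?thesis using C by (auto intro!: mult_nonneg_nonneg add_nonneg_nonneg)
  qed
  then show ?thesis using C by (intro exI[of _ C]) blast
qed


section \<open>Trilinear forms as functions of the kernel\<close>

context conv_measure
begin

definition trilinear_form :: "('a \<Rightarrow> 'a \<Rightarrow> ennreal) \<Rightarrow> ('a \<Rightarrow> ennreal) \<Rightarrow> ('a \<Rightarrow> ennreal) \<Rightarrow> ('a \<Rightarrow> ennreal) \<Rightarrow>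
    ennreal" where
  "trilinear_form f u v w = (\<integral>\<^sup>+x. \<integral>\<^sup>+y. f x y * u x * v (x - y) * w y \<partial>M \<partial>M)"

lemma trilinear_form_mono: "(\<And>x y. f x y \<le> g x y) \<Longrightarrow> trilinear_form f u v w \<le> trilinear_form g u v w"
  unfolding trilinear_form_def by (intro nn_integral_mono mult_right_mono) auto

lemma trilinear_form_sum:
  assumes "finite I" and f: "\<And>i. i \<in> I \<Longrightarrow> (\<lambda>(x, y). f i x y) \<in> borel_measurable (M \<Otimes>\<^sub>M M)"
    and per: "periodic u" "periodic v" "periodic w"
  shows "trilinear_form (\<lambda>x y. C * (\<Sum>i\<in>I. f i x y)) u v w = C * (\<Sum>i\<in>I. trilinear_form (f i) u v w)"
proof -
  note [measurable] = per[THEN periodic_measurable]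
  define g where "g = (\<lambda>i x y. f i x y * u x * v (x - y) * w y)"
  have g: "(\<lambda>(x, y). g i x y) \<in> borel_measurable (M \<Otimes>\<^sub>M M)" if "i \<in> I" for i
  proof -
    note [measurable] = f[OF that]
    show ?thesis unfolding g_def split_beta' by (use f[OF that] in \<open>simp add: split_beta'\<close>)
  qed
  have gs: "g i x \<in> borel_measurable M" if "i \<in> I" for i x
    using measurable_compose[OF _ g[OF that], of "\<lambda>y. (x, y)" M] by (simp add: space_UNIV)
  have gi: "(\<lambda>x. \<integral>\<^sup>+y. g i x y \<partial>M) \<in> borel_measurable M" if "i \<in> I" for i
    by (rule borel_measurable_nn_integral[OF g[OF that]])
  have "trilinear_form (\<lambda>x y. C * (\<Sum>i\<in>I. f i x y)) u v w = (\<integral>\<^sup>+x. \<integral>\<^sup>+y. C * (\<Sum>i\<in>I. g i x y) \<partial>M \<partial>M)"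
    unfolding trilinear_form_def g_def by (simp add: sum_distrib_right mult.assoc)
  also have "\<dots> = (\<integral>\<^sup>+x. C * (\<Sum>i\<in>I. \<integral>\<^sup>+y. g i x y \<partial>M) \<partial>M)"
  proof (rule nn_integral_cong)
    fix x
    have "(\<integral>\<^sup>+y. C * (\<Sum>i\<in>I. g i x y) \<partial>M) = C * (\<integral>\<^sup>+y. (\<Sum>i\<in>I. g i x y) \<partial>M)"
      by (rule nn_integral_cmult) (intro borel_measurable_sum gs)
    also have "(\<integral>\<^sup>+y. (\<Sum>i\<in>I. g i x y) \<partial>M) = (\<Sum>i\<in>I. \<integral>\<^sup>+y. g i x y \<partial>M)"
      by (rule nn_integral_sum) (auto intro: gs)
    finally show "(\<integral>\<^sup>+y. C * (\<Sum>i\<in>I. g i x y) \<partial>M) = C * (\<Sum>i\<in>I. \<integral>\<^sup>+y. g i x y \<partial>M)" .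
  qed
  also have "\<dots> = C * (\<integral>\<^sup>+x. (\<Sum>i\<in>I. \<integral>\<^sup>+y. g i x y \<partial>M) \<partial>M)"
    by (rule nn_integral_cmult) (intro borel_measurable_sum gi)
  also have "(\<integral>\<^sup>+x. (\<Sum>i\<in>I. \<integral>\<^sup>+y. g i x y \<partial>M) \<partial>M) = (\<Sum>i\<in>I. \<integral>\<^sup>+x. \<integral>\<^sup>+y. g i x y \<partial>M \<partial>M)"
    by (rule nn_integral_sum) (auto intro: gi)
  finally show ?thesis by (simp add: trilinear_form_def g_def)
qed

end

lemma measurable_phase_shift [measurable]:
  assumes [measurable]: "L \<in> borel_measurable borel"
  shows "(\<lambda>p. L (snd p + \<phi> (fst p))) \<in> borel_measurable (freq_time_measure \<tau>)"
proof -
  have "(\<lambda>p. \<phi> (fst p)) \<in> borel_measurable (freq_time_measure \<tau>)"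
    by (rule measurable_compose[OF measurable_fst]) simp
  then show ?thesis by measurable
qed

lemma measurable_freq_fun [measurable]:
  "(\<lambda>p. a (fst p) :: 'b::topological_space) \<in> borel_measurable (freq_time_measure \<tau>)"
  by (rule measurable_compose[OF measurable_fst]) simp

text \<open>All functions are nonnegative, so the form is monotone in the kernel and the summands of
  the pointwise kernel bound can be estimated one by one. What has to be arranged is that one
  \<beta> satisfies all constraints.\<close>

theorem trilinear_estimate:
  fixes c s0 s b :: real
  assumes c: "0 < c" "c < 2 * pi"
    and s0: "s0 = max 0 (real CARD('d::finite) / 2 - 1)" and s: "s > s0"
    and b: "3/8 < b" "1/2 - 1/2 * (s - s0) < b" "b < 1/2"
  shows "\<exists>C\<ge>0. \<forall>\<tau> e U V W. 0 < \<tau> \<longrightarrow> \<tau> < 1 \<longrightarrow> \<bar>e\<bar> = 1 \<longrightarrow>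
    freq_time_periodic \<tau> U \<longrightarrow> freq_time_periodic \<tau> V \<longrightarrow> freq_time_periodic \<tau> W \<longrightarrow>
    (\<integral>\<^sup>+x. \<integral>\<^sup>+y. ennreal (interaction_kernel c s b \<tau> e x (y :: (int ^ 'd) \<times> real)) * U x * V (x - y) * W y
      \<partial>freq_time_measure \<tau> \<partial>freq_time_measure \<tau>)\<^sup>2
    \<le> ennreal C * (\<integral>\<^sup>+x. (U x)\<^sup>2 \<partial>freq_time_measure \<tau>) * (\<integral>\<^sup>+x. (V x)\<^sup>2 \<partial>freq_time_measure \<tau>)
        * (\<integral>\<^sup>+x. (W x)\<^sup>2 \<partial>freq_time_measure \<tau>)"
proof -
  \<comment> \<open>\<beta> has to exceed 1/2 for integrability in time, stay below 2 b for the
    kernel bound, and stay below (s - s0)/2 + b so that the exponent s' of <k1> remains above s0.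
    Both upper bounds exceed 1/2 by the assumptions on b.\<close>
  have "1/2 < 2 * b" using b by linarith
  moreover have "1/2 < (s - s0 + 2 * b) / 2" using b(2) by (simp add: field_simps)
  ultimately have "1/2 < min (2 * b) ((s - s0 + 2 * b) / 2)" by simp
  then obtain \<beta> where \<beta>: "1/2 < \<beta>" "\<beta> < min (2 * b) ((s - s0 + 2 * b) / 2)" using dense by blast
  define s' where "s' = s - 2 * \<beta> + 2 * b"
  have s': "s' > s0" using \<beta> by (simp add: s'_def)
  have s00: "s0 \<ge> 0" "real CARD('d) / 2 \<le> s0 + 1" unfolding s0 by linarith+
  \<comment> \<open>The exponent in the pieces settled by Cauchy-Schwarz alone. Square summability
    over the lattice asks for 2 \<alpha> > d, which follows from s + 2 b > s0 + 1 and s0 + 1 \<ge> d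
    / 2.\<close>
  define \<alpha> where "\<alpha> = s + 2 * b"
  have "1 < s - s0 + 2 * b" using b(2) by (simp add: field_simps)
  then have "D < 2 * (s + 2 * b)" if "D / 2 \<le> s0 + 1" for D using that by (simp add: field_simps)
  from this[OF s00(2)] have \<alpha>: "2 * \<alpha> > real CARD('d)" by (simp only: \<alpha>_def)
  obtain C0 where C0: "C0 \<ge> 0" and kb: "\<And>\<tau> e (x :: (int ^ 'd) \<times> real) y. \<lbrakk>0 < \<tau>; \<tau> < 1; \<bar>e\<bar> = 1\<rbrakk> \<Longrightarrow>
    interaction_kernel c s b \<tau> e x y \<le> C0 * (
      (brk (fst x) powr (- \<alpha>) + brk (fst (x - y)) powr (- \<alpha>) + brk (fst y) powr (- \<alpha>))
      * (lam \<tau> (snd x + schroedinger_phase (fst x)) powr (- 2 * b)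
        + lam \<tau> (snd (x - y) + e * norm (real_vec (fst (x - y)))) powr (- 2 * b)
        + lam \<tau> (snd y + schroedinger_phase (fst y)) powr (- 2 * b))
      + brk (fst (x - y)) powr (- s')
        * (indicator {k. \<tau> * schroedinger_phase k \<le> 4 * c} (fst x) * lam \<tau> (snd x
            + schroedinger_phase (fst x)) powr (- \<beta>))
        * (indicator {k. \<tau> * schroedinger_phase k \<le> 4 * c} (fst y) * lam \<tau> (snd y
            + schroedinger_phase (fst y)) powr (- \<beta>)))"
  proof -
    have "s \<ge> 0" "1/4 < b" "\<beta> \<le> 2 * b" "b \<le> \<beta>" using s s00(1) b \<beta> by auto
    from interaction_kernel_bound[OF c this(1,2) b(3) this(3,4)] that show ?thesis
      unfolding \<alpha>_def s'_def by blast
  qed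
  obtain A where A: "A \<ge> 0" "(\<integral>\<^sup>+k. ennreal (brk (k :: int ^ 'd) powr (-(2 * \<alpha>))) \<partial>count_space UNIV)
      \<le> ennreal A"
    using sum_brk_powr[OF \<alpha>] by blast
  obtain D where D: "D \<ge> 0" "\<And>\<tau>. \<tau> > 0 \<Longrightarrow> (\<integral>\<^sup>+\<sigma>. ennreal (lam \<tau> \<sigma> powr (-(4 * b))) \<partial>time_measure \<tau>) \<le> ennreal D"
    using nn_integral_lam_powr[of "4 * b"] b by auto
  obtain B where B: "B \<ge> 0" and strich: "\<And>\<tau> U V W. \<lbrakk>0 < \<tau>; \<tau> < 1; freq_time_periodic \<tau> U;
      freq_time_periodic \<tau> V; freq_time_periodic \<tau> W\<rbrakk> \<Longrightarrow>
    (\<integral>\<^sup>+x. \<integral>\<^sup>+y. ennreal (brk (fst (x - y) :: int ^ 'd) powr (- s'))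
        * ennreal (indicator {k. \<tau> * schroedinger_phase k
            \<le> 4 * c} (fst x) * lam \<tau> (snd x + schroedinger_phase (fst x)) powr (- \<beta>))
        * ennreal (indicator {k. \<tau> * schroedinger_phase k
            \<le> 4 * c} (fst y) * lam \<tau> (snd y + schroedinger_phase (fst y)) powr (- \<beta>))
        * U x * V (x - y) * W y \<partial>freq_time_measure \<tau> \<partial>freq_time_measure \<tau>)\<^sup>2
    \<le> ennreal B * (\<integral>\<^sup>+x. (U x)\<^sup>2 \<partial>freq_time_measure \<tau>) * (\<integral>\<^sup>+x. (V x)\<^sup>2 \<partial>freq_time_measure \<tau>)
        * (\<integral>\<^sup>+x. (W x)\<^sup>2 \<partial>freq_time_measure \<tau>)"
  proof -
    have "s' > max 0 (real CARD('d) / 2 - 1)" "1/2 < \<beta>" "0 \<le> 4 * c" using s' s0 \<beta> c by auto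
    from trilinear_strichartz[where 'd = 'd, OF this] that show ?thesis by blast
  qed
  \<comment> \<open>The square of the constant of the kernel bound, times 10^2 for a sum of ten
    terms, times a common bound for their squares.\<close>
  define C where "C = C0\<^sup>2 * (100 * (D * A + B))"
  have "(\<integral>\<^sup>+x. \<integral>\<^sup>+y. ennreal (interaction_kernel c s b \<tau> e x (y :: (int ^ 'd) \<times> real)) * U x * V (x - y) * W y
      \<partial>freq_time_measure \<tau> \<partial>freq_time_measure \<tau>)\<^sup>2
    \<le> ennreal C * (\<integral>\<^sup>+x. (U x)\<^sup>2 \<partial>freq_time_measure \<tau>) * (\<integral>\<^sup>+x. (V x)\<^sup>2 \<partial>freq_time_measure \<tau>)
        * (\<integral>\<^sup>+x. (W x)\<^sup>2 \<partial>freq_time_measure \<tau>)"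
    if \<tau>: "0 < \<tau>" "\<tau> < 1" "\<bar>e\<bar> = 1"
      and per: "freq_time_periodic \<tau> U" "freq_time_periodic \<tau> V" "freq_time_periodic \<tau> W" for \<tau> e U V W
  proof -
    interpret T: conv_measure "time_measure \<tau>" "{2 * pi / \<tau>}" by (rule conv_measure_time_measure) fact
    interpret N: conv_measure "freq_time_measure \<tau> :: ((int ^ 'd) \<times> real) measure" "{(0, 2 * pi / \<tau>)}"
      by (rule conv_measure_freq_time_measure) fact
    define NN where "NN = (\<integral>\<^sup>+x. (U x)\<^sup>2 \<partial>freq_time_measure \<tau>) * (\<integral>\<^sup>+x. (V x)\<^sup>2 \<partial>freq_time_measure \<tau>)
        * (\<integral>\<^sup>+x. (W x)\<^sup>2 \<partial>freq_time_measure \<tau>)"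
    define a where "a = (\<lambda>k :: int ^ 'd. ennreal (brk k powr (- \<alpha>)))"
    define L where "L = (\<lambda>\<sigma>. ennreal (lam \<tau> \<sigma> powr (- 2 * b)))"
    define wphase where "wphase = (\<lambda>k :: int ^ 'd. e * norm (real_vec k))"
    define S where "S = (\<lambda>x y. ennreal (brk (fst (x - y) :: int ^ 'd) powr (- s'))
        * ennreal (indicator {k. \<tau> * schroedinger_phase k
            \<le> 4 * c} (fst x) * lam \<tau> (snd x + schroedinger_phase (fst x)) powr (- \<beta>))
        * ennreal (indicator {k. \<tau> * schroedinger_phase k
            \<le> 4 * c} (fst y) * lam \<tau> (snd y + schroedinger_phase (fst y)) powr (- \<beta>)))"
    \<comment> \<open>The nine indices of the grid are the products of a frequency and a modulation
      weight; the index (3, 3) outside the grid stands for the Strichartz piece.\<close>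
    define I where "I = insert (3, 3) ({..<3::nat} \<times> {..<3::nat})"
    define f where "f = (\<lambda>i x y. if i = (3, 3) then S x y else
       pick (fst i) (a (fst x)) (a (fst (x - y))) (a (fst y))
      * pick (snd i) (L (snd x + schroedinger_phase (fst x))) (L (snd (x - y)
          + wphase (fst (x - y)))) (L (snd y + schroedinger_phase (fst y))))"
    have I: "finite I" "card I = 10" by (simp_all add: I_def)
    have three: "{..<3} = {0, 1, 2::nat}" by auto
    have pow2: "(x powr y)\<^sup>2 = x powr (2 * y)" for x y :: real by (simp add: power2_eq_square flip: powr_add)
    have [measurable]: "L \<in> borel_measurable borel" unfolding L_def by measurable
    have Lper: "T.periodic L" using lam_periodic[OF \<tau>(1)] by (simp add: T.periodic_def L_def)
    have LD: "(\<integral>\<^sup>+\<sigma>. (L \<sigma>)\<^sup>2 \<partial>time_measure \<tau>) \<le> ennreal D"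
      using D(2)[OF \<tau>(1)] by (simp add: L_def ennreal_power pow2)
    have aA: "(\<integral>\<^sup>+k. (a k)\<^sup>2 \<partial>count_space UNIV) \<le> ennreal A"
      using A(2) by (simp add: a_def ennreal_power pow2)
    have le: "ennreal (interaction_kernel c s b \<tau> e x y) \<le> ennreal C0 * (\<Sum>i\<in>I. f i x y)" for x y
    proof -
      define r0 r1 r2 where "r0 = brk (fst x) powr (- \<alpha>)" and "r1
          = brk (fst (x - y)) powr (- \<alpha>)" and "r2 = brk (fst y) powr (- \<alpha>)"
      define t0 t1 t2 where "t0 = lam \<tau> (snd x + schroedinger_phase (fst x)) powr (- 2 * b)"
        and "t1 = lam \<tau> (snd (x - y) + e * norm (real_vec (fst (x - y)))) powr (- 2 * b)"
        and "t2 = lam \<tau> (snd y + schroedinger_phase (fst y)) powr (- 2 * b)"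
      define S' where "S' = brk (fst (x - y)) powr (- s')
        * (indicator {k. \<tau> * schroedinger_phase k \<le> 4 * c} (fst x) * lam \<tau> (snd x
            + schroedinger_phase (fst x)) powr (- \<beta>))
        * (indicator {k. \<tau> * schroedinger_phase k \<le> 4 * c} (fst y) * lam \<tau> (snd y
            + schroedinger_phase (fst y)) powr (- \<beta>))"
      have nn: "r0 \<ge> 0" "r1 \<ge> 0" "r2 \<ge> 0" "t0 \<ge> 0" "t1 \<ge> 0" "t2 \<ge> 0" "S' \<ge> 0"
        by (simp_all add: r0_def r1_def r2_def t0_def t1_def t2_def S'_def)
      have fS: "S x y = ennreal S'" unfolding S_def S'_def by (simp add: ennreal_mult mult.assoc)
      have "f (j, l) x y = pick j (ennreal r0) (ennreal r1) (ennreal r2)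
          * pick l (ennreal t0) (ennreal t1) (ennreal t2)"
        if "j < 3" for j l
        using that by (simp add: f_def a_def L_def wphase_def r0_def r1_def r2_def t0_def t1_def t2_def)
      note fj = this
      have "(\<Sum>i\<in>I. f i x y) = f (3, 3) x y + (\<Sum>i\<in>{..<3} \<times> {..<3}. f i x y)"
        by (simp add: I_def)
      also have "f (3, 3) x y = ennreal S'" using fS by (simp add: f_def)
      also have "(\<Sum>i\<in>{..<3} \<times> {..<3}. f i x y) = (\<Sum>(j, l)\<in>{..<3} \<times> {..<3}.
          pick j (ennreal r0) (ennreal r1) (ennreal r2) * pick l (ennreal t0) (ennreal t1) (ennreal t2))"
        by (rule sum.cong[OF refl]) (use fj in auto)
      also have "\<dots> = (\<Sum>j\<in>{..<3}. \<Sum>l\<in>{..<3}. pick j (ennreal r0) (ennreal r1) (ennreal r2)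
          * pick l (ennreal t0) (ennreal t1) (ennreal t2))"
        by (rule sum.cartesian_product[symmetric])
      also have "\<dots> = ennreal ((r0 + r1 + r2) * (t0 + t1 + t2))"
        using nn by (simp add: three pick_def algebra_simps flip: ennreal_mult ennreal_plus)
      finally have "ennreal C0 * (\<Sum>i\<in>I. f i x y) = ennreal (C0 * ((r0 + r1 + r2) * (t0 + t1 + t2) + S'))"
        using C0 nn by (simp add: add.commute flip: ennreal_mult ennreal_plus)
      then show ?thesis
        using kb[OF \<tau>, of x y] by (simp add: r0_def r1_def r2_def t0_def t1_def t2_def S'_def ennreal_leI)
    qed
    have fm: "(\<lambda>(x, y). f i x y) \<in> borel_measurable (freq_time_measure \<tau> \<Otimes>\<^sub>M freq_time_measure \<tau>)" for i
    proof -
      have d: "(\<lambda>p. fst p - snd p) \<in> freq_time_measure \<tau> \<Otimes>\<^sub>M freq_time_measure \<tau> \<rightarrow>\<^sub>M (freq_time_measure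
          \<tau> :: ((int ^ 'd) \<times> real) measure)"
        by measurable
      have m1: "(\<lambda>p. F (fst p)) \<in> borel_measurable (freq_time_measure \<tau> \<Otimes>\<^sub>M freq_time_measure \<tau>)"
          "(\<lambda>p. F (snd p)) \<in> borel_measurable (freq_time_measure \<tau> \<Otimes>\<^sub>M freq_time_measure \<tau>)"
          "(\<lambda>p. F (fst p - snd p)) \<in> borel_measurable (freq_time_measure \<tau> \<Otimes>\<^sub>M freq_time_measure \<tau>)"
        if "F \<in> borel_measurable (freq_time_measure \<tau>)" for F :: "(int ^ 'd) \<times> real \<Rightarrow> ennreal"
        using measurable_compose[OF measurable_fst that] measurable_compose[OF measurable_snd that]
          measurable_compose[OF d that] by auto
      have mL: "(\<lambda>p. L (snd p + \<phi> (fst p))) \<in> borel_measurable (freq_time_measure \<tau>)" for \<phi> :: "int ^ 'd \<Rightarrow> real"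
        by (rule measurable_phase_shift) simp
      have ma: "(\<lambda>p. a (fst p)) \<in> borel_measurable (freq_time_measure \<tau>)" by (rule measurable_freq_fun)
      have mb: "(\<lambda>p. ennreal (brk (fst p :: int ^ 'd) powr (- s'))) \<in> borel_measurable (freq_time_measure \<tau>)"
        by (rule measurable_freq_fun)
      have mi: "(\<lambda>p. ennreal (indicator {k. \<tau> * schroedinger_phase k
          \<le> 4 * c} (fst p :: int ^ 'd) * lam \<tau> (snd p + schroedinger_phase (fst p)) powr (- \<beta>))) \<in>
          borel_measurable (freq_time_measure \<tau>)"
        using measurable_freq_fun[of "\<lambda>k. indicator {k. \<tau> * schroedinger_phase k \<le> 4 * c} k :: real" \<tau>]
          measurable_phase_shift[OF measurable_lam, of \<tau> schroedinger_phase \<tau>] by measurable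
      note [measurable] = m1(1)[OF mL[of schroedinger_phase]] m1(2)[OF mL[of schroedinger_phase]]
          m1(3)[OF mL[of wphase]]
        m1(1)[OF ma] m1(2)[OF ma] m1(3)[OF ma] m1(3)[OF mb] m1(1)[OF mi] m1(2)[OF mi]
      show ?thesis unfolding f_def S_def pick_def split_beta' by measurable
    qed
    have each: "(N.trilinear_form (f i) U V W)\<^sup>2 \<le> ennreal (D * A + B) * NN" if "i \<in> I" for i
    proof (cases "i = (3, 3)")
      case True
      have "(N.trilinear_form (f i) U V W)\<^sup>2 \<le> ennreal B * NN"
        using strich[OF \<tau>(1,2) per] by (simp add: True f_def N.trilinear_form_def S_def NN_def mult.assoc)
      also have "\<dots> \<le> ennreal (D * A + B) * NN"
        using A(1) D(1) by (intro mult_right_mono ennreal_leI) auto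
      finally show ?thesis .
    next
      case False
      have "(N.trilinear_form (f i) U V W)\<^sup>2 \<le> ennreal D * ennreal A * NN"
        using trilinear_freq_time_pick[OF \<tau>(1) per Lper LD aA, of "fst i" "snd i" schroedinger_phase
            wphase schroedinger_phase] False
        by (simp add: f_def N.trilinear_form_def NN_def mult.assoc)
      also have "\<dots> \<le> ennreal (D * A + B) * NN"
        using A(1) D(1) B by (intro mult_right_mono) (auto intro!: ennreal_leI simp flip: ennreal_mult)
      finally show ?thesis .
    qed
    have "N.trilinear_form (\<lambda>x y. ennreal (interaction_kernel c s b \<tau> e x y)) U V W
        \<le> N.trilinear_form (\<lambda>x y. ennreal C0 * (\<Sum>i\<in>I. f i x y)) U V W"
      by (intro N.trilinear_form_mono le)
    also have "\<dots> = ennreal C0 * (\<Sum>i\<in>I. N.trilinear_form (f i) U V W)"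
      by (rule N.trilinear_form_sum[OF I(1) fm per])
    finally have "(N.trilinear_form (\<lambda>x y. ennreal (interaction_kernel c s b \<tau> e x y)) U V W)\<^sup>2
        \<le> (ennreal C0 * (\<Sum>i\<in>I. N.trilinear_form (f i) U V W))\<^sup>2" by (rule power_mono) simp
    also have "\<dots> = (ennreal C0)\<^sup>2 * (\<Sum>i\<in>I. N.trilinear_form (f i) U V W)\<^sup>2" by (simp add: power_mult_distrib)
    also have "\<dots> \<le> (ennreal C0)\<^sup>2 * ((of_nat (card I))\<^sup>2 * (ennreal (D * A + B) * NN))"
      by (intro mult_left_mono sum_square_le I each) auto
    also have "\<dots> = ennreal C * NN"
    proof -
      have "(ennreal C0)\<^sup>2 = ennreal (C0\<^sup>2)" using C0 by (rule ennreal_power)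
      moreover have "(of_nat (card I) :: ennreal)\<^sup>2 = ennreal 100"
        unfolding I(2) by (simp add: power2_eq_square)
      moreover have "ennreal C = ennreal (C0\<^sup>2) * (ennreal 100 * ennreal (D * A + B))"
      proof -
        have "D * A + B \<ge> 0" using A(1) B D(1) by simp
        then show ?thesis unfolding C_def by (simp only: ennreal_mult zero_le_power2 zero_le_numeral
            zero_le_mult_iff simp_thms)
      qed
      ultimately show ?thesis by (simp only: mult.assoc)
    qed
    finally show ?thesis by (simp add: N.trilinear_form_def NN_def mult.assoc)
  qed
  moreover have "C \<ge> 0" using A(1) B D(1) by (simp add: C_def)
  ultimately show ?thesis by blast
qed

section \<open>Discrete time Fourier transforms\<close>

definition energy :: "real \<Rightarrow> (real \<Rightarrow> complex) \<Rightarrow> ennreal" where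
  "energy \<tau> f = (\<integral>\<^sup>+\<sigma>. ennreal ((cmod (f \<sigma>))\<^sup>2) \<partial>time_measure \<tau>)"

definition partial_dft :: "real \<Rightarrow> (int \<Rightarrow> complex) \<Rightarrow> int set \<Rightarrow> real \<Rightarrow> complex" where
  "partial_dft \<tau> a F \<sigma> =
     complex_of_real \<tau> * (\<Sum>m\<in>F. a m * exp (- \<i> * complex_of_real (of_int m * \<tau> * \<sigma>)))"

text \<open>The transform of a scalar sequence, that is, of the coefficients at one fixed frequency.
  Sums, conjugates and products can be treated here without reference to the torus.\<close>

definition time_dft :: "real \<Rightarrow> (int \<Rightarrow> complex) \<Rightarrow> (real \<Rightarrow> complex) \<Rightarrow> bool" where
  "time_dft \<tau> a g \<longleftrightarrow> g \<in> borel_measurable borel \<and>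
     ((\<lambda>F. energy \<tau> (\<lambda>\<sigma>. partial_dft \<tau> a F \<sigma> - g \<sigma>)) \<longlongrightarrow> 0) (finite_subsets_at_top UNIV)"

lemma measurable_partial_dft [measurable]: "partial_dft \<tau> a F \<in> borel_measurable borel"
  unfolding partial_dft_def by measurable

lemma energy_eq:
  "f \<in> borel_measurable borel \<Longrightarrow>
    energy \<tau> f = (\<integral>\<^sup>+\<sigma>\<in>{- pi / \<tau> <..< pi / \<tau>}. ennreal ((cmod (f \<sigma>))\<^sup>2) \<partial>lborel)"
  unfolding energy_def by (rule nn_integral_time_measure) measurable

lemma is_dft_iff: "is_dft \<tau> v k g \<longleftrightarrow> time_dft \<tau> (\<lambda>m. fourier_coeff (v m) k) g"
proof (cases "g \<in> borel_measurable borel")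
  case [measurable]: True
  have "energy \<tau> (\<lambda>\<sigma>. partial_dft \<tau> a F \<sigma> - g \<sigma>) = (\<integral>\<^sup>+\<sigma>\<in>{- pi / \<tau> <..< pi / \<tau>}.
      ennreal ((cmod (partial_dft \<tau> a F \<sigma> - g \<sigma>))\<^sup>2) \<partial>lborel)" for a F
    by (rule energy_eq) measurable
  then show ?thesis using True by (simp add: is_dft_def time_dft_def partial_dft_def)
qed (simp add: is_dft_def time_dft_def)

lemma norm_sum_square_le: "(cmod (x + y))\<^sup>2 \<le> 2 * ((cmod x)\<^sup>2 + (cmod y)\<^sup>2)"
proof -
  have "(cmod (x + y))\<^sup>2 \<le> (cmod x + cmod y)\<^sup>2" by (intro power_mono norm_triangle_ineq) auto
  also have "\<dots> \<le> 2 * ((cmod x)\<^sup>2 + (cmod y)\<^sup>2)"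
    using zero_le_power2[of "cmod x - cmod y"] by (simp add: power2_sum power2_diff)
  finally show ?thesis .
qed

lemma energy_add_le:
  assumes [measurable]: "f \<in> borel_measurable borel" "g \<in> borel_measurable borel"
  shows "energy \<tau> (\<lambda>\<sigma>. f \<sigma> + g \<sigma>) \<le> 2 * (energy \<tau> f + energy \<tau> g)"
proof -
  have "energy \<tau> (\<lambda>\<sigma>. f \<sigma> + g \<sigma>) \<le> (\<integral>\<^sup>+\<sigma>. 2 * (ennreal ((cmod (f \<sigma>))\<^sup>2)
      + ennreal ((cmod (g \<sigma>))\<^sup>2)) \<partial>time_measure \<tau>)"
    unfolding energy_def
  proof (rule nn_integral_mono)
    fix \<sigma>
    have "ennreal ((cmod (f \<sigma> + g \<sigma>))\<^sup>2) \<le> ennreal (2 * ((cmod (f \<sigma>))\<^sup>2 + (cmod (g \<sigma>))\<^sup>2))"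
      by (intro ennreal_leI norm_sum_square_le)
    also have "\<dots> = 2 * (ennreal ((cmod (f \<sigma>))\<^sup>2) + ennreal ((cmod (g \<sigma>))\<^sup>2))"
      by (simp add: ennreal_mult)
    finally show "ennreal ((cmod (f \<sigma> + g \<sigma>))\<^sup>2) \<le> 2 * (ennreal ((cmod (f \<sigma>))\<^sup>2) + ennreal ((cmod (g \<sigma>))\<^sup>2))" .
  qed
  also have "\<dots> = 2 * (energy \<tau> f + energy \<tau> g)"
    unfolding energy_def by (subst nn_integral_cmult, measurable, subst nn_integral_add, measurable)
  finally show ?thesis .
qed

lemma energy_minus: "energy \<tau> (\<lambda>\<sigma>. - f \<sigma>) = energy \<tau> f"
  by (simp add: energy_def)

lemma energy_cmult:
  assumes [measurable]: "f \<in> borel_measurable borel"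
  shows "energy \<tau> (\<lambda>\<sigma>. z * f \<sigma>) = ennreal ((cmod z)\<^sup>2) * energy \<tau> f"
  unfolding energy_def norm_mult power_mult_distrib
  by (subst nn_integral_cmult[symmetric], measurable) (simp add: ennreal_mult)

lemma time_dft_measurable: "time_dft \<tau> a g \<Longrightarrow> g \<in> borel_measurable borel"
  by (simp add: time_dft_def)

text \<open>Limits in L2 of the same partial sums coincide. The lemma is needed because
  \<open>dft\<close> picks an arbitrary representative, about which only almost everywhere
  statements are possible.\<close>

lemma time_dft_unique:
  assumes "time_dft \<tau> a g" "time_dft \<tau> a h"
  shows "AE \<sigma> in time_measure \<tau>. g \<sigma> = h \<sigma>"
proof -
  note [measurable] = assms[THEN time_dft_measurable]
  let ?E = "\<lambda>F f. energy \<tau> (\<lambda>\<sigma>. partial_dft \<tau> a F \<sigma> - f \<sigma>)"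
  have "energy \<tau> (\<lambda>\<sigma>. h \<sigma> - g \<sigma>) \<le> 2 * (?E F g + ?E F h)" for F
  proof -
    have "energy \<tau> (\<lambda>\<sigma>. h \<sigma> - g \<sigma>) = energy \<tau> (\<lambda>\<sigma>. (partial_dft \<tau> a F \<sigma> - g \<sigma>) + - (partial_dft \<tau> a F \<sigma> - h \<sigma>))"
      by simp
    also have "\<dots> \<le> 2 * (?E F g + energy \<tau> (\<lambda>\<sigma>. - (partial_dft \<tau> a F \<sigma> - h \<sigma>)))"
      by (rule energy_add_le) measurable
    finally show ?thesis by (simp only: energy_minus)
  qed
  moreover have "((\<lambda>F. 2 * (?E F g + ?E F h)) \<longlongrightarrow> 2 * (0 + 0)) (finite_subsets_at_top UNIV)"
    using assms by (intro tendsto_mult_ennreal tendsto_add tendsto_const) (auto simp: time_dft_def)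
  ultimately have "energy \<tau> (\<lambda>\<sigma>. h \<sigma> - g \<sigma>) \<le> 2 * (0 + 0)"
    by (intro tendsto_lowerbound[where F = "finite_subsets_at_top UNIV"]) (auto intro: always_eventually)
  then have "(\<integral>\<^sup>+\<sigma>. ennreal ((cmod (h \<sigma> - g \<sigma>))\<^sup>2) \<partial>time_measure \<tau>) = 0" by (simp add: energy_def)
  then have "AE \<sigma> in time_measure \<tau>. ennreal ((cmod (h \<sigma> - g \<sigma>))\<^sup>2) = 0"
    by (subst (asm) nn_integral_0_iff_AE) measurable
  then show ?thesis by eventually_elim simp
qed

lemma time_dft_cong:
  assumes "time_dft \<tau> a g" "h \<in> borel_measurable borel" "\<And>\<sigma>. \<sigma> \<in> {- pi / \<tau> <..< pi / \<tau>} \<Longrightarrow> g \<sigma> = h \<sigma>"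
  shows "time_dft \<tau> a h"
proof -
  note [measurable] = time_dft_measurable[OF assms(1)] assms(2)
  have "energy \<tau> (\<lambda>\<sigma>. partial_dft \<tau> a F \<sigma> - g \<sigma>) = energy \<tau> (\<lambda>\<sigma>. partial_dft \<tau> a F \<sigma> - h \<sigma>)" for F
    using assms(3) by (simp add: energy_eq) (intro nn_integral_cong, auto simp: indicator_def)
  then show ?thesis using assms by (simp add: time_dft_def)
qed

lemma tendsto_zero_ennreal_le:
  fixes f g :: "'a \<Rightarrow> ennreal"
  assumes "\<And>x. f x \<le> g x" "(g \<longlongrightarrow> 0) N"
  shows "(f \<longlongrightarrow> 0) N"
  by (rule tendsto_sandwich[of "\<lambda>_. 0" f N g 0]) (use assms in \<open>auto intro: always_eventually\<close>)

lemma time_dft_zero: "time_dft \<tau> (\<lambda>_. 0) (\<lambda>_. 0)"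
  by (simp add: time_dft_def partial_dft_def energy_def)

lemma time_dft_add:
  assumes "time_dft \<tau> a g" "time_dft \<tau> b h"
  shows "time_dft \<tau> (\<lambda>m. a m + b m) (\<lambda>\<sigma>. g \<sigma> + h \<sigma>)"
proof -
  note [measurable] = assms[THEN time_dft_measurable]
  have "energy \<tau> (\<lambda>\<sigma>. partial_dft \<tau> (\<lambda>m. a m + b m) F \<sigma> - (g \<sigma> + h \<sigma>))
      \<le> 2 * (energy \<tau> (\<lambda>\<sigma>. partial_dft \<tau> a F \<sigma> - g \<sigma>) + energy \<tau> (\<lambda>\<sigma>. partial_dft \<tau> b F \<sigma> - h \<sigma>))" for F
  proof -
    have "partial_dft \<tau> (\<lambda>m. a m + b m) F \<sigma> - (g \<sigma> + h \<sigma>)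
        = (partial_dft \<tau> a F \<sigma> - g \<sigma>) + (partial_dft \<tau> b F \<sigma> - h \<sigma>)" for \<sigma>
      by (simp add: partial_dft_def sum.distrib algebra_simps)
    then show ?thesis by (simp only:) (rule energy_add_le, measurable)
  qed
  note le = this
  have "((\<lambda>F. 2 * (energy \<tau> (\<lambda>\<sigma>. partial_dft \<tau> a F \<sigma> - g \<sigma>) + energy \<tau> (\<lambda>\<sigma>. partial_dft \<tau> b F \<sigma> - h \<sigma>)))
      \<longlongrightarrow> 2 * (0 + 0)) (finite_subsets_at_top UNIV)"
    using assms by (intro tendsto_mult_ennreal tendsto_add tendsto_const) (auto simp: time_dft_def)
  moreover have "2 * (0 + 0) = (0 :: ennreal)" by simp
  ultimately have "((\<lambda>F. 2 * (energy \<tau> (\<lambda>\<sigma>. partial_dft \<tau> a F \<sigma> - g \<sigma>)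
      + energy \<tau> (\<lambda>\<sigma>. partial_dft \<tau> b F \<sigma> - h \<sigma>)))
      \<longlongrightarrow> 0) (finite_subsets_at_top UNIV)" by (simp only:)
  from tendsto_zero_ennreal_le[OF le this] show ?thesis unfolding time_dft_def by simp
qed

lemma time_dft_cmult:
  assumes "time_dft \<tau> a g"
  shows "time_dft \<tau> (\<lambda>m. z * a m) (\<lambda>\<sigma>. z * g \<sigma>)"
proof -
  note [measurable] = assms[THEN time_dft_measurable]
  have "energy \<tau> (\<lambda>\<sigma>. partial_dft \<tau> (\<lambda>m. z * a m) F \<sigma> - z * g \<sigma>)
      = ennreal ((cmod z)\<^sup>2) * energy \<tau> (\<lambda>\<sigma>. partial_dft \<tau> a F \<sigma> - g \<sigma>)" for F
  proof -
    have "partial_dft \<tau> (\<lambda>m. z * a m) F \<sigma> - z * g \<sigma> = z * (partial_dft \<tau> a F \<sigma> - g \<sigma>)" for \<sigma>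
      by (simp add: partial_dft_def sum_distrib_left algebra_simps)
    then show ?thesis by (simp only:) (rule energy_cmult, measurable)
  qed
  moreover have "((\<lambda>F. ennreal ((cmod z)\<^sup>2) * energy \<tau> (\<lambda>\<sigma>. partial_dft \<tau> a F \<sigma> - g \<sigma>))
      \<longlongrightarrow> ennreal ((cmod z)\<^sup>2) * 0) (finite_subsets_at_top UNIV)"
    using assms by (intro tendsto_mult_ennreal tendsto_const) (auto simp: time_dft_def)
  ultimately show ?thesis using assms by (simp add: time_dft_def)
qed

lemma time_dft_sum:
  assumes "finite S" "\<And>i. i \<in> S \<Longrightarrow> time_dft \<tau> (a i) (g i)"
  shows "time_dft \<tau> (\<lambda>m. \<Sum>i\<in>S. a i m) (\<lambda>\<sigma>. \<Sum>i\<in>S. g i \<sigma>)"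
  using assms by (induction S rule: finite_induct) (auto intro: time_dft_zero time_dft_add)

section \<open>Periodic representatives, finite energy and orthogonality\<close>

lemma exp_2pi_int: "exp (complex_of_int (2 * n) * (of_real pi * \<i>)) = 1"
  using exp_integer_2pi[of "of_int n"] by (simp add: mult_ac)

lemma partial_dft_periodic: "\<tau> \<noteq> 0 \<Longrightarrow> partial_dft \<tau> a F (\<sigma> + 2 * pi / \<tau>) = partial_dft \<tau> a F \<sigma>"
proof -
  assume \<tau>: "\<tau> \<noteq> 0"
  have "exp (- \<i> * complex_of_real (of_int m * \<tau> * (\<sigma> + 2 * pi / \<tau>)))
      = exp (- \<i> * complex_of_real (of_int m * \<tau> * \<sigma>))" for m
  proof -
    have "- \<i> * complex_of_real (of_int m * \<tau> * (\<sigma> + 2 * pi / \<tau>))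
        = - \<i> * complex_of_real (of_int m * \<tau> * \<sigma>) + complex_of_int (2 * (- m)) * (of_real pi * \<i>)"
      using \<tau> by (simp add: field_simps)
    then show ?thesis by (simp only: exp_add exp_2pi_int mult_1_right)
  qed
  then show ?thesis by (simp add: partial_dft_def)
qed

lemma energy_reflect:
  assumes \<tau>: "\<tau> > 0" and [measurable]: "f \<in> borel_measurable borel"
    and per: "\<And>\<sigma>. f (\<sigma> + 2 * pi / \<tau>) = f \<sigma>"
  shows "energy \<tau> (\<lambda>\<sigma>. f (- \<sigma>)) = energy \<tau> f"
proof -
  interpret conv_measure "time_measure \<tau>" "{2 * pi / \<tau>}" by (rule conv_measure_time_measure) fact
  have "periodic (\<lambda>\<sigma>. ennreal ((cmod (f \<sigma>))\<^sup>2))" by (simp add: periodic_def per)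
  from integral_refl[OF this] show ?thesis by (simp add: energy_def)
qed

lemma time_dft_cnj:
  assumes \<tau>: "\<tau> > 0" and g: "time_dft \<tau> a g" and per: "\<And>\<sigma>. g (\<sigma> + 2 * pi / \<tau>) = g \<sigma>"
  shows "time_dft \<tau> (\<lambda>m. cnj (a m)) (\<lambda>\<sigma>. cnj (g (- \<sigma>)))"
proof -
  note [measurable] = g[THEN time_dft_measurable]
  have "energy \<tau> (\<lambda>\<sigma>. partial_dft \<tau> (\<lambda>m. cnj (a m)) F \<sigma> - cnj (g (- \<sigma>)))
      = energy \<tau> (\<lambda>\<sigma>. partial_dft \<tau> a F \<sigma> - g \<sigma>)" for F
  proof -
    have "partial_dft \<tau> (\<lambda>m. cnj (a m)) F \<sigma> = cnj (partial_dft \<tau> a F (- \<sigma>))" for \<sigma>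
      by (simp add: partial_dft_def cnj_sum exp_cnj)
    then have "energy \<tau> (\<lambda>\<sigma>. partial_dft \<tau> (\<lambda>m. cnj (a m)) F \<sigma> - cnj (g (- \<sigma>)))
        = energy \<tau> (\<lambda>\<sigma>. partial_dft \<tau> a F (- \<sigma>) - g (- \<sigma>))"
      by (simp add: energy_def flip: complex_cnj_diff)
    also have "\<dots> = energy \<tau> (\<lambda>\<sigma>. partial_dft \<tau> a F \<sigma> - g \<sigma>)"
      using \<tau> by (intro energy_reflect) (auto simp: per partial_dft_periodic)
    finally show ?thesis .
  qed
  moreover have "(\<lambda>\<sigma>. cnj (g (- \<sigma>))) \<in> borel_measurable borel"
    by (rule borel_measurable_continuous_onI[THEN measurable_compose[rotated]]) (auto intro: continuous_intros)
  ultimately show ?thesis using g by (simp add: time_dft_def)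
qed

text \<open>The values on the open period interval determine a transform up to null sets. Repeating
  them periodically gives a representative for which convolution over a period is translation
  invariant.\<close>

lemma time_dft_periodize:
  assumes \<tau>: "\<tau> > 0" and g: "time_dft \<tau> a g"
  obtains h where "time_dft \<tau> a h" "\<And>\<sigma>. h (\<sigma> + 2 * pi / \<tau>) = h \<sigma>"
    "\<And>\<sigma>. \<sigma> \<in> {- pi / \<tau> <..< pi / \<tau>} \<Longrightarrow> h \<sigma> = g \<sigma>"
proof -
  note [measurable] = g[THEN time_dft_measurable]
  define P where "P = 2 * pi / \<tau>"
  have P: "P > 0" using \<tau> by (simp add: P_def)
  define h where "h = (\<lambda>\<sigma>. g (\<sigma> - P * of_int \<lfloor>(\<sigma> + P / 2) / P\<rfloor>))"
  have "h (\<sigma> + P) = h \<sigma>" for \<sigma>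
  proof -
    have "(\<sigma> + P + P / 2) / P = (\<sigma> + P / 2) / P + 1" using P by (simp add: field_simps)
    then have "\<lfloor>(\<sigma> + P + P / 2) / P\<rfloor> = \<lfloor>(\<sigma> + P / 2) / P\<rfloor> + 1" by simp
    then show ?thesis by (simp add: h_def algebra_simps)
  qed
  then have per: "h (\<sigma> + 2 * pi / \<tau>) = h \<sigma>" for \<sigma> by (simp add: P_def)
  have eq: "h \<sigma> = g \<sigma>" if "\<sigma> \<in> {- pi / \<tau> <..< pi / \<tau>}" for \<sigma>
  proof -
    have "\<sigma> + of_int 0 * P \<in> {- P / 2 ..< P / 2}" using that by (simp add: P_def)
    then have "\<lfloor>(\<sigma> + P / 2) / P\<rfloor> = 0" using ex_unique_period_shift[OF P, of \<sigma> 0] by simp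
    then show ?thesis by (simp add: h_def)
  qed
  have "h \<in> borel_measurable borel" unfolding h_def by measurable
  then have "time_dft \<tau> a h" using time_dft_cong[OF g] eq by simp
  then show ?thesis using that per eq by blast
qed

lemma finite_measure_time_measure: "\<tau> > 0 \<Longrightarrow> finite_measure (time_measure \<tau>)"
  by (intro finite_measureI) (simp add: time_measure_def emeasure_density)

lemma energy_partial_dft_finite:
  assumes \<tau>: "\<tau> > 0"
  shows "energy \<tau> (partial_dft \<tau> a F) < \<infinity>"
proof -
  interpret finite_measure "time_measure \<tau>" by (rule finite_measure_time_measure) fact
  define K where "K = \<tau> * (\<Sum>m\<in>F. cmod (a m))"
  have "cmod (partial_dft \<tau> a F \<sigma>) \<le> K" for \<sigma>
  proof -
    have "cmod (\<Sum>m\<in>F. a m * exp (- \<i> * complex_of_real (of_int m * \<tau> * \<sigma>))) \<le> (\<Sum>m\<in>F. cmod (a m))"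
      by (rule sum_norm_le) (simp add: norm_mult norm_exp_eq_Re)
    then show ?thesis using \<tau> by (simp add: partial_dft_def K_def norm_mult mult_left_mono)
  qed
  then have "energy \<tau> (partial_dft \<tau> a F) \<le> (\<integral>\<^sup>+\<sigma>. ennreal (K\<^sup>2) \<partial>time_measure \<tau>)"
    unfolding energy_def by (intro nn_integral_mono ennreal_leI power_mono) auto
  also have "\<dots> < \<infinity>" by (simp add: ennreal_mult_less_top emeasure_eq_measure)
  finally show ?thesis .
qed

text \<open>Some finite partial sum is within energy 1 of g, and partial sums are bounded functions
  on an interval of finite length.\<close>

lemma time_dft_energy_finite:
  assumes \<tau>: "\<tau> > 0" and g: "time_dft \<tau> a g"
  shows "energy \<tau> g < \<infinity>"
proof -
  note [measurable] = g[THEN time_dft_measurable]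
  have "eventually (\<lambda>F. energy \<tau> (\<lambda>\<sigma>. partial_dft \<tau> a F \<sigma> - g \<sigma>) < 1) (finite_subsets_at_top UNIV)"
    using g by (intro order_tendstoD(2)[of _ 0]) (auto simp: time_dft_def)
  then obtain F where F: "energy \<tau> (\<lambda>\<sigma>. partial_dft \<tau> a F \<sigma> - g \<sigma>) < 1"
    using eventually_happens'[OF finite_subsets_at_top_neq_bot] by blast
  have "energy \<tau> g = energy \<tau> (\<lambda>\<sigma>. partial_dft \<tau> a F \<sigma> + - (partial_dft \<tau> a F \<sigma> - g \<sigma>))" by simp
  also have "\<dots> \<le> 2 * (energy \<tau> (partial_dft \<tau> a F) + energy \<tau> (\<lambda>\<sigma>. - (partial_dft \<tau> a F \<sigma> - g \<sigma>)))"
    by (rule energy_add_le) measurable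
  also have "\<dots> < \<infinity>"
    unfolding energy_minus using energy_partial_dft_finite[OF \<tau>, of a F] F
    by (auto simp: ennreal_mult_less_top less_top intro: less_trans)
  finally show ?thesis .
qed

lemma integral_exp_period:
  assumes \<tau>: "\<tau> > 0"
  shows "(LINT \<sigma>|time_measure \<tau>. exp (\<i> * complex_of_real (of_int n * \<tau> * \<sigma>)))
    = (if n = 0 then complex_of_real (2 * pi / \<tau>) else 0)"
proof -
  have eq: "(LINT \<sigma>|time_measure \<tau>. exp (\<i> * complex_of_real (of_int n * \<tau> * \<sigma>)))
     = (LINT \<sigma>|lborel. indicator {- pi / \<tau> .. pi / \<tau>} \<sigma> *\<^sub>R exp (\<i> * complex_of_real (of_int n * \<tau> * \<sigma>)))"
  proof -
    have "time_measure \<tau> = density lborel (\<lambda>x. ennreal (indicator {- pi / \<tau> <..< pi / \<tau>} x))"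
      by (simp add: time_measure_def ennreal_indicator)
    then have "(LINT \<sigma>|time_measure \<tau>. exp (\<i> * complex_of_real (of_int n * \<tau> * \<sigma>)))
      = (LINT \<sigma>|lborel. indicator {- pi / \<tau> <..< pi / \<tau>} \<sigma> *\<^sub>R exp (\<i> * complex_of_real (of_int n * \<tau> * \<sigma>)))"
      by (simp add: integral_density)
    also have "\<dots> = (LINT \<sigma>|lborel. indicator {- pi / \<tau> .. pi / \<tau>} \<sigma> *\<^sub>R exp (\<i>
        * complex_of_real (of_int n * \<tau> * \<sigma>)))"
    proof (rule integral_cong_AE)
      have "AE \<sigma> in lborel. \<sigma> \<noteq> - pi / \<tau>" "AE \<sigma> in lborel. \<sigma> \<noteq> pi / \<tau>" by (rule AE_lborel_singleton)+
      then show "AE \<sigma> in lborel. indicator {- pi / \<tau> <..< pi / \<tau>} \<sigma> *\<^sub>R exp (\<i>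
          * complex_of_real (of_int n * \<tau> * \<sigma>))
         = indicator {- pi / \<tau> .. pi / \<tau>} \<sigma> *\<^sub>R exp (\<i> * complex_of_real (of_int n * \<tau> * \<sigma>))"
        by eventually_elim (auto simp: indicator_def)
    qed measurable
    finally show ?thesis .
  qed
  show ?thesis
  proof (cases "n = 0")
    case True
    have "(LINT \<sigma>|lborel. indicator {- pi / \<tau> .. pi / \<tau>} \<sigma> *\<^sub>R (1::complex)) = complex_of_real (2 * pi / \<tau>)"
      using \<tau> by (simp add: measure_def scaleR_conv_of_real)
    then show ?thesis using True eq by simp
  next
    case False
    define F where "F = (\<lambda>\<sigma>::real. exp (\<i> * complex_of_real (of_int n * \<tau> * \<sigma>)) / (\<i>
        * complex_of_real (of_int n * \<tau>)))"
    have nz: "\<i> * complex_of_real (of_int n * \<tau>) \<noteq> 0" using False \<tau> by simp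
    have "(LINT \<sigma>|lborel. indicator {- pi / \<tau> .. pi / \<tau>} \<sigma> *\<^sub>R exp (\<i> * complex_of_real (of_int n * \<tau> * \<sigma>)))
        = F (pi / \<tau>) - F (- pi / \<tau>)"
    proof (rule integral_FTC_Icc)
      show "(F has_vector_derivative exp (\<i> * complex_of_real (of_int n * \<tau>
          * x))) (at x within {- pi / \<tau> .. pi / \<tau>})" for x
      proof -
        have "((\<lambda>z. exp (\<i> * complex_of_real (of_int n * \<tau>) * z) / (\<i> * complex_of_real (of_int n * \<tau>)))
            has_field_derivative exp (\<i> * complex_of_real (of_int n * \<tau>)
                * complex_of_real x)) (at (complex_of_real x))"
          using nz by (auto intro!: derivative_eq_intros)
        from has_vector_derivative_real_field[OF this] show ?thesis
          unfolding F_def by (simp add: mult.assoc has_vector_derivative_at_within)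
      qed
      show "continuous_on {- pi / \<tau> .. pi / \<tau>} (\<lambda>\<sigma>. exp (\<i> * complex_of_real (of_int n * \<tau> * \<sigma>)))"
        by (intro continuous_intros)
    qed (use \<tau> in auto)
    also have "F (pi / \<tau>) = F (- pi / \<tau>)"
    proof -
      have "\<i> * complex_of_real (of_int n * \<tau> * (pi / \<tau>))
          = \<i> * complex_of_real (of_int n * \<tau> * (- pi / \<tau>)) + complex_of_int (2 * n) * (of_real pi * \<i>)"
        using \<tau> by (simp add: field_simps)
      then have "exp (\<i> * complex_of_real (of_int n * \<tau> * (pi / \<tau>)))
          = exp (\<i> * complex_of_real (of_int n * \<tau> * (- pi / \<tau>)))"
        by (simp only: exp_add exp_2pi_int mult_1_right)
      then show ?thesis by (simp only: F_def)
    qed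
    finally show ?thesis using False eq by simp
  qed
qed

section \<open>Transforms of products\<close>

text \<open>The normalisation matches termwise products of sequences: two transforms carry \<tau>^2,
  orthogonality contributes 2 pi / \<tau>, and division by 2 pi leaves the single \<tau> of a
  transform.\<close>

definition periodic_conv :: "real \<Rightarrow> (real \<Rightarrow> complex) \<Rightarrow> (real \<Rightarrow> complex) \<Rightarrow> real \<Rightarrow> complex" where
  "periodic_conv \<tau> A B \<sigma> = (LINT x|time_measure \<tau>. A (\<sigma> - x) * B x) / complex_of_real (2 * pi)"

definition periodic_signal :: "real \<Rightarrow> (real \<Rightarrow> complex) \<Rightarrow> bool" where
  "periodic_signal \<tau> A \<longleftrightarrow> A \<in> borel_measurable borel \<and> (\<forall>\<sigma>. A (\<sigma> + 2 * pi / \<tau>) = A \<sigma>)"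

lemma periodic_signal_measurable: "periodic_signal \<tau> A \<Longrightarrow> A \<in> borel_measurable borel"
  by (simp add: periodic_signal_def)

lemma periodic_signal_diff: "periodic_signal \<tau> A \<Longrightarrow> periodic_signal \<tau> B \<Longrightarrow> periodic_signal \<tau> (\<lambda>\<sigma>. A \<sigma> - B \<sigma>)"
  by (auto simp: periodic_signal_def intro: borel_measurable_diff)

lemma periodic_signal_partial_dft: "\<tau> \<noteq> 0 \<Longrightarrow> periodic_signal \<tau> (partial_dft \<tau> a F)"
  by (simp add: periodic_signal_def partial_dft_periodic)

lemma convolution_square_le:
  assumes \<tau>: "\<tau> > 0" and A: "periodic_signal \<tau> A" and B: "periodic_signal \<tau> B"
  shows "(\<integral>\<^sup>+x. ennreal (cmod (A (\<sigma> - x))) * ennreal (cmod (B x)) \<partial>time_measure \<tau>)\<^sup>2 \<le> energy \<tau> A * energy \<tau> B"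
proof -
  interpret conv_measure "time_measure \<tau>" "{2 * pi / \<tau>}" by (rule conv_measure_time_measure) fact
  note [measurable] = A[THEN periodic_signal_measurable] B[THEN periodic_signal_measurable]
  have per: "periodic (\<lambda>x. (ennreal (cmod (A x)))\<^sup>2)" using A by (simp add: periodic_def periodic_signal_def)
  have sq: "(\<integral>\<^sup>+x. (ennreal (cmod (f x)))\<^sup>2 \<partial>time_measure \<tau>) = energy \<tau> f" for f :: "real \<Rightarrow> complex"
    by (simp add: energy_def ennreal_power)
  have "(\<integral>\<^sup>+x. ennreal (cmod (A (\<sigma> - x))) * ennreal (cmod (B x)) \<partial>time_measure \<tau>)\<^sup>2
      \<le> (\<integral>\<^sup>+x. (ennreal (cmod (A (\<sigma> - x))))\<^sup>2 \<partial>time_measure \<tau>)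
          * (\<integral>\<^sup>+x. (ennreal (cmod (B x)))\<^sup>2 \<partial>time_measure \<tau>)"
    by (rule Cauchy_Schwarz_nn_integral) measurable
  then show ?thesis unfolding integral_diff2[OF per] sq .
qed

lemma convolution_integrable:
  assumes \<tau>: "\<tau> > 0" and A: "periodic_signal \<tau> A" "energy \<tau> A < \<infinity>" and B: "periodic_signal \<tau> B" "energy \<tau> B < \<infinity>"
  shows "integrable (time_measure \<tau>) (\<lambda>x. A (\<sigma> - x) * B x)"
proof (rule integrableI_bounded)
  note [measurable] = A(1)[THEN periodic_signal_measurable] B(1)[THEN periodic_signal_measurable]
  show "(\<lambda>x. A (\<sigma> - x) * B x) \<in> borel_measurable (time_measure \<tau>)" by measurable
  have "energy \<tau> A * energy \<tau> B < \<infinity>" using A(2) B(2) by (simp add: ennreal_mult_less_top)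
  with convolution_square_le[OF \<tau> A(1) B(1), of \<sigma>]
  have "(\<integral>\<^sup>+x. ennreal (cmod (A (\<sigma> - x))) * ennreal (cmod (B x)) \<partial>time_measure \<tau>)\<^sup>2 < \<infinity>" by (rule le_less_trans)
  then have "(\<integral>\<^sup>+x. ennreal (cmod (A (\<sigma> - x))) * ennreal (cmod (B x)) \<partial>time_measure \<tau>) < \<infinity>"
    by (simp add: power2_eq_square ennreal_mult_less_top) (auto simp: less_top)
  then show "(\<integral>\<^sup>+x. ennreal (norm (A (\<sigma> - x) * B x)) \<partial>time_measure \<tau>) < \<infinity>"
    by (simp add: norm_mult ennreal_mult)
qed

text \<open>For a function that is not integrable the integral has the default value 0 and the bound
  is trivial. The factor 1 / (2 pi) is estimated by 1.\<close>

lemma norm_integral_div_2pi_le: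
  "ennreal (cmod ((LINT x|M. f x) / complex_of_real (2 * pi))) \<le> (\<integral>\<^sup>+x. ennreal (cmod (f x)) \<partial>M)"
proof (cases "integrable M f")
  case True
  have "cmod ((LINT x|M. f x) / complex_of_real (2 * pi)) \<le> cmod (LINT x|M. f x) / 1"
    unfolding norm_divide using pi_gt3 by (intro divide_left_mono) auto
  then have "ennreal (cmod ((LINT x|M. f x) / complex_of_real (2 * pi))) \<le> ennreal (cmod (LINT x|M. f x))"
    by (intro ennreal_leI) simp
  also have "\<dots> \<le> (\<integral>\<^sup>+x. ennreal (cmod (f x)) \<partial>M)" by (rule integral_norm_bound_ennreal[OF True])
  finally show ?thesis .
qed (simp add: not_integrable_integral_eq)

lemma norm_periodic_conv_le:
  "ennreal (cmod (periodic_conv \<tau> A B \<sigma>)) \<le> (\<integral>\<^sup>+x. ennreal (cmod (A (\<sigma> - x)))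
      * ennreal (cmod (B x)) \<partial>time_measure \<tau>)"
  using norm_integral_div_2pi_le[of "time_measure \<tau>" "\<lambda>x. A (\<sigma> - x) * B x"]
  by (simp add: periodic_conv_def norm_mult ennreal_mult)

lemma measurable_periodic_conv:
  assumes \<tau>: "\<tau> > 0" and [measurable]: "A \<in> borel_measurable borel" "B \<in> borel_measurable borel"
  shows "periodic_conv \<tau> A B \<in> borel_measurable borel"
proof -
  interpret conv_measure "time_measure \<tau>" "{2 * pi / \<tau>}" by (rule conv_measure_time_measure) fact
  have "(\<lambda>(\<sigma>, x). A (\<sigma> - x) * B x) \<in> borel_measurable (borel \<Otimes>\<^sub>M time_measure \<tau>)" by measurable
  from borel_measurable_lebesgue_integral[OF this] have [measurable]:
    "(\<lambda>\<sigma>. LINT x|time_measure \<tau>. A (\<sigma> - x) * B x) \<in> borel_measurable borel" by simp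
  show ?thesis unfolding periodic_conv_def by measurable
qed

text \<open>Convolution is continuous from L2 times L2 to bounded functions, by A B - A' B' = (A -
  A') B + A' (B - B'). The constant 3 comes from the crude p q \<le> p^2 + q^2 in the square of p +
  q.\<close>

lemma periodic_conv_diff_le:
  assumes \<tau>: "\<tau> > 0" and A: "periodic_signal \<tau> A" "energy \<tau> A < \<infinity>" "periodic_signal \<tau> A'" "energy \<tau> A' < \<infinity>"
    and B: "periodic_signal \<tau> B" "energy \<tau> B < \<infinity>" "periodic_signal \<tau> B'" "energy \<tau> B' < \<infinity>"
  shows "ennreal ((cmod (periodic_conv \<tau> A B \<sigma> - periodic_conv \<tau> A' B' \<sigma>))\<^sup>2)
    \<le> 3 * (energy \<tau> (\<lambda>x. A x - A' x) * energy \<tau> B + energy \<tau> A' * energy \<tau> (\<lambda>x. B x - B' x))"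
proof -
  note [measurable] = A(1,3)[THEN periodic_signal_measurable] B(1,3)[THEN periodic_signal_measurable]
  define p where "p = (\<integral>\<^sup>+x. ennreal (cmod (A (\<sigma> - x) - A' (\<sigma> - x))) * ennreal (cmod (B x)) \<partial>time_measure \<tau>)"
  define q where "q = (\<integral>\<^sup>+x. ennreal (cmod (A' (\<sigma> - x))) * ennreal (cmod (B x - B' x)) \<partial>time_measure \<tau>)"
  have "periodic_conv \<tau> A B \<sigma> - periodic_conv \<tau> A' B' \<sigma>
      = (LINT x|time_measure \<tau>. A (\<sigma> - x) * B x - A' (\<sigma> - x) * B' x) / complex_of_real (2 * pi)"
    unfolding periodic_conv_def
    by (subst Bochner_Integration.integral_diff[OF convolution_integrable[OF \<tau> A(1,2) B(1,2)]
        convolution_integrable[OF \<tau> A(3,4) B(3,4)]])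
      (simp add: diff_divide_distrib)
  then have "ennreal (cmod (periodic_conv \<tau> A B \<sigma> - periodic_conv \<tau> A' B' \<sigma>))
      \<le> (\<integral>\<^sup>+x. ennreal (cmod (A (\<sigma> - x) * B x - A' (\<sigma> - x) * B' x)) \<partial>time_measure \<tau>)"
    by (simp only: norm_integral_div_2pi_le)
  also have "\<dots> \<le> (\<integral>\<^sup>+x. ennreal (cmod (A (\<sigma> - x) - A' (\<sigma> - x))) * ennreal (cmod (B x))
      + ennreal (cmod (A' (\<sigma> - x))) * ennreal (cmod (B x - B' x)) \<partial>time_measure \<tau>)"
  proof (rule nn_integral_mono)
    fix x
    have "A (\<sigma> - x) * B x - A' (\<sigma> - x) * B' x = (A (\<sigma> - x) - A' (\<sigma> - x)) * B x + A' (\<sigma> - x) * (B x - B' x)"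
      by (simp add: algebra_simps)
    then have "cmod (A (\<sigma> - x) * B x - A' (\<sigma> - x) * B' x)
        \<le> cmod (A (\<sigma> - x) - A' (\<sigma> - x)) * cmod (B x) + cmod (A' (\<sigma> - x)) * cmod (B x - B' x)"
      by (simp only: norm_mult[symmetric] norm_triangle_ineq)
    then show "ennreal (cmod (A (\<sigma> - x) * B x - A' (\<sigma> - x) * B' x))
        \<le> ennreal (cmod (A (\<sigma> - x) - A' (\<sigma> - x))) * ennreal (cmod (B x)) + ennreal (cmod (A' (\<sigma> - x)))
            * ennreal (cmod (B x - B' x))"
      by (simp add: ennreal_leI flip: ennreal_mult ennreal_plus)
  qed
  also have "\<dots> = p + q" unfolding p_def q_def by (rule nn_integral_add) measurable
  finally have "(ennreal (cmod (periodic_conv \<tau> A B \<sigma> - periodic_conv \<tau> A' B' \<sigma>)))\<^sup>2 \<le> (p + q)\<^sup>2"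
    by (rule power_mono) simp
  also have "\<dots> = (p\<^sup>2 + q\<^sup>2) + (p * q + p * q)" by (simp add: power2_eq_square distrib_left
      distrib_right add_ac mult_ac)
  also have "\<dots> \<le> (p\<^sup>2 + q\<^sup>2) + ((p\<^sup>2 + q\<^sup>2) + (p\<^sup>2 + q\<^sup>2))"
    by (intro add_left_mono add_mono ennreal_mult_le_sum_squares)
  also have "\<dots> = 3 * (p\<^sup>2 + q\<^sup>2)"
  proof -
    have "(3 :: ennreal) = 1 + (1 + 1)" by simp
    then show ?thesis by (simp only: distrib_right mult_1)
  qed
  also have "\<dots> \<le> 3 * (energy \<tau> (\<lambda>x. A x - A' x) * energy \<tau> B + energy \<tau> A' * energy \<tau> (\<lambda>x. B x - B' x))"
    unfolding p_def q_def
    using convolution_square_le[OF \<tau> periodic_signal_diff[OF A(1,3)] B(1), of \<sigma>]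
      convolution_square_le[OF \<tau> A(3) periodic_signal_diff[OF B(1,3)], of \<sigma>]
    by (intro mult_left_mono add_mono) auto
  finally show ?thesis by (simp add: ennreal_power)
qed

text \<open>Orthogonality of the exponentials over a period removes all off-diagonal terms, so for
  finite sums the convolution theorem is an identity.\<close>

lemma periodic_conv_partial_dft:
  assumes \<tau>: "\<tau> > 0" and F: "finite F"
  shows "periodic_conv \<tau> (partial_dft \<tau> a F) (partial_dft \<tau> b F) \<sigma> = partial_dft \<tau> (\<lambda>m. a m * b m) F \<sigma>"
proof -
  interpret finite_measure "time_measure \<tau>" by (rule finite_measure_time_measure) fact
  define e where "e = (\<lambda>n x. exp (\<i> * complex_of_real (of_int n * \<tau> * x)))"
  have int: "integrable (time_measure \<tau>) (e n)" for n
    by (rule integrable_const_bound[where B = 1]) (auto simp: e_def norm_exp_eq_Re)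
  have prod: "partial_dft \<tau> a F (\<sigma> - x) * partial_dft \<tau> b F x
      = (\<Sum>m\<in>F. \<Sum>n\<in>F. (complex_of_real (\<tau>\<^sup>2) * a m * b n * exp (- \<i> * complex_of_real (of_int m * \<tau>
          * \<sigma>))) * e (m - n) x)" for x
  proof -
    have "partial_dft \<tau> a F (\<sigma> - x) * partial_dft \<tau> b F x = (\<Sum>m\<in>F. \<Sum>n\<in>F. complex_of_real (\<tau>\<^sup>2) *
        ((a m * exp (- \<i> * complex_of_real (of_int m * \<tau> * (\<sigma> - x)))) * (b n * exp (- \<i>
            * complex_of_real (of_int n * \<tau> * x)))))"
      unfolding partial_dft_def
      by (simp add: sum_product sum_distrib_left power2_eq_square mult_ac)
    also have "\<dots> = (\<Sum>m\<in>F. \<Sum>n\<in>F. (complex_of_real (\<tau>\<^sup>2) * a m * b n * exp (- \<i>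
        * complex_of_real (of_int m * \<tau> * \<sigma>))) * e (m - n) x)"
    proof (intro sum.cong refl)
      fix m n
      have "exp (- \<i> * complex_of_real (of_int m * \<tau> * (\<sigma> - x))) * exp (- \<i>
          * complex_of_real (of_int n * \<tau> * x))
          = exp (- \<i> * complex_of_real (of_int m * \<tau> * \<sigma>)) * e (m - n) x"
        unfolding e_def exp_add[symmetric] by (simp add: algebra_simps)
      then show "complex_of_real (\<tau>\<^sup>2) *
        ((a m * exp (- \<i> * complex_of_real (of_int m * \<tau> * (\<sigma> - x)))) * (b n * exp (- \<i>
            * complex_of_real (of_int n * \<tau> * x))))
        = (complex_of_real (\<tau>\<^sup>2) * a m * b n * exp (- \<i> * complex_of_real (of_int m * \<tau> * \<sigma>))) * e (m - n) x"
        by (metis (no_types, opaque_lifting) mult.assoc mult.left_commute)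
    qed
    finally show ?thesis .
  qed
  have "(LINT x|time_measure \<tau>. partial_dft \<tau> a F (\<sigma> - x) * partial_dft \<tau> b F x)
      = (\<Sum>m\<in>F. \<Sum>n\<in>F. (complex_of_real (\<tau>\<^sup>2) * a m * b n * exp (- \<i> * complex_of_real (of_int m * \<tau> * \<sigma>)))
          * (LINT x|time_measure \<tau>. e (m - n) x))"
    unfolding prod using int by (simp add: Bochner_Integration.integral_sum)
  also have "\<dots> = (\<Sum>m\<in>F. \<Sum>n\<in>F. if n = m then (complex_of_real (\<tau>\<^sup>2) * a m * b m * exp (- \<i>
      * complex_of_real (of_int m * \<tau> * \<sigma>)))
          * complex_of_real (2 * pi / \<tau>) else 0)"
    unfolding e_def integral_exp_period[OF \<tau>] by (intro sum.cong refl) auto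
  also have "\<dots> = (\<Sum>m\<in>F. (complex_of_real (\<tau>\<^sup>2) * a m * b m * exp (- \<i> * complex_of_real (of_int m * \<tau> * \<sigma>)))
          * complex_of_real (2 * pi / \<tau>))"
    using F by (simp add: sum.delta)
  also have "\<dots> = complex_of_real (2 * pi) * partial_dft \<tau> (\<lambda>m. a m * b m) F \<sigma>"
    using \<tau> by (simp add: partial_dft_def sum_distrib_left power2_eq_square mult_ac)
  finally show ?thesis by (simp add: periodic_conv_def)
qed

text \<open>The convolution theorem is exact on partial sums. Both sides pass to the limit, since
  convolution is continuous into bounded functions and a period has finite measure.\<close>

lemma time_dft_mult:
  assumes \<tau>: "\<tau> > 0" and A: "time_dft \<tau> a A" "\<And>\<sigma>. A (\<sigma> + 2 * pi / \<tau>) = A \<sigma>"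
    and B: "time_dft \<tau> b B" "\<And>\<sigma>. B (\<sigma> + 2 * pi / \<tau>) = B \<sigma>"
  shows "time_dft \<tau> (\<lambda>m. a m * b m) (periodic_conv \<tau> A B)"
proof -
  interpret finite_measure "time_measure \<tau>" by (rule finite_measure_time_measure) fact
  have pA: "periodic_signal \<tau> A" "energy \<tau> A < \<infinity>" and pB: "periodic_signal \<tau> B" "energy \<tau> B < \<infinity>"
    using A B time_dft_energy_finite[OF \<tau>] by (auto simp: periodic_signal_def time_dft_def)
  note [measurable] = pA(1)[THEN periodic_signal_measurable] pB(1)[THEN periodic_signal_measurable]
  let ?ea = "\<lambda>F. energy \<tau> (\<lambda>\<sigma>. partial_dft \<tau> a F \<sigma> - A \<sigma>)"
  let ?eb = "\<lambda>F. energy \<tau> (\<lambda>\<sigma>. partial_dft \<tau> b F \<sigma> - B \<sigma>)"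
  define K where "K = emeasure (time_measure \<tau>) UNIV"
  have K: "K < \<infinity>" by (simp add: K_def emeasure_eq_measure)
  have "energy \<tau> (\<lambda>\<sigma>. partial_dft \<tau> (\<lambda>m. a m * b m) F \<sigma> - periodic_conv \<tau> A B \<sigma>)
      \<le> 3 * (?ea F * (2 * (?eb F + energy \<tau> B)) + energy \<tau> A * ?eb F) * K" if F: "finite F" for F
  proof -
    have pF: "periodic_signal \<tau> (partial_dft \<tau> a F)" "periodic_signal \<tau> (partial_dft \<tau> b F)"
      using \<tau> by (auto intro: periodic_signal_partial_dft)
    have eb: "energy \<tau> (partial_dft \<tau> b F) \<le> 2 * (?eb F + energy \<tau> B)"
      using energy_add_le[of "\<lambda>\<sigma>. partial_dft \<tau> b F \<sigma> - B \<sigma>" B \<tau>] by simp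
    have "energy \<tau> (\<lambda>\<sigma>. partial_dft \<tau> (\<lambda>m. a m * b m) F \<sigma> - periodic_conv \<tau> A B \<sigma>)
        \<le> (\<integral>\<^sup>+\<sigma>. 3 * (?ea F * (2 * (?eb F + energy \<tau> B)) + energy \<tau> A * ?eb F) \<partial>time_measure \<tau>)"
      unfolding energy_def[of \<tau> "\<lambda>\<sigma>. partial_dft \<tau> (\<lambda>m. a m * b m) F \<sigma> - periodic_conv \<tau> A B \<sigma>"]
    proof (rule nn_integral_mono)
      fix \<sigma>
      have "ennreal ((cmod (partial_dft \<tau> (\<lambda>m. a m * b m) F \<sigma> - periodic_conv \<tau> A B \<sigma>))\<^sup>2)
          \<le> 3 * (?ea F * energy \<tau> (partial_dft \<tau> b F) + energy \<tau> A * ?eb F)"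
        unfolding periodic_conv_partial_dft[OF \<tau> F, symmetric]
        by (rule periodic_conv_diff_le[OF \<tau> pF(1) energy_partial_dft_finite[OF \<tau>] pA pF(2)
            energy_partial_dft_finite[OF \<tau>] pB])
      also have "\<dots> \<le> 3 * (?ea F * (2 * (?eb F + energy \<tau> B)) + energy \<tau> A * ?eb F)"
        by (intro mult_left_mono add_right_mono eb) auto
      finally show "ennreal ((cmod (partial_dft \<tau> (\<lambda>m. a m * b m) F \<sigma> - periodic_conv \<tau> A B \<sigma>))\<^sup>2)
          \<le> 3 * (?ea F * (2 * (?eb F + energy \<tau> B)) + energy \<tau> A * ?eb F)" .
    qed
    then show ?thesis by (simp add: K_def)
  qed
  then have le: "eventually (\<lambda>F. energy \<tau> (\<lambda>\<sigma>. partial_dft \<tau> (\<lambda>m. a m * b m) F \<sigma> - periodic_conv \<tau> A B \<sigma>)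
      \<le> 3 * (?ea F * (2 * (?eb F + energy \<tau> B)) + energy \<tau> A * ?eb F) * K) (finite_subsets_at_top UNIV)"
    by (intro eventually_finite_subsets_at_top_weakI)
  \<comment> \<open>All fixed energies and the measure of the period are finite, which is what lets
    products of extended reals converge to 0 here.\<close>
  have lim: "((\<lambda>F. 3 * (?ea F * (2 * (?eb F + energy \<tau> B)) + energy \<tau> A * ?eb F) * K)
      \<longlongrightarrow> 3 * (0 * (2 * (0 + energy \<tau> B)) + energy \<tau> A * 0) * K) (finite_subsets_at_top UNIV)"
    using A(1) B(1) K pA(2) pB(2)
    by (intro tendsto_mult_ennreal tendsto_add tendsto_const) (auto simp: time_dft_def ennreal_mult_eq_top_iff)
  have "3 * (0 * (2 * (0 + energy \<tau> B)) + energy \<tau> A * 0) * K = 0" by simp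
  from lim[unfolded this] have lim0: "((\<lambda>F. 3 * (?ea F * (2 * (?eb F + energy \<tau> B)) + energy \<tau> A * ?eb F) * K)
      \<longlongrightarrow> 0) (finite_subsets_at_top UNIV)" .
  have "((\<lambda>F. energy \<tau> (\<lambda>\<sigma>. partial_dft \<tau> (\<lambda>m. a m * b m) F \<sigma> - periodic_conv \<tau> A B \<sigma>)) \<longlongrightarrow> 0)
      (finite_subsets_at_top UNIV)"
    by (rule tendsto_sandwich[OF _ le tendsto_const lim0]) simp
  then show ?thesis
    using measurable_periodic_conv[OF \<tau>, of A B] by (simp add: time_dft_def)
qed

section \<open>Fourier coefficients of trigonometric polynomials and of filtered products\<close>

lemma lborel_integral_prod_Basis:
  fixes h :: "'a::euclidean_space \<Rightarrow> real \<Rightarrow> complex"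
  assumes "\<And>b. b \<in> Basis \<Longrightarrow> integrable lborel (h b)"
  shows "(LINT x|lborel. (\<Prod>b\<in>Basis. h b (x \<bullet> b))) = (\<Prod>b\<in>(Basis :: 'a set). LINT t|lborel. h b t)"
proof -
  interpret product_sigma_finite "\<lambda>_::'a. lborel :: real measure" ..
  have [measurable]: "h b \<in> borel_measurable borel" if "b \<in> Basis" for b
    using borel_measurable_integrable[OF assms[OF that]] by simp
  have m: "(\<lambda>x :: 'a. \<Prod>b\<in>Basis. h b (x \<bullet> b)) \<in> borel_measurable borel" by measurable
  have "(LINT x|lborel. (\<Prod>b\<in>Basis. h b ((x :: 'a) \<bullet> b)))
      = (LINT x|distr (\<Pi>\<^sub>M b\<in>Basis. lborel) borel (\<lambda>f. \<Sum>b\<in>Basis. f b *\<^sub>R b). (\<Prod>b\<in>Basis. h b ((x :: 'a) \<bullet> b)))"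
    by (subst lborel_eq[where 'a = 'a]) (rule refl)
  also have "\<dots> = (LINT f|(\<Pi>\<^sub>M b\<in>Basis. lborel). (\<Prod>b\<in>Basis. h b ((\<Sum>b\<in>Basis. f b *\<^sub>R b :: 'a) \<bullet> b)))"
  proof (rule integral_distr[OF _ m])
    show "(\<lambda>f. \<Sum>b\<in>Basis. f b *\<^sub>R b :: 'a) \<in> (\<Pi>\<^sub>M b\<in>Basis. lborel) \<rightarrow>\<^sub>M borel"
      by measurable
  qed
  also have "\<dots> = (LINT f|(\<Pi>\<^sub>M b\<in>(Basis :: 'a set). lborel). (\<Prod>b\<in>Basis. h b (f b)))"
    by (simp add: inner_sum_left inner_Basis if_distrib cong: if_cong)
  also have "\<dots> = (\<Prod>b\<in>(Basis :: 'a set). LINT t|lborel. h b t)"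
    by (rule product_integral_prod) (use assms in auto)
  finally show ?thesis .
qed

definition torus_char :: "int ^ 'd \<Rightarrow> real ^ 'd \<Rightarrow> complex" where
  "torus_char k x = exp (\<i> * complex_of_real (real_vec k \<bullet> x))"

lemma integral_exp_2pi:
  "(LINT t|lborel. indicator {0..2 * pi} t *\<^sub>R exp (\<i> * complex_of_real (of_int n * t)))
     = (if n = 0 then complex_of_real (2 * pi) else 0)"
proof (cases "n = 0")
  case True
  have "(LINT t|lborel. indicator {0..2 * pi} t *\<^sub>R (1::complex)) = complex_of_real (2 * pi)"
    by (simp add: measure_def scaleR_conv_of_real)
  then show ?thesis using True by simp
next
  case False
  define F where "F = (\<lambda>t::real. exp (\<i> * complex_of_real (of_int n * t)) / (\<i> * complex_of_real (of_int n)))"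
  have nz: "\<i> * complex_of_real (of_int n) \<noteq> 0" using False by simp
  have "(LINT t|lborel. indicator {0..2 * pi} t *\<^sub>R exp (\<i> * complex_of_real (of_int n * t)))
      = F (2 * pi) - F 0"
  proof (rule integral_FTC_Icc)
    show "(F has_vector_derivative exp (\<i> * complex_of_real (of_int n * x))) (at x within {0..2 * pi})" for x
    proof -
      have "((\<lambda>z. exp (\<i> * complex_of_real (of_int n) * z) / (\<i> * complex_of_real (of_int n)))
          has_field_derivative exp (\<i> * complex_of_real (of_int n)
              * complex_of_real x)) (at (complex_of_real x))"
        using nz by (auto intro!: derivative_eq_intros)
      from has_vector_derivative_real_field[OF this] show ?thesis
        unfolding F_def by (simp add: mult.assoc has_vector_derivative_at_within)
    qed
    show "continuous_on {0..2 * pi} (\<lambda>t. exp (\<i> * complex_of_real (of_int n * t)))"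
      by (intro continuous_intros)
  qed auto
  also have "F (2 * pi) = F 0"
  proof -
    have "\<i> * complex_of_real (of_int n * (2 * pi)) = complex_of_int (2 * n) * (of_real pi * \<i>)" by simp
    then have "exp (\<i> * complex_of_real (of_int n * (2 * pi))) = 1" by (simp only: exp_2pi_int)
    then show ?thesis by (simp add: F_def)
  qed
  finally show ?thesis using False by simp
qed

lemma integral_torus_char:
  "(LINT x:period_cell|lebesgue. torus_char k x) = (if k = 0 then complex_of_real (2 * pi) ^ CARD('d) else 0)"
  for k :: "int ^ 'd::finite"
proof -
  define h where "h = (\<lambda>b (t::real). indicator {0..2 * pi} t *\<^sub>R exp (\<i>
      * complex_of_real ((real_vec k \<bullet> b) * t)))"
  have [measurable]: "period_cell \<in> sets (borel :: (real ^ 'd) measure)" by (simp add: period_cell_def)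
  have [measurable]: "torus_char k \<in> borel_measurable borel" unfolding torus_char_def by measurable
  have pt: "indicator period_cell x *\<^sub>R torus_char k x = (\<Prod>b\<in>Basis. h b (x \<bullet> b))" for x :: "real ^ 'd"
  proof -
    have "torus_char k x = (\<Prod>b\<in>Basis. exp (\<i> * complex_of_real ((real_vec k \<bullet> b) * (x \<bullet> b))))"
      unfolding torus_char_def by (subst euclidean_inner) (simp add: sum_distrib_left exp_sum)
    moreover have "(\<Prod>b\<in>Basis. indicator {0..2 * pi} (x \<bullet> b)) = (indicator period_cell x :: real)"
    proof -
      have one: "((\<chi> i. 2 * pi) :: real ^ 'd) \<bullet> b = 2 * pi" if "b \<in> Basis" for b
        using that by (auto simp: Basis_vec_def inner_axis)
      have mem: "x \<in> period_cell \<longleftrightarrow> (\<forall>b\<in>Basis. x \<bullet> b \<in> {0..2 * pi})"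
        by (simp add: period_cell_def mem_box one)
      show ?thesis
      proof (cases "x \<in> period_cell")
      case True
      then have "x \<bullet> b \<in> {0..2 * pi}" if "b \<in> Basis" for b
        using that mem by blast
      then show ?thesis using True by simp
    next
      case False
      then obtain b where b: "b \<in> Basis" "x \<bullet> b \<notin> {0..2 * pi}"
        using mem by blast
      then have "(\<Prod>b\<in>Basis. indicator {0..2 * pi} (x \<bullet> b)) = (0::real)"
        by (intro prod_zero) (auto simp: indicator_def)
      then show ?thesis using False by simp
      qed
    qed
    ultimately show ?thesis
      unfolding h_def scaleR_conv_of_real prod.distrib by (simp flip: of_real_prod)
  qed
  have hint: "integrable lborel (h b)" for b
    unfolding h_def
    by (rule borel_integrable_compact[unfolded set_integrable_def]) (auto intro!: continuous_intros)
  have "(LINT x:period_cell|lebesgue. torus_char k x) = (LINT x|lborel. (\<Prod>b\<in>Basis. h b ((x :: real ^ 'd) \<bullet> b)))"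
    unfolding set_lebesgue_integral_def pt[symmetric]
    by (rule integral_completion) measurable
  also have "\<dots> = (\<Prod>b\<in>(Basis :: (real ^ 'd) set). LINT t|lborel. h b t)"
    by (rule lborel_integral_prod_Basis) (rule hint)
  also have "\<dots> = (\<Prod>i\<in>UNIV. LINT t|lborel. h (axis i 1) t)"
  proof -
    have B: "Basis = (\<lambda>i. axis i (1::real)) ` (UNIV :: 'd set)" by (auto simp: Basis_vec_def)
    have inj: "inj (\<lambda>i::'d. axis i (1::real))" by (auto simp: inj_on_def axis_eq_axis)
    show ?thesis unfolding B by (subst prod.reindex[OF inj]) (simp add: o_def)
  qed
  also have "\<dots> = (\<Prod>i\<in>UNIV. if k $ i = 0 then complex_of_real (2 * pi) else 0)"
    unfolding h_def using integral_exp_2pi by (simp add: inner_axis real_vec_def)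
  also have "\<dots> = (if k = 0 then complex_of_real (2 * pi) ^ CARD('d) else 0)"
  proof (cases "k = 0")
    case False
    then obtain i where "k $ i \<noteq> 0" by (auto simp: vec_eq_iff)
    then have "(\<Prod>i\<in>UNIV. if k $ i = 0 then complex_of_real (2 * pi) else 0) = 0"
      by (intro prod_zero) auto
    then show ?thesis using False by simp
  qed simp
  finally show ?thesis .
qed

lemma fourier_coeff_trig_poly:
  fixes h :: "'p \<Rightarrow> int ^ 'd::finite"
  assumes S: "finite S"
  shows "fourier_coeff (\<lambda>x. \<Sum>p\<in>S. z p * torus_char (h p) x) k
    = complex_of_real (2 * pi) ^ CARD('d) * (\<Sum>p\<in>{p \<in> S. h p = k}. z p)"
proof -
  have mult: "torus_char q x * exp (- \<i> * complex_of_real (real_vec k \<bullet> x)) = torus_char (q - k) x" for q x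
    unfolding torus_char_def exp_add[symmetric] by (simp add: real_vec_diff inner_diff_left algebra_simps)
  have [measurable]: "period_cell \<in> sets (borel :: (real ^ 'd) measure)" by (simp add: period_cell_def)
  have int: "set_integrable lebesgue period_cell (torus_char q)" for q :: "int ^ 'd"
  proof -
    have "continuous_on period_cell (torus_char q)" unfolding torus_char_def by (intro continuous_intros)
    then have i: "integrable lborel (\<lambda>x. indicator period_cell x *\<^sub>R torus_char q x)"
      by (intro borel_integrable_compact) (auto simp: period_cell_def)
    from integrable_completion[OF borel_measurable_integrable[OF i]] i show ?thesis
      unfolding set_integrable_def by simp
  qed
  have "fourier_coeff (\<lambda>x. \<Sum>p\<in>S. z p * torus_char (h p) x) k
      = (LINT x:period_cell|lebesgue. \<Sum>p\<in>S. z p * torus_char (h p - k) x)"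
    unfolding fourier_coeff_def by (simp add: sum_distrib_right mult.assoc mult[unfolded mult_minus_left])
  also have "\<dots> = (\<Sum>p\<in>S. z p * (LINT x:period_cell|lebesgue. torus_char (h p - k) x))"
  proof -
    have "(LINT x:period_cell|lebesgue. \<Sum>p\<in>S. z p * torus_char (h p - k) x)
        = (LINT x|lebesgue. (\<Sum>p\<in>S. z p * (indicator period_cell x *\<^sub>R torus_char (h p - k) x)))"
      unfolding set_lebesgue_integral_def by (simp add: scaleR_sum_right)
    also have "\<dots> = (\<Sum>p\<in>S. (LINT x|lebesgue. z p * (indicator period_cell x *\<^sub>R torus_char (h p - k) x)))"
      using int by (intro Bochner_Integration.integral_sum integrable_mult_right) (simp add: set_integrable_def)
    also have "\<dots> = (\<Sum>p\<in>S. z p * (LINT x:period_cell|lebesgue. torus_char (h p - k) x))"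
      unfolding set_lebesgue_integral_def by (intro sum.cong refl integral_mult_right_zero)
    finally show ?thesis .
  qed
  also have "\<dots> = (\<Sum>p\<in>S. if h p = k then z p * complex_of_real (2 * pi) ^ CARD('d) else 0)"
    unfolding integral_torus_char by (intro sum.cong) auto
  also have "\<dots> = (\<Sum>p\<in>{p \<in> S. h p = k}. z p * complex_of_real (2 * pi) ^ CARD('d))"
    by (rule sum.inter_filter[OF S, symmetric])
  finally show ?thesis by (simp add: sum_distrib_left mult.commute)
qed

text \<open>Filtered functions are trigonometric polynomials, so the coefficients of a product form
  a finite convolution. Each filter divides by (2 pi)^d and the integral restores one such factor,
  hence one remains.\<close>

lemma fourier_coeff_filter_product:
  fixes f g :: "real ^ 'd::finite \<Rightarrow> complex"
  assumes "\<theta> > 0"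
  shows "fourier_coeff (\<lambda>x. freq_filter c \<theta> f x * freq_filter c \<theta> g x) k
    = (\<Sum>(k1, k2)\<in>{(k1, k2) \<in> filter_freqs c \<theta> \<times> filter_freqs c \<theta>. k1 + k2
        = k}. fourier_coeff f k1 * fourier_coeff g k2)
      / complex_of_real (2 * pi) ^ CARD('d)"
proof -
  let ?F = "filter_freqs c \<theta> :: (int ^ 'd) set"
  let ?D = "complex_of_real (2 * pi) ^ CARD('d)"
  have F: "finite ?F" by (rule finite_filter_freqs) fact
  have "freq_filter c \<theta> f x * freq_filter c \<theta> g x
      = (\<Sum>p\<in>?F \<times> ?F. (fourier_coeff f (fst p) * fourier_coeff g (snd p) / (?D * ?D))
          * torus_char (fst p + snd p) x)" for x
  proof -
    have "freq_filter c \<theta> f x * freq_filter c \<theta> g x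
        = (\<Sum>k1\<in>?F. \<Sum>k2\<in>?F. (fourier_coeff f k1 * torus_char k1 x) * (fourier_coeff g k2
            * torus_char k2 x)) / (?D * ?D)"
      unfolding freq_filter_def torus_char_def by (simp add: sum_product)
    also have "\<dots> = (\<Sum>p\<in>?F \<times> ?F. ((fourier_coeff f (fst p) * torus_char (fst p) x)
        * (fourier_coeff g (snd p) * torus_char (snd p) x)) / (?D * ?D))"
      by (simp add: sum.cartesian_product sum_divide_distrib split_beta')
    also have "\<dots> = (\<Sum>p\<in>?F \<times> ?F. (fourier_coeff f (fst p) * fourier_coeff g (snd p) / (?D * ?D))
        * torus_char (fst p + snd p) x)"
    proof (intro sum.cong refl)
      fix p
      have "torus_char (fst p + snd p) x = torus_char (fst p) x * torus_char (snd p) x"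
        unfolding torus_char_def exp_add[symmetric] by (simp add: real_vec_add inner_add_left distrib_left)
      then show "((fourier_coeff f (fst p) * torus_char (fst p) x) * (fourier_coeff g (snd p)
          * torus_char (snd p) x)) / (?D * ?D)
          = (fourier_coeff f (fst p) * fourier_coeff g (snd p) / (?D * ?D)) * torus_char (fst p + snd p) x"
        by simp
    qed
    finally show ?thesis .
  qed
  then have "fourier_coeff (\<lambda>x. freq_filter c \<theta> f x * freq_filter c \<theta> g x) k
      = ?D * (\<Sum>p\<in>{p \<in> ?F \<times> ?F. fst p + snd p = k}. fourier_coeff f (fst p)
          * fourier_coeff g (snd p) / (?D * ?D))"
    using F by (simp only: fourier_coeff_trig_poly[OF finite_cartesian_product])
  also have "\<dots> = (\<Sum>p\<in>{p \<in> ?F \<times> ?F. fst p + snd p = k}. fourier_coeff f (fst p) * fourier_coeff g (snd p)) / ?D"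
    by (simp add: sum_divide_distrib[symmetric])
  finally show ?thesis by (simp add: split_beta' Collect_case_prod mem_Times_iff)
qed

lemma fourier_coeff_cnj: "fourier_coeff (\<lambda>x. cnj (f x)) k = cnj (fourier_coeff f (- k))"
proof -
  have "cnj (fourier_coeff f (- k)) = (LINT x|lebesgue. cnj (indicator period_cell x *\<^sub>R (f x
      * exp (- \<i> * complex_of_real (real_vec (- k) \<bullet> x)))))"
    unfolding fourier_coeff_def set_lebesgue_integral_def by (simp only: Bochner_Integration.integral_cnj)
  also have "\<dots> = fourier_coeff (\<lambda>x. cnj (f x)) k"
    unfolding fourier_coeff_def set_lebesgue_integral_def
    by (intro Bochner_Integration.integral_cong refl) (simp add: exp_cnj real_vec_minus)
  finally show ?thesis by simp
qed

section \<open>Bourgain norms as weighted integrals\<close>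

text \<open>The factor d^(-1/2) in the side of the frequency cube makes the cube fit into the ball
  of squared radius c. Lowering \<theta> to \<tau> keeps the bound.\<close>

lemma filter_freqs_bound:
  fixes k :: "int ^ 'd::finite"
  assumes k: "k \<in> filter_freqs c \<theta>" and \<tau>: "0 < \<tau>" "\<tau> \<le> \<theta>" and c: "c > 0"
  shows "\<tau> * (norm (real_vec k))\<^sup>2 \<le> c"
proof -
  let ?d = "real CARD('d)"
  have d: "?d > 0" by simp
  have "\<theta> * (real_of_int (k $ i))\<^sup>2 \<le> c / ?d" for i
  proof -
    have "- (sqrt c / sqrt ?d) \<le> sqrt \<theta> * real_of_int (k $ i) \<and> sqrt \<theta> * real_of_int (k $ i) < sqrt c / sqrt ?d"
      using k unfolding filter_freqs_def by auto
    then have "\<bar>sqrt \<theta> * real_of_int (k $ i)\<bar> \<le> sqrt c / sqrt ?d" by linarith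
    then have "(\<bar>sqrt \<theta> * real_of_int (k $ i)\<bar>)\<^sup>2 \<le> (sqrt c / sqrt ?d)\<^sup>2" by (rule power_mono) simp
    then show ?thesis using \<tau> c by (simp add: power_mult_distrib power_divide)
  qed
  then have "(\<Sum>i\<in>(UNIV :: 'd set). \<theta> * (real_of_int (k $ i))\<^sup>2) \<le> (\<Sum>i\<in>(UNIV :: 'd set). c / ?d)"
      by (intro sum_mono)
  then have "\<theta> * (norm (real_vec k))\<^sup>2 \<le> c"
    using d by (simp add: norm_real_vec_sq int_sq_def flip: sum_distrib_left)
  moreover have "\<tau> * (norm (real_vec k))\<^sup>2 \<le> \<theta> * (norm (real_vec k))\<^sup>2" using \<tau> by (intro mult_right_mono) auto
  ultimately show ?thesis by linarith
qed

definition amplitude :: "(int ^ 'd \<Rightarrow> real \<Rightarrow> complex) \<Rightarrow> (int ^ 'd) \<times> real \<Rightarrow> ennreal" where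
  "amplitude A p = ennreal (cmod (A (fst p) (snd p)))"

definition restrict_freqs :: "(int ^ 'd) set \<Rightarrow> ((int ^ 'd) \<times> real \<Rightarrow> ennreal) \<Rightarrow> (int ^ 'd) \<times> real \<Rightarrow>
    ennreal" where
  "restrict_freqs S f p = (if fst p \<in> S then f p else 0)"

lemma measurable_freq_time_sections:
  fixes f :: "(int ^ 'd::finite) \<times> real \<Rightarrow> 'b::topological_space"
  assumes "\<And>k. (\<lambda>\<sigma>. f (k, \<sigma>)) \<in> borel_measurable borel"
  shows "f \<in> borel_measurable (freq_time_measure \<tau>)"
proof -
  have "(\<lambda>(k, \<sigma>). f (k, \<sigma>)) \<in> borel_measurable (count_space UNIV \<Otimes>\<^sub>M time_measure \<tau>)"
    by (rule measurable_pair_measure_countable1)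
      (use assms in \<open>auto simp: measurable_cong_sets[OF sets_time_measure refl]\<close>)
  then show ?thesis by simp
qed

lemma freq_time_periodic_amplitude:
  assumes "\<tau> > 0" "\<And>k. periodic_signal \<tau> (A k)"
  shows "freq_time_periodic \<tau> (amplitude A)"
proof -
  have "(\<lambda>\<sigma>. amplitude A (k, \<sigma>)) \<in> borel_measurable borel" for k
    using periodic_signal_measurable[OF assms(2)[of k]] unfolding amplitude_def by simp
  then have "amplitude A \<in> borel_measurable (freq_time_measure \<tau>)" by (rule measurable_freq_time_sections)
  then show ?thesis using assms(2) by (simp add: freq_time_periodic_iff[OF assms(1)] amplitude_def
      periodic_signal_def)
qed

lemma freq_time_periodic_restrict:
  assumes "\<tau> > 0" "freq_time_periodic \<tau> f"
  shows "freq_time_periodic \<tau> (restrict_freqs S f)"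
proof -
  have f: "f \<in> borel_measurable (freq_time_measure \<tau>)" using assms by (simp add: freq_time_periodic_iff)
  have "(\<lambda>\<sigma>. restrict_freqs S f (k, \<sigma>)) \<in> borel_measurable borel" for k
    using measurable_freq_time_section[OF f, of k] by (cases "k \<in> S") (simp_all add: restrict_freqs_def)
  then have "restrict_freqs S f \<in> borel_measurable (freq_time_measure \<tau>)"
      by (rule measurable_freq_time_sections)
  then show ?thesis using assms by (simp add: freq_time_periodic_iff restrict_freqs_def)
qed

lemma sum_le_nn_integral_count_space:
  fixes f :: "'a \<Rightarrow> ennreal"
  assumes "finite T" "\<And>k. k \<in> T \<Longrightarrow> f k \<le> g k"
  shows "(\<Sum>k\<in>T. f k) \<le> (\<integral>\<^sup>+k. g k \<partial>count_space UNIV)"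
proof -
  have "(\<Sum>k\<in>T. f k) = (\<integral>\<^sup>+k. f k \<partial>count_space T)" by (rule nn_integral_count_space_finite[OF assms(1),
      symmetric])
  also have "\<dots> = (\<integral>\<^sup>+k. f k * indicator T k \<partial>count_space UNIV)"
    by (simp add: nn_integral_count_space_indicator)
  also have "\<dots> \<le> (\<integral>\<^sup>+k. g k \<partial>count_space UNIV)"
    using assms(2) by (intro nn_integral_mono) (auto simp: indicator_def)
  finally show ?thesis .
qed

text \<open>The transform of the product is a finite sum of convolutions in time. Taking absolute
  values and dropping normalising factors of modulus at most 1 leaves a convolution of amplitudes
  over frequency and time together; from here on only sizes matter.\<close>

lemma dft_filter_product:
  fixes v w :: "int \<Rightarrow> real ^ 'd::finite \<Rightarrow> complex" and c :: real
  assumes \<tau>: "\<tau> > 0" and \<theta>: "\<theta> > 0"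
    and A: "\<And>k. is_dft \<tau> v k (A k)" "\<And>k. periodic_signal \<tau> (A k)"
    and B: "\<And>k. is_dft \<tau> w k (B k)" "\<And>k. periodic_signal \<tau> (B k)"
    and u_def: "u = (\<lambda>n x. freq_filter c \<theta> (v n) x * freq_filter c \<theta> (w n) x)"
  shows "\<exists>g. is_dft \<tau> u k g"
    and "AE \<sigma> in time_measure \<tau>. ennreal (cmod (dft \<tau> u k \<sigma>))
      \<le> (\<integral>\<^sup>+y. restrict_freqs (filter_freqs c \<theta>) (amplitude A) ((k, \<sigma>) - y)
          * restrict_freqs (filter_freqs c \<theta>) (amplitude B) y
          \<partial>freq_time_measure \<tau>)"
proof -
  let ?F = "filter_freqs c \<theta> :: (int ^ 'd) set"
  let ?D = "complex_of_real (2 * pi) ^ CARD('d)"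
  have F: "finite ?F" by (rule finite_filter_freqs) fact
  define S where "S = {(k1, k2) \<in> ?F \<times> ?F. k1 + k2 = k}"
  have S: "finite S" unfolding S_def by (rule finite_subset[OF _ finite_cartesian_product[OF F F]]) auto
  define g where "g = (\<lambda>\<sigma>. (1 / ?D) * (\<Sum>p\<in>S. periodic_conv \<tau> (A (fst p)) (B (snd p)) \<sigma>))"
  have each: "time_dft \<tau> (\<lambda>m. fourier_coeff (v m) k1 * fourier_coeff (w m) k2) (periodic_conv \<tau> (A k1)
      (B k2))" for k1 k2
    using A B by (intro time_dft_mult[OF \<tau>]) (auto simp: is_dft_iff periodic_signal_def)
  have "time_dft \<tau> (\<lambda>m. (1 / ?D) * (\<Sum>p\<in>S. fourier_coeff (v m) (fst p) * fourier_coeff (w m) (snd p))) g"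
    unfolding g_def by (intro time_dft_cmult time_dft_sum S each)
  moreover have "fourier_coeff (u m) k = (1 / ?D) * (\<Sum>p\<in>S. fourier_coeff (v m) (fst p)
      * fourier_coeff (w m) (snd p))" for m
    unfolding u_def fourier_coeff_filter_product[OF \<theta>] S_def by (simp add: split_beta')
  ultimately have g: "is_dft \<tau> u k g" by (simp add: is_dft_iff)
  then show ex: "\<exists>g. is_dft \<tau> u k g" by blast
  have "is_dft \<tau> u k (dft \<tau> u k)" unfolding dft_def using ex by (rule someI_ex)
  then have ae: "AE \<sigma> in time_measure \<tau>. dft \<tau> u k \<sigma> = g \<sigma>"
    using g unfolding is_dft_iff by (rule time_dft_unique)
  let ?f = "restrict_freqs ?F (amplitude A)"
  let ?g = "restrict_freqs ?F (amplitude B)"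
  interpret N: conv_measure "freq_time_measure \<tau> :: ((int ^ 'd) \<times> real) measure" "{(0, 2 * pi / \<tau>)}"
    by (rule conv_measure_freq_time_measure) fact
  have f1: "N.periodic ?f"
    by (intro freq_time_periodic_restrict freq_time_periodic_amplitude \<tau> A(2))
  have f2: "N.periodic ?g"
    by (intro freq_time_periodic_restrict freq_time_periodic_amplitude \<tau> B(2))
  note fper = f1 f2
  have bound: "ennreal (cmod (g \<sigma>)) \<le> (\<integral>\<^sup>+y. ?f ((k, \<sigma>) - y) * ?g y \<partial>freq_time_measure \<tau>)" for \<sigma>
  proof -
    define J where "J = (\<lambda>k2. \<integral>\<^sup>+x. ennreal (cmod (A (k - k2) (\<sigma> - x)))
        * ennreal (cmod (B k2 x)) \<partial>time_measure \<tau>)"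
    define T where "T = {k2 \<in> ?F. k - k2 \<in> ?F}"
    have T: "finite T" using F by (simp add: T_def)
    have ST: "S = (\<lambda>k2. (k - k2, k2)) ` T" by (auto simp: S_def T_def)
    have D1: "1 \<le> cmod ?D"
    proof -
      have "(1::real) \<le> (2 * pi) ^ CARD('d)" using pi_gt3 by (intro one_le_power) simp
      also have "\<dots> = cmod ?D" unfolding norm_power norm_of_real by simp
      finally show ?thesis .
    qed
    have "cmod (g \<sigma>) = cmod (\<Sum>p\<in>S. periodic_conv \<tau> (A (fst p)) (B (snd p)) \<sigma>) / cmod ?D"
      by (simp add: g_def norm_mult norm_divide)
    also have "\<dots> \<le> cmod (\<Sum>p\<in>S. periodic_conv \<tau> (A (fst p)) (B (snd p)) \<sigma>) / 1"
      using D1 by (intro divide_left_mono) auto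
    also have "\<dots> \<le> (\<Sum>p\<in>S. cmod (periodic_conv \<tau> (A (fst p)) (B (snd p)) \<sigma>))" by (simp add: norm_sum)
    also have "\<dots> = (\<Sum>k2\<in>T. cmod (periodic_conv \<tau> (A (k - k2)) (B k2) \<sigma>))"
      unfolding ST by (subst sum.reindex) (auto simp: inj_on_def)
    finally have "ennreal (cmod (g \<sigma>)) \<le> (\<Sum>k2\<in>T. ennreal (cmod (periodic_conv \<tau> (A (k - k2)) (B k2) \<sigma>)))"
      by (simp add: sum_ennreal ennreal_leI)
    also have "\<dots> \<le> (\<Sum>k2\<in>T. J k2)"
      unfolding J_def by (intro sum_mono norm_periodic_conv_le)
    also have "\<dots> \<le> (\<integral>\<^sup>+k2. (\<integral>\<^sup>+x. ?f ((k, \<sigma>) - (k2, x)) * ?g (k2, x) \<partial>time_measure \<tau>) \<partial>count_space UNIV)"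
      using T by (intro sum_le_nn_integral_count_space) (auto simp: T_def J_def restrict_freqs_def
          amplitude_def)
    also have "\<dots> = (\<integral>\<^sup>+y. ?f ((k, \<sigma>) - y) * ?g y \<partial>freq_time_measure \<tau>)"
    proof (rule nn_integral_freq_time[OF \<tau>, symmetric])
      show "(\<lambda>y. ?f ((k, \<sigma>) - y) * ?g y) \<in> borel_measurable (freq_time_measure \<tau>)"
        by (rule N.periodic_measurable[OF N.periodic_mult[OF N.periodic_diff2[OF fper(1)] fper(2)]])
    qed
    finally show ?thesis .
  qed
  show "AE \<sigma> in time_measure \<tau>. ennreal (cmod (dft \<tau> u k \<sigma>))
      \<le> (\<integral>\<^sup>+y. ?f ((k, \<sigma>) - y) * ?g y \<partial>freq_time_measure \<tau>)"
    using ae by eventually_elim (simp only: bound)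
qed

definition bourgain_weight :: "(int ^ 'd \<Rightarrow> real) \<Rightarrow> real \<Rightarrow> real \<Rightarrow> real \<Rightarrow> (int ^ 'd) \<times> real \<Rightarrow> real" where
  "bourgain_weight \<omega> \<tau> s b p = brk (fst p) powr s * lam \<tau> (snd p + \<omega> (fst p)) powr b"

lemma bourgain_weight_nonneg: "bourgain_weight \<omega> \<tau> s b p \<ge> 0"
  by (simp add: bourgain_weight_def)

lemma freq_time_periodic_bourgain_weight:
  assumes "\<tau> > 0"
  shows "freq_time_periodic \<tau> (\<lambda>p. ennreal (bourgain_weight \<omega> \<tau> s b p))"
proof -
  have "lam \<tau> (\<sigma> + 2 * pi / \<tau> + x) = lam \<tau> (\<sigma> + x)" for \<sigma> x
    using lam_periodic[OF assms, of "\<sigma> + x"] by (simp add: add_ac)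
  moreover have "(\<lambda>p. ennreal (bourgain_weight \<omega> \<tau> s b p)) \<in> borel_measurable (freq_time_measure \<tau>)"
    unfolding bourgain_weight_def by (rule measurable_freq_time_sections) simp
  ultimately show ?thesis by (simp add: freq_time_periodic_iff[OF assms] bourgain_weight_def)
qed

lemma bourgain_norm_square:
  assumes "\<And>k. \<exists>g. is_dft \<tau> v k g"
  shows "(bourgain_norm \<omega> \<tau> s b v)\<^sup>2
    = (\<integral>\<^sup>+k. \<integral>\<^sup>+\<sigma>. (ennreal (bourgain_weight \<omega> \<tau> s b (k, \<sigma>))
        * ennreal (cmod (dft \<tau> v k \<sigma>)))\<^sup>2 \<partial>time_measure \<tau> \<partial>count_space UNIV)"
proof -
  have "is_dft \<tau> v k (dft \<tau> v k)" for k unfolding dft_def using assms by (rule someI_ex)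
  then have [measurable]: "dft \<tau> v k \<in> borel_measurable borel" for k by (auto simp: is_dft_def)
  have "(bourgain_norm \<omega> \<tau> s b v)\<^sup>2 = (\<integral>\<^sup>+k. (\<integral>\<^sup>+\<sigma>\<in>{- pi / \<tau> <..< pi / \<tau>}.
            ennreal ((cmod (complex_of_real
              (japanese_bracket (real_vec k) powr s
                * japanese_bracket (d_tau \<tau> (\<sigma> + \<omega> k)) powr b)
              * dft \<tau> v k \<sigma>))\<^sup>2) \<partial>lborel) \<partial>count_space UNIV)"
    using assms by (simp add: bourgain_norm_def ennreal_sqrt_square)
  also have "\<dots> = (\<integral>\<^sup>+k. \<integral>\<^sup>+\<sigma>. ennreal ((cmod (complex_of_real (brk k powr s * lam \<tau> (\<sigma> + \<omega> k) powr b)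
      * dft \<tau> v k \<sigma>))\<^sup>2)
      \<partial>time_measure \<tau> \<partial>count_space UNIV)"
    by (intro nn_integral_cong nn_integral_time_measure[symmetric]) measurable
  also have "\<dots> = (\<integral>\<^sup>+k. \<integral>\<^sup>+\<sigma>. (ennreal (bourgain_weight \<omega> \<tau> s b (k, \<sigma>))
      * ennreal (cmod (dft \<tau> v k \<sigma>)))\<^sup>2 \<partial>time_measure \<tau> \<partial>count_space UNIV)"
    by (intro nn_integral_cong)
      (simp add: bourgain_weight_def norm_mult abs_mult power_mult_distrib ennreal_mult ennreal_power)
  finally show ?thesis .
qed

text \<open>A finite norm is what guarantees a transform at every frequency, since otherwise the
  norm is infinite by definition. Passing to periodic representatives does not change the
  integral.\<close>

lemma bourgain_norm_finite:
  assumes \<tau>: "\<tau> > 0" and fin: "bourgain_norm \<omega> \<tau> s b (v :: int \<Rightarrow> real ^ 'd::finite \<Rightarrow> complex) < \<infinity>"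
  obtains A where "\<And>k. is_dft \<tau> v k (A k)" "\<And>k. periodic_signal \<tau> (A k)"
    "(bourgain_norm \<omega> \<tau> s b v)\<^sup>2 = (\<integral>\<^sup>+p. (ennreal (bourgain_weight \<omega> \<tau> s b p)
        * amplitude A p)\<^sup>2 \<partial>freq_time_measure \<tau>)"
proof -
  have ex: "\<exists>g. is_dft \<tau> v k g" for k using fin by (auto simp: bourgain_norm_def split: if_splits)
  then have d: "is_dft \<tau> v k (dft \<tau> v k)" for k unfolding dft_def by (rule someI_ex)
  have "\<exists>h. time_dft \<tau> (\<lambda>m. fourier_coeff (v m) k) h \<and> (\<forall>\<sigma>. h (\<sigma> + 2 * pi / \<tau>) = h \<sigma>) \<and>
      (\<forall>\<sigma>\<in>{- pi / \<tau> <..< pi / \<tau>}. h \<sigma> = dft \<tau> v k \<sigma>)" for k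
    using time_dft_periodize[OF \<tau> d[of k, unfolded is_dft_iff]] by metis
  then obtain A where A: "\<And>k. time_dft \<tau> (\<lambda>m. fourier_coeff (v m) k) (A k)" "\<And>k \<sigma>. A k (\<sigma> + 2 * pi / \<tau>) = A k \<sigma>"
    "\<And>k \<sigma>. \<sigma> \<in> {- pi / \<tau> <..< pi / \<tau>} \<Longrightarrow> A k \<sigma> = dft \<tau> v k \<sigma>"
    by metis
  have per: "periodic_signal \<tau> (A k)" for k using A by (auto simp: periodic_signal_def time_dft_def)
  interpret N: conv_measure "freq_time_measure \<tau> :: ((int ^ 'd) \<times> real) measure" "{(0, 2 * pi / \<tau>)}"
    by (rule conv_measure_freq_time_measure) fact
  have [measurable]: "dft \<tau> v k \<in> borel_measurable borel" "A k \<in> borel_measurable borel" for k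
    using d[of k] per[of k] by (auto simp: is_dft_def periodic_signal_def)
  have [measurable]: "(\<lambda>\<sigma>. bourgain_weight \<omega> \<tau> s b (k, \<sigma>)) \<in> borel_measurable borel" for k
    unfolding bourgain_weight_def by simp
  have "(bourgain_norm \<omega> \<tau> s b v)\<^sup>2 = (\<integral>\<^sup>+k. \<integral>\<^sup>+\<sigma>. (ennreal (bourgain_weight \<omega> \<tau> s b (k, \<sigma>))
      * amplitude A (k, \<sigma>))\<^sup>2
      \<partial>time_measure \<tau> \<partial>count_space UNIV)"
    unfolding bourgain_norm_square[OF ex]
  proof (rule nn_integral_cong)
    fix k
    show "(\<integral>\<^sup>+\<sigma>. (ennreal (bourgain_weight \<omega> \<tau> s b (k, \<sigma>)) * ennreal (cmod (dft \<tau> v k \<sigma>)))\<^sup>2 \<partial>time_measure \<tau>)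
        = (\<integral>\<^sup>+\<sigma>. (ennreal (bourgain_weight \<omega> \<tau> s b (k, \<sigma>)) * amplitude A (k, \<sigma>))\<^sup>2 \<partial>time_measure \<tau>)"
      unfolding amplitude_def fst_conv snd_conv
      by (subst (1 2) nn_integral_time_measure, measurable) (intro nn_integral_cong, auto simp: A(3)
          indicator_def)
  qed
  also have "\<dots> = (\<integral>\<^sup>+p. (ennreal (bourgain_weight \<omega> \<tau> s b p) * amplitude A p)\<^sup>2 \<partial>freq_time_measure \<tau>)"
  proof (rule nn_integral_freq_time[OF \<tau>, symmetric])
    show "(\<lambda>p. (ennreal (bourgain_weight \<omega> \<tau> s b p) * amplitude A p)\<^sup>2) \<in> borel_measurable
        (freq_time_measure \<tau>)"
      by (rule N.periodic_measurable[OF N.periodic_power[OF N.periodic_mult[OF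
          freq_time_periodic_bourgain_weight[OF \<tau>]
            freq_time_periodic_amplitude[OF \<tau> per]]]])
  qed
  finally show ?thesis using that A per by (auto simp: is_dft_iff)
qed

lemma bourgain_norm_square_le:
  assumes \<tau>: "\<tau> > 0" and ex: "\<And>k. \<exists>g. is_dft \<tau> v k g"
    and Z: "Z \<in> borel_measurable (freq_time_measure \<tau>)"
    and le: "\<And>k. AE \<sigma> in time_measure \<tau>. ennreal (cmod (dft \<tau> (v :: int \<Rightarrow> real ^ 'd::finite \<Rightarrow> complex) k
        \<sigma>)) \<le> Z (k, \<sigma>)"
  shows "(bourgain_norm \<omega> \<tau> s b v)\<^sup>2 \<le> (\<integral>\<^sup>+p. (ennreal (bourgain_weight \<omega> \<tau> s b p)
      * Z p)\<^sup>2 \<partial>freq_time_measure \<tau>)"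
proof -
  interpret N: conv_measure "freq_time_measure \<tau> :: ((int ^ 'd) \<times> real) measure" "{(0, 2 * pi / \<tau>)}"
    by (rule conv_measure_freq_time_measure) fact
  have "(bourgain_norm \<omega> \<tau> s b v)\<^sup>2 \<le> (\<integral>\<^sup>+k. \<integral>\<^sup>+\<sigma>. (ennreal (bourgain_weight \<omega> \<tau> s b (k, \<sigma>))
      * Z (k, \<sigma>))\<^sup>2 \<partial>time_measure \<tau> \<partial>count_space UNIV)"
    unfolding bourgain_norm_square[OF ex]
  proof (rule nn_integral_mono, rule nn_integral_mono_AE)
    fix k
    show "AE \<sigma> in time_measure \<tau>. (ennreal (bourgain_weight \<omega> \<tau> s b (k, \<sigma>)) * ennreal (cmod (dft \<tau> v k \<sigma>)))\<^sup>2
        \<le> (ennreal (bourgain_weight \<omega> \<tau> s b (k, \<sigma>)) * Z (k, \<sigma>))\<^sup>2"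
      using le[of k] by eventually_elim (intro power_mono mult_left_mono, auto)
  qed
  also have "\<dots> = (\<integral>\<^sup>+p. (ennreal (bourgain_weight \<omega> \<tau> s b p) * Z p)\<^sup>2 \<partial>freq_time_measure \<tau>)"
  proof (rule nn_integral_freq_time[OF \<tau>, symmetric])
    note [measurable] = Z N.periodic_measurable[OF freq_time_periodic_bourgain_weight[OF \<tau>, of \<omega> s b]]
    show "(\<lambda>p. (ennreal (bourgain_weight \<omega> \<tau> s b p) * Z p)\<^sup>2) \<in> borel_measurable (freq_time_measure \<tau>)"
      by measurable
  qed
  finally show ?thesis .
qed

section \<open>Bilinear estimates by duality\<close>

text \<open>Finiteness of \<open>Q\<close> is essential: at \<infinity> the first premise says
  nothing as soon as D > 0.\<close>

lemma ennreal_absorb: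
  fixes Q D :: ennreal
  assumes "Q\<^sup>2 \<le> D * Q" "Q < \<infinity>"
  shows "Q \<le> D"
proof (cases "Q = 0")
  case False
  have "Q * Q \<le> Q * D" using assms(1) by (simp add: power2_eq_square mult.commute)
  then show ?thesis using False assms(2) by (simp add: ennreal_mult_le_mult_iff)
qed simp

context conv_measure
begin

lemma periodic_convolution:
  assumes "periodic F" "periodic G"
  shows "periodic (\<lambda>x. \<integral>\<^sup>+y. F (x - y) * G y \<partial>M)"
proof -
  note [measurable] = assms[THEN periodic_measurable]
  have "(\<lambda>x. \<integral>\<^sup>+y. F (x - y) * G y \<partial>M) \<in> borel_measurable M" by measurable
  moreover have "(\<integral>\<^sup>+y. F (x + h - y) * G y \<partial>M) = (\<integral>\<^sup>+y. F (x - y) * G y \<partial>M)" if "h \<in> per" for h x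
  proof (rule nn_integral_cong)
    fix y
    have "F ((x - y) + h) = F (x - y)" using assms(1) that unfolding periodic_def by blast
    then show "F (x + h - y) * G y = F (x - y) * G y" by (simp add: algebra_simps)
  qed
  ultimately show ?thesis unfolding periodic_def by blast
qed

lemma convolution_pointwise_square:
  assumes "periodic F" "periodic G"
  shows "(\<integral>\<^sup>+y. F (x - y) * G y \<partial>M)\<^sup>2 \<le> (\<integral>\<^sup>+y. (F y)\<^sup>2 \<partial>M) * (\<integral>\<^sup>+y. (G y)\<^sup>2 \<partial>M)"
proof -
  note [measurable] = assms[THEN periodic_measurable]
  have "(\<integral>\<^sup>+y. F (x - y) * G y \<partial>M)\<^sup>2 \<le> (\<integral>\<^sup>+y. (F (x - y))\<^sup>2 \<partial>M) * (\<integral>\<^sup>+y. (G y)\<^sup>2 \<partial>M)"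
    by (rule Cauchy_Schwarz_nn_integral) measurable
  then show ?thesis unfolding integral_diff2[OF periodic_power[OF assms(1)]] .
qed

text \<open>The trilinear bound is tested on the output itself, and one factor of its (finite) norm cancels.\<close>

lemma output_bound_convolution:
  assumes per: "periodic F" "periodic G" "periodic wt" "periodic wF" "periodic wG"
    and tri: "\<And>U V W. periodic U \<Longrightarrow> periodic V \<Longrightarrow> periodic W \<Longrightarrow>
      (\<integral>\<^sup>+x. \<integral>\<^sup>+y. K x y * U x * V (x - y) * W y \<partial>M \<partial>M)\<^sup>2
      \<le> D * (\<integral>\<^sup>+x. (U x)\<^sup>2 \<partial>M) * (\<integral>\<^sup>+x. (V x)\<^sup>2 \<partial>M) * (\<integral>\<^sup>+x. (W x)\<^sup>2 \<partial>M)"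
    and H: "\<And>x y. wt x * (F (x - y) * G y) \<le> K x y * (wF (x - y) * F (x - y)) * (wG y * G y)"
    and fin: "(\<integral>\<^sup>+x. (wt x * (\<integral>\<^sup>+y. F (x - y) * G y \<partial>M))\<^sup>2 \<partial>M) < \<infinity>"
  shows "(\<integral>\<^sup>+x. (wt x * (\<integral>\<^sup>+y. F (x - y) * G y \<partial>M))\<^sup>2 \<partial>M)
    \<le> D * (\<integral>\<^sup>+x. (wF x * F x)\<^sup>2 \<partial>M) * (\<integral>\<^sup>+x. (wG x * G x)\<^sup>2 \<partial>M)"
proof -
  note [measurable] = per[THEN periodic_measurable]
  define Z where "Z = (\<lambda>x. \<integral>\<^sup>+y. F (x - y) * G y \<partial>M)"
  define U where "U = (\<lambda>x. wt x * Z x)"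
  have perU: "periodic U" unfolding U_def Z_def by (rule periodic_mult[OF per(3) periodic_convolution[OF
      per(1,2)]])
  have "(\<integral>\<^sup>+x. (U x)\<^sup>2 \<partial>M) \<le> (\<integral>\<^sup>+x. \<integral>\<^sup>+y. K x y * U x * (wF (x - y) * F (x - y)) * (wG y * G y) \<partial>M \<partial>M)"
  proof (rule nn_integral_mono)
    fix x
    have "(U x)\<^sup>2 = (U x * wt x) * (\<integral>\<^sup>+y. F (x - y) * G y \<partial>M)"
      by (simp add: power2_eq_square U_def Z_def mult_ac)
    also have "\<dots> = (\<integral>\<^sup>+y. (U x * wt x) * (F (x - y) * G y) \<partial>M)"
        by (rule nn_integral_cmult[symmetric]) measurable
    also have "\<dots> \<le> (\<integral>\<^sup>+y. K x y * U x * (wF (x - y) * F (x - y)) * (wG y * G y) \<partial>M)"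
    proof (rule nn_integral_mono)
      fix y
      have "U x * (wt x * (F (x - y) * G y)) \<le> U x * (K x y * (wF (x - y) * F (x - y)) * (wG y * G y))"
        by (intro mult_left_mono H) simp
      then show "(U x * wt x) * (F (x - y) * G y) \<le> K x y * U x * (wF (x - y) * F (x - y)) * (wG y * G y)"
        by (simp add: mult_ac)
    qed
    finally show "(U x)\<^sup>2 \<le> (\<integral>\<^sup>+y. K x y * U x * (wF (x - y) * F (x - y)) * (wG y * G y) \<partial>M)" .
  qed
  then have "(\<integral>\<^sup>+x. (U x)\<^sup>2 \<partial>M)\<^sup>2 \<le> (\<integral>\<^sup>+x. \<integral>\<^sup>+y. K x y * U x * (wF (x - y) * F (x - y)) * (wG y * G y) \<partial>M \<partial>M)\<^sup>2"
    by (rule power_mono) simp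
  also have "\<dots> \<le> D * (\<integral>\<^sup>+x. (U x)\<^sup>2 \<partial>M) * (\<integral>\<^sup>+x. (wF x * F x)\<^sup>2 \<partial>M) * (\<integral>\<^sup>+x. (wG x * G x)\<^sup>2 \<partial>M)"
    by (rule tri[OF perU periodic_mult[OF per(4,1)] periodic_mult[OF per(5,2)]])
  finally have "(\<integral>\<^sup>+x. (U x)\<^sup>2 \<partial>M)\<^sup>2 \<le> (D * (\<integral>\<^sup>+x. (wF x * F x)\<^sup>2 \<partial>M) * (\<integral>\<^sup>+x. (wG x * G x)\<^sup>2 \<partial>M))
      * (\<integral>\<^sup>+x. (U x)\<^sup>2 \<partial>M)"
    by (simp add: mult_ac)
  then show ?thesis using fin unfolding U_def Z_def by (rule ennreal_absorb)
qed

text \<open>Here the output lives in the difference variable, so the function tested against itself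
  takes the place of \<open>V\<close> and the two inputs take those of \<open>U\<close> and
  \<open>W\<close>.\<close>

lemma output_bound_correlation:
  assumes per: "periodic F" "periodic G" "periodic wt" "periodic wF" "periodic wG"
    and tri: "\<And>U V W. periodic U \<Longrightarrow> periodic V \<Longrightarrow> periodic W \<Longrightarrow>
      (\<integral>\<^sup>+x. \<integral>\<^sup>+y. K x y * U x * V (x - y) * W y \<partial>M \<partial>M)\<^sup>2
      \<le> D * (\<integral>\<^sup>+x. (U x)\<^sup>2 \<partial>M) * (\<integral>\<^sup>+x. (V x)\<^sup>2 \<partial>M) * (\<integral>\<^sup>+x. (W x)\<^sup>2 \<partial>M)"
    and H: "\<And>x y. wt (x - y) * (F x * G y) \<le> K x y * (wF x * F x) * (wG y * G y)"
    and fin: "(\<integral>\<^sup>+z. (wt z * (\<integral>\<^sup>+y. F (z + y) * G y \<partial>M))\<^sup>2 \<partial>M) < \<infinity>"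
  shows "(\<integral>\<^sup>+z. (wt z * (\<integral>\<^sup>+y. F (z + y) * G y \<partial>M))\<^sup>2 \<partial>M)
    \<le> D * (\<integral>\<^sup>+x. (wF x * F x)\<^sup>2 \<partial>M) * (\<integral>\<^sup>+x. (wG x * G x)\<^sup>2 \<partial>M)"
proof -
  note [measurable] = per[THEN periodic_measurable]
  define Z where "Z = (\<lambda>z. \<integral>\<^sup>+y. F (z + y) * G y \<partial>M)"
  have Z: "Z = (\<lambda>z. \<integral>\<^sup>+y. F (z - y) * G (- y) \<partial>M)"
  proof (rule ext)
    fix z
    have "periodic (\<lambda>y. F (z - y) * G (- y))"
      by (rule periodic_mult[OF periodic_diff2[OF per(1)] periodic_refl[OF per(2)]])
    from integral_refl[OF this] show "Z z = (\<integral>\<^sup>+y. F (z - y) * G (- y) \<partial>M)" by (simp add: Z_def)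
  qed
  define U where "U = (\<lambda>x. wt x * Z x)"
  have perU: "periodic U"
    unfolding U_def Z by (rule periodic_mult[OF per(3) periodic_convolution[OF per(1) periodic_refl[OF
        per(2)]]])
  have "(\<integral>\<^sup>+x. (U x)\<^sup>2 \<partial>M) = (\<integral>\<^sup>+z. \<integral>\<^sup>+y. (U z * wt z) * (F (z + y) * G y) \<partial>M \<partial>M)"
  proof (rule nn_integral_cong)
    fix z
    have "(U z)\<^sup>2 = (U z * wt z) * (\<integral>\<^sup>+y. F (z + y) * G y \<partial>M)"
      by (simp add: power2_eq_square U_def Z_def mult_ac)
    also have "\<dots> = (\<integral>\<^sup>+y. (U z * wt z) * (F (z + y) * G y) \<partial>M)"
        by (rule nn_integral_cmult[symmetric]) measurable
    finally show "(U z)\<^sup>2 = (\<integral>\<^sup>+y. (U z * wt z) * (F (z + y) * G y) \<partial>M)" .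
  qed
  also have "\<dots> = (\<integral>\<^sup>+x. \<integral>\<^sup>+y. (U (x - y) * wt (x - y)) * (F x * G y) \<partial>M \<partial>M)"
    by (rule integral_rotate[OF periodic_mult[OF perU per(3)] per(1,2), symmetric])
  also have "\<dots> \<le> (\<integral>\<^sup>+x. \<integral>\<^sup>+y. K x y * (wF x * F x) * U (x - y) * (wG y * G y) \<partial>M \<partial>M)"
  proof (intro nn_integral_mono)
    fix x y
    have "U (x - y) * (wt (x - y) * (F x * G y)) \<le> U (x - y) * (K x y * (wF x * F x) * (wG y * G y))"
      by (intro mult_left_mono H) simp
    then show "(U (x - y) * wt (x - y)) * (F x * G y) \<le> K x y * (wF x * F x) * U (x - y) * (wG y * G y)"
      by (simp add: mult_ac)
  qed
  finally have "(\<integral>\<^sup>+x. (U x)\<^sup>2 \<partial>M)\<^sup>2 \<le> (\<integral>\<^sup>+x. \<integral>\<^sup>+y. K x y * (wF x * F x) * U (x - y) * (wG y * G y) \<partial>M \<partial>M)\<^sup>2"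
    by (rule power_mono) simp
  also have "\<dots> \<le> D * (\<integral>\<^sup>+x. (wF x * F x)\<^sup>2 \<partial>M) * (\<integral>\<^sup>+x. (U x)\<^sup>2 \<partial>M) * (\<integral>\<^sup>+x. (wG x * G x)\<^sup>2 \<partial>M)"
    by (rule tri[OF periodic_mult[OF per(4,1)] perU periodic_mult[OF per(5,2)]])
  finally have "(\<integral>\<^sup>+x. (U x)\<^sup>2 \<partial>M)\<^sup>2 \<le> (D * (\<integral>\<^sup>+x. (wF x * F x)\<^sup>2 \<partial>M) * (\<integral>\<^sup>+x. (wG x * G x)\<^sup>2 \<partial>M))
      * (\<integral>\<^sup>+x. (U x)\<^sup>2 \<partial>M)"
    by (simp add: mult_ac)
  then show ?thesis using fin unfolding U_def Z_def by (rule ennreal_absorb)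
qed

end

text \<open>This supplies the finiteness needed for cancelling a norm. The output is supported on a
  finite set of sums of frequencies, is bounded pointwise by Cauchy-Schwarz, and a period has finite
  measure. The bound depends on the filter and serves only this purpose.\<close>

lemma finite_weighted_convolution:
  fixes F G :: "(int ^ 'd::finite) \<times> real \<Rightarrow> ennreal"
  assumes \<tau>: "\<tau> > 0" and per: "freq_time_periodic \<tau> F" "freq_time_periodic \<tau> G" "freq_time_periodic \<tau> wt"
    and S: "finite S" "\<And>p. F p \<noteq> 0 \<Longrightarrow> fst p \<in> S" "\<And>p. G p \<noteq> 0 \<Longrightarrow> fst p \<in> S"
    and fin: "(\<integral>\<^sup>+p. (F p)\<^sup>2 \<partial>freq_time_measure \<tau>) < \<infinity>" "(\<integral>\<^sup>+p. (G p)\<^sup>2 \<partial>freq_time_measure \<tau>) < \<infinity>"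
    and wt: "\<And>p. wt p \<le> ennreal (m (fst p))"
  shows "(\<integral>\<^sup>+x. (wt x * (\<integral>\<^sup>+y. F (x - y) * G y \<partial>freq_time_measure \<tau>))\<^sup>2 \<partial>freq_time_measure \<tau>) < \<infinity>"
proof -
  interpret N: conv_measure "freq_time_measure \<tau> :: ((int ^ 'd) \<times> real) measure" "{(0, 2 * pi / \<tau>)}"
    by (rule conv_measure_freq_time_measure) fact
  interpret T: finite_measure "time_measure \<tau>" by (rule finite_measure_time_measure) fact
  define Z where "Z = (\<lambda>x. \<integral>\<^sup>+y. F (x - y) * G y \<partial>freq_time_measure \<tau>)"
  define E where "E = (\<integral>\<^sup>+p. (F p)\<^sup>2 \<partial>freq_time_measure \<tau>) * (\<integral>\<^sup>+p. (G p)\<^sup>2 \<partial>freq_time_measure \<tau>)"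
  have E: "E < \<infinity>" using fin by (simp add: E_def ennreal_mult_less_top)
  define R where "R = (\<lambda>(a, b). a + b) ` (S \<times> S)"
  have R: "finite R" using S by (simp add: R_def)
  have Z0: "Z x = 0" if "fst x \<notin> R" for x
  proof -
    have "F (x - y) * G y = 0" for y
    proof (rule ccontr)
      assume "F (x - y) * G y \<noteq> 0"
      then have nz: "F (x - y) \<noteq> 0" "G y \<noteq> 0" by auto
      have "fst (x - y) \<in> S" using nz(1) by (rule S(2))
      moreover have "fst y \<in> S" using nz(2) by (rule S(3))
      ultimately have "(fst (x - y), fst y) \<in> S \<times> S" by simp
      then have "(\<lambda>(a, b). a + b) (fst (x - y), fst y) \<in> R" unfolding R_def by (rule imageI)
      then show False using that by simp
    qed
    then show ?thesis by (simp only: Z_def) simp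
  qed
  have ZE: "(Z x)\<^sup>2 \<le> E" for x
    unfolding Z_def E_def by (rule N.convolution_pointwise_square[OF per(1,2)])
  have Zm: "(\<lambda>x. (wt x * Z x)\<^sup>2) \<in> borel_measurable (freq_time_measure \<tau>)"
    unfolding Z_def
    by (rule N.periodic_measurable[OF N.periodic_power[OF N.periodic_mult[OF per(3)
        N.periodic_convolution[OF per(1,2)]]]])
  have "(\<integral>\<^sup>+x. (wt x * Z x)\<^sup>2 \<partial>freq_time_measure \<tau>)
      = (\<integral>\<^sup>+k. \<integral>\<^sup>+\<sigma>. (wt (k, \<sigma>) * Z (k, \<sigma>))\<^sup>2 \<partial>time_measure \<tau> \<partial>count_space UNIV)"
    by (rule nn_integral_freq_time[OF \<tau> Zm])
  also have "\<dots> \<le> (\<integral>\<^sup>+k. (ennreal (m k))\<^sup>2 * E * emeasure (time_measure \<tau>) UNIV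
      * indicator R k \<partial>count_space UNIV)"
  proof (rule nn_integral_mono)
    fix k
    have "(\<integral>\<^sup>+\<sigma>. (wt (k, \<sigma>) * Z (k, \<sigma>))\<^sup>2 \<partial>time_measure \<tau>)
        \<le> (\<integral>\<^sup>+\<sigma>. (ennreal (m k))\<^sup>2 * E * indicator R k \<partial>time_measure \<tau>)"
    proof (rule nn_integral_mono)
      fix \<sigma>
      show "(wt (k, \<sigma>) * Z (k, \<sigma>))\<^sup>2 \<le> (ennreal (m k))\<^sup>2 * E * indicator R k"
      proof (cases "k \<in> R")
        case True
        have "(wt (k, \<sigma>))\<^sup>2 * (Z (k, \<sigma>))\<^sup>2 \<le> (ennreal (m k))\<^sup>2 * E"
          using wt[of "(k, \<sigma>)"] by (intro mult_mono power_mono ZE) auto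
        then show ?thesis using True by (simp add: power_mult_distrib)
      next
        case False
        then show ?thesis using Z0[of "(k, \<sigma>)"] by simp
      qed
    qed
    also have "\<dots> = (ennreal (m k))\<^sup>2 * E * emeasure (time_measure \<tau>) UNIV * indicator R k"
        by (simp add: mult_ac)
    finally show "(\<integral>\<^sup>+\<sigma>. (wt (k, \<sigma>) * Z (k, \<sigma>))\<^sup>2 \<partial>time_measure \<tau>)
        \<le> (ennreal (m k))\<^sup>2 * E * emeasure (time_measure \<tau>) UNIV * indicator R k" .
  qed
  also have "\<dots> = (\<Sum>k\<in>R. (ennreal (m k))\<^sup>2 * E * emeasure (time_measure \<tau>) UNIV)"
    by (subst nn_integral_indicator_finite[OF R]) auto
  also have "\<dots> < \<infinity>"
  proof -
    have "(ennreal r)\<^sup>2 < top" for r by (simp add: power2_eq_square ennreal_mult_less_top)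
    then show ?thesis using E R by (simp add: ennreal_mult_less_top T.emeasure_eq_measure)
  qed
  finally show ?thesis by (simp add: Z_def)
qed

section \<open>Norm weights of the three factors and the two kinds of output\<close>

abbreviation wave_phase :: "real \<Rightarrow> int ^ 'd \<Rightarrow> real" where
  "wave_phase e k \<equiv> e * norm (real_vec k)"

lemma brk_diff_le: "brk (a - b) \<le> brk a + brk b"
  by (rule bracket_add_le) (simp add: real_vec_diff norm_triangle_ineq4)

lemma brk_minus: "brk (- k) = brk k"
  by (simp add: japanese_bracket_def real_vec_minus)

lemma brk_triangle:
  "brk a \<le> brk (a - b) + brk b" "brk (a - b) \<le> brk a + brk b" "brk b \<le> brk a + brk (a - b)"
proof -
  have "brk a \<le> brk (a - b) + brk (- b)" using brk_diff_le[of "a - b" "- b"] by simp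
  then show "brk a \<le> brk (a - b) + brk b" by (simp add: brk_minus)
  show "brk (a - b) \<le> brk a + brk b" by (rule brk_diff_le)
  show "brk b \<le> brk a + brk (a - b)" using brk_diff_le[of a "a - b"] by simp
qed

lemma bourgain_weight_ge_1:
  assumes "s \<ge> 0" "b \<ge> 0"
  shows "1 \<le> bourgain_weight \<omega> \<tau> s b p"
proof -
  have "1 * 1 \<le> brk (fst p) powr s * lam \<tau> (snd p + \<omega> (fst p)) powr b"
    by (intro mult_mono ge_one_powr_ge_zero bracket_ge_1 assms) auto
  then show ?thesis by (simp add: bourgain_weight_def)
qed

lemma bourgain_weight_neg_le:
  assumes "b \<ge> 0"
  shows "bourgain_weight \<omega> \<tau> s (- b) p \<le> brk (fst p) powr s"
proof -
  have "lam \<tau> (snd p + \<omega> (fst p)) powr (- b) \<le> 1"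
    using powr_mono2'[of "- b" 1 "lam \<tau> (snd p + \<omega> (fst p))"] assms lam_ge_1[of \<tau> "snd p + \<omega> (fst p)"] by simp
  from mult_left_mono[OF this, of "brk (fst p) powr s"] show ?thesis by (simp add: bourgain_weight_def)
qed

lemma restrict_freqs_le: "restrict_freqs S f p \<le> f p"
  by (simp add: restrict_freqs_def)

lemma square_integral_restrict_finite:
  assumes "(\<integral>\<^sup>+p. (ennreal (bourgain_weight \<omega> \<tau> s b p) * f p)\<^sup>2 \<partial>freq_time_measure \<tau>) < \<infinity>" "s \<ge> 0" "b \<ge> 0"
  shows "(\<integral>\<^sup>+p. (restrict_freqs S f p)\<^sup>2 \<partial>freq_time_measure \<tau>) < \<infinity>"
proof -
  have "restrict_freqs S f p \<le> ennreal (bourgain_weight \<omega> \<tau> s b p) * f p" for p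
  proof -
    have "1 * f p \<le> ennreal (bourgain_weight \<omega> \<tau> s b p) * f p"
      using bourgain_weight_ge_1[OF assms(2,3), of \<omega> \<tau> p]
          by (intro mult_right_mono) (auto simp: ennreal_leI simp flip: ennreal_1)
    then show ?thesis using restrict_freqs_le[of S f p] by (simp add: order_trans)
  qed
  then have "(\<integral>\<^sup>+p. (restrict_freqs S f p)\<^sup>2 \<partial>freq_time_measure \<tau>)
      \<le> (\<integral>\<^sup>+p. (ennreal (bourgain_weight \<omega> \<tau> s b p) * f p)\<^sup>2 \<partial>freq_time_measure \<tau>)"
    by (intro nn_integral_mono power_mono) auto
  then show ?thesis using assms(1) by (rule le_less_trans)
qed

lemma square_integral_scaled_restrict_le:
  assumes K: "K \<ge> 0" and m: "g \<in> borel_measurable (freq_time_measure \<tau>)" "f \<in> borel_measurable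
      (freq_time_measure \<tau>)"
  shows "(\<integral>\<^sup>+p. ((ennreal K * g p) * restrict_freqs S f p)\<^sup>2 \<partial>freq_time_measure \<tau>)
    \<le> ennreal (K\<^sup>2) * (\<integral>\<^sup>+p. (g p * f p)\<^sup>2 \<partial>freq_time_measure \<tau>)"
proof -
  note [measurable] = m
  have "(\<integral>\<^sup>+p. ((ennreal K * g p) * restrict_freqs S f p)\<^sup>2 \<partial>freq_time_measure \<tau>)
      \<le> (\<integral>\<^sup>+p. ennreal (K\<^sup>2) * (g p * f p)\<^sup>2 \<partial>freq_time_measure \<tau>)"
  proof (rule nn_integral_mono)
    fix p
    have "(ennreal K * g p) * restrict_freqs S f p \<le> (ennreal K * g p) * f p"
      by (intro mult_left_mono restrict_freqs_le) simp
    then have "((ennreal K * g p) * restrict_freqs S f p)\<^sup>2 \<le> ((ennreal K * g p) * f p)\<^sup>2"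
        by (rule power_mono) simp
    also have "\<dots> = ennreal (K\<^sup>2) * (g p * f p)\<^sup>2"
      using K by (simp add: power_mult_distrib ennreal_power mult_ac)
    finally show "((ennreal K * g p) * restrict_freqs S f p)\<^sup>2 \<le> ennreal (K\<^sup>2) * (g p * f p)\<^sup>2" .
  qed
  also have "\<dots> = ennreal (K\<^sup>2) * (\<integral>\<^sup>+p. (g p * f p)\<^sup>2 \<partial>freq_time_measure \<tau>)"
    by (rule nn_integral_cmult) measurable
  finally show ?thesis .
qed

lemma powr_neg_cancel:
  fixes l0 l1 l2 b :: real
  assumes "l0 \<ge> 1" "l1 \<ge> 1" "l2 \<ge> 1"
  shows "(l0 * l1 * l2) powr (- b) * (l1 powr b * l2 powr b) = l0 powr (- b)"
    and "(l0 * l1 * l2) powr (- b) * (l0 powr b * l2 powr b) = l1 powr (- b)"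
  using assms by (simp_all add: powr_mult powr_minus field_simps)

text \<open>Multiplying and dividing by the norm weights of both inputs turns the weighted output
  into the interaction kernel: the modulations of the inputs cancel in the product of all three, and
  \<open>wt\<close> takes care of the frequencies. The inputs sit at x - y and y, where the filter
  acts.\<close>

lemma schroedinger_output:
  fixes f g :: "(int ^ 'd::finite) \<times> real \<Rightarrow> ennreal"
  assumes \<tau>: "\<tau> > 0" and K: "K \<ge> 0" and b: "b \<ge> 0" and S12: "S1 \<ge> 0" "S2 \<ge> 0"
    and tri: "\<And>U V W. freq_time_periodic \<tau> U \<Longrightarrow> freq_time_periodic \<tau> V \<Longrightarrow> freq_time_periodic \<tau> W \<Longrightarrow>
      (\<integral>\<^sup>+x. \<integral>\<^sup>+y. ennreal (interaction_kernel c s b \<tau> e x (y :: (int ^ 'd) \<times> real)) * U x * V (x - y) * W y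
        \<partial>freq_time_measure \<tau> \<partial>freq_time_measure \<tau>)\<^sup>2
      \<le> C * (\<integral>\<^sup>+x. (U x)\<^sup>2 \<partial>freq_time_measure \<tau>) * (\<integral>\<^sup>+x. (V x)\<^sup>2 \<partial>freq_time_measure \<tau>)
          * (\<integral>\<^sup>+x. (W x)\<^sup>2 \<partial>freq_time_measure \<tau>)"
    and wt: "\<And>x y z. \<lbrakk>1 \<le> x; 1 \<le> y; 1 \<le> z; x \<le> y + z; y \<le> x + z; z \<le> x + y\<rbrakk> \<Longrightarrow>
      x powr S0 \<le> K * freq_weight s x y z * (y powr S1 * z powr S2)"
    and per: "freq_time_periodic \<tau> f" "freq_time_periodic \<tau> g"
    and S: "finite S" "\<And>k. k \<in> S \<Longrightarrow> \<tau> * (norm (real_vec k))\<^sup>2 \<le> c"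
    and fin: "(\<integral>\<^sup>+p. (ennreal (bourgain_weight (wave_phase e) \<tau> S1 b p) * f p)\<^sup>2 \<partial>freq_time_measure \<tau>) < \<infinity>"
      "(\<integral>\<^sup>+p. (ennreal (bourgain_weight schroedinger_phase \<tau> S2 b p) * g p)\<^sup>2 \<partial>freq_time_measure \<tau>) < \<infinity>"
  shows "(\<integral>\<^sup>+x. (ennreal (bourgain_weight schroedinger_phase \<tau> S0 (- b) x)
      * (\<integral>\<^sup>+y. restrict_freqs S f (x - y) * restrict_freqs S g y \<partial>freq_time_measure \<tau>))\<^sup>2 \<partial>freq_time_measure \<tau>)
    \<le> (C * ennreal (K\<^sup>2)) * (\<integral>\<^sup>+p. (ennreal (bourgain_weight (wave_phase e) \<tau> S1 b p)
        * f p)\<^sup>2 \<partial>freq_time_measure \<tau>)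
      * (\<integral>\<^sup>+p. (ennreal (bourgain_weight schroedinger_phase \<tau> S2 b p) * g p)\<^sup>2 \<partial>freq_time_measure \<tau>)"
proof -
  interpret N: conv_measure "freq_time_measure \<tau> :: ((int ^ 'd) \<times> real) measure" "{(0, 2 * pi / \<tau>)}"
    by (rule conv_measure_freq_time_measure) fact
  define F where "F = restrict_freqs S f"
  define G where "G = restrict_freqs S g"
  have FG: "N.periodic F" "N.periodic G"
    unfolding F_def G_def by (rule freq_time_periodic_restrict[OF \<tau>]; fact)+
  define wo where "wo = (\<lambda>p :: (int ^ 'd) \<times> real. ennreal (bourgain_weight schroedinger_phase \<tau> S0 (- b) p))"
  define w1 where "w1 = (\<lambda>p :: (int ^ 'd) \<times> real. ennreal (bourgain_weight (wave_phase e) \<tau> S1 b p))"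
  define w2 where "w2 = (\<lambda>p :: (int ^ 'd) \<times> real. ennreal (bourgain_weight schroedinger_phase \<tau> S2 b p))"
  have wper: "N.periodic wo" "N.periodic w1" "N.periodic w2"
    unfolding wo_def w1_def w2_def by (rule freq_time_periodic_bourgain_weight[OF \<tau>])+
  have wF: "N.periodic (\<lambda>p. ennreal K * w1 p)" by (rule N.periodic_mult[OF N.periodic_const wper(2)])
  have H: "wo x * (F (x - y) * G y) \<le> ennreal (interaction_kernel c s b \<tau> e x y) * ((ennreal K
      * w1 (x - y)) * F (x - y)) * (w2 y * G y)"
    for x y
  proof (cases "fst (x - y) \<in> S \<and> fst y \<in> S")
    case True
    then have tf: "two_filtered c \<tau> (fst x) (fst (x - y)) (fst y)" using S(2) by (auto simp: two_filtered_def)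
    define l0 where "l0 = lam \<tau> (snd x + schroedinger_phase (fst x))"
    define l1 where "l1 = lam \<tau> (snd (x - y) + wave_phase e (fst (x - y)))"
    define l2 where "l2 = lam \<tau> (snd y + schroedinger_phase (fst y))"
    define k0 k1 k2 where "k0 = brk (fst x)" and "k1 = brk (fst (x - y))" and "k2 = brk (fst y)"
    have l: "l0 \<ge> 1" "l1 \<ge> 1" "l2 \<ge> 1" by (simp_all add: l0_def l1_def l2_def lam_ge_1)
    have "k0 powr S0 \<le> K * freq_weight s k0 k1 k2 * (k1 powr S1 * k2 powr S2)"
      unfolding k0_def k1_def k2_def using brk_triangle[where a = "fst x" and b = "fst y"]
      by (intro wt bracket_ge_1) auto
    then have "k0 powr S0 * l0 powr (- b) \<le> (K * freq_weight s k0 k1 k2 * (k1 powr S1 * k2 powr S2))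
        * l0 powr (- b)"
      by (rule mult_right_mono) simp
    also have "\<dots> = (freq_weight s k0 k1 k2 * (l0 * l1 * l2) powr (- b)) * (K * (k1 powr S1
        * l1 powr b)) * (k2 powr S2 * l2 powr b)"
      unfolding powr_neg_cancel(1)[OF l, of b, symmetric] by (simp add: mult_ac)
    finally have real: "bourgain_weight schroedinger_phase \<tau> S0 (- b) x
        \<le> interaction_kernel c s b \<tau> e x y * (K * bourgain_weight (wave_phase e) \<tau> S1 b (x - y))
            * bourgain_weight schroedinger_phase \<tau> S2 b y"
      using tf by (simp add: bourgain_weight_def interaction_kernel_def l0_def l1_def l2_def k0_def
          k1_def k2_def)
    have k0: "interaction_kernel c s b \<tau> e x y \<ge> 0" by (simp add: interaction_kernel_def freq_weight_def)
    have "wo x \<le> ennreal (interaction_kernel c s b \<tau> e x y) * (ennreal K * w1 (x - y)) * w2 y"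
      unfolding wo_def w1_def w2_def using real k0 K
      by (simp add: ennreal_leI bourgain_weight_nonneg flip: ennreal_mult)
    then have "wo x * (F (x - y) * G y) \<le> (ennreal (interaction_kernel c s b \<tau> e x y) * (ennreal K
        * w1 (x - y)) * w2 y) * (F (x - y) * G y)"
      by (rule mult_right_mono) simp
    then show ?thesis by (simp add: mult_ac)
  qed (auto simp: F_def G_def restrict_freqs_def)
  have finZ: "(\<integral>\<^sup>+x. (wo x * (\<integral>\<^sup>+y. F (x - y) * G y \<partial>freq_time_measure \<tau>))\<^sup>2 \<partial>freq_time_measure \<tau>) < \<infinity>"
  proof (rule finite_weighted_convolution[OF \<tau> FG wper(1) S(1)])
    show "wo p \<le> ennreal (brk (fst p) powr S0)" for p
      unfolding wo_def by (intro ennreal_leI bourgain_weight_neg_le b)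
    show "(\<integral>\<^sup>+p. (F p)\<^sup>2 \<partial>freq_time_measure \<tau>) < \<infinity>"
      unfolding F_def by (rule square_integral_restrict_finite[OF fin(1) S12(1) b])
    show "(\<integral>\<^sup>+p. (G p)\<^sup>2 \<partial>freq_time_measure \<tau>) < \<infinity>"
      unfolding G_def by (rule square_integral_restrict_finite[OF fin(2) S12(2) b])
  qed (auto simp: F_def G_def restrict_freqs_def split: if_splits)
  have "(\<integral>\<^sup>+x. (wo x * (\<integral>\<^sup>+y. F (x - y) * G y \<partial>freq_time_measure \<tau>))\<^sup>2 \<partial>freq_time_measure \<tau>)
      \<le> C * (\<integral>\<^sup>+x. ((ennreal K * w1 x) * F x)\<^sup>2 \<partial>freq_time_measure \<tau>) * (\<integral>\<^sup>+x. (w2 x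
          * G x)\<^sup>2 \<partial>freq_time_measure \<tau>)"
    by (rule N.output_bound_convolution[OF FG wper(1) wF wper(3) tri H finZ])
  also have "\<dots> \<le> C * (ennreal (K\<^sup>2) * (\<integral>\<^sup>+x. (w1 x * f x)\<^sup>2 \<partial>freq_time_measure \<tau>)) * (\<integral>\<^sup>+x. (w2 x
      * g x)\<^sup>2 \<partial>freq_time_measure \<tau>)"
    unfolding F_def G_def
    by (intro mult_mono mult_left_mono square_integral_scaled_restrict_le K N.periodic_measurable wper
        per nn_integral_mono power_mono restrict_freqs_le) auto
  finally show ?thesis by (simp add: F_def G_def wo_def w1_def w2_def mult.assoc)
qed

text \<open>The inputs sit at x and y and the output at x - y. The two frequency sets are kept apart
  because one input is the amplitude of a conjugated factor after reflection, whose frequencies are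
  the negatives of the filtered ones.\<close>

lemma wave_output:
  fixes f g :: "(int ^ 'd::finite) \<times> real \<Rightarrow> ennreal"
  assumes \<tau>: "\<tau> > 0" and K: "K \<ge> 0" and b: "b \<ge> 0" and S12: "S1 \<ge> 0" "S2 \<ge> 0"
    and tri: "\<And>U V W. freq_time_periodic \<tau> U \<Longrightarrow> freq_time_periodic \<tau> V \<Longrightarrow> freq_time_periodic \<tau> W \<Longrightarrow>
      (\<integral>\<^sup>+x. \<integral>\<^sup>+y. ennreal (interaction_kernel c s b \<tau> e x (y :: (int ^ 'd) \<times> real)) * U x * V (x - y) * W y
        \<partial>freq_time_measure \<tau> \<partial>freq_time_measure \<tau>)\<^sup>2
      \<le> C * (\<integral>\<^sup>+x. (U x)\<^sup>2 \<partial>freq_time_measure \<tau>) * (\<integral>\<^sup>+x. (V x)\<^sup>2 \<partial>freq_time_measure \<tau>)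
          * (\<integral>\<^sup>+x. (W x)\<^sup>2 \<partial>freq_time_measure \<tau>)"
    and wt: "\<And>x y z. \<lbrakk>1 \<le> x; 1 \<le> y; 1 \<le> z; x \<le> y + z; y \<le> x + z; z \<le> x + y\<rbrakk> \<Longrightarrow>
      y powr S0 \<le> K * freq_weight s x y z * (x powr S1 * z powr S2)"
    and per: "freq_time_periodic \<tau> f" "freq_time_periodic \<tau> g"
    and S: "finite SF" "finite SG" "\<And>k. k \<in> SF \<union> SG \<Longrightarrow> \<tau> * (norm (real_vec k))\<^sup>2 \<le> c"
    and fin: "(\<integral>\<^sup>+p. (ennreal (bourgain_weight schroedinger_phase \<tau> S1 b p) * f p)\<^sup>2 \<partial>freq_time_measure \<tau>) < \<infinity>"
      "(\<integral>\<^sup>+p. (ennreal (bourgain_weight schroedinger_phase \<tau> S2 b p) * g p)\<^sup>2 \<partial>freq_time_measure \<tau>) < \<infinity>"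
  shows "(\<integral>\<^sup>+z. (ennreal (bourgain_weight (wave_phase e) \<tau> S0 (- b) z)
      * (\<integral>\<^sup>+y. restrict_freqs SF f (z + y) * restrict_freqs SG g y \<partial>freq_time_measure \<tau>))\<^sup>2
          \<partial>freq_time_measure \<tau>)
    \<le> (C * ennreal (K\<^sup>2)) * (\<integral>\<^sup>+p. (ennreal (bourgain_weight schroedinger_phase \<tau> S1 b p)
        * f p)\<^sup>2 \<partial>freq_time_measure \<tau>)
      * (\<integral>\<^sup>+p. (ennreal (bourgain_weight schroedinger_phase \<tau> S2 b p) * g p)\<^sup>2 \<partial>freq_time_measure \<tau>)"
proof -
  interpret N: conv_measure "freq_time_measure \<tau> :: ((int ^ 'd) \<times> real) measure" "{(0, 2 * pi / \<tau>)}"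
    by (rule conv_measure_freq_time_measure) fact
  define F where "F = restrict_freqs SF f"
  define G where "G = restrict_freqs SG g"
  have FG: "N.periodic F" "N.periodic G"
    unfolding F_def G_def by (rule freq_time_periodic_restrict[OF \<tau>]; fact)+
  define wo where "wo = (\<lambda>p :: (int ^ 'd) \<times> real. ennreal (bourgain_weight (wave_phase e) \<tau> S0 (- b) p))"
  define w1 where "w1 = (\<lambda>p :: (int ^ 'd) \<times> real. ennreal (bourgain_weight schroedinger_phase \<tau> S1 b p))"
  define w2 where "w2 = (\<lambda>p :: (int ^ 'd) \<times> real. ennreal (bourgain_weight schroedinger_phase \<tau> S2 b p))"
  have wper: "N.periodic wo" "N.periodic w1" "N.periodic w2"
    unfolding wo_def w1_def w2_def by (rule freq_time_periodic_bourgain_weight[OF \<tau>])+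
  have wF: "N.periodic (\<lambda>p. ennreal K * w1 p)" by (rule N.periodic_mult[OF N.periodic_const wper(2)])
  have H: "wo (x - y) * (F x * G y) \<le> ennreal (interaction_kernel c s b \<tau> e x y) * ((ennreal K * w1 x)
      * F x) * (w2 y * G y)"
    for x y
  proof (cases "fst x \<in> SF \<and> fst y \<in> SG")
    case True
    then have tf: "two_filtered c \<tau> (fst x) (fst (x - y)) (fst y)" using S(3) by (auto simp: two_filtered_def)
    define l0 where "l0 = lam \<tau> (snd x + schroedinger_phase (fst x))"
    define l1 where "l1 = lam \<tau> (snd (x - y) + wave_phase e (fst (x - y)))"
    define l2 where "l2 = lam \<tau> (snd y + schroedinger_phase (fst y))"
    define k0 k1 k2 where "k0 = brk (fst x)" and "k1 = brk (fst (x - y))" and "k2 = brk (fst y)"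
    have l: "l0 \<ge> 1" "l1 \<ge> 1" "l2 \<ge> 1" by (simp_all add: l0_def l1_def l2_def lam_ge_1)
    have "k1 powr S0 \<le> K * freq_weight s k0 k1 k2 * (k0 powr S1 * k2 powr S2)"
      unfolding k0_def k1_def k2_def using brk_triangle[where a = "fst x" and b = "fst y"]
      by (intro wt bracket_ge_1) auto
    then have "k1 powr S0 * l1 powr (- b) \<le> (K * freq_weight s k0 k1 k2 * (k0 powr S1 * k2 powr S2))
        * l1 powr (- b)"
      by (rule mult_right_mono) simp
    also have "\<dots> = (freq_weight s k0 k1 k2 * (l0 * l1 * l2) powr (- b)) * (K * (k0 powr S1
        * l0 powr b)) * (k2 powr S2 * l2 powr b)"
      unfolding powr_neg_cancel(2)[OF l, of b, symmetric] by (simp add: mult_ac)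
    finally have real: "bourgain_weight (wave_phase e) \<tau> S0 (- b) (x - y)
        \<le> interaction_kernel c s b \<tau> e x y * (K * bourgain_weight schroedinger_phase \<tau> S1 b x)
            * bourgain_weight schroedinger_phase \<tau> S2 b y"
      using tf by (simp add: bourgain_weight_def interaction_kernel_def l0_def l1_def l2_def k0_def
          k1_def k2_def)
    have k0: "interaction_kernel c s b \<tau> e x y \<ge> 0" by (simp add: interaction_kernel_def freq_weight_def)
    have "wo (x - y) \<le> ennreal (interaction_kernel c s b \<tau> e x y) * (ennreal K * w1 x) * w2 y"
      unfolding wo_def w1_def w2_def using real k0 K
      by (simp add: ennreal_leI bourgain_weight_nonneg flip: ennreal_mult)
    then have "wo (x - y) * (F x * G y) \<le> (ennreal (interaction_kernel c s b \<tau> e x y) * (ennreal K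
        * w1 x) * w2 y) * (F x * G y)"
      by (rule mult_right_mono) simp
    then show ?thesis by (simp add: mult_ac)
  qed (auto simp: F_def G_def restrict_freqs_def)
  \<comment> \<open>Reflecting the integration variable writes the correlation as a convolution with
    reflected \<open>G\<close>, so that the finiteness lemma applies; the support of
    \<open>G\<close> is reflected accordingly.\<close>
  have Z: "(\<integral>\<^sup>+y. F (z + y) * G y \<partial>freq_time_measure \<tau>)
      = (\<integral>\<^sup>+y. F (z - y) * G (- y) \<partial>freq_time_measure \<tau>)" for z
    using N.integral_refl[OF N.periodic_mult[OF N.periodic_diff2[OF FG(1)] N.periodic_refl[OF FG(2)]],
        of z] by simp
  have finZ: "(\<integral>\<^sup>+z. (wo z * (\<integral>\<^sup>+y. F (z + y) * G y \<partial>freq_time_measure \<tau>))\<^sup>2 \<partial>freq_time_measure \<tau>) < \<infinity>"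
    unfolding Z
  proof (rule finite_weighted_convolution[OF \<tau> FG(1) N.periodic_refl[OF FG(2)] wper(1)])
    show "finite (SF \<union> uminus ` SG)" using S by simp
    show "fst p \<in> SF \<union> uminus ` SG" if "F p \<noteq> 0" for p
      using that by (auto simp: F_def restrict_freqs_def split: if_splits)
    show "fst p \<in> SF \<union> uminus ` SG" if "G (- p) \<noteq> 0" for p
    proof -
      have "- fst p \<in> SG" using that by (auto simp: G_def restrict_freqs_def split: if_splits)
      then have "- (- fst p) \<in> uminus ` SG" by (rule imageI)
      then show ?thesis by simp
    qed
    show "wo p \<le> ennreal (brk (fst p) powr S0)" for p
      unfolding wo_def by (intro ennreal_leI bourgain_weight_neg_le b)
    show "(\<integral>\<^sup>+p. (F p)\<^sup>2 \<partial>freq_time_measure \<tau>) < \<infinity>"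
      unfolding F_def by (rule square_integral_restrict_finite[OF fin(1) S12(1) b])
    show "(\<integral>\<^sup>+p. (G (- p))\<^sup>2 \<partial>freq_time_measure \<tau>) < \<infinity>"
      using square_integral_restrict_finite[OF fin(2) S12(2) b, of SG]
      unfolding N.integral_refl[OF N.periodic_power[OF FG(2)]] by (simp add: G_def)
  qed
  have "(\<integral>\<^sup>+z. (wo z * (\<integral>\<^sup>+y. F (z + y) * G y \<partial>freq_time_measure \<tau>))\<^sup>2 \<partial>freq_time_measure \<tau>)
      \<le> C * (\<integral>\<^sup>+x. ((ennreal K * w1 x) * F x)\<^sup>2 \<partial>freq_time_measure \<tau>) * (\<integral>\<^sup>+x. (w2 x
          * G x)\<^sup>2 \<partial>freq_time_measure \<tau>)"
    by (rule N.output_bound_correlation[OF FG wper(1) wF wper(3) tri H finZ])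
  also have "\<dots> \<le> C * (ennreal (K\<^sup>2) * (\<integral>\<^sup>+x. (w1 x * f x)\<^sup>2 \<partial>freq_time_measure \<tau>)) * (\<integral>\<^sup>+x. (w2 x
      * g x)\<^sup>2 \<partial>freq_time_measure \<tau>)"
    unfolding F_def G_def
    by (intro mult_mono mult_left_mono square_integral_scaled_restrict_le K N.periodic_measurable wper
        per nn_integral_mono power_mono restrict_freqs_le) auto
  finally show ?thesis by (simp add: F_def G_def wo_def w1_def w2_def mult.assoc)
qed

section \<open>Effect of complex conjugation, and the two families of bilinear estimates\<close>

definition conjugate_dft :: "(int ^ 'd \<Rightarrow> real \<Rightarrow> complex) \<Rightarrow> int ^ 'd \<Rightarrow> real \<Rightarrow> complex" where
  "conjugate_dft A k \<sigma> = cnj (A (- k) (- \<sigma>))"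

lemma is_dft_cnj:
  assumes \<tau>: "\<tau> > 0" and A: "\<And>k. is_dft \<tau> v k (A k)" "\<And>k. periodic_signal \<tau> (A k)"
  shows "is_dft \<tau> (\<lambda>n x. cnj (v n x)) k (conjugate_dft A k)"
    and "periodic_signal \<tau> (conjugate_dft A k)"
proof -
  have "time_dft \<tau> (\<lambda>m. cnj (fourier_coeff (v m) (- k))) (\<lambda>\<sigma>. cnj (A (- k) (- \<sigma>)))"
    using A(1)[of "- k"] A(2)[of "- k"] by (intro time_dft_cnj[OF \<tau>]) (auto simp: is_dft_iff
        periodic_signal_def)
  then show d: "is_dft \<tau> (\<lambda>n x. cnj (v n x)) k (conjugate_dft A k)"
    by (simp add: is_dft_iff fourier_coeff_cnj conjugate_dft_def[abs_def])
  have "A (- k) (- \<sigma> - 2 * pi / \<tau>) = A (- k) (- \<sigma>)" for \<sigma>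
  proof -
    have "A (- k) ((- \<sigma> - 2 * pi / \<tau>) + 2 * pi / \<tau>) = A (- k) (- \<sigma> - 2 * pi / \<tau>)"
      using A(2)[of "- k"] unfolding periodic_signal_def by blast
    then show ?thesis by simp
  qed
  then show "periodic_signal \<tau> (conjugate_dft A k)"
    using d by (simp add: periodic_signal_def is_dft_def conjugate_dft_def)
qed

lemma amplitude_conjugate_dft: "amplitude (conjugate_dft A) p = amplitude A (- p)"
  by (simp add: amplitude_def conjugate_dft_def)

lemma restrict_amplitude_conjugate_dft:
  "restrict_freqs S (amplitude (conjugate_dft A)) p = restrict_freqs (uminus ` S) (amplitude A) (- p)"
proof -
  have "fst (- p) \<in> uminus ` S \<longleftrightarrow> fst p \<in> S" by (auto simp: image_iff)
  then show ?thesis by (simp only: restrict_freqs_def amplitude_conjugate_dft)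
qed

text \<open>Conjugation reflects frequency and time. As \<open>lam\<close> is even, this exchanges
  the wave phase |k| with -|k|, so a conjugated wave factor has the same norm with the opposite sign
  \<open>e\<close>.\<close>

lemma bourgain_weight_wave_reflect:
  assumes "\<tau> > 0"
  shows "bourgain_weight (wave_phase 1) \<tau> s b p = bourgain_weight (wave_phase (- 1)) \<tau> s b (- p)"
proof -
  have "lam \<tau> (- snd p - norm (real_vec (fst p))) = lam \<tau> (- (snd p + norm (real_vec (fst p))))" by simp
  also have "\<dots> = lam \<tau> (snd p + norm (real_vec (fst p)))" by (rule lam_minus[OF assms])
  finally show ?thesis by (simp add: bourgain_weight_def japanese_bracket_def real_vec_minus)
qed

lemma X2_norm_eq: "X2_norm = bourgain_norm (wave_phase (- 1))"
  by (simp add: X2_norm_def)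

lemma norm_le_of_square_le:
  fixes N V W :: ennreal
  assumes "N\<^sup>2 \<le> ennreal D * V\<^sup>2 * W\<^sup>2" "D \<ge> 0"
  shows "N \<le> ennreal (sqrt D) * V * W"
proof (rule ennreal_le_of_square_le)
  have "(ennreal (sqrt D))\<^sup>2 = ennreal D" using assms(2) by (simp add: ennreal_power)
  then show "N\<^sup>2 \<le> (ennreal (sqrt D) * V * W)\<^sup>2" using assms(1) by (simp add: power_mult_distrib)
qed

lemma ennreal_double:
  assumes "D \<ge> 0"
  shows "ennreal (2 * sqrt D) = ennreal (sqrt D) + ennreal (sqrt D)"
  using assms by (simp flip: ennreal_plus)

text \<open>The products with v and with its conjugate differ only in the sign of the wave phase,
  and the trilinear estimate is uniform in that sign. Each contributes sqrt D, whence the factor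
  2.\<close>

lemma schroedinger_bilinear_estimate:
  fixes c s0 s b S0 S1 S2 K :: real
  assumes c: "0 < c" "c < 2 * pi"
    and s0: "s0 = max 0 (real CARD('d::finite) / 2 - 1)" and s: "s > s0"
    and b: "3/8 < b" "1/2 - 1/2 * (s - s0) < b" "b < 1/2"
    and S12: "S1 \<ge> 0" "S2 \<ge> 0" and K: "K \<ge> 0"
    and wt: "\<And>x y z. \<lbrakk>1 \<le> x; 1 \<le> y; 1 \<le> z; x \<le> y + z; y \<le> x + z; z \<le> x + y\<rbrakk> \<Longrightarrow>
      x powr S0 \<le> K * freq_weight s x y z * (y powr S1 * z powr S2)"
  shows "\<exists>C\<ge>0. \<forall>\<tau> \<theta>. \<forall>(v :: int \<Rightarrow> real ^ 'd \<Rightarrow> complex) w. 0 < \<tau> \<longrightarrow> \<tau> < 1 \<longrightarrow> \<tau> \<le> \<theta> \<longrightarrow>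
    X2_norm \<tau> S1 b v < \<infinity> \<longrightarrow> X1_norm \<tau> S2 b w < \<infinity> \<longrightarrow>
    X1_norm \<tau> S0 (- b) (\<lambda>n x. freq_filter c \<theta> (v n) x * freq_filter c \<theta> (w n) x)
    + X1_norm \<tau> S0 (- b) (\<lambda>n x. freq_filter c \<theta> (\<lambda>y. cnj (v n y)) x * freq_filter c \<theta> (w n) x)
    \<le> ennreal C * X2_norm \<tau> S1 b v * X1_norm \<tau> S2 b w"
proof -
  obtain C where C: "C \<ge> 0" and tri: "\<And>\<tau> e U V W. \<lbrakk>0 < \<tau>; \<tau> < 1; \<bar>e\<bar> = 1;
    freq_time_periodic \<tau> U; freq_time_periodic \<tau> V; freq_time_periodic \<tau> W\<rbrakk> \<Longrightarrow>
    (\<integral>\<^sup>+x. \<integral>\<^sup>+y. ennreal (interaction_kernel c s b \<tau> e x (y :: (int ^ 'd) \<times> real)) * U x * V (x - y) * W y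
      \<partial>freq_time_measure \<tau> \<partial>freq_time_measure \<tau>)\<^sup>2
    \<le> ennreal C * (\<integral>\<^sup>+x. (U x)\<^sup>2 \<partial>freq_time_measure \<tau>) * (\<integral>\<^sup>+x. (V x)\<^sup>2 \<partial>freq_time_measure \<tau>)
        * (\<integral>\<^sup>+x. (W x)\<^sup>2 \<partial>freq_time_measure \<tau>)"
    using trilinear_estimate[OF c s0 s b] by blast
  define D where "D = C * K\<^sup>2"
  have D: "D \<ge> 0" using C by (simp add: D_def)
  have "X1_norm \<tau> S0 (- b) (\<lambda>n x. freq_filter c \<theta> (v n) x * freq_filter c \<theta> (w n) x)
    + X1_norm \<tau> S0 (- b) (\<lambda>n x. freq_filter c \<theta> (\<lambda>y. cnj (v n y)) x * freq_filter c \<theta> (w n) x)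
    \<le> ennreal (2 * sqrt D) * X2_norm \<tau> S1 b v * X1_norm \<tau> S2 b w"
    if \<tau>: "0 < \<tau>" "\<tau> < 1" "\<tau> \<le> \<theta>" and fin: "X2_norm \<tau> S1 b v < \<infinity>" "X1_norm \<tau> S2 b w < \<infinity>"
    for \<tau> \<theta> and v w :: "int \<Rightarrow> real ^ 'd \<Rightarrow> complex"
  proof -
    interpret N: conv_measure "freq_time_measure \<tau> :: ((int ^ 'd) \<times> real) measure" "{(0, 2 * pi / \<tau>)}"
      by (rule conv_measure_freq_time_measure) fact
    have \<theta>: "\<theta> > 0" using \<tau> by simp
    let ?F = "filter_freqs c \<theta> :: (int ^ 'd) set"
    have F: "finite ?F" "\<And>k. k \<in> ?F \<Longrightarrow> \<tau> * (norm (real_vec k))\<^sup>2 \<le> c"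
      using finite_filter_freqs[OF \<theta>] filter_freqs_bound[OF _ \<tau>(1,3) c(1)] by auto
    obtain A where A0: "\<And>k. is_dft \<tau> v k (A k)" "\<And>k. periodic_signal \<tau> (A k)"
      "(bourgain_norm (wave_phase (- 1)) \<tau> S1 b v)\<^sup>2 = (\<integral>\<^sup>+p. (ennreal (bourgain_weight (wave_phase (-
          1)) \<tau> S1 b p) * amplitude A p)\<^sup>2 \<partial>freq_time_measure \<tau>)"
      by (rule bourgain_norm_finite[OF \<tau>(1) fin(1)[unfolded X2_norm_eq]]) (rule that)
    note A = A0(1,2) A0(3)[folded X2_norm_eq]
    obtain B where B0: "\<And>k. is_dft \<tau> w k (B k)" "\<And>k. periodic_signal \<tau> (B k)"
      "(bourgain_norm schroedinger_phase \<tau> S2 b w)\<^sup>2 = (\<integral>\<^sup>+p. (ennreal (bourgain_weight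
          schroedinger_phase \<tau> S2 b p) * amplitude B p)\<^sup>2 \<partial>freq_time_measure \<tau>)"
      by (rule bourgain_norm_finite[OF \<tau>(1) fin(2)[unfolded X1_norm_def]]) (rule that)
    note B = B0(1,2) B0(3)[folded X1_norm_def]
    have cA: "is_dft \<tau> (\<lambda>n x. cnj (v n x)) k (conjugate_dft A k)" "periodic_signal \<tau> (conjugate_dft A k)" for k
      by (rule is_dft_cnj[where v = v and A = A], rule \<tau>(1), rule A(1), rule A(2))+
    have sqfin: "(X2_norm \<tau> S1 b v)\<^sup>2 < \<infinity>" "(X1_norm \<tau> S2 b w)\<^sup>2 < \<infinity>"
      using fin by (auto simp: power2_eq_square ennreal_mult_less_top)
    \<comment> \<open>Stated for any factor v' whose amplitude, weighted with phase sign e, has the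
      norm of v. The instances are v itself with e = -1 and its conjugate with e = 1.\<close>
    have main: "X1_norm \<tau> S0 (- b) (\<lambda>n x. freq_filter c \<theta> (v' n) x * freq_filter c \<theta> (w n) x)
        \<le> ennreal (sqrt D) * X2_norm \<tau> S1 b v * X1_norm \<tau> S2 b w"
      if e: "\<bar>e\<bar> = 1" and A': "\<And>k. is_dft \<tau> v' k (A' k)" "\<And>k. periodic_signal \<tau> (A' k)"
        "(X2_norm \<tau> S1 b v)\<^sup>2 = (\<integral>\<^sup>+p. (ennreal (bourgain_weight (wave_phase e) \<tau> S1 b p)
            * amplitude A' p)\<^sup>2 \<partial>freq_time_measure \<tau>)"
      for e v' A'
    proof (rule norm_le_of_square_le[OF _ D])
      let ?u = "\<lambda>n x. freq_filter c \<theta> (v' n) x * freq_filter c \<theta> (w n) x"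
      let ?Z = "\<lambda>x. \<integral>\<^sup>+y. restrict_freqs ?F (amplitude A') (x - y)
          * restrict_freqs ?F (amplitude B) y \<partial>freq_time_measure \<tau>"
      have perAB: "freq_time_periodic \<tau> (amplitude A')" "freq_time_periodic \<tau> (amplitude B)"
        by (intro freq_time_periodic_amplitude \<tau> A'(2) B(2))+
      have Zm: "?Z \<in> borel_measurable (freq_time_measure \<tau>)"
        by (intro N.periodic_measurable N.periodic_convolution freq_time_periodic_restrict \<tau> perAB)
      note dft = dft_filter_product[OF \<tau>(1) \<theta> A'(1,2) B(1,2) refl, where c = c]
      have "(X1_norm \<tau> S0 (- b) ?u)\<^sup>2 \<le> (\<integral>\<^sup>+p. (ennreal (bourgain_weight schroedinger_phase \<tau> S0 (- b)
          p) * ?Z p)\<^sup>2 \<partial>freq_time_measure \<tau>)"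
        unfolding X1_norm_def by (rule bourgain_norm_square_le[OF \<tau>(1) dft(1) Zm dft(2)])
      also have "\<dots> \<le> (ennreal C * ennreal (K\<^sup>2)) * (X2_norm \<tau> S1 b v)\<^sup>2 * (X1_norm \<tau> S2 b w)\<^sup>2"
        unfolding A'(3) B(3)
        by (rule schroedinger_output[where c = c and s = s, OF \<tau>(1) K _ S12 tri[OF \<tau>(1,2) e] wt perAB F])
          (use b sqfin in \<open>auto simp: A'(3) B(3)\<close>)
      finally show "(X1_norm \<tau> S0 (- b) ?u)\<^sup>2 \<le> ennreal D * (X2_norm \<tau> S1 b v)\<^sup>2 * (X1_norm \<tau> S2 b w)\<^sup>2"
        using C by (simp add: D_def ennreal_mult)
    qed
    have conj: "(X2_norm \<tau> S1 b v)\<^sup>2 = (\<integral>\<^sup>+p. (ennreal (bourgain_weight (wave_phase 1) \<tau> S1 b p)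
        * amplitude (conjugate_dft A) p)\<^sup>2 \<partial>freq_time_measure \<tau>)"
    proof -
      have "N.periodic (\<lambda>p. (ennreal (bourgain_weight (wave_phase (- 1)) \<tau> S1 b p) * amplitude A p)\<^sup>2)"
        by (intro N.periodic_power N.periodic_mult freq_time_periodic_bourgain_weight
            freq_time_periodic_amplitude \<tau> A(2))
      from N.integral_refl[OF this] show ?thesis
        unfolding A(3) amplitude_conjugate_dft bourgain_weight_wave_reflect[OF \<tau>(1)] by simp
    qed
    have "X1_norm \<tau> S0 (- b) (\<lambda>n x. freq_filter c \<theta> (v n) x * freq_filter c \<theta> (w n) x)
        + X1_norm \<tau> S0 (- b) (\<lambda>n x. freq_filter c \<theta> (\<lambda>y. cnj (v n y)) x * freq_filter c \<theta> (w n) x)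
        \<le> ennreal (sqrt D) * X2_norm \<tau> S1 b v * X1_norm \<tau> S2 b w + ennreal (sqrt D) * X2_norm \<tau> S1 b v
            * X1_norm \<tau> S2 b w"
    proof (rule add_mono)
      show "X1_norm \<tau> S0 (- b) (\<lambda>n x. freq_filter c \<theta> (v n) x * freq_filter c \<theta> (w n) x)
        \<le> ennreal (sqrt D) * X2_norm \<tau> S1 b v * X1_norm \<tau> S2 b w"
        by (rule main[where e = "- 1" and A' = A]) (simp, rule A(1), rule A(2), rule A(3))
      show "X1_norm \<tau> S0 (- b) (\<lambda>n x. freq_filter c \<theta> (\<lambda>y. cnj (v n y)) x * freq_filter c \<theta> (w n) x)
        \<le> ennreal (sqrt D) * X2_norm \<tau> S1 b v * X1_norm \<tau> S2 b w"
        by (rule main[where e = 1 and A' = "conjugate_dft A"]) (simp, rule cA(1), rule cA(2), rule conj)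
    qed
    also have "\<dots> = ennreal (2 * sqrt D) * X2_norm \<tau> S1 b v * X1_norm \<tau> S2 b w"
      unfolding ennreal_double[OF D] by (simp only: distrib_right)
    finally show ?thesis .
  qed
  moreover have "2 * sqrt D \<ge> 0" using D by simp
  ultimately show ?thesis by blast
qed

text \<open>A conjugated factor has reflected amplitude, which turns the convolution into a
  correlation. The two products give correlations with the roles of v and w exchanged, both with
  wave sign -1.\<close>

lemma wave_bilinear_estimate:
  fixes c s0 s b S0 S1 S2 K :: real
  assumes c: "0 < c" "c < 2 * pi"
    and s0: "s0 = max 0 (real CARD('d::finite) / 2 - 1)" and s: "s > s0"
    and b: "3/8 < b" "1/2 - 1/2 * (s - s0) < b" "b < 1/2"
    and S12: "S1 \<ge> 0" "S2 \<ge> 0" and K: "K \<ge> 0"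
    and wt: "\<And>x y z. \<lbrakk>1 \<le> x; 1 \<le> y; 1 \<le> z; x \<le> y + z; y \<le> x + z; z \<le> x + y\<rbrakk> \<Longrightarrow>
      y powr S0 \<le> K * freq_weight s x y z * (x powr S1 * z powr S2)"
  shows "\<exists>C\<ge>0. \<forall>\<tau> \<theta>. \<forall>(v :: int \<Rightarrow> real ^ 'd \<Rightarrow> complex) w. 0 < \<tau> \<longrightarrow> \<tau> < 1 \<longrightarrow> \<tau> \<le> \<theta> \<longrightarrow>
    X1_norm \<tau> S1 b v < \<infinity> \<longrightarrow> X1_norm \<tau> S2 b w < \<infinity> \<longrightarrow>
    X2_norm \<tau> S0 (- b) (\<lambda>n x. freq_filter c \<theta> (v n) x * freq_filter c \<theta> (\<lambda>y. cnj (w n y)) x)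
    + X2_norm \<tau> S0 (- b) (\<lambda>n x. freq_filter c \<theta> (\<lambda>y. cnj (v n y)) x * freq_filter c \<theta> (w n) x)
    \<le> ennreal C * X1_norm \<tau> S1 b v * X1_norm \<tau> S2 b w"
proof -
  obtain C where C: "C \<ge> 0" and tri: "\<And>\<tau> e U V W. \<lbrakk>0 < \<tau>; \<tau> < 1; \<bar>e\<bar> = 1;
    freq_time_periodic \<tau> U; freq_time_periodic \<tau> V; freq_time_periodic \<tau> W\<rbrakk> \<Longrightarrow>
    (\<integral>\<^sup>+x. \<integral>\<^sup>+y. ennreal (interaction_kernel c s b \<tau> e x (y :: (int ^ 'd) \<times> real)) * U x * V (x - y) * W y
      \<partial>freq_time_measure \<tau> \<partial>freq_time_measure \<tau>)\<^sup>2
    \<le> ennreal C * (\<integral>\<^sup>+x. (U x)\<^sup>2 \<partial>freq_time_measure \<tau>) * (\<integral>\<^sup>+x. (V x)\<^sup>2 \<partial>freq_time_measure \<tau>)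
        * (\<integral>\<^sup>+x. (W x)\<^sup>2 \<partial>freq_time_measure \<tau>)"
    using trilinear_estimate[OF c s0 s b] by blast
  \<comment> \<open>Symmetry of the frequency weight in the two Schroedinger brackets permits the
    exchange of v and w.\<close>
  have wt': "y powr S0 \<le> K * freq_weight s x y z * (x powr S2 * z powr S1)"
    if "1 \<le> x" "1 \<le> y" "1 \<le> z" "x \<le> y + z" "y \<le> x + z" "z \<le> x + y" for x y z
    using wt[of z y x] that unfolding freq_weight_swap[of s x y z] by (simp add: add.commute mult.commute)
  define D where "D = C * K\<^sup>2"
  have D: "D \<ge> 0" using C by (simp add: D_def)
  have "X2_norm \<tau> S0 (- b) (\<lambda>n x. freq_filter c \<theta> (v n) x * freq_filter c \<theta> (\<lambda>y. cnj (w n y)) x)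
    + X2_norm \<tau> S0 (- b) (\<lambda>n x. freq_filter c \<theta> (\<lambda>y. cnj (v n y)) x * freq_filter c \<theta> (w n) x)
    \<le> ennreal (2 * sqrt D) * X1_norm \<tau> S1 b v * X1_norm \<tau> S2 b w"
    if \<tau>: "0 < \<tau>" "\<tau> < 1" "\<tau> \<le> \<theta>" and fin: "X1_norm \<tau> S1 b v < \<infinity>" "X1_norm \<tau> S2 b w < \<infinity>"
    for \<tau> \<theta> and v w :: "int \<Rightarrow> real ^ 'd \<Rightarrow> complex"
  proof -
    interpret N: conv_measure "freq_time_measure \<tau> :: ((int ^ 'd) \<times> real) measure" "{(0, 2 * pi / \<tau>)}"
      by (rule conv_measure_freq_time_measure) fact
    have \<theta>: "\<theta> > 0" using \<tau> by simp
    let ?F = "filter_freqs c \<theta> :: (int ^ 'd) set"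
    let ?R = "uminus ` ?F"
    have F: "finite ?F" "finite ?R" using finite_filter_freqs[OF \<theta>] by auto
    have Fb: "\<tau> * (norm (real_vec k))\<^sup>2 \<le> c" if "k \<in> ?F \<union> ?R" for k
      using that filter_freqs_bound[OF _ \<tau>(1,3) c(1)] by (auto simp: real_vec_minus)
    obtain A where A0: "\<And>k. is_dft \<tau> v k (A k)" "\<And>k. periodic_signal \<tau> (A k)"
      "(bourgain_norm schroedinger_phase \<tau> S1 b v)\<^sup>2 = (\<integral>\<^sup>+p. (ennreal (bourgain_weight
          schroedinger_phase \<tau> S1 b p) * amplitude A p)\<^sup>2 \<partial>freq_time_measure \<tau>)"
      by (rule bourgain_norm_finite[OF \<tau>(1) fin(1)[unfolded X1_norm_def]]) (rule that)
    note A = A0(1,2) A0(3)[folded X1_norm_def]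
    obtain B where B0: "\<And>k. is_dft \<tau> w k (B k)" "\<And>k. periodic_signal \<tau> (B k)"
      "(bourgain_norm schroedinger_phase \<tau> S2 b w)\<^sup>2 = (\<integral>\<^sup>+p. (ennreal (bourgain_weight
          schroedinger_phase \<tau> S2 b p) * amplitude B p)\<^sup>2 \<partial>freq_time_measure \<tau>)"
      by (rule bourgain_norm_finite[OF \<tau>(1) fin(2)[unfolded X1_norm_def]]) (rule that)
    note B = B0(1,2) B0(3)[folded X1_norm_def]
    have cA: "is_dft \<tau> (\<lambda>n x. cnj (v n x)) k (conjugate_dft A k)" "periodic_signal \<tau> (conjugate_dft A k)" for k
      by (rule is_dft_cnj[where v = v and A = A], rule \<tau>(1), rule A(1), rule A(2))+
    have cB: "is_dft \<tau> (\<lambda>n x. cnj (w n x)) k (conjugate_dft B k)" "periodic_signal \<tau> (conjugate_dft B k)" for k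
      by (rule is_dft_cnj[where v = w and A = B], rule \<tau>(1), rule B(1), rule B(2))+
    have sqfin: "(X1_norm \<tau> S1 b v)\<^sup>2 < \<infinity>" "(X1_norm \<tau> S2 b w)\<^sup>2 < \<infinity>"
      using fin by (auto simp: power2_eq_square ennreal_mult_less_top)
    have perAB: "freq_time_periodic \<tau> (amplitude A)" "freq_time_periodic \<tau> (amplitude B)"
      by (intro freq_time_periodic_amplitude \<tau> A(2) B(2))+
    have perR: "N.periodic (restrict_freqs S (amplitude A))" "N.periodic (restrict_freqs S (amplitude B))" for S
      by (intro freq_time_periodic_restrict \<tau> perAB)+
    have e: "\<bar>- 1 :: real\<bar> = 1" by simp
    have b0: "b \<ge> 0" using b by simp
    have DK: "ennreal C * ennreal (K\<^sup>2) = ennreal D" using C by (simp add: D_def ennreal_mult)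
    have v_cw: "X2_norm \<tau> S0 (- b) (\<lambda>n x. freq_filter c \<theta> (v n) x * freq_filter c \<theta> (\<lambda>y. cnj (w n y)) x)
        \<le> ennreal (sqrt D) * X1_norm \<tau> S1 b v * X1_norm \<tau> S2 b w"
    proof (rule norm_le_of_square_le[OF _ D])
      let ?u = "\<lambda>n x. freq_filter c \<theta> (v n) x * freq_filter c \<theta> (\<lambda>y. cnj (w n y)) x"
      let ?Z = "\<lambda>x. \<integral>\<^sup>+y. restrict_freqs ?F (amplitude A) (x - y)
          * restrict_freqs ?F (amplitude (conjugate_dft B)) y \<partial>freq_time_measure \<tau>"
      have Z: "?Z z = (\<integral>\<^sup>+y. restrict_freqs ?F (amplitude A) (z + y)
          * restrict_freqs ?R (amplitude B) y \<partial>freq_time_measure \<tau>)" for z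
        unfolding restrict_amplitude_conjugate_dft
        using N.integral_refl[OF N.periodic_mult[OF N.periodic_diff2[OF perR(1)[of ?F]]
            N.periodic_refl[OF perR(2)[of ?R]]], of z]
        by simp
      have Zm: "?Z \<in> borel_measurable (freq_time_measure \<tau>)"
        by (intro N.periodic_measurable N.periodic_convolution freq_time_periodic_restrict
            freq_time_periodic_amplitude \<tau> A(2)
            cB(2))
      note dft = dft_filter_product[OF \<tau>(1) \<theta> A(1,2) cB refl, where c = c]
      have "(X2_norm \<tau> S0 (- b) ?u)\<^sup>2 \<le> (\<integral>\<^sup>+p. (ennreal (bourgain_weight (wave_phase (- 1)) \<tau> S0 (- b)
          p) * ?Z p)\<^sup>2 \<partial>freq_time_measure \<tau>)"
        unfolding X2_norm_eq by (rule bourgain_norm_square_le[OF \<tau>(1) dft(1) Zm dft(2)])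
      also have "\<dots> \<le> (ennreal C * ennreal (K\<^sup>2)) * (X1_norm \<tau> S1 b v)\<^sup>2 * (X1_norm \<tau> S2 b w)\<^sup>2"
        unfolding Z A(3) B(3)
        by (rule wave_output[where c = c and s = s, OF \<tau>(1) K b0 S12 tri[OF \<tau>(1,2) e] wt perAB F Fb])
          (use sqfin in \<open>auto simp: A(3) B(3)\<close>)
      finally show "(X2_norm \<tau> S0 (- b) ?u)\<^sup>2 \<le> ennreal D * (X1_norm \<tau> S1 b v)\<^sup>2 * (X1_norm \<tau> S2 b w)\<^sup>2"
        unfolding DK .
    qed
    have cv_w: "X2_norm \<tau> S0 (- b) (\<lambda>n x. freq_filter c \<theta> (\<lambda>y. cnj (v n y)) x * freq_filter c \<theta> (w n) x)
        \<le> ennreal (sqrt D) * X1_norm \<tau> S2 b w * X1_norm \<tau> S1 b v"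
    proof (rule norm_le_of_square_le[OF _ D])
      let ?u = "\<lambda>n x. freq_filter c \<theta> (\<lambda>y. cnj (v n y)) x * freq_filter c \<theta> (w n) x"
      let ?Z = "\<lambda>x. \<integral>\<^sup>+y. restrict_freqs ?F (amplitude (conjugate_dft A)) (x - y)
          * restrict_freqs ?F (amplitude B) y \<partial>freq_time_measure \<tau>"
      have Z: "?Z z = (\<integral>\<^sup>+y. restrict_freqs ?F (amplitude B) (z + y)
          * restrict_freqs ?R (amplitude A) y \<partial>freq_time_measure \<tau>)" for z
        unfolding restrict_amplitude_conjugate_dft
        using N.integral_diff[OF N.periodic_mult[OF N.periodic_add[OF perR(2)[of ?F]] perR(1)[of ?R]], of z z]
        by (simp add: add.commute mult.commute)
      have Zm: "?Z \<in> borel_measurable (freq_time_measure \<tau>)"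
        by (intro N.periodic_measurable N.periodic_convolution freq_time_periodic_restrict
            freq_time_periodic_amplitude \<tau> B(2)
            cA(2))
      note dft = dft_filter_product[OF \<tau>(1) \<theta> cA B(1,2) refl, where c = c]
      have "(X2_norm \<tau> S0 (- b) ?u)\<^sup>2 \<le> (\<integral>\<^sup>+p. (ennreal (bourgain_weight (wave_phase (- 1)) \<tau> S0 (- b)
          p) * ?Z p)\<^sup>2 \<partial>freq_time_measure \<tau>)"
        unfolding X2_norm_eq by (rule bourgain_norm_square_le[OF \<tau>(1) dft(1) Zm dft(2)])
      also have "\<dots> \<le> (ennreal C * ennreal (K\<^sup>2)) * (X1_norm \<tau> S2 b w)\<^sup>2 * (X1_norm \<tau> S1 b v)\<^sup>2"
        unfolding Z A(3) B(3)
        by (rule wave_output[where c = c and s = s, OF \<tau>(1) K b0 S12(2,1) tri[OF \<tau>(1,2) e] wt' perAB(2,1) F Fb])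
          (use sqfin in \<open>auto simp: A(3) B(3)\<close>)
      finally show "(X2_norm \<tau> S0 (- b) ?u)\<^sup>2 \<le> ennreal D * (X1_norm \<tau> S2 b w)\<^sup>2 * (X1_norm \<tau> S1 b v)\<^sup>2"
        unfolding DK .
    qed
    have "X2_norm \<tau> S0 (- b) (\<lambda>n x. freq_filter c \<theta> (v n) x * freq_filter c \<theta> (\<lambda>y. cnj (w n y)) x)
        + X2_norm \<tau> S0 (- b) (\<lambda>n x. freq_filter c \<theta> (\<lambda>y. cnj (v n y)) x * freq_filter c \<theta> (w n) x)
        \<le> ennreal (sqrt D) * X1_norm \<tau> S1 b v * X1_norm \<tau> S2 b w + ennreal (sqrt D) * X1_norm \<tau> S1 b v
            * X1_norm \<tau> S2 b w"
      by (rule add_mono[OF v_cw cv_w[unfolded mult.assoc mult.commute[of "X1_norm \<tau> S2 b w"], folded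
          mult.assoc]])
    also have "\<dots> = ennreal (2 * sqrt D) * X1_norm \<tau> S1 b v * X1_norm \<tau> S2 b w"
      unfolding ennreal_double[OF D] by (simp only: distrib_right)
    finally show ?thesis .
  qed
  moreover have "2 * sqrt D \<ge> 0" using D by simp
  ultimately show ?thesis by blast
qed

lemma freq_weight_transfer:
  fixes a q s s0 P Q Q' c0 :: real
  assumes base: "a \<le> c0 * freq_weight s0 x y z * P" and "1 \<le> x" "1 \<le> y" "1 \<le> z" "min x (min y z) \<le> q" "s0 \<le> s"
    and "c0 \<ge> 0" "P \<ge> 0" and Q: "P * q powr (s - s0) = Q"
  shows "a \<le> c0 * freq_weight s x y z * Q"
proof -
  have "c0 * freq_weight s0 x y z * P \<le> c0 * (freq_weight s x y z * q powr (s - s0)) * P"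
    using assms by (intro mult_right_mono mult_left_mono freq_weight_raise) auto
  also have "\<dots> = c0 * freq_weight s x y z * Q" unfolding Q[symmetric] by (simp add: mult_ac)
  finally show ?thesis using base by linarith
qed

theorem theorem3p5:
  fixes c s0 s2 b :: real
  assumes "0 < c" "c < 2 * pi"
    and "s0 = max 0 (real CARD('d::finite) / 2 - 1)"
    and "s2 > s0"
    and "max (3/8) (1/2 - 1/2 * (s2 - s0)) < b" "b < 1/2"
  shows "\<exists>C::real. \<forall>\<tau> \<theta>. \<forall>(v :: int \<Rightarrow> real ^ 'd \<Rightarrow> complex) (w :: int \<Rightarrow> real ^ 'd \<Rightarrow> complex).
    0 < \<tau> \<longrightarrow> \<tau> < 1 \<longrightarrow> \<tau> \<le> \<theta> \<longrightarrow>
    (\<forall>n. torus_function (v n)) \<longrightarrow> (\<forall>n. torus_function (w n)) \<longrightarrow>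
    (let P = freq_filter c \<theta>;
         vw = (\<lambda>n x. P (v n) x * P (w n) x);
         cv_w = (\<lambda>n x. P (\<lambda>y. cnj (v n y)) x * P (w n) x);
         v_cw = (\<lambda>n x. P (v n) x * P (\<lambda>y. cnj (w n y)) x)
     in
      (X2_norm \<tau> s2 b v < \<infinity> \<and> X1_norm \<tau> (s2 + 1/2) b w < \<infinity> \<longrightarrow>
         X1_norm \<tau> (s2 + 1/2) (- b) vw + X1_norm \<tau> (s2 + 1/2) (- b) cv_w
           \<le> ennreal C * X2_norm \<tau> s2 b v * X1_norm \<tau> (s2 + 1/2) b w) \<and>
      (X2_norm \<tau> s0 b v < \<infinity> \<and> X1_norm \<tau> (s2 + 1/2) b w < \<infinity> \<longrightarrow>
         X1_norm \<tau> (s0 + 1/2) (- b) vw + X1_norm \<tau> (s0 + 1/2) (- b) cv_w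
           \<le> ennreal C * X2_norm \<tau> s0 b v * X1_norm \<tau> (s2 + 1/2) b w) \<and>
      (X2_norm \<tau> s2 b v < \<infinity> \<and> X1_norm \<tau> (s0 + 1/2) b w < \<infinity> \<longrightarrow>
         X1_norm \<tau> (s0 + 1/2) (- b) vw + X1_norm \<tau> (s0 + 1/2) (- b) cv_w
           \<le> ennreal C * X2_norm \<tau> s2 b v * X1_norm \<tau> (s0 + 1/2) b w) \<and>
      (X1_norm \<tau> (s2 + 1/2) b v < \<infinity> \<and> X1_norm \<tau> (s2 + 1/2) b w < \<infinity> \<longrightarrow>
         X2_norm \<tau> (s2 + 1) (- b) v_cw + X2_norm \<tau> (s2 + 1) (- b) cv_w
           \<le> ennreal C * X1_norm \<tau> (s2 + 1/2) b v * X1_norm \<tau> (s2 + 1/2) b w) \<and>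
      (X1_norm \<tau> (s2 + 1/2) b v < \<infinity> \<and> X1_norm \<tau> (s0 + 1/2) b w < \<infinity> \<longrightarrow>
         X2_norm \<tau> (s0 + 1) (- b) v_cw + X2_norm \<tau> (s0 + 1) (- b) cv_w
           \<le> ennreal C * X1_norm \<tau> (s2 + 1/2) b v * X1_norm \<tau> (s0 + 1/2) b w))"
proof -
  have b: "3/8 < b" "1/2 - 1/2 * (s2 - s0) < b" "b < 1/2" using assms(5,6) by auto
  have s: "s0 \<ge> 0" "s2 \<ge> 0" using assms(3,4) by auto
  \<comment> \<open>The kernel exponent is s2 in all cases; the five bounds differ only in how
    powers of the three brackets are distributed.\<close>
  note schroedinger = schroedinger_bilinear_estimate[where 'd = 'd, OF assms(1-4) b]
  note wave = wave_bilinear_estimate[where 'd = 'd, OF assms(1-4) b]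
  have add_powr: "y powr p * y powr (s2 - s0) = y powr (p + s2 - s0)" if "1 \<le> y" for y p
    using that by (simp flip: powr_add add: algebra_simps)
  obtain C1 where C1: "C1 \<ge> 0" and est1: "\<And>\<tau> \<theta> (v :: int \<Rightarrow> real ^ 'd \<Rightarrow> complex) w.
    \<lbrakk>0 < \<tau>; \<tau> < 1; \<tau> \<le> \<theta>; X2_norm \<tau> s2 b v < \<infinity>; X1_norm \<tau> (s2 + 1/2) b w < \<infinity>\<rbrakk> \<Longrightarrow>
    X1_norm \<tau> (s2 + 1/2) (- b) (\<lambda>n x. freq_filter c \<theta> (v n) x * freq_filter c \<theta> (w n) x)
    + X1_norm \<tau> (s2 + 1/2) (- b) (\<lambda>n x. freq_filter c \<theta> (\<lambda>y. cnj (v n y)) x * freq_filter c \<theta> (w n) x)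
    \<le> ennreal C1 * X2_norm \<tau> s2 b v * X1_norm \<tau> (s2 + 1/2) b w"
    using schroedinger[of s2 "s2 + 1/2" "2 powr s2" "s2 + 1/2"] s freq_weight_Schroedinger[of _ _ _ s2]
    by auto
  obtain C2 where C2: "C2 \<ge> 0" and est2: "\<And>\<tau> \<theta> (v :: int \<Rightarrow> real ^ 'd \<Rightarrow> complex) w.
    \<lbrakk>0 < \<tau>; \<tau> < 1; \<tau> \<le> \<theta>; X2_norm \<tau> s0 b v < \<infinity>; X1_norm \<tau> (s2 + 1/2) b w < \<infinity>\<rbrakk> \<Longrightarrow>
    X1_norm \<tau> (s0 + 1/2) (- b) (\<lambda>n x. freq_filter c \<theta> (v n) x * freq_filter c \<theta> (w n) x)
    + X1_norm \<tau> (s0 + 1/2) (- b) (\<lambda>n x. freq_filter c \<theta> (\<lambda>y. cnj (v n y)) x * freq_filter c \<theta> (w n) x)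
    \<le> ennreal C2 * X2_norm \<tau> s0 b v * X1_norm \<tau> (s2 + 1/2) b w"
  proof -
    \<comment> \<open>The surplus s2 - s0 is carried by w, whose bracket is z.\<close>
    have "x powr (s0 + 1/2) \<le> 2 powr s0 * freq_weight s2 x y z * (y powr s0 * z powr (s2 + 1/2))"
      if "1 \<le> x" "1 \<le> y" "1 \<le> z" "x \<le> y + z" for x y z
      by (rule freq_weight_transfer[where q = z, OF freq_weight_Schroedinger])
        (use that s assms(4) add_powr[of z "s0 + 1/2"] in \<open>auto simp: mult.assoc algebra_simps\<close>)
    then show ?thesis using that schroedinger[of s0 "s2 + 1/2" "2 powr s0" "s0 + 1/2"] s by auto
  qed
  obtain C3 where C3: "C3 \<ge> 0" and est3: "\<And>\<tau> \<theta> (v :: int \<Rightarrow> real ^ 'd \<Rightarrow> complex) w.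
    \<lbrakk>0 < \<tau>; \<tau> < 1; \<tau> \<le> \<theta>; X2_norm \<tau> s2 b v < \<infinity>; X1_norm \<tau> (s0 + 1/2) b w < \<infinity>\<rbrakk> \<Longrightarrow>
    X1_norm \<tau> (s0 + 1/2) (- b) (\<lambda>n x. freq_filter c \<theta> (v n) x * freq_filter c \<theta> (w n) x)
    + X1_norm \<tau> (s0 + 1/2) (- b) (\<lambda>n x. freq_filter c \<theta> (\<lambda>y. cnj (v n y)) x * freq_filter c \<theta> (w n) x)
    \<le> ennreal C3 * X2_norm \<tau> s2 b v * X1_norm \<tau> (s0 + 1/2) b w"
  proof -
    \<comment> \<open>Now v, with bracket y, is the factor measured in s2 and carries the
      surplus.\<close>
    have "x powr (s0 + 1/2) \<le> 2 powr s0 * freq_weight s2 x y z * (y powr s2 * z powr (s0 + 1/2))"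
      if "1 \<le> x" "1 \<le> y" "1 \<le> z" "x \<le> y + z" for x y z
      by (rule freq_weight_transfer[where q = y, OF freq_weight_Schroedinger])
        (use that s assms(4) add_powr[of y s0] in \<open>auto simp: mult_ac\<close>)
    then show ?thesis using that schroedinger[of s2 "s0 + 1/2" "2 powr s0" "s0 + 1/2"] s by auto
  qed
  obtain C4 where C4: "C4 \<ge> 0" and est4: "\<And>\<tau> \<theta> (v :: int \<Rightarrow> real ^ 'd \<Rightarrow> complex) w.
    \<lbrakk>0 < \<tau>; \<tau> < 1; \<tau> \<le> \<theta>; X1_norm \<tau> (s2 + 1/2) b v < \<infinity>; X1_norm \<tau> (s2 + 1/2) b w < \<infinity>\<rbrakk> \<Longrightarrow>
    X2_norm \<tau> (s2 + 1) (- b) (\<lambda>n x. freq_filter c \<theta> (v n) x * freq_filter c \<theta> (\<lambda>y. cnj (w n y)) x)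
    + X2_norm \<tau> (s2 + 1) (- b) (\<lambda>n x. freq_filter c \<theta> (\<lambda>y. cnj (v n y)) x * freq_filter c \<theta> (w n) x)
    \<le> ennreal C4 * X1_norm \<tau> (s2 + 1/2) b v * X1_norm \<tau> (s2 + 1/2) b w"
    using wave[of "s2 + 1/2" "s2 + 1/2" "2 powr (s2 + 1)" "s2 + 1"] s freq_weight_wave[of _ _ _ s2]
    by auto
  obtain C5 where C5: "C5 \<ge> 0" and est5: "\<And>\<tau> \<theta> (v :: int \<Rightarrow> real ^ 'd \<Rightarrow> complex) w.
    \<lbrakk>0 < \<tau>; \<tau> < 1; \<tau> \<le> \<theta>; X1_norm \<tau> (s2 + 1/2) b v < \<infinity>; X1_norm \<tau> (s0 + 1/2) b w < \<infinity>\<rbrakk> \<Longrightarrow>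
    X2_norm \<tau> (s0 + 1) (- b) (\<lambda>n x. freq_filter c \<theta> (v n) x * freq_filter c \<theta> (\<lambda>y. cnj (w n y)) x)
    + X2_norm \<tau> (s0 + 1) (- b) (\<lambda>n x. freq_filter c \<theta> (\<lambda>y. cnj (v n y)) x * freq_filter c \<theta> (w n) x)
    \<le> ennreal C5 * X1_norm \<tau> (s2 + 1/2) b v * X1_norm \<tau> (s0 + 1/2) b w"
  proof -
    \<comment> \<open>For the wave output the factor measured in s2 + 1/2 is v, whose bracket is
      x.\<close>
    have "y powr (s0 + 1) \<le> 2 powr (s0 + 1) * freq_weight s2 x y z * (x powr (s2 + 1/2) * z powr (s0 + 1/2))"
      if "1 \<le> x" "1 \<le> y" "1 \<le> z" "y \<le> x + z" for x y z
      by (rule freq_weight_transfer[where q = x, OF freq_weight_wave])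
        (use that s assms(4) add_powr[of x "s0 + 1/2"] in \<open>auto simp: mult_ac algebra_simps\<close>)
    then show ?thesis using that wave[of "s2 + 1/2" "s0 + 1/2" "2 powr (s0 + 1)" "s0 + 1"] s by auto
  qed
  define C where "C = C1 + C2 + C3 + C4 + C5"
  have enlarge: "N \<le> ennreal C * X * Y" if "N \<le> ennreal C' * X
      * Y" "C' \<in> {C1, C2, C3, C4, C5}" for N X Y :: ennreal and C'
  proof -
    have "ennreal C' \<le> ennreal C" using that(2) C1 C2 C3 C4 C5 by (intro ennreal_leI) (auto simp: C_def)
    then have "ennreal C' * X * Y \<le> ennreal C * X * Y" by (intro mult_right_mono) auto
    with that(1) show ?thesis by (rule order_trans)
  qed
  show ?thesis
    unfolding Let_def
    by (rule exI[of _ C], intro allI impI conjI; elim conjE)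
      (rule enlarge[OF est1] enlarge[OF est2] enlarge[OF est3] enlarge[OF est4] enlarge[OF est5]; simp; fail)+
qed

end
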